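(* Let $\mathfrak{g}$ be a simple finite-dimensional complex Lie algebra not of type $\mathbf{A_1}$, and let $\mathcal{O}_{\min}$ be its minimal nilpotent orbit. Then $\mathcal{O}_{\min}$ is little, that is, $0<2\dim\mathcal{O}_{\min}\le\dim\mathfrak{g}$. In particular, $\mathcal{J}_m(\overline{\mathcal{O}_{\min}})$ is reducible for every integer $m\ge 1$.
   Context: The minimal nilpotent orbit $\mathcal{O}_{\min}$ of a simple Lie algebra $\mathfrak{g}$ is the unique nonzero nilpotent orbit of minimal dimension; it is contained in the closure of every nonzero nilpotent orbit. In general a nilpotent orbit $\mathcal{O}$ of a reductive Lie algebra $\mathfrak{g}$ is called little if $0<2\dim\mathcal{O}\le\dim\mathfrak{g}_{\mathcal{O}}$, where $\mathfrak{g}_{\mathcal{O}}$ is the smallest semisimple ideal of $\mathfrak{g}$ containing $\mathcal{O}$ (equal to $\mathfrak{g}$ when $\mathfrak{g}$ is simple and $\mathcal{O}\ne 0$). For a scheme $X$ of finite type over $\mathbb{C}$ and $m\in\mathbb{N}$, $\mathcal{J}_m(X)$ denotes the $m$-th jet scheme of $X$, i.e. the scheme with $\mathrm{Hom}(Z,\mathcal{J}_m(X))=\mathrm{Hom}(Z\times \mathrm{Spec}\,\mathbb{C}[t]/(t^{m+1}),X)$ for every scheme $Z$ over $\mathbb{C}$. Closures $\overline{\mathcal{O}}$ of nilpotent orbits are regarded as reduced affine schemes. *)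

theory Defs
  imports
    "HOL-Analysis.Analysis"
    "HOL-Algebra.QuotRing"
    "HOL-Library.Extended_Nat"
    "HOL-Computational_Algebra.Polynomial"
begin

section \<open>Irreducibility and dimension of topological spaces\<close>

definition reducible_space :: "'a topology \<Rightarrow> bool" where
  "reducible_space X \<longleftrightarrow>
     (\<exists>A B. closedin X A \<and> closedin X B \<and> A \<noteq> topspace X \<and> B \<noteq> topspace X \<and> A \<union> B = topspace X)"

definition irreducible_space :: "'a topology \<Rightarrow> bool" where
  "irreducible_space X \<longleftrightarrow> topspace X \<noteq> {} \<and> \<not> reducible_space X"

text \<open>Supremum of the lengths of chains of irreducible closed subsets; the dimension of
  a (quasi-affine) variety is that of its Zariski topology. The empty space gets dimension 0.\<close>

definition krull_dim :: "'a topology \<Rightarrow> enat" where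
  "krull_dim X = Sup {enat n | n. \<exists>Z :: nat \<Rightarrow> 'a set.
     (\<forall>i\<le>n. closedin X (Z i) \<and> irreducible_space (subtopology X (Z i))) \<and>
     (\<forall>i<n. Z i \<subset> Z (Suc i))}"

section \<open>The prime spectrum\<close>

definition Spec :: "('a, 'b) ring_scheme \<Rightarrow> 'a set topology" where
  "Spec R = topology (\<lambda>U. \<exists>S \<subseteq> carrier R. U = {P. primeideal P R \<and> \<not> S \<subseteq> P})"

lemma istopology_Spec:
  "istopology (\<lambda>U. \<exists>S \<subseteq> carrier R. U = {P. primeideal P R \<and> \<not> S \<subseteq> P})"
  unfolding istopology_def
proof (intro conjI allI impI)
  fix U V
  assume "\<exists>S \<subseteq> carrier R. U = {P. primeideal P R \<and> \<not> S \<subseteq> P}"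
    and "\<exists>S \<subseteq> carrier R. V = {P. primeideal P R \<and> \<not> S \<subseteq> P}"
  then obtain S T where S: "S \<subseteq> carrier R" "U = {P. primeideal P R \<and> \<not> S \<subseteq> P}"
    and T: "T \<subseteq> carrier R" "V = {P. primeideal P R \<and> \<not> T \<subseteq> P}" by blast
  show "\<exists>S \<subseteq> carrier R. U \<inter> V = {P. primeideal P R \<and> \<not> S \<subseteq> P}"
  proof (cases "\<exists>P. primeideal P R")
    case False
    then show ?thesis using S by (intro exI[of _ "{}"]) auto
  next
    case True
    then interpret cring R by (auto simp: primeideal_def)
    let ?W = "{s \<otimes>\<^bsub>R\<^esub> t | s t. s \<in> S \<and> t \<in> T}"
    have "U \<inter> V = {P. primeideal P R \<and> \<not> ?W \<subseteq> P}"
    proof (intro equalityI subsetI)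
      fix P assume "P \<in> U \<inter> V"
      then have P: "primeideal P R" and n: "\<not> S \<subseteq> P" "\<not> T \<subseteq> P" using S T by auto
      then obtain s t where st: "s \<in> S" "s \<notin> P" "t \<in> T" "t \<notin> P" by blast
      then have "s \<otimes>\<^bsub>R\<^esub> t \<notin> P" using primeideal.I_prime[OF P] S T by blast
      with st P show "P \<in> {P. primeideal P R \<and> \<not> ?W \<subseteq> P}" by blast
    next
      fix P assume "P \<in> {P. primeideal P R \<and> \<not> ?W \<subseteq> P}"
      then obtain s t where P: "primeideal P R" and st: "s \<in> S" "t \<in> T" "s \<otimes>\<^bsub>R\<^esub> t \<notin> P"
        by blast
      interpret P: primeideal P R by (rule P)
      have "s \<notin> P" "t \<notin> P" using st S T P.I_l_closed P.I_r_closed by blast+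
      then show "P \<in> U \<inter> V" using st S T P by blast
    qed
    moreover have "?W \<subseteq> carrier R" using S T by blast
    ultimately show ?thesis by blast
  qed
next
  fix \<U> :: "'a set set set"
  assume "\<forall>U\<in>\<U>. \<exists>S \<subseteq> carrier R. U = {P. primeideal P R \<and> \<not> S \<subseteq> P}"
  from bchoice[OF this] obtain S where
    "\<forall>U\<in>\<U>. S U \<subseteq> carrier R \<and> U = {P. primeideal P R \<and> \<not> S U \<subseteq> P}" ..
  then have S: "\<And>U. U \<in> \<U> \<Longrightarrow> S U \<subseteq> carrier R \<and> U = {P. primeideal P R \<and> \<not> S U \<subseteq> P}"
    by (rule bspec)
  have "\<Union>\<U> = {P. primeideal P R \<and> \<not> (\<Union>U\<in>\<U>. S U) \<subseteq> P}"
    using S by blast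
  moreover have "(\<Union>U\<in>\<U>. S U) \<subseteq> carrier R" using S by blast
  ultimately show "\<exists>S \<subseteq> carrier R. \<Union>\<U> = {P. primeideal P R \<and> \<not> S \<subseteq> P}" by blast
qed

lemma openin_Spec:
  "openin (Spec R) U \<longleftrightarrow> (\<exists>S \<subseteq> carrier R. U = {P. primeideal P R \<and> \<not> S \<subseteq> P})"
  unfolding Spec_def by (rule fun_cong[OF topology_inverse'[OF istopology_Spec]])

section \<open>Algebras of polynomial functions\<close>

text \<open>The subalgebra of all functions generated by a given set of functions.\<close>

inductive_set alg_gen :: "('x \<Rightarrow> complex) set \<Rightarrow> ('x \<Rightarrow> complex) set" for F where
  const: "(\<lambda>_. c) \<in> alg_gen F"
| gen: "f \<in> F \<Longrightarrow> f \<in> alg_gen F"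
| add: "f \<in> alg_gen F \<Longrightarrow> g \<in> alg_gen F \<Longrightarrow> (\<lambda>x. f x + g x) \<in> alg_gen F"
| mult: "f \<in> alg_gen F \<Longrightarrow> g \<in> alg_gen F \<Longrightarrow> (\<lambda>x. f x * g x) \<in> alg_gen F"

definition fun_ring :: "('x \<Rightarrow> complex) set \<Rightarrow> ('x \<Rightarrow> complex) ring" where
  "fun_ring A = \<lparr>carrier = A, mult = (\<lambda>f g x. f x * g x), one = (\<lambda>_. 1),
                 zero = (\<lambda>_. 0), add = (\<lambda>f g x. f x + g x)\<rparr>"

lemma cring_fun_ring: "cring (fun_ring (alg_gen F))"
proof (rule cringI)
  have neg: "(\<lambda>x. - f x) \<in> alg_gen F" if "f \<in> alg_gen F" for f
    using alg_gen.mult[OF alg_gen.const[of "-1"] that] by simp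
  show "abelian_group (fun_ring (alg_gen F))"
    by (rule abelian_groupI)
      (auto simp: fun_ring_def algebra_simps intro: alg_gen.intros intro!: bexI[OF _ neg])
  show "comm_monoid (fun_ring (alg_gen F))"
    by (rule comm_monoidI) (auto simp: fun_ring_def algebra_simps intro: alg_gen.intros)
qed (auto simp: fun_ring_def algebra_simps)

section \<open>Affine geometry of a finite-dimensional complex vector space\<close>

locale fd_complex_space = vector_space scale
  for scale :: "complex \<Rightarrow> 'g::ab_group_add \<Rightarrow> 'g" (infixr \<open>\<odot>\<close> 75) +
  assumes finite_dim: "\<exists>B. finite B \<and> span B = UNIV"
begin

definition functional :: "('g \<Rightarrow> complex) \<Rightarrow> bool" where
  "functional \<phi> \<longleftrightarrow> Vector_Spaces.linear (\<odot>) (*) \<phi>"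

definition coord_ring :: "('g \<Rightarrow> complex) ring" where
  "coord_ring = fun_ring (alg_gen {\<phi>. functional \<phi>})"

definition zariski :: "'g topology" where
  "zariski = topology (\<lambda>U. \<exists>S \<subseteq> carrier coord_ring. U = {x. \<exists>f\<in>S. f x \<noteq> 0})"

definition zariski_dim :: "'g set \<Rightarrow> enat" where
  "zariski_dim X = krull_dim (subtopology zariski X)"

definition vanishing_ideal :: "'g set \<Rightarrow> ('g \<Rightarrow> complex) set" where
  "vanishing_ideal X = {f \<in> carrier coord_ring. \<forall>x\<in>X. f x = 0}"

text \<open>The algebra of polynomial functions on the space of \<open>m\<close>-jets
  \<open>x\<^sub>0 + x\<^sub>1 t + \<dots> + x\<^sub>m t\<^sup>m\<close>: only the coordinates of \<open>x 0, \<dots>, x m\<close> occur, so this is the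
  polynomial algebra of the \<open>(m + 1)\<close>-fold power of the space, although the functions are
  formally defined on all sequences.\<close>

definition jet_ring :: "nat \<Rightarrow> ((nat \<Rightarrow> 'g) \<Rightarrow> complex) ring" where
  "jet_ring m = fun_ring (alg_gen {\<lambda>x. \<phi> (x j) | \<phi> j. functional \<phi> \<and> j \<le> m})"

text \<open>The coefficient of \<open>t\<^sup>k\<close> in \<open>f (x\<^sub>0 + x\<^sub>1 t + \<dots> + x\<^sub>m t\<^sup>m)\<close>.\<close>

definition jet_coeff :: "nat \<Rightarrow> ('g \<Rightarrow> complex) \<Rightarrow> nat \<Rightarrow> (nat \<Rightarrow> 'g) \<Rightarrow> complex" where
  "jet_coeff m f k x =
     poly.coeff (THE p. \<forall>t. poly p t = f (\<Sum>j\<le>m. t ^ j \<odot> x j)) k"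

definition jet_ideal :: "nat \<Rightarrow> ('g \<Rightarrow> complex) set \<Rightarrow> ((nat \<Rightarrow> 'g) \<Rightarrow> complex) set" where
  "jet_ideal m I = genideal (jet_ring m) {jet_coeff m f k | f k. f \<in> I \<and> k \<le> m}"

text \<open>The underlying space of the \<open>m\<close>-th jet scheme of the closed subscheme defined by the
  ideal \<open>I\<close> of the coordinate ring. That the quotient ring represents the functor of
  \<open>m\<close>-jets is the lemma \<open>jet_ring_represents\<close> below.\<close>

definition jet_scheme :: "nat \<Rightarrow> ('g \<Rightarrow> complex) set \<Rightarrow> ((nat \<Rightarrow> 'g) \<Rightarrow> complex) set set topology" where
  "jet_scheme m I = Spec (jet_ring m Quot jet_ideal m I)"

lemma istopology_zariski:
  "istopology (\<lambda>U. \<exists>S \<subseteq> carrier coord_ring. U = {x. \<exists>f\<in>S. f x \<noteq> 0})"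
  unfolding istopology_def
proof (intro conjI allI impI)
  fix U V
  assume "\<exists>S \<subseteq> carrier coord_ring. U = {x. \<exists>f\<in>S. f x \<noteq> 0}"
    and "\<exists>S \<subseteq> carrier coord_ring. V = {x. \<exists>f\<in>S. f x \<noteq> 0}"
  then obtain S T where S: "S \<subseteq> carrier coord_ring" "U = {x. \<exists>f\<in>S. f x \<noteq> 0}"
    and T: "T \<subseteq> carrier coord_ring" "V = {x. \<exists>f\<in>T. f x \<noteq> 0}" by blast
  let ?W = "{\<lambda>x. s x * t x | s t. s \<in> S \<and> t \<in> T}"
  have "?W \<subseteq> carrier coord_ring"
    using S(1) T(1) by (auto simp: coord_ring_def fun_ring_def intro: alg_gen.mult)
  moreover have "U \<inter> V = {x. \<exists>f\<in>?W. f x \<noteq> 0}"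
    unfolding S(2) T(2) by force
  ultimately show "\<exists>S \<subseteq> carrier coord_ring. U \<inter> V = {x. \<exists>f\<in>S. f x \<noteq> 0}"
    by (intro exI[of _ ?W] conjI)
next
  fix \<U> :: "'g set set"
  assume "\<forall>U\<in>\<U>. \<exists>S \<subseteq> carrier coord_ring. U = {x. \<exists>f\<in>S. f x \<noteq> 0}"
  from bchoice[OF this] obtain S where
    "\<forall>U\<in>\<U>. S U \<subseteq> carrier coord_ring \<and> U = {x. \<exists>f\<in>S U. f x \<noteq> 0}" ..
  then have S: "\<And>U. U \<in> \<U> \<Longrightarrow> S U \<subseteq> carrier coord_ring \<and> U = {x. \<exists>f\<in>S U. f x \<noteq> 0}"
    by (rule bspec)
  have "\<Union>\<U> = {x. \<exists>f\<in>(\<Union>U\<in>\<U>. S U). f x \<noteq> 0}"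
    using S by blast
  moreover have "(\<Union>U\<in>\<U>. S U) \<subseteq> carrier coord_ring" using S by blast
  ultimately show "\<exists>S \<subseteq> carrier coord_ring. \<Union>\<U> = {x. \<exists>f\<in>S. f x \<noteq> 0}" by blast
qed

lemma openin_zariski:
  "openin zariski U \<longleftrightarrow> (\<exists>S \<subseteq> carrier coord_ring. U = {x. \<exists>f\<in>S. f x \<noteq> 0})"
  unfolding zariski_def by (rule fun_cong[OF topology_inverse'[OF istopology_zariski]])

end

section \<open>Representability of the functor of jets\<close>

datatype 'v pexp = Const complex | Var 'v | Plus "'v pexp" "'v pexp" | Times "'v pexp" "'v pexp"

fun peval :: "(complex \<Rightarrow> 'c::comm_ring_1) \<Rightarrow> ('v \<Rightarrow> 'c) \<Rightarrow> 'v pexp \<Rightarrow> 'c" where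
  "peval \<iota> \<eta> (Const c) = \<iota> c"
| "peval \<iota> \<eta> (Var v) = \<eta> v"
| "peval \<iota> \<eta> (Plus e e') = peval \<iota> \<eta> e + peval \<iota> \<eta> e'"
| "peval \<iota> \<eta> (Times e e') = peval \<iota> \<eta> e * peval \<iota> \<eta> e'"

fun plus_list :: "'v pexp list \<Rightarrow> 'v pexp list \<Rightarrow> 'v pexp list" where
  "plus_list [] ys = ys"
| "plus_list (x # xs) [] = x # xs"
| "plus_list (x # xs) (y # ys) = Plus x y # plus_list xs ys"

fun times_list :: "'v pexp list \<Rightarrow> 'v pexp list \<Rightarrow> 'v pexp list" where
  "times_list [] ys = []"
| "times_list (x # xs) ys = plus_list (map (Times x) ys) (Const 0 # times_list xs ys)"

text \<open>Coefficients of an expression as a polynomial in one of its variables.\<close>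

fun coeff_list :: "'v \<Rightarrow> 'v pexp \<Rightarrow> 'v pexp list" where
  "coeff_list v (Const c) = [Const c]"
| "coeff_list v (Var w) = (if w = v then [Const 0, Const 1] else [Var w])"
| "coeff_list v (Plus e e') = plus_list (coeff_list v e) (coeff_list v e')"
| "coeff_list v (Times e e') = times_list (coeff_list v e) (coeff_list v e')"

definition complex_hom :: "(complex \<Rightarrow> 'c::comm_ring_1) \<Rightarrow> bool" where
  "complex_hom \<iota> \<longleftrightarrow> \<iota> 1 = 1 \<and> (\<forall>a b. \<iota> (a + b) = \<iota> a + \<iota> b) \<and> (\<forall>a b. \<iota> (a * b) = \<iota> a * \<iota> b)"

lemma complex_homD:
  assumes "complex_hom \<iota>"
  shows "\<iota> 1 = 1" "\<iota> (a + b) = \<iota> a + \<iota> b" "\<iota> (a * b) = \<iota> a * \<iota> b" "\<iota> 0 = 0" "\<iota> (- a) = - \<iota> a"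
proof -
  show 1: "\<iota> 1 = 1" "\<iota> (a + b) = \<iota> a + \<iota> b" "\<iota> (a * b) = \<iota> a * \<iota> b" for a b
    using assms unfolding complex_hom_def by blast+
  show 0: "\<iota> 0 = 0" using 1(2)[of 0 0] by simp
  have "\<iota> a + \<iota> (- a) = 0" using 1(2)[of a "- a"] 0 by simp
  then show "\<iota> (- a) = - \<iota> a" by (rule minus_unique[symmetric])
qed

lemma complex_hom_id: "complex_hom (\<lambda>c. c)"
  by (simp add: complex_hom_def)

definition horner :: "(complex \<Rightarrow> 'c::comm_ring_1) \<Rightarrow> ('v \<Rightarrow> 'c) \<Rightarrow> 'v pexp list \<Rightarrow> 'c \<Rightarrow> 'c" where
  "horner \<iota> \<eta> es x = foldr (\<lambda>e a. peval \<iota> \<eta> e + x * a) es 0"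

lemma horner_simps [simp]:
  "horner \<iota> \<eta> [] x = 0" "horner \<iota> \<eta> (e # es) x = peval \<iota> \<eta> e + x * horner \<iota> \<eta> es x"
  by (simp_all add: horner_def)

lemma horner_plus: "horner \<iota> \<eta> (plus_list xs ys) x = horner \<iota> \<eta> xs x + horner \<iota> \<eta> ys x"
  by (induction xs ys rule: plus_list.induct) (auto simp: algebra_simps)

lemma horner_map: "horner \<iota> \<eta> (map (Times e) ys) x = peval \<iota> \<eta> e * horner \<iota> \<eta> ys x"
  by (induction ys) (auto simp: algebra_simps)

lemma horner_times:
  assumes "complex_hom \<iota>"
  shows "horner \<iota> \<eta> (times_list xs ys) x = horner \<iota> \<eta> xs x * horner \<iota> \<eta> ys x"
  by (induction xs ys rule: times_list.induct)
    (auto simp: horner_plus horner_map complex_homD[OF assms] algebra_simps)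

lemma horner_coeff_list:
  assumes "complex_hom \<iota>"
  shows "horner \<iota> \<eta> (coeff_list v e) (\<eta> v) = peval \<iota> \<eta> e"
  by (induction e) (auto simp: horner_plus horner_times[OF assms] complex_homD[OF assms])

lemma vars_plus_list: "(\<Union>e\<in>set (plus_list xs ys). set_pexp e) \<subseteq>
    (\<Union>e\<in>set xs. set_pexp e) \<union> (\<Union>e\<in>set ys. set_pexp e)"
  by (induction xs ys rule: plus_list.induct) auto

lemma vars_times_list: "(\<Union>e\<in>set (times_list xs ys). set_pexp e) \<subseteq>
    (\<Union>e\<in>set xs. set_pexp e) \<union> (\<Union>e\<in>set ys. set_pexp e)"
proof (induction xs ys rule: times_list.induct)
  case (2 x xs ys)
  have "(\<Union>e\<in>set (times_list (x # xs) ys). set_pexp e)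
      \<subseteq> (\<Union>e\<in>set (map (Times x) ys). set_pexp e)
        \<union> (\<Union>e\<in>set (Const 0 # times_list xs ys). set_pexp e)"
    using vars_plus_list by (simp only: times_list.simps)
  also have "\<dots> \<subseteq> (set_pexp x \<union> (\<Union>e\<in>set (ys). set_pexp e)) \<union> (\<Union>e\<in>set (times_list xs ys). set_pexp e)"
    by (intro Un_mono) auto
  also have "\<dots> \<subseteq> (\<Union>e\<in>set (x # xs). set_pexp e) \<union> (\<Union>e\<in>set (ys). set_pexp e)"
    using 2 by (simp only: list.set UN_insert) blast
  finally show ?case .
qed simp

lemma vars_coeff_list: "(\<Union>e'\<in>set (coeff_list v e). set_pexp e') \<subseteq> set_pexp e - {v}"
proof (induction e)
  case (Plus e e')
  show ?case
    using subset_trans[OF vars_plus_list Un_mono[OF Plus]] by (simp add: Un_Diff)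
next
  case (Times e e')
  show ?case
    using subset_trans[OF vars_times_list Un_mono[OF Times]] by (simp add: Un_Diff)
qed auto

lemma peval_cong: "(\<And>v. v \<in> set_pexp e \<Longrightarrow> \<eta> v = \<eta>' v) \<Longrightarrow> peval \<iota> \<eta> e = peval \<iota> \<eta>' e"
  by (induction e) auto

lemma peval_no_vars:
  assumes "complex_hom \<iota>"
  shows "set_pexp e = {} \<Longrightarrow> peval \<iota> \<eta> e = \<iota> (peval (\<lambda>c. c) \<eta>' e)"
  by (induction e) (auto simp: complex_homD[OF assms])

text \<open>A polynomial expression that vanishes identically on complex numbers vanishes identically
  on every commutative \<open>\<complex>\<close>-algebra.\<close>

lemma peval_zero:
  assumes \<iota>: "complex_hom \<iota>"
  shows "finite V \<Longrightarrow> set_pexp e \<subseteq> V \<Longrightarrow> (\<And>\<eta>. peval (\<lambda>c. c) \<eta> e = 0) \<Longrightarrow> peval \<iota> \<eta>' e = 0"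
proof (induction V arbitrary: e rule: finite_induct)
  case empty
  then show ?case using peval_no_vars[OF \<iota>, of e \<eta>' "\<lambda>_. 0"] complex_homD(4)[OF \<iota>] by simp
next
  case (insert v V)
  let ?es = "coeff_list v e"
  have vars: "set_pexp e' \<subseteq> V" "v \<notin> set_pexp e'" if "e' \<in> set ?es" for e'
    using vars_coeff_list[of v e] insert.prems(1) that by blast+
  have zero: "peval (\<lambda>c. c) \<eta> e' = 0" if e': "e' \<in> set ?es" for e' \<eta>
  proof -
    have poly_horner: "poly (Poly (map (peval (\<lambda>c. c) \<eta>) es)) x = horner (\<lambda>c. c) \<eta> es x" for es x
      by (induction es) auto
    have "poly (Poly (map (peval (\<lambda>c. c) \<eta>) ?es)) x = 0" for x
    proof -
      let ?\<eta> = "\<eta>(v := x)"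
      have m: "map (peval (\<lambda>c. c) \<eta>) ?es = map (peval (\<lambda>c. c) ?\<eta>) ?es"
        using vars by (intro map_cong refl peval_cong) auto
      have "horner (\<lambda>c. c) \<eta> ?es x = horner (\<lambda>c. c) ?\<eta> ?es x"
        using m by (auto simp: horner_def intro!: foldr_cong)
      also have "\<dots> = peval (\<lambda>c. c) ?\<eta> e"
        using horner_coeff_list[OF complex_hom_id, of ?\<eta> v e] by simp
      finally show ?thesis using insert.prems(2) poly_horner by simp
    qed
    then have "Poly (map (peval (\<lambda>c. c) \<eta>) ?es) = 0"
      using poly_all_0_iff_0 by blast
    then have "\<exists>n. map (peval (\<lambda>c. c) \<eta>) ?es = replicate n 0"
      by (simp add: Poly_eq_0)
    moreover have "peval (\<lambda>c. c) \<eta> e' \<in> set (map (peval (\<lambda>c. c) \<eta>) ?es)" using e' by simp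
    ultimately show ?thesis by force
  qed
  have "horner \<iota> \<eta>' es x = 0" if "set es \<subseteq> set ?es" for es x
    using that
  proof (induction es)
    case (Cons a es)
    have "peval \<iota> \<eta>' a = 0"
      using Cons.prems insert.IH[of a] vars zero by auto
    with Cons show ?case by simp
  qed simp
  from this[of ?es] show ?case using horner_coeff_list[OF \<iota>] by (metis subset_refl)
qed

text \<open>Homomorphisms of \<open>\<complex>\<close>-algebras from an algebra of functions to a \<open>\<complex>\<close>-algebra with structure
  map \<open>\<iota>\<close>, resp. to its ring of polynomials in \<open>t\<close> modulo \<open>t\<^sup>m\<^sup>+\<^sup>1\<close>, whose elements are
  represented by polynomials of degree at most \<open>m\<close>. All maps are normalised outside of their
  domain.\<close>

definition alg_homs :: "('x \<Rightarrow> complex) set \<Rightarrow> (complex \<Rightarrow> 'b::comm_ring_1)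
    \<Rightarrow> (('x \<Rightarrow> complex) \<Rightarrow> 'b) set" where
  "alg_homs A \<iota> = {\<psi> \<in> extensional A. (\<forall>c. \<psi> (\<lambda>_. c) = \<iota> c) \<and>
     (\<forall>f\<in>A. \<forall>g\<in>A. \<psi> (\<lambda>x. f x + g x) = \<psi> f + \<psi> g \<and> \<psi> (\<lambda>x. f x * g x) = \<psi> f * \<psi> g)}"

definition arc_homs :: "nat \<Rightarrow> ('x \<Rightarrow> complex) set \<Rightarrow> (complex \<Rightarrow> 'b::comm_ring_1)
    \<Rightarrow> (('x \<Rightarrow> complex) \<Rightarrow> 'b poly) set" where
  "arc_homs m A \<iota> = {u \<in> extensional A. (\<forall>f\<in>A. degree (u f) \<le> m) \<and> (\<forall>c. u (\<lambda>_. c) = [:\<iota> c:]) \<and>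
     (\<forall>f\<in>A. \<forall>g\<in>A. u (\<lambda>x. f x + g x) = u f + u g \<and>
        (\<forall>k\<le>m. poly.coeff (u (\<lambda>x. f x * g x)) k = poly.coeff (u f * u g) k))}"

context fd_complex_space
begin

lemma carrier_coord_ring: "carrier coord_ring = alg_gen {\<phi>. functional \<phi>}"
  by (simp add: coord_ring_def fun_ring_def)

lemma carrier_jet_ring:
  "carrier (jet_ring m) = alg_gen {\<lambda>x. \<phi> (x j) | \<phi> j. functional \<phi> \<and> j \<le> m}"
  by (simp add: jet_ring_def fun_ring_def)

lemma functionalD:
  assumes "functional \<phi>"
  shows "\<phi> (x + y) = \<phi> x + \<phi> y" "\<phi> (c \<odot> x) = c * \<phi> x" "\<phi> (sum h S) = (\<Sum>i\<in>S. \<phi> (h i))"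
proof -
  interpret \<phi>: Vector_Spaces.linear "(\<odot>)" "(*)" \<phi> using assms by (simp add: functional_def)
  show "\<phi> (x + y) = \<phi> x + \<phi> y" "\<phi> (c \<odot> x) = c * \<phi> x" "\<phi> (sum h S) = (\<Sum>i\<in>S. \<phi> (h i))"
    by (auto simp: \<phi>.add \<phi>.scale \<phi>.sum)
qed

lemma poly_along_arc:
  assumes "f \<in> carrier coord_ring"
  shows "\<exists>p. \<forall>t. poly p t = f (\<Sum>j\<le>m. t ^ j \<odot> x j)"
  using assms unfolding carrier_coord_ring
proof induction
  case (const c)
  show ?case by (rule exI[of _ "[:c:]"]) simp
next
  case (gen \<phi>)
  then show ?case
    by (intro exI[of _ "\<Sum>j\<le>m. monom (\<phi> (x j)) j"])
      (simp add: functionalD poly_sum poly_monom mult.commute)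
next
  case (add f g)
  then obtain p q where "\<forall>t. poly p t = f (\<Sum>j\<le>m. t ^ j \<odot> x j)" "\<forall>t. poly q t = g (\<Sum>j\<le>m. t ^ j \<odot> x j)"
    by blast
  then show ?case by (intro exI[of _ "p + q"]) simp
next
  case (mult f g)
  then obtain p q where "\<forall>t. poly p t = f (\<Sum>j\<le>m. t ^ j \<odot> x j)" "\<forall>t. poly q t = g (\<Sum>j\<le>m. t ^ j \<odot> x j)"
    by blast
  then show ?case by (intro exI[of _ "p * q"]) simp
qed

lemma jet_coeff_eqI:
  assumes "\<And>t. poly p t = f (\<Sum>j\<le>m. t ^ j \<odot> x j)"
  shows "jet_coeff m f k x = poly.coeff p k"
proof -
  have "(THE p. \<forall>t. poly p t = f (\<Sum>j\<le>m. t ^ j \<odot> x j)) = p"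
    using assms by (intro the_equality) (auto simp: poly_eq_poly_eq_iff[symmetric])
  then show ?thesis by (simp add: jet_coeff_def)
qed

lemma jet_coeff_const: "jet_coeff m (\<lambda>_. c) k = (\<lambda>_. if k = 0 then c else 0)"
  by (rule ext, subst jet_coeff_eqI[of "[:c:]"]) (auto simp: coeff_pCons split: nat.split)

lemma jet_coeff_functional:
  assumes "functional \<phi>" "k \<le> m"
  shows "jet_coeff m \<phi> k = (\<lambda>x. \<phi> (x k))"
proof
  fix x
  have "jet_coeff m \<phi> k x = poly.coeff (\<Sum>j\<le>m. monom (\<phi> (x j)) j) k"
    by (rule jet_coeff_eqI) (simp add: assms functionalD poly_sum poly_monom mult.commute)
  also have "\<dots> = \<phi> (x k)" using assms by (simp add: coeff_sum)
  finally show "jet_coeff m \<phi> k x = \<phi> (x k)" .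
qed

lemma jet_coeff_add:
  assumes "f \<in> carrier coord_ring" "g \<in> carrier coord_ring"
  shows "jet_coeff m (\<lambda>x. f x + g x) k = (\<lambda>x. jet_coeff m f k x + jet_coeff m g k x)"
proof
  fix x
  obtain p q where p: "\<And>t. poly p t = f (\<Sum>j\<le>m. t ^ j \<odot> x j)"
    and q: "\<And>t. poly q t = g (\<Sum>j\<le>m. t ^ j \<odot> x j)"
    using assms poly_along_arc by metis
  show "jet_coeff m (\<lambda>x. f x + g x) k x = jet_coeff m f k x + jet_coeff m g k x"
    by (subst jet_coeff_eqI[of "p + q"]) (simp_all add: p q jet_coeff_eqI[of p f, OF p] jet_coeff_eqI[of q g, OF q])
qed

lemma jet_coeff_mult:
  assumes "f \<in> carrier coord_ring" "g \<in> carrier coord_ring"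
  shows "jet_coeff m (\<lambda>x. f x * g x) k = (\<lambda>x. \<Sum>i\<le>k. jet_coeff m f i x * jet_coeff m g (k - i) x)"
proof
  fix x
  obtain p q where p: "\<And>t. poly p t = f (\<Sum>j\<le>m. t ^ j \<odot> x j)"
    and q: "\<And>t. poly q t = g (\<Sum>j\<le>m. t ^ j \<odot> x j)"
    using assms poly_along_arc by metis
  show "jet_coeff m (\<lambda>x. f x * g x) k x = (\<Sum>i\<le>k. jet_coeff m f i x * jet_coeff m g (k - i) x)"
    by (subst jet_coeff_eqI[of "p * q"])
      (simp_all add: p q coeff_mult jet_coeff_eqI[of p f, OF p] jet_coeff_eqI[of q g, OF q])
qed

lemma alg_gen_sum:
  "finite S \<Longrightarrow> (\<And>i. i \<in> S \<Longrightarrow> h i \<in> alg_gen F) \<Longrightarrow> (\<lambda>x. \<Sum>i\<in>S. h i x) \<in> alg_gen F"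
  by (induction S rule: finite_induct) (auto intro: alg_gen.intros)

lemma jet_coeff_in_jet_ring:
  assumes "f \<in> carrier coord_ring" "k \<le> m"
  shows "jet_coeff m f k \<in> carrier (jet_ring m)"
  using assms unfolding carrier_coord_ring carrier_jet_ring
proof (induction arbitrary: k)
  case (const c)
  show ?case by (simp add: jet_coeff_const alg_gen.const)
next
  case (gen f)
  then show ?case by (auto simp: jet_coeff_functional intro!: alg_gen.gen)
next
  case (add f g)
  then show ?case by (simp add: jet_coeff_add carrier_coord_ring alg_gen.add)
next
  case (mult f g)
  then show ?case by (auto simp: jet_coeff_mult carrier_coord_ring intro!: alg_gen_sum alg_gen.mult)
qed

lemma alg_homs_sum:
  assumes "\<psi> \<in> alg_homs (alg_gen F) \<iota>" "\<iota> 0 = 0" "finite S" "\<And>i. i \<in> S \<Longrightarrow> h i \<in> alg_gen F"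
  shows "\<psi> (\<lambda>x. \<Sum>i\<in>S. h i x) = (\<Sum>i\<in>S. \<psi> (h i))"
  using assms(3,4)
proof (induction S rule: finite_induct)
  case empty
  then show ?case using assms by (simp add: alg_homs_def)
next
  case (insert i S)
  then have "(\<lambda>x. \<Sum>i\<in>S. h i x) \<in> alg_gen F" by (intro alg_gen_sum) auto
  with insert assms(1) show ?case by (simp add: alg_homs_def)
qed

lemma alg_homs_kills_ideal:
  assumes \<iota>: "complex_hom \<iota>" and \<psi>: "\<psi> \<in> alg_homs (carrier (jet_ring m)) \<iota>"
    and I: "I \<subseteq> carrier coord_ring"
  shows "(\<forall>F\<in>jet_ideal m I. \<psi> F = 0) \<longleftrightarrow> (\<forall>f\<in>I. \<forall>k\<le>m. \<psi> (jet_coeff m f k) = 0)"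
proof
  let ?G = "{jet_coeff m f k | f k. f \<in> I \<and> k \<le> m}"
  interpret J: cring "jet_ring m" unfolding jet_ring_def by (rule cring_fun_ring)
  have G: "?G \<subseteq> carrier (jet_ring m)" using I jet_coeff_in_jet_ring by blast
  {
    assume "\<forall>F\<in>jet_ideal m I. \<psi> F = 0"
    then show "\<forall>f\<in>I. \<forall>k\<le>m. \<psi> (jet_coeff m f k) = 0"
      using J.genideal_self[OF G] unfolding jet_ideal_def by blast
  next
    assume gen: "\<forall>f\<in>I. \<forall>k\<le>m. \<psi> (jet_coeff m f k) = 0"
    let ?K = "{F \<in> carrier (jet_ring m). \<psi> F = 0}"
    have ops: "F \<oplus>\<^bsub>jet_ring m\<^esub> H = (\<lambda>x. F x + H x)" "F \<otimes>\<^bsub>jet_ring m\<^esub> H = (\<lambda>x. F x * H x)"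
      "\<zero>\<^bsub>jet_ring m\<^esub> = (\<lambda>_. 0)" for F H
      by (simp_all add: jet_ring_def fun_ring_def)
    have hom: "\<psi> (\<lambda>x. F x + H x) = \<psi> F + \<psi> H" "\<psi> (\<lambda>x. F x * H x) = \<psi> F * \<psi> H"
      if "F \<in> carrier (jet_ring m)" "H \<in> carrier (jet_ring m)" for F H
      using \<psi> that by (auto simp: alg_homs_def)
    have const: "\<psi> (\<lambda>_. c) = \<iota> c" for c using \<psi> by (simp add: alg_homs_def)
    have "ideal ?K (jet_ring m)"
    proof (rule idealI)
      show "ring (jet_ring m)" by (rule J.ring_axioms)
      show "subgroup ?K (add_monoid (jet_ring m))"
      proof (rule J.add.subgroupI)
        show "?K \<noteq> {}" using const complex_homD(4)[OF \<iota>] J.zero_closed unfolding ops by auto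
      next
        fix F assume F: "F \<in> ?K"
        have "\<psi> (\<ominus>\<^bsub>jet_ring m\<^esub> F \<oplus>\<^bsub>jet_ring m\<^esub> F) = \<psi> (\<ominus>\<^bsub>jet_ring m\<^esub> F) + \<psi> F"
          using F unfolding ops by (intro hom) auto
        moreover have "\<psi> (\<ominus>\<^bsub>jet_ring m\<^esub> F \<oplus>\<^bsub>jet_ring m\<^esub> F) = 0"
          using F const complex_homD(4)[OF \<iota>] J.l_neg[of F] by (simp add: ops(3))
        ultimately show "\<ominus>\<^bsub>jet_ring m\<^esub> F \<in> ?K" using F by simp
      next
        fix F H assume "F \<in> ?K" "H \<in> ?K"
        then show "F \<oplus>\<^bsub>jet_ring m\<^esub> H \<in> ?K" using hom(1)[of F H] J.a_closed[of F H] by (simp add: ops(1))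
      qed auto
    next
      fix F H assume "F \<in> ?K" "H \<in> carrier (jet_ring m)"
      then show "H \<otimes>\<^bsub>jet_ring m\<^esub> F \<in> ?K" "F \<otimes>\<^bsub>jet_ring m\<^esub> H \<in> ?K"
        using hom(2)[of F H] hom(2)[of H F] J.m_closed[of F H] J.m_closed[of H F] by (simp_all add: ops(2))
    qed
    moreover have "?G \<subseteq> ?K" using gen G by blast
    ultimately have "jet_ideal m I \<subseteq> ?K"
      unfolding jet_ideal_def by (rule J.genideal_minimal)
    then show "\<forall>F\<in>jet_ideal m I. \<psi> F = 0" by blast
  }
qed

text \<open>Every arc with values in a \<open>\<complex>\<close>-algebra comes from a unique point of the jet space, here for
  the whole vector space.\<close>

lemma jet_ring_universal:
  assumes \<iota>: "complex_hom \<iota>" and u: "u \<in> arc_homs m (carrier coord_ring) \<iota>"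
  shows "\<exists>\<psi> \<in> alg_homs (carrier (jet_ring m)) \<iota>.
           \<forall>f\<in>carrier coord_ring. \<forall>k\<le>m. \<psi> (jet_coeff m f k) = poly.coeff (u f) k"
proof -
  obtain B0 where B0: "finite B0" "span B0 = UNIV" using finite_dim by blast
  obtain B where B: "B \<subseteq> B0" "independent B" "span B = UNIV"
    using maximal_independent_subset[of B0] B0
    by (metis span_mono span_span subset_antisym top_greatest)
  have finB: "finite B" using B B0 finite_subset by blast
  define co where "co b x = representation B x b" for b x
  have co: "functional (co b)" for b
    unfolding functional_def co_def
    by unfold_locales (simp_all add: representation_add representation_scale B)
  have expand: "(\<Sum>b\<in>B. co b x \<odot> b) = x" for x
    unfolding co_def using sum_representation_eq[OF B(2) _ finB subset_refl] B(3) by simp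
  have co_basis: "co b (\<Sum>b\<in>B. c b \<odot> b) = c b" if "b \<in> B" for b c
  proof -
    have "co b b' = (if b' = b then 1 else 0)" if "b' \<in> B" for b'
      unfolding co_def using representation_basis[OF B(2) that] by auto
    then have "(\<Sum>b'\<in>B. c b' * co b b') = (\<Sum>b'\<in>B. if b' = b then c b' else 0)"
      by (intro sum.cong) auto
    then show ?thesis using \<open>b \<in> B\<close> finB by (simp add: functionalD[OF co])
  qed
  have functional_expand: "\<phi> x = (\<Sum>b\<in>B. \<phi> b * co b x)" if "functional \<phi>" for \<phi> x
    using functionalD[OF that] expand[of x] by (metis (no_types, lifting) mult.commute sum.cong)
  have functional_expand': "(\<lambda>x. \<Sum>b\<in>B. \<phi> b * co b (h x)) = (\<lambda>x. \<phi> (h x))"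
    if "functional \<phi>" for \<phi> and h :: "'x \<Rightarrow> 'g"
    using functional_expand[OF that] by (intro ext) (rule sym)
  define V where "V = B \<times> {..m}"
  have finV: "finite V" using finB by (simp add: V_def)
  define pt where "pt x = (\<lambda>(b, j). co b (x j))" for x :: "nat \<Rightarrow> 'g"
  have exp_ex: "\<exists>e. set_pexp e \<subseteq> V \<and> F = (\<lambda>x. peval (\<lambda>c. c) (pt x) e)"
    if "F \<in> carrier (jet_ring m)" for F
    using that unfolding carrier_jet_ring
  proof induction
    case (const c)
    show ?case by (rule exI[of _ "Const c"]) simp
  next
    case (gen F)
    then obtain \<phi> j where \<phi>: "functional \<phi>" "j \<le> m" "F = (\<lambda>x. \<phi> (x j))" by blast
    have "\<exists>e. set_pexp e \<subseteq> V \<and> (\<lambda>x. \<Sum>b\<in>B'. \<phi> b * co b (x j)) = (\<lambda>x. peval (\<lambda>c. c) (pt x) e)"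
      if "finite B'" "B' \<subseteq> B" for B'
      using that
    proof (induction B' rule: finite_induct)
      case empty
      show ?case by (rule exI[of _ "Const 0"]) simp
    next
      case (insert b B')
      then obtain e where "set_pexp e \<subseteq> V"
        "(\<lambda>x. \<Sum>b\<in>B'. \<phi> b * co b (x j)) = (\<lambda>x. peval (\<lambda>c. c) (pt x) e)" by auto
      with insert \<phi>(2) show ?case
        by (intro exI[of _ "Plus (Times (Const (\<phi> b)) (Var (b, j))) e"])
          (auto simp: V_def pt_def fun_eq_iff)
    qed
    from this[OF finB subset_refl] show ?case
      unfolding functional_expand'[OF \<phi>(1)] \<phi>(3) .
  next
    case (add F H)
    then obtain e e' where "set_pexp e \<subseteq> V" "F = (\<lambda>x. peval (\<lambda>c. c) (pt x) e)"
      "set_pexp e' \<subseteq> V" "H = (\<lambda>x. peval (\<lambda>c. c) (pt x) e')" by blast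
    then show ?case by (intro exI[of _ "Plus e e'"]) auto
  next
    case (mult F H)
    then obtain e e' where "set_pexp e \<subseteq> V" "F = (\<lambda>x. peval (\<lambda>c. c) (pt x) e)"
      "set_pexp e' \<subseteq> V" "H = (\<lambda>x. peval (\<lambda>c. c) (pt x) e')" by blast
    then show ?case by (intro exI[of _ "Times e e'"]) auto
  qed
  define \<epsilon> where "\<epsilon> F = (SOME e. set_pexp e \<subseteq> V \<and> F = (\<lambda>x. peval (\<lambda>c. c) (pt x) e))" for F
  have \<epsilon>: "set_pexp (\<epsilon> F) \<subseteq> V" "F = (\<lambda>x. peval (\<lambda>c. c) (pt x) (\<epsilon> F))"
    if "F \<in> carrier (jet_ring m)" for F
    using someI_ex[OF exp_ex[OF that]] unfolding \<epsilon>_def by blast+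
  define \<eta> where "\<eta> = (\<lambda>(b, j). poly.coeff (u (co b)) j)"
  define \<psi> where "\<psi> = restrict (\<lambda>F. peval \<iota> \<eta> (\<epsilon> F)) (carrier (jet_ring m))"
  have well_def: "peval \<iota> \<eta> e = peval \<iota> \<eta> e'"
    if e: "set_pexp e \<subseteq> V" "set_pexp e' \<subseteq> V"
      and eq: "\<And>x. peval (\<lambda>c. c) (pt x) e = peval (\<lambda>c. c) (pt x) e'" for e e'
  proof -
    let ?d = "Plus e (Times (Const (- 1)) e')"
    have d: "set_pexp ?d \<subseteq> V" using e by simp
    have "peval (\<lambda>c. c) \<zeta> ?d = 0" for \<zeta>
    proof -
      define x where "x = (\<lambda>j. \<Sum>b\<in>B. \<zeta> (b, j) \<odot> b)"
      have "pt x v = \<zeta> v" if "v \<in> V" for v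
        using that by (auto simp: pt_def x_def V_def co_basis)
      then have "peval (\<lambda>c. c) \<zeta> ?d = peval (\<lambda>c. c) (pt x) ?d"
        using d by (intro peval_cong) (metis subsetD)
      then show ?thesis using eq[of x] by simp
    qed
    from peval_zero[OF \<iota> finV d this, of \<eta>] show ?thesis
      by (simp add: complex_homD[OF \<iota>])
  qed
  have \<psi>_eq: "\<psi> F = peval \<iota> \<eta> e"
    if "F \<in> carrier (jet_ring m)" "set_pexp e \<subseteq> V" "F = (\<lambda>x. peval (\<lambda>c. c) (pt x) e)" for F e
  proof -
    have "peval (\<lambda>c. c) (pt x) (\<epsilon> F) = peval (\<lambda>c. c) (pt x) e" for x
      using fun_cong[OF \<epsilon>(2)[OF that(1)], of x] fun_cong[OF that(3), of x] by simp
    from well_def[OF \<epsilon>(1)[OF that(1)] that(2) this] show ?thesis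
      using that(1) by (simp add: \<psi>_def)
  qed
  have const_in: "(\<lambda>_. c) \<in> carrier (jet_ring m)" for c
    by (simp add: carrier_jet_ring alg_gen.const)
  have add_in: "(\<lambda>x. F x + H x) \<in> carrier (jet_ring m)" and mult_in: "(\<lambda>x. F x * H x) \<in> carrier (jet_ring m)"
    if "F \<in> carrier (jet_ring m)" "H \<in> carrier (jet_ring m)" for F H
    using that by (simp_all add: carrier_jet_ring alg_gen.add alg_gen.mult)
  have \<psi>_hom: "\<psi> \<in> alg_homs (carrier (jet_ring m)) \<iota>"
    unfolding alg_homs_def
  proof (intro CollectI conjI allI ballI)
    show "\<psi> \<in> extensional (carrier (jet_ring m))" by (simp add: \<psi>_def)
    show "\<psi> (\<lambda>_. c) = \<iota> c" for c
      using \<psi>_eq[OF const_in, of "Const c" c] by simp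
    fix F H assume F: "F \<in> carrier (jet_ring m)" and H: "H \<in> carrier (jet_ring m)"
    have pF: "F x = peval (\<lambda>c. c) (pt x) (\<epsilon> F)" and pH: "H x = peval (\<lambda>c. c) (pt x) (\<epsilon> H)" for x
      using fun_cong[OF \<epsilon>(2)[OF F], of x] fun_cong[OF \<epsilon>(2)[OF H], of x] by simp_all
    show "\<psi> (\<lambda>x. F x + H x) = \<psi> F + \<psi> H"
      using \<psi>_eq[OF add_in[OF F H], of "Plus (\<epsilon> F) (\<epsilon> H)"] \<epsilon>(1)[OF F] \<epsilon>(1)[OF H] F H
      by (simp add: pF[symmetric] pH[symmetric]) (simp add: \<psi>_def)
    show "\<psi> (\<lambda>x. F x * H x) = \<psi> F * \<psi> H"
      using \<psi>_eq[OF mult_in[OF F H], of "Times (\<epsilon> F) (\<epsilon> H)"] \<epsilon>(1)[OF F] \<epsilon>(1)[OF H] F H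
      by (simp add: pF[symmetric] pH[symmetric]) (simp add: \<psi>_def)
  qed
  have \<iota>0: "\<iota> 0 = 0" by (rule complex_homD(4)[OF \<iota>])
  have \<psi>_const: "\<psi> (\<lambda>_. c) = \<iota> c" for c
    using \<psi>_hom by (simp add: alg_homs_def)
  have \<psi>_add: "\<psi> (\<lambda>x. F x + H x) = \<psi> F + \<psi> H" and \<psi>_mult: "\<psi> (\<lambda>x. F x * H x) = \<psi> F * \<psi> H"
    if "F \<in> carrier (jet_ring m)" "H \<in> carrier (jet_ring m)" for F H
    using \<psi>_hom that by (auto simp: alg_homs_def)
  have u_const: "u (\<lambda>_. c) = [:\<iota> c:]" for c
    using u by (simp add: arc_homs_def)
  have u_add: "u (\<lambda>x. f x + g x) = u f + u g"
    and u_mult: "k \<le> m \<Longrightarrow> poly.coeff (u (\<lambda>x. f x * g x)) k = poly.coeff (u f * u g) k"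
    if "f \<in> carrier coord_ring" "g \<in> carrier coord_ring" for f g k
    using u that by (auto simp: arc_homs_def)
  have u_sum: "poly.coeff (u (\<lambda>x. \<Sum>b\<in>B'. \<phi> b * co b x)) k = (\<Sum>b\<in>B'. \<iota> (\<phi> b) * poly.coeff (u (co b)) k)"
    if "finite B'" "k \<le> m" for B' k and \<phi> :: "'g \<Rightarrow> complex"
    using that
  proof (induction B' rule: finite_induct)
    case empty
    then show ?case by (simp add: u_const \<iota>0)
  next
    case (insert b B')
    have co_in: "co b \<in> carrier coord_ring" for b
      using co by (auto simp: carrier_coord_ring intro: alg_gen.gen)
    have c_in: "(\<lambda>_. c) \<in> carrier coord_ring" for c
      by (auto simp: carrier_coord_ring intro: alg_gen.const)
    have t_in: "(\<lambda>x. \<phi> b * co b x) \<in> carrier coord_ring" for b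
      using c_in co_in unfolding carrier_coord_ring by (intro alg_gen.mult)
    have "(\<lambda>x. \<Sum>b\<in>B'. \<phi> b * co b x) \<in> carrier coord_ring"
      using t_in insert(1) unfolding carrier_coord_ring by (intro alg_gen_sum) auto
    from u_add[OF t_in[of b] this] insert u_mult[OF c_in co_in, of k "\<phi> b" b]
    show ?case by (simp add: u_const)
  qed
  have key: "\<psi> (jet_coeff m f k) = poly.coeff (u f) k" if "f \<in> carrier coord_ring" "k \<le> m" for f k
    using that(1) that(2) unfolding carrier_coord_ring
  proof (induction arbitrary: k)
    case (const c)
    show ?case by (auto simp: jet_coeff_const \<psi>_const u_const \<iota>0 coeff_pCons split: nat.split)
  next
    case (gen \<phi>)
    then have \<phi>: "functional \<phi>" by simp
    have in_jet: "(\<lambda>x. co b (x k)) \<in> carrier (jet_ring m)" for b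
      using co gen.prems unfolding carrier_jet_ring by (intro alg_gen.gen) auto
    have coord: "\<psi> (\<lambda>x. co b (x k)) = poly.coeff (u (co b)) k" if "b \<in> B" for b
      using \<psi>_eq[OF in_jet, of "Var (b, k)" b] that gen.prems by (simp add: V_def pt_def \<eta>_def)
    have "\<psi> (jet_coeff m \<phi> k) = \<psi> (\<lambda>x. \<Sum>b\<in>B. \<phi> b * co b (x k))"
      unfolding jet_coeff_functional[OF \<phi> gen.prems] functional_expand'[OF \<phi>] ..
    also have "\<dots> = (\<Sum>b\<in>B. \<psi> (\<lambda>x. \<phi> b * co b (x k)))"
      using alg_homs_sum[OF \<psi>_hom[unfolded carrier_jet_ring] \<iota>0 finB,
          of "\<lambda>b x. \<phi> b * co b (x k)"] mult_in[OF const_in in_jet]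
      by (simp add: carrier_jet_ring)
    also have "\<dots> = (\<Sum>b\<in>B. \<iota> (\<phi> b) * poly.coeff (u (co b)) k)"
      using \<psi>_mult[OF const_in in_jet] coord by (intro sum.cong refl) (simp add: \<psi>_const)
    also have "\<dots> = poly.coeff (u (\<lambda>x. \<Sum>b\<in>B. \<phi> b * co b x)) k"
      using u_sum[OF finB gen.prems] by simp
    also have "(\<lambda>x. \<Sum>b\<in>B. \<phi> b * co b x) = \<phi>"
      by (rule functional_expand'[OF \<phi>])
    finally show ?case .
  next
    case (add f g)
    then show ?case
      by (simp add: carrier_coord_ring[symmetric] jet_coeff_add \<psi>_add u_add jet_coeff_in_jet_ring)
  next
    case (mult f g)
    note fg = mult.hyps[folded carrier_coord_ring]
    have j: "jet_coeff m f i \<in> carrier (jet_ring m)" "jet_coeff m g (k - i) \<in> carrier (jet_ring m)"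
      if "i \<le> k" for i
      using that fg mult.prems by (auto intro!: jet_coeff_in_jet_ring)
    have "\<psi> (jet_coeff m (\<lambda>x. f x * g x) k)
        = (\<Sum>i\<le>k. \<psi> (\<lambda>x. jet_coeff m f i x * jet_coeff m g (k - i) x))"
      unfolding jet_coeff_mult[OF fg]
      using alg_homs_sum[OF \<psi>_hom[unfolded carrier_jet_ring] \<iota>0 finite_atMost[of k],
          of "\<lambda>i x. jet_coeff m f i x * jet_coeff m g (k - i) x"] mult_in[OF j]
      by (simp add: carrier_jet_ring)
    also have "\<dots> = (\<Sum>i\<le>k. poly.coeff (u f) i * poly.coeff (u g) (k - i))"
      using mult.IH mult.prems by (intro sum.cong refl) (simp add: \<psi>_mult[OF j])
    finally show ?case using u_mult[OF fg mult.prems] by (simp add: coeff_mult)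
  qed
  show ?thesis using \<psi>_hom key by blast
qed

text \<open>\<open>jet_ring m Quot jet_ideal m I\<close> represents the functor of \<open>m\<close>-jets of the closed subscheme
  defined by \<open>I\<close>: for every commutative \<open>\<complex>\<close>-algebra \<open>b\<close> with structure map \<open>\<iota>\<close>, its
  homomorphisms to \<open>b\<close> (that is, homomorphisms on \<open>jet_ring m\<close> that kill the jet ideal)
  correspond to the homomorphisms from the coordinate ring modulo \<open>I\<close> to \<open>b[t]/(t\<^sup>m\<^sup>+\<^sup>1)\<close>.\<close>

theorem jet_ring_represents:
  fixes \<iota> :: "complex \<Rightarrow> 'b::comm_ring_1"
  assumes \<iota>: "complex_hom \<iota>" and I: "I \<subseteq> carrier coord_ring"
  shows "bij_betw (\<lambda>\<psi>. restrict (\<lambda>f. \<Sum>k\<le>m. monom (\<psi> (jet_coeff m f k)) k) (carrier coord_ring))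
    {\<psi> \<in> alg_homs (carrier (jet_ring m)) \<iota>. \<forall>F\<in>jet_ideal m I. \<psi> F = 0}
    {u \<in> arc_homs m (carrier coord_ring) \<iota>. \<forall>f\<in>I. u f = 0}"
    (is "bij_betw ?\<Phi> ?P ?U")
proof -
  have \<Phi>_coeff: "poly.coeff (?\<Phi> \<psi> f) k = (if k \<le> m then \<psi> (jet_coeff m f k) else 0)"
    if "f \<in> carrier coord_ring" for \<psi> :: "((nat \<Rightarrow> 'g) \<Rightarrow> complex) \<Rightarrow> 'b" and f k
    using that by (simp add: coeff_sum)
  have \<iota>0: "\<iota> 0 = 0" by (rule complex_homD(4)[OF \<iota>])
  have closed: "(\<lambda>_. c) \<in> carrier coord_ring"
    "f \<in> carrier coord_ring \<Longrightarrow> g \<in> carrier coord_ring \<Longrightarrow> (\<lambda>x. f x + g x) \<in> carrier coord_ring"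
    "f \<in> carrier coord_ring \<Longrightarrow> g \<in> carrier coord_ring \<Longrightarrow> (\<lambda>x. f x * g x) \<in> carrier coord_ring"
    for c f g
    by (auto simp: carrier_coord_ring intro: alg_gen.intros)
  have into: "?\<Phi> \<psi> \<in> ?U" if "\<psi> \<in> ?P" for \<psi>
  proof -
    from that have \<psi>: "\<psi> \<in> alg_homs (carrier (jet_ring m)) \<iota>"
      and kill: "\<forall>f\<in>I. \<forall>k\<le>m. \<psi> (jet_coeff m f k) = 0"
      using alg_homs_kills_ideal[OF \<iota> _ I] by auto
    have \<psi>_const: "\<psi> (\<lambda>_. c) = \<iota> c" for c
      using \<psi> by (simp add: alg_homs_def)
    have \<psi>_add: "\<psi> (\<lambda>x. F x + H x) = \<psi> F + \<psi> H" and \<psi>_mult: "\<psi> (\<lambda>x. F x * H x) = \<psi> F * \<psi> H"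
      if "F \<in> carrier (jet_ring m)" "H \<in> carrier (jet_ring m)" for F H
      using \<psi> that by (auto simp: alg_homs_def)
    have "?\<Phi> \<psi> \<in> arc_homs m (carrier coord_ring) \<iota>"
      unfolding arc_homs_def
    proof (intro CollectI conjI ballI allI impI)
      show "?\<Phi> \<psi> \<in> extensional (carrier coord_ring)" by simp
      show "degree (?\<Phi> \<psi> f) \<le> m" if "f \<in> carrier coord_ring" for f
        using \<Phi>_coeff[OF that] by (intro degree_le) auto
      show "?\<Phi> \<psi> (\<lambda>_. c) = [:\<iota> c:]" for c
        using \<Phi>_coeff[OF closed(1)[of c]]
        by (intro poly_eqI) (auto simp: jet_coeff_const \<psi>_const \<iota>0 coeff_pCons split: nat.split)
      fix f g assume f: "f \<in> carrier coord_ring" and g: "g \<in> carrier coord_ring"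
      show "?\<Phi> \<psi> (\<lambda>x. f x + g x) = ?\<Phi> \<psi> f + ?\<Phi> \<psi> g"
        using \<Phi>_coeff[OF f] \<Phi>_coeff[OF g] \<Phi>_coeff[OF closed(2)[OF f g]]
        by (intro poly_eqI)
          (simp add: jet_coeff_add[OF f g] \<psi>_add jet_coeff_in_jet_ring f g del: restrict_apply restrict_apply')
      fix k assume k: "k \<le> m"
      have j: "jet_coeff m f i \<in> carrier (jet_ring m)" "jet_coeff m g (k - i) \<in> carrier (jet_ring m)"
        if "i \<le> k" for i
        using that f g k by (auto intro!: jet_coeff_in_jet_ring)
      have "\<psi> (jet_coeff m (\<lambda>x. f x * g x) k)
          = (\<Sum>i\<le>k. \<psi> (\<lambda>x. jet_coeff m f i x * jet_coeff m g (k - i) x))"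
        unfolding jet_coeff_mult[OF f g]
        using alg_homs_sum[OF \<psi>[unfolded carrier_jet_ring] \<iota>0 finite_atMost[of k],
            of "\<lambda>i x. jet_coeff m f i x * jet_coeff m g (k - i) x"] j
        by (simp add: carrier_jet_ring alg_gen.mult)
      also have "\<dots> = (\<Sum>i\<le>k. \<psi> (jet_coeff m f i) * \<psi> (jet_coeff m g (k - i)))"
        by (intro sum.cong refl) (simp add: \<psi>_mult[OF j])
      also have "\<dots> = poly.coeff (?\<Phi> \<psi> f * ?\<Phi> \<psi> g) k"
        unfolding coeff_mult \<Phi>_coeff[OF f] \<Phi>_coeff[OF g] using k by (intro sum.cong) auto
      finally show "poly.coeff (?\<Phi> \<psi> (\<lambda>x. f x * g x)) k = poly.coeff (?\<Phi> \<psi> f * ?\<Phi> \<psi> g) k"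
        using \<Phi>_coeff[OF closed(3)[OF f g]] k by (simp del: restrict_apply restrict_apply')
    qed
    moreover have "?\<Phi> \<psi> f = 0" if "f \<in> I" for f
      using that I kill by (auto intro!: sum.neutral)
    ultimately show ?thesis by blast
  qed
  have inj: "\<psi> = \<psi>'" if P: "\<psi> \<in> ?P" "\<psi>' \<in> ?P" and eq: "?\<Phi> \<psi> = ?\<Phi> \<psi>'" for \<psi> \<psi>'
  proof
    fix F
    have hom: "\<psi> \<in> alg_homs (carrier (jet_ring m)) \<iota>" "\<psi>' \<in> alg_homs (carrier (jet_ring m)) \<iota>"
      using P by auto
    show "\<psi> F = \<psi>' F"
    proof (cases "F \<in> carrier (jet_ring m)")
      case False
      then show ?thesis using hom by (auto simp: alg_homs_def extensional_def)
    next
      case True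
      then show ?thesis unfolding carrier_jet_ring
      proof induction
        case (gen F)
        then obtain \<phi> j where \<phi>: "functional \<phi>" "j \<le> m" "F = (\<lambda>x. \<phi> (x j))" by blast
        then have "\<phi> \<in> carrier coord_ring" by (auto simp: carrier_coord_ring intro: alg_gen.gen)
        from \<Phi>_coeff[OF this, of \<psi> j] \<Phi>_coeff[OF this, of \<psi>' j] show ?case
          using \<phi> jet_coeff_functional[OF \<phi>(1,2)] eq by simp
      qed (use hom in \<open>auto simp: alg_homs_def carrier_jet_ring\<close>)
    qed
  qed
  have surj: "\<exists>\<psi>\<in>?P. ?\<Phi> \<psi> = u" if "u \<in> ?U" for u
  proof -
    from that have u: "u \<in> arc_homs m (carrier coord_ring) \<iota>" and uI: "\<forall>f\<in>I. u f = 0" by auto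
    obtain \<psi> where \<psi>: "\<psi> \<in> alg_homs (carrier (jet_ring m)) \<iota>"
      and key: "\<forall>f\<in>carrier coord_ring. \<forall>k\<le>m. \<psi> (jet_coeff m f k) = poly.coeff (u f) k"
      using jet_ring_universal[OF \<iota> u] by blast
    have "\<forall>f\<in>I. \<forall>k\<le>m. \<psi> (jet_coeff m f k) = 0" using key uI I by (metis coeff_0 subsetD)
    then have "\<psi> \<in> ?P" using \<psi> alg_homs_kills_ideal[OF \<iota> \<psi> I] by blast
    moreover have "?\<Phi> \<psi> = u"
    proof
      fix f
      show "?\<Phi> \<psi> f = u f"
      proof (cases "f \<in> carrier coord_ring")
        case False
        then show ?thesis using u by (simp add: arc_homs_def extensional_def)
      next
        case True
        have "degree (u f) \<le> m" using True u by (simp add: arc_homs_def)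
        then show ?thesis
          using \<Phi>_coeff[OF True, of \<psi>] key True
          by (intro poly_eqI) (simp add: coeff_eq_0 del: restrict_apply restrict_apply')
      qed
    qed
    ultimately show ?thesis by blast
  qed
  have "inj_on ?\<Phi> ?P" by (rule inj_onI) (rule inj)
  moreover have "?\<Phi> ` ?P = ?U"
  proof (intro equalityI subsetI)
    fix u assume "u \<in> ?\<Phi> ` ?P"
    then show "u \<in> ?U" using into by blast
  next
    fix u assume "u \<in> ?U"
    then show "u \<in> ?\<Phi> ` ?P" using surj by blast
  qed
  ultimately show ?thesis unfolding bij_betw_def by blast
qed

end

section \<open>Finite-dimensional complex Lie algebras\<close>

locale lie_algebra = fd_complex_space scale
  for scale :: "complex \<Rightarrow> 'g::ab_group_add \<Rightarrow> 'g" (infixr \<open>\<odot>\<close> 75) +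
  fixes br :: "'g \<Rightarrow> 'g \<Rightarrow> 'g"
  assumes br_add_left: "br (x + y) z = br x z + br y z"
    and br_add_right: "br x (y + z) = br x y + br x z"
    and br_scale_left: "br (c \<odot> x) y = c \<odot> br x y"
    and br_scale_right: "br x (c \<odot> y) = c \<odot> br x y"
    and br_self: "br x x = 0"
    and jacobi: "br x (br y z) + br y (br z x) + br z (br x y) = 0"
begin

definition br_span :: "'g set \<Rightarrow> 'g set \<Rightarrow> 'g set" where
  "br_span I J = span {br x y | x y. x \<in> I \<and> y \<in> J}"

definition lie_ideal :: "'g set \<Rightarrow> 'g set \<Rightarrow> bool" where
  "lie_ideal J I \<longleftrightarrow> subspace J \<and> J \<subseteq> I \<and> (\<forall>x\<in>I. \<forall>y\<in>J. br x y \<in> J)"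

definition solvable :: "'g set \<Rightarrow> bool" where
  "solvable I \<longleftrightarrow> (\<exists>k. ((\<lambda>J. br_span J J) ^^ k) I = {0})"

text \<open>The radical of the subalgebra \<open>I\<close> vanishes.\<close>

definition semisimple :: "'g set \<Rightarrow> bool" where
  "semisimple I \<longleftrightarrow> (\<forall>J. lie_ideal J I \<and> solvable J \<longrightarrow> J = {0})"

text \<open>The exponential of \<open>ad x\<close>. The exponential series converges in the canonical topology of a
  finite-dimensional complex vector space, in which convergence is tested by linear functionals.\<close>

definition exp_ad :: "'g \<Rightarrow> 'g \<Rightarrow> 'g" where
  "exp_ad x y = (THE z. \<forall>\<phi>. functional \<phi> \<longrightarrow> (\<lambda>n. \<phi> ((br x ^^ n) y) / fact n) sums \<phi> z)"

text \<open>The group generated by all \<open>exp (ad x)\<close>; inverses are included since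
  \<open>exp (ad (- x))\<close> is inverse to \<open>exp (ad x)\<close>.\<close>

inductive_set adjoint_group :: "('g \<Rightarrow> 'g) set" where
  "id \<in> adjoint_group"
| "\<gamma> \<in> adjoint_group \<Longrightarrow> exp_ad x \<circ> \<gamma> \<in> adjoint_group"

definition orbit :: "'g \<Rightarrow> 'g set" where
  "orbit x = {\<gamma> x | \<gamma>. \<gamma> \<in> adjoint_group}"

text \<open>Nilpotent elements of a reductive Lie algebra; membership in the derived algebra excludes
  the nonzero central elements and is automatic for simple Lie algebras.\<close>

definition nilpotent :: "'g \<Rightarrow> bool" where
  "nilpotent x \<longleftrightarrow> x \<in> br_span UNIV UNIV \<and> (\<exists>n. \<forall>y. (br x ^^ n) y = 0)"

definition nilpotent_orbit :: "'g set \<Rightarrow> bool" where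
  "nilpotent_orbit \<O> \<longleftrightarrow> (\<exists>x. nilpotent x \<and> \<O> = orbit x)"

definition minimal_nilpotent_orbit :: "'g set \<Rightarrow> bool" where
  "minimal_nilpotent_orbit \<O> \<longleftrightarrow> nilpotent_orbit \<O> \<and> \<O> \<noteq> {0} \<and>
     (\<forall>\<O>'. nilpotent_orbit \<O>' \<and> \<O>' \<noteq> {0} \<longrightarrow> zariski_dim \<O> \<le> zariski_dim \<O>')"

definition smallest_semisimple_ideal :: "'g set \<Rightarrow> 'g set \<Rightarrow> bool" where
  "smallest_semisimple_ideal \<O> I \<longleftrightarrow>
     lie_ideal I UNIV \<and> semisimple I \<and> \<O> \<subseteq> I \<and>
     (\<forall>J. lie_ideal J UNIV \<and> semisimple J \<and> \<O> \<subseteq> J \<longrightarrow> I \<subseteq> J)"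

definition little :: "'g set \<Rightarrow> bool" where
  "little \<O> \<longleftrightarrow> nilpotent_orbit \<O> \<and>
     (\<exists>I. smallest_semisimple_ideal \<O> I \<and> 0 < 2 * zariski_dim \<O> \<and> 2 * zariski_dim \<O> \<le> enat (dim I))"

text \<open>A simple Lie algebra is of type \<open>A\<^sub>1\<close> iff it is isomorphic to the Lie algebra
  of traceless \<open>2 \<times> 2\<close> matrices.\<close>

definition type_A1 :: bool where
  "type_A1 \<longleftrightarrow> (\<exists>\<theta> :: 'g \<Rightarrow> complex^2^2. bij_betw \<theta> UNIV {A. trace A = 0} \<and>
     (\<forall>x y. \<theta> (x + y) = \<theta> x + \<theta> y) \<and> (\<forall>c x. \<theta> (c \<odot> x) = (\<chi> i j. c * \<theta> x $ i $ j)) \<and>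
     (\<forall>x y. \<theta> (br x y) = \<theta> x ** \<theta> y - \<theta> y ** \<theta> x))"

end

locale simple_lie_algebra = lie_algebra +
  assumes nonabelian: "\<exists>x y. br x y \<noteq> 0"
    and simple: "lie_ideal I UNIV \<Longrightarrow> I = {0} \<or> I = UNIV"

end

theory Submission
  imports Defs "HOL-Computational_Algebra.Fundamental_Theorem_Algebra"
begin

text \<open>A simple Lie algebra contains an \<open>\<ss>\<ll>\<^sub>2\<close>-triple \<open>e, h, f\<close> with \<open>e\<close> extremal, that is
  \<open>(ad e)\<^sup>2\<close> has image \<open>\<complex> e\<close>; it is found without the classification by minimising the rank of
  \<open>(ad e)\<^sup>2\<close> among the elements with \<open>(ad e)\<^sup>3 = 0\<close>. The orbit \<open>O\<close> of \<open>f\<close> has dimension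
  \<open>N = dim [e, g]\<close>, since its points with \<open>\<alpha> \<noteq> 0\<close>, where \<open>\<alpha>\<close> is the coordinate of \<open>f\<close>, are
  determined by their bracket with \<open>e\<close>. In the grading by \<open>ad h\<close> the image of \<open>ad e\<close> is
  \<open>\<complex> h + g\<^sub>1 + \<complex> e\<close>, and its kernel contains \<open>g\<^sub>1 + \<complex> e\<close> and, except for type \<open>A\<^sub>1\<close>, a further
  element of weight \<open>0\<close>; hence \<open>2 N \<le> dim g\<close>.

  Nilpotent orbits are cones, as follows from the nondegeneracy of the Killing form, and contracting
  by \<open>\<lambda>\<^sup>2 exp (s ad h)\<close> puts \<open>O\<close> into the closure of each nonzero one. So the minimal orbit has the
  closure of \<open>O\<close>.

  If its \<open>m\<close>-th jet scheme were irreducible, its dimension would be \<open>(m + 1) N\<close>, because \<open>N\<close>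
  coordinates are rational generators where \<open>\<alpha> \<noteq> 0\<close>. But the arcs of order at least \<open>(m + 1) / 2\<close>
  form a proper closed subset of dimension at least \<open>(m + 1) N\<close>, as the ideal of the cone \<open>O\<close>
  contains only functions of order at least \<open>2\<close>.\<close>

section \<open>Growth of function algebras modulo ideals\<close>

text \<open>Two kinds of dimension have to be compared: the Krull dimension of an orbit as a space,
  and the size of a quotient of the jet algebra. Both are measured by growth, the number of
  functions of degree at most k independent modulo an ideal. Enlarging a prime ideal loses at least
  one order of growth; rational generators bound growth from above, algebraically independent
  functions from below. Upper growth bounds limit chains of closed sets; long chains must be
  constructed, by fixing the parameters of a parametrised orbit one by one at generic values. The
  obstacle is that exp (ad y) is not polynomial in y. For extremal y, exp (s ad y) is quadratic in
  s, and extremal elements span the algebra, so products of such exponentials determine the ideal of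
  an orbit. Properties are carried along the group by differentiating polynomial equations, not by
  using that exp (ad y) is an automorphism. The estimate 2 N <= dim g is just enough: a proper
  closed subset of dimension at least (m + 1) N forces at least (m + 1) N + 1 for an irreducible
  whole.\<close>

inductive fdeg :: "('x \<Rightarrow> complex) set \<Rightarrow> nat \<Rightarrow> ('x \<Rightarrow> complex) \<Rightarrow> bool" for F where
  const: "fdeg F k (\<lambda>_. c)"
| gen: "f \<in> F \<Longrightarrow> fdeg F (Suc k) f"
| add: "fdeg F k f \<Longrightarrow> fdeg F k g \<Longrightarrow> fdeg F k (\<lambda>x. f x + g x)"
| mult: "fdeg F j f \<Longrightarrow> fdeg F k g \<Longrightarrow> fdeg F (j + k) (\<lambda>x. f x * g x)"

text \<open>The rules \<open>const\<close> and \<open>gen\<close> leave slack in the index; in a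
  product the second factor absorbs it.\<close>

lemma fdeg_mono: "fdeg F j f \<Longrightarrow> j \<le> k \<Longrightarrow> fdeg F k f"
proof (induction arbitrary: k rule: fdeg.induct)
  case (const j c)
  show ?case by (rule fdeg.const)
next
  case (gen f j)
  then show ?case by (metis Suc_le_D fdeg.gen)
next
  case (add j f g)
  then show ?case by (simp add: fdeg.add)
next
  case (mult j f i g)
  then have "fdeg F (j + (k - j)) (\<lambda>x. f x * g x)"
    by (intro fdeg.mult mult.IH) auto
  with mult show ?case by simp
qed

lemma fdeg_imp_alg_gen: "fdeg F k f \<Longrightarrow> f \<in> alg_gen F"
  by (induction rule: fdeg.induct) (auto intro: alg_gen.intros)

lemma alg_gen_imp_fdeg: "f \<in> alg_gen F \<Longrightarrow> \<exists>k. fdeg F k f"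
proof (induction rule: alg_gen.induct)
  case (add f g)
  then obtain j k where "fdeg F j f" "fdeg F k g" by blast
  then have "fdeg F (max j k) f" "fdeg F (max j k) g" by (auto elim: fdeg_mono)
  then show ?case by (blast intro: fdeg.add)
qed (blast intro: fdeg.intros)+

lemma fdeg_scale: "fdeg F k f \<Longrightarrow> fdeg F k (\<lambda>x. c * f x)"
  using fdeg.mult[OF fdeg.const[of F 0 c], of k f] by simp

lemma fdeg_sum:
  "finite I \<Longrightarrow> (\<And>i. i \<in> I \<Longrightarrow> fdeg F k (h i)) \<Longrightarrow> fdeg F k (\<lambda>x. \<Sum>i\<in>I. h i x)"
  by (induction I rule: finite_induct) (auto intro: fdeg.intros)

lemma fdeg_power: "fdeg F k f \<Longrightarrow> fdeg F (k * n) (\<lambda>x. f x ^ n)"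
  by (induction n) (auto intro: fdeg.const[of F 0 1, simplified] fdeg.mult)

lemma fdeg_prod:
  "finite I \<Longrightarrow> (\<And>i. i \<in> I \<Longrightarrow> fdeg F (k i) (h i)) \<Longrightarrow> fdeg F (\<Sum>i\<in>I. k i) (\<lambda>x. \<Prod>i\<in>I. h i x)"
  by (induction I rule: finite_induct) (auto intro: fdeg.const[of F 0 1, simplified] fdeg.mult)

lemma alg_gen_scale: "f \<in> alg_gen F \<Longrightarrow> (\<lambda>x. c * f x) \<in> alg_gen F"
  by (rule alg_gen.mult[OF alg_gen.const])

lemma alg_gen_diff:
  assumes "f \<in> alg_gen F" "g \<in> alg_gen F"
  shows "(\<lambda>x. f x - g x) \<in> alg_gen F"
  using alg_gen.add[OF assms(1) alg_gen_scale[OF assms(2), of "- 1"]] by simp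

lemma alg_gen_power: "f \<in> alg_gen F \<Longrightarrow> (\<lambda>x. f x ^ n) \<in> alg_gen F"
  by (induction n) (auto intro: alg_gen.const[of 1] alg_gen.mult)

lemma alg_gen_subset:
  assumes "U \<subseteq> alg_gen F"
  shows "alg_gen U \<subseteq> alg_gen F"
proof
  fix f assume "f \<in> alg_gen U"
  then show "f \<in> alg_gen F" by induction (use assms in \<open>auto intro: alg_gen.intros\<close>)
qed

lemma alg_gen_mono: "U \<subseteq> F \<Longrightarrow> alg_gen U \<subseteq> alg_gen F"
  by (intro alg_gen_subset) (auto intro: alg_gen.gen)

lemma alg_gen_sum':
  "finite I \<Longrightarrow> (\<And>i. i \<in> I \<Longrightarrow> h i \<in> alg_gen F) \<Longrightarrow> (\<lambda>x. \<Sum>i\<in>I. h i x) \<in> alg_gen F"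
  by (induction I rule: finite_induct) (auto intro: alg_gen.intros)

section \<open>Linear independence and rank modulo a subspace of functions\<close>

definition fsub :: "('x \<Rightarrow> complex) set \<Rightarrow> bool" where
  "fsub P \<longleftrightarrow> (\<lambda>_. 0) \<in> P \<and> (\<forall>f\<in>P. \<forall>g\<in>P. (\<lambda>x. f x + g x) \<in> P) \<and> (\<forall>c. \<forall>f\<in>P. (\<lambda>x. c * f x) \<in> P)"

lemma fsubD:
  assumes "fsub P"
  shows "(\<lambda>_. 0) \<in> P" "f \<in> P \<Longrightarrow> g \<in> P \<Longrightarrow> (\<lambda>x. f x + g x) \<in> P" "f \<in> P \<Longrightarrow> (\<lambda>x. c * f x) \<in> P"
    "f \<in> P \<Longrightarrow> g \<in> P \<Longrightarrow> (\<lambda>x. f x - g x) \<in> P"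
proof -
  show *: "(\<lambda>_. 0) \<in> P" "f \<in> P \<Longrightarrow> g \<in> P \<Longrightarrow> (\<lambda>x. f x + g x) \<in> P" "f \<in> P \<Longrightarrow> (\<lambda>x. c * f x) \<in> P" for f g c
    using assms unfolding fsub_def by blast+
  show "f \<in> P \<Longrightarrow> g \<in> P \<Longrightarrow> (\<lambda>x. f x - g x) \<in> P"
    using *(2)[OF _ *(3)[of g "- 1"], of f] by simp
qed

lemma fsub_sum:
  assumes "fsub P"
  shows "finite I \<Longrightarrow> (\<And>i. i \<in> I \<Longrightarrow> h i \<in> P) \<Longrightarrow> (\<lambda>x. \<Sum>i\<in>I. h i x) \<in> P"
  by (induction I rule: finite_induct) (auto intro: fsubD[OF assms])

lemma fsub_lincomb:
  assumes "fsub P" "finite I" "\<And>i. i \<in> I \<Longrightarrow> h i \<in> P"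
  shows "(\<lambda>x. \<Sum>i\<in>I. c i * h i x) \<in> P"
  using fsub_sum[OF assms(1,2), of "\<lambda>i x. c i * h i x"] fsubD(3)[OF assms(1)] assms(3) by blast

lemma fsub_Int: "fsub V \<Longrightarrow> fsub P \<Longrightarrow> fsub (V \<inter> P)"
  unfolding fsub_def by blast

lemma fsub_fdeg: "fsub {f. fdeg F k f}"
  unfolding fsub_def by (auto intro: fdeg.intros fdeg_scale)

text \<open>Linear independence of a family in the quotient by P, expressed without forming the
  quotient.\<close>

definition findep :: "('x \<Rightarrow> complex) set \<Rightarrow> 'i set \<Rightarrow> ('i \<Rightarrow> 'x \<Rightarrow> complex) \<Rightarrow> bool" where
  "findep P I h \<longleftrightarrow> finite I \<and> (\<forall>c. (\<lambda>x. \<Sum>i\<in>I. c i * h i x) \<in> P \<longrightarrow> (\<forall>i\<in>I. c i = 0))"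

text \<open>The image of V modulo P has dimension at least n. Lower bounds make sense for spaces of
  infinite dimension as well. Natural numbers as indices fix one type; \<open>rkI\<close> transfers
  from any other.\<close>

definition rk :: "('x \<Rightarrow> complex) set \<Rightarrow> ('x \<Rightarrow> complex) set \<Rightarrow> nat \<Rightarrow> bool" where
  "rk V P n \<longleftrightarrow> (\<exists>(I::nat set) h. card I = n \<and> findep P I h \<and> (\<forall>i\<in>I. h i \<in> V))"

lemma findepD: "findep P I h \<Longrightarrow> (\<lambda>x. \<Sum>i\<in>I. c i * h i x) \<in> P \<Longrightarrow> i \<in> I \<Longrightarrow> c i = 0"
  unfolding findep_def by blast

lemma findep_reindex:
  assumes "findep P I h" "bij_betw g J I"
  shows "findep P J (h \<circ> g)"
  unfolding findep_def
proof (intro conjI allI impI ballI)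
  have "finite I" using assms(1) by (simp add: findep_def)
  then show "finite J" using bij_betw_finite[OF assms(2)] by simp
  fix c j assume c: "(\<lambda>x. \<Sum>i\<in>J. c i * (h \<circ> g) i x) \<in> P" and j: "j \<in> J"
  define g' where "g' = inv_into J g"
  have inj: "inj_on g J" and im: "g ` J = I" using assms(2) by (auto simp: bij_betw_def)
  have "(\<Sum>i\<in>J. c i * (h \<circ> g) i x) = (\<Sum>i\<in>I. c (g' i) * h i x)" for x
    unfolding im[symmetric] sum.reindex[OF inj]
    by (intro sum.cong) (auto simp: g'_def inv_into_f_f[OF inj])
  with c have "(\<lambda>x. \<Sum>i\<in>I. c (g' i) * h i x) \<in> P" by simp
  from findepD[OF assms(1) this, of "g j"] show "c j = 0"
    using j im inv_into_f_f[OF inj j] by (auto simp: g'_def)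
qed

lemma rkI:
  assumes "findep P (I :: 'i set) h" "\<And>i. i \<in> I \<Longrightarrow> h i \<in> V"
  shows "rk V P (card I)"
proof -
  have "finite I" using assms(1) by (simp add: findep_def)
  then obtain g where g: "bij_betw g {0..<card I} I" using ex_bij_betw_nat_finite by blast
  have "\<forall>i\<in>{0..<card I}. (h \<circ> g) i \<in> V" using assms(2) g by (auto simp: bij_betw_def)
  with findep_reindex[OF assms(1) g] show ?thesis
    unfolding rk_def by (intro exI[of _ "{0..<card I}"] exI[of _ "h \<circ> g"]) auto
qed

lemma findep_subset:
  assumes "findep P I h" "J \<subseteq> I"
  shows "findep P J h"
  unfolding findep_def
proof (intro conjI allI impI ballI)
  show fin: "finite J" using assms finite_subset by (auto simp: findep_def)
  have finI: "finite I" using assms by (auto simp: findep_def)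
  fix c i assume c: "(\<lambda>x. \<Sum>i\<in>J. c i * h i x) \<in> P" and i: "i \<in> J"
  have "(\<Sum>i\<in>I. (if i \<in> J then c i else 0) * h i x) = (\<Sum>i\<in>J. c i * h i x)" for x
    using assms(2) finI by (intro sum.mono_neutral_cong_right) auto
  with c have "(\<lambda>x. \<Sum>i\<in>I. (if i \<in> J then c i else 0) * h i x) \<in> P" by simp
  from findepD[OF assms(1) this, of i] show "c i = 0" using i assms(2) by auto
qed

lemma rk_antimono: "rk V P n \<Longrightarrow> m \<le> n \<Longrightarrow> rk V P m"
  unfolding rk_def by (metis findep_subset obtain_subset_with_card_n subsetD)

lemma rk_mono: "rk V P n \<Longrightarrow> V \<subseteq> V' \<Longrightarrow> rk V' P n"
  unfolding rk_def by blast

lemma rk_0: "rk V P 0"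
  unfolding rk_def findep_def by (intro exI[of _ "{}"]) auto

lemma rk_antimono_ideal: "rk V P' n \<Longrightarrow> P \<subseteq> P' \<Longrightarrow> rk V P n"
  unfolding rk_def findep_def by blast

text \<open>One step of Gaussian elimination. V meets P in codimension at most one, with
  \<open>g\<close> representing the missing direction, so subtracting multiples of one member with
  nonzero \<open>g\<close>-part costs only that member.\<close>

lemma rk_pivot:
  assumes V: "fsub V" and P: "fsub P" and rk: "rk V Q (Suc n)"
    and cov: "\<And>v. v \<in> V \<Longrightarrow> \<exists>p\<in>P. \<exists>c. v = (\<lambda>x. p x + c * g x)"
  shows "rk (V \<inter> P) Q n"
proof -
  obtain I :: "nat set" and h where I: "card I = Suc n" "findep Q I h" "\<And>i. i \<in> I \<Longrightarrow> h i \<in> V"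
    using rk unfolding rk_def by blast
  have finI: "finite I" using I(1) card.infinite by fastforce
  have "\<forall>i\<in>I. \<exists>c. \<exists>p\<in>P. h i = (\<lambda>x. p x + c * g x)" using cov I(3) by blast
  then obtain c where "\<forall>i\<in>I. \<exists>p\<in>P. h i = (\<lambda>x. p x + c i * g x)" by (rule bchoice[THEN exE])
  then obtain p where p: "\<forall>i\<in>I. p i \<in> P \<and> h i = (\<lambda>x. p i x + c i * g x)"
    by (metis (no_types, lifting))
  show ?thesis
  proof (cases "\<forall>i\<in>I. c i = 0")
    case True
    then have "\<And>i. i \<in> I \<Longrightarrow> h i \<in> V \<inter> P" using p I(3) by auto
    from rkI[OF I(2) this] I(1) show ?thesis by (auto intro: rk_antimono)
  next
    case False
    then obtain k where k: "k \<in> I" "c k \<noteq> 0" by blast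
    define h' where "h' i = (\<lambda>x. h i x - (c i / c k) * h k x)" for i
    have "findep Q (I - {k}) h'"
      unfolding findep_def
    proof (intro conjI allI impI ballI)
      show "finite (I - {k})" using finI by simp
      fix d i assume d: "(\<lambda>x. \<Sum>i\<in>I - {k}. d i * h' i x) \<in> Q" and i: "i \<in> I - {k}"
      \<comment> \<open>The same combination in terms of the original family: the pivot collects all
        the subtracted multiples.\<close>
      define d' where "d' i = (if i = k then - (\<Sum>j\<in>I - {k}. d j * (c j / c k)) else d i)" for i
      have "(\<Sum>i\<in>I. d' i * h i x) = (\<Sum>i\<in>I - {k}. d i * h' i x)" for x
      proof -
        have "(\<Sum>i\<in>I. d' i * h i x) = d' k * h k x + (\<Sum>i\<in>I - {k}. d' i * h i x)"
          by (rule sum.remove[OF finI k(1)])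
        also have "(\<Sum>i\<in>I - {k}. d' i * h i x) = (\<Sum>i\<in>I - {k}. d i * h i x)"
          by (intro sum.cong) (auto simp: d'_def)
        also have "d' k * h k x + \<dots> = (\<Sum>i\<in>I - {k}. d i * h' i x)"
          by (simp add: d'_def h'_def algebra_simps sum_subtractf sum_distrib_left)
        finally show ?thesis .
      qed
      with d have "(\<lambda>x. \<Sum>i\<in>I. d' i * h i x) \<in> Q" by simp
      from findepD[OF I(2) this, of i] show "d i = 0" using i by (auto simp: d'_def)
    qed
    moreover have "h' i \<in> V \<inter> P" if "i \<in> I - {k}" for i
    proof
      show "h' i \<in> V" unfolding h'_def
        using that k I(3) by (intro fsubD(4)[OF V] fsubD(3)[OF V]) auto
      have "h' i = (\<lambda>x. p i x - (c i / c k) * p k x)"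
      proof
        fix x
        have "h i x = p i x + c i * g x" "h k x = p k x + c k * g x" using p that k by auto
        then show "h' i x = p i x - (c i / c k) * p k x"
          unfolding h'_def using k(2) by (simp add: field_simps)
      qed
      then show "h' i \<in> P"
        using that k p fsubD(4)[OF P _ fsubD(3)[OF P, of "p k" "c i / c k"], of "p i"] by simp
    qed
    ultimately show ?thesis using rkI[of Q "I - {k}" h' "V \<inter> P"] I(1) k finI by simp
  qed
qed

inductive_set flin :: "('x \<Rightarrow> complex) set \<Rightarrow> ('x \<Rightarrow> complex) set" for S where
  zero: "(\<lambda>_. 0) \<in> flin S"
| step: "s \<in> S \<Longrightarrow> f \<in> flin S \<Longrightarrow> (\<lambda>x. c * s x + f x) \<in> flin S"

lemma flin_base: "s \<in> S \<Longrightarrow> s \<in> flin S"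
  using flin.step[of s S "\<lambda>_. 0" 1] by (simp add: flin.zero)

lemma flin_add: "f \<in> flin S \<Longrightarrow> g \<in> flin S \<Longrightarrow> (\<lambda>x. f x + g x) \<in> flin S"
  by (induction rule: flin.induct) (auto simp: add.assoc intro: flin.step)

lemma flin_scale: "f \<in> flin S \<Longrightarrow> (\<lambda>x. c * f x) \<in> flin S"
proof (induction rule: flin.induct)
  case (step s f d)
  then show ?case using flin.step[of s S "\<lambda>x. c * f x" "c * d"] by (simp add: algebra_simps)
qed (simp add: flin.zero)

lemma flin_mult:
  assumes "\<And>s t. s \<in> S \<Longrightarrow> t \<in> T \<Longrightarrow> (\<lambda>x. s x * t x) \<in> flin R" "f \<in> flin S" "g \<in> flin T"
  shows "(\<lambda>x. f x * g x) \<in> flin R"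
  using assms(2)
proof (induction rule: flin.induct)
  case (step s f c)
  have "(\<lambda>x. s x * g x) \<in> flin R"
    using assms(3)
  proof (induction rule: flin.induct)
    case (step t g d)
    have "(\<lambda>x. d * (s x * t x) + s x * g x) \<in> flin R"
      by (intro flin_add flin_scale assms(1) step \<open>s \<in> S\<close>)
    then show ?case by (simp add: algebra_simps)
  qed (simp add: flin.zero)
  then have "(\<lambda>x. c * (s x * g x) + f x * g x) \<in> flin R"
    by (intro flin_add flin_scale step)
  then show ?case by (simp add: algebra_simps)
qed (simp add: flin.zero)

lemma flin_insertE:
  assumes "f \<in> flin (insert g S)"
  obtains c f' where "f' \<in> flin S" "f = (\<lambda>x. c * g x + f' x)"
proof -
  from assms have "\<exists>c. \<exists>f'\<in>flin S. f = (\<lambda>x. c * g x + f' x)"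
  proof (induction rule: flin.induct)
    case zero
    show ?case by (intro exI[of _ 0] bexI[of _ "\<lambda>_. 0"]) (auto intro: flin.zero)
  next
    case (step s f c)
    then obtain d f' where f': "f' \<in> flin S" "f = (\<lambda>x. d * g x + f' x)" by blast
    show ?case
    proof (cases "s = g")
      case True
      with f' show ?thesis by (intro exI[of _ "c + d"] bexI[of _ f']) (auto simp: algebra_simps)
    next
      case False
      then have "(\<lambda>x. c * s x + f' x) \<in> flin S" using step f' by (intro flin.step) auto
      with f' show ?thesis
        by (intro exI[of _ d] bexI[of _ "\<lambda>x. c * s x + f' x"]) (auto simp: algebra_simps)
    qed
  qed
  with that show ?thesis by blast
qed

text \<open>A codimension count: P and the span of S cover V, so intersecting with P costs at most
  \<open>card S\<close>. The elements of S are used up one at a time by \<open>rk_pivot\<close>,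
  with P enlarged accordingly.\<close>

lemma rk_quotient:
  assumes "finite S" "fsub V" "fsub P" "rk V Q n"
    "\<And>v. v \<in> V \<Longrightarrow> \<exists>p\<in>P. \<exists>w\<in>flin S. v = (\<lambda>x. p x + w x)"
  shows "rk (V \<inter> P) Q (n - card S)"
  using assms
proof (induction S arbitrary: P rule: finite_induct)
  case empty
  have "V \<inter> P = V"
  proof
    show "V \<subseteq> V \<inter> P"
    proof
      fix v assume v: "v \<in> V"
      then obtain p w where "p \<in> P" "w \<in> flin {}" "v = (\<lambda>x. p x + w x)" using empty by blast
      moreover from this have "w = (\<lambda>_. 0)" by (auto elim: flin.cases)
      ultimately show "v \<in> V \<inter> P" using v by simp
    qed
  qed auto
  with empty show ?case by simp
next
  case (insert g S)
  \<comment> \<open>P plus the line through \<open>g\<close>. The induction hypothesis reaches the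
    intersection with \<open>P'\<close>, and a single pivot leads from there to P.\<close>
  define P' where "P' = {\<lambda>x. p x + c * g x | p c. p \<in> P}"
  have P': "fsub P'"
    unfolding fsub_def
  proof (intro conjI ballI allI)
    show "(\<lambda>_. 0) \<in> P'" unfolding P'_def
      using fsubD(1)[OF insert.prems(2)] by (intro CollectI exI[of _ "\<lambda>_. 0"] exI[of _ 0]) auto
  next
    fix f f' assume "f \<in> P'" "f' \<in> P'"
    then obtain p c p' c' where "p \<in> P" "p' \<in> P" "f = (\<lambda>x. p x + c * g x)" "f' = (\<lambda>x. p' x + c' * g x)"
      unfolding P'_def by blast
    then show "(\<lambda>x. f x + f' x) \<in> P'" unfolding P'_def
      by (intro CollectI exI[of _ "\<lambda>x. p x + p' x"] exI[of _ "c + c'"])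
        (auto simp: algebra_simps intro: fsubD(2)[OF insert.prems(2)])
  next
    fix f d assume "f \<in> P'"
    then obtain p c where "p \<in> P" "f = (\<lambda>x. p x + c * g x)" unfolding P'_def by blast
    then show "(\<lambda>x. d * f x) \<in> P'" unfolding P'_def
      by (intro CollectI exI[of _ "\<lambda>x. d * p x"] exI[of _ "d * c"])
        (auto simp: algebra_simps intro: fsubD(3)[OF insert.prems(2)])
  qed
  have "rk (V \<inter> P') Q (n - card S)"
  proof (rule insert.IH[OF insert.prems(1) P' insert.prems(3)])
    fix v assume "v \<in> V"
    then obtain p w where p: "p \<in> P" "w \<in> flin (insert g S)" "v = (\<lambda>x. p x + w x)"
      using insert.prems(4) by blast
    then obtain c w' where "w' \<in> flin S" "w = (\<lambda>x. c * g x + w' x)" by (blast elim: flin_insertE)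
    with p show "\<exists>p\<in>P'. \<exists>w\<in>flin S. v = (\<lambda>x. p x + w x)"
      by (intro bexI[of _ "\<lambda>x. p x + c * g x"] bexI[of _ w']) (auto simp: P'_def algebra_simps)
  qed
  show ?case
  proof (cases "n - card S")
    case 0
    then show ?thesis using insert.hyps by (simp add: rk_0)
  next
    case (Suc m)
    have "rk (V \<inter> P' \<inter> P) Q m"
      using \<open>rk (V \<inter> P') Q (n - card S)\<close> unfolding Suc
      by (rule rk_pivot[OF fsub_Int[OF insert.prems(1) P'] insert.prems(2)]) (auto simp: P'_def)
    moreover have "m = n - card (insert g S)" using Suc insert.hyps by simp
    ultimately show ?thesis by (auto elim!: rk_mono)
  qed
qed

lemma rk_self:
  assumes "V \<subseteq> P" "fsub P" "rk V P n"
  shows "n = 0"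
proof (rule ccontr)
  assume "n \<noteq> 0"
  obtain I :: "nat set" and h where I: "card I = n" "findep P I h" "\<forall>i\<in>I. h i \<in> V"
    using assms(3) unfolding rk_def by blast
  then obtain i where "i \<in> I" using \<open>n \<noteq> 0\<close> by fastforce
  moreover have "(\<lambda>x. \<Sum>i\<in>I. 1 * h i x) \<in> P"
    using I assms by (intro fsub_lincomb) (auto simp: findep_def)
  ultimately show False using findepD[OF I(2), of "\<lambda>_. 1"] by auto
qed

lemma rk_bound:
  assumes "finite S" "fsub V" "fsub P" "rk V P n"
    "\<And>v. v \<in> V \<Longrightarrow> \<exists>p\<in>P. \<exists>w\<in>flin S. v = (\<lambda>x. p x + w x)"
  shows "n \<le> card S"
  using rk_self[OF _ assms(3) rk_quotient[OF assms]] by simp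

text \<open>A family of maximal size among those independent modulo P spans V modulo P: adjoining
  any \<open>v\<close> creates a relation in which \<open>v\<close> has a nonzero
  coefficient.\<close>

lemma not_rk_cover:
  assumes "\<not> rk V P (Suc R)" "fsub P"
  obtains S where "finite S" "card S \<le> R" "\<And>v. v \<in> V \<Longrightarrow> \<exists>p\<in>P. \<exists>w\<in>flin S. v = (\<lambda>x. p x + w x)"
proof -
  define n where "n = Max {n. rk V P n}"
  have sub: "{n. rk V P n} \<subseteq> {..R}"
    using assms(1) rk_antimono by (metis CollectD atMost_iff not_less_eq_eq subsetI)
  then have fin: "finite {n. rk V P n}" using finite_subset by blast
  have n: "rk V P n" using Max_in[OF fin] rk_0 by (auto simp: n_def)
  have max: "\<not> rk V P (Suc n)" using Max_ge[OF fin, of "Suc n"] by (auto simp: n_def)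
  obtain I :: "nat set" and h where I: "card I = n" "findep P I h" "\<forall>i\<in>I. h i \<in> V"
    using n unfolding rk_def by blast
  have finI: "finite I" using I by (simp add: findep_def)
  have sum_in: "(\<lambda>x. \<Sum>i\<in>J. c i * h i x) \<in> flin (h ` I)" if "J \<subseteq> I" for c J
    using finite_subset[OF that finI] that
    by (induction J rule: finite_induct) (auto intro: flin.intros)
  show ?thesis
  proof (rule that)
    show "finite (h ` I)" using finI by simp
    show "card (h ` I) \<le> R" using card_image_le[OF finI, of h] n sub I(1) by auto
    fix v assume v: "v \<in> V"
    obtain k where k: "k \<notin> I" using finI ex_new_if_finite infinite_UNIV_nat by blast
    define h' where "h' = h(k := v)"
    have "\<not> findep P (insert k I) h'"
    proof
      assume "findep P (insert k I) h'"
      moreover have "\<And>i. i \<in> insert k I \<Longrightarrow> h' i \<in> V" using I(3) v by (auto simp: h'_def)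
      ultimately have "rk V P (card (insert k I))" by (rule rkI)
      then show False using max k finI I(1) by simp
    qed
    then obtain c j where c: "(\<lambda>x. \<Sum>i\<in>insert k I. c i * h' i x) \<in> P" "j \<in> insert k I" "c j \<noteq> 0"
      using finI unfolding findep_def by auto
    have s: "(\<Sum>i\<in>insert k I. c i * h' i x) = c k * v x + (\<Sum>i\<in>I. c i * h i x)" for x
    proof -
      have "(\<Sum>i\<in>I. c i * h' i x) = (\<Sum>i\<in>I. c i * h i x)"
        using k by (intro sum.cong) (auto simp: h'_def)
      then show ?thesis using k finI by (simp add: h'_def)
    qed
    have ck: "c k \<noteq> 0"
    proof
      assume "c k = 0"
      with c(1) s have "(\<lambda>x. \<Sum>i\<in>I. c i * h i x) \<in> P" by simp
      then show False using findepD[OF I(2)] c \<open>c k = 0\<close> by auto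
    qed
    let ?p = "\<lambda>x. (1 / c k) * (\<Sum>i\<in>insert k I. c i * h' i x)"
    let ?w = "\<lambda>x. (- 1 / c k) * (\<Sum>i\<in>I. c i * h i x)"
    have "v = (\<lambda>x. ?p x + ?w x)" using ck unfolding s by (auto simp: field_simps)
    moreover have "?p \<in> P" by (rule fsubD(3)[OF assms(2) c(1)])
    moreover have "?w \<in> flin (h ` I)" by (intro flin_scale sum_in) simp
    ultimately show "\<exists>p\<in>P. \<exists>w\<in>flin (h ` I). v = (\<lambda>x. p x + w x)"
      by (intro bexI[of _ ?p] bexI[of _ ?w])
  qed
qed

lemma rk_cut:
  assumes "fsub V" "fsub P" "rk V Q n" "\<not> rk V P (Suc R)"
  shows "rk (V \<inter> P) Q (n - R)"
proof -
  obtain S where S: "finite S" "card S \<le> R" "\<And>v. v \<in> V \<Longrightarrow> \<exists>p\<in>P. \<exists>w\<in>flin S. v = (\<lambda>x. p x + w x)"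
    using not_rk_cover[OF assms(4,2)] by blast
  have "rk (V \<inter> P) Q (n - card S)"
    using S assms by (intro rk_quotient) auto
  then show ?thesis using S(2) by (auto intro: rk_antimono)
qed

text \<open>Each \<open>P t\<close> has codimension at most R in V. In
  \<open>growth_hyperplane\<close> the \<open>P t\<close> are ideals of sections, and the surviving
  functions vanish on all of them.\<close>

lemma rk_cut_many:
  assumes "fsub V" "rk V Q n" "finite T"
    "\<And>t. t \<in> T \<Longrightarrow> fsub (P t)" "\<And>t. t \<in> T \<Longrightarrow> \<not> rk V (P t) (Suc R)"
  shows "rk (V \<inter> (\<Inter>t\<in>T. P t)) Q (n - card T * R)"
  using assms(3,4,5)
proof (induction T rule: finite_induct)
  case empty
  then show ?case using assms by simp
next
  case (insert t T)
  let ?W = "V \<inter> (\<Inter>t\<in>T. P t)"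
  have W: "fsub ?W"
    using assms(1) insert.prems(1) unfolding fsub_def by auto
  have "rk (?W \<inter> P t) Q (n - card T * R - R)"
  proof (rule rk_cut[OF W])
    show "fsub (P t)" using insert.prems by simp
    show "rk ?W Q (n - card T * R)" using insert by simp
    show "\<not> rk ?W (P t) (Suc R)" using insert.prems(2)[of t] rk_mono[of ?W "P t" "Suc R" V] by auto
  qed
  moreover have "?W \<inter> P t = V \<inter> (\<Inter>t\<in>insert t T. P t)" by auto
  moreover have "n - card T * R - R = n - card (insert t T) * R" using insert.hyps by simp
  ultimately show ?case by simp
qed

subsection \<open>Ideals of function algebras\<close>

definition fideal :: "('x \<Rightarrow> complex) set \<Rightarrow> ('x \<Rightarrow> complex) set \<Rightarrow> bool" where
  "fideal F P \<longleftrightarrow> P \<subseteq> alg_gen F \<and> (\<lambda>_. 0) \<in> P \<and> (\<forall>f\<in>P. \<forall>g\<in>P. (\<lambda>x. f x + g x) \<in> P) \<and>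
     (\<forall>f\<in>alg_gen F. \<forall>g\<in>P. (\<lambda>x. f x * g x) \<in> P)"

definition fprime :: "('x \<Rightarrow> complex) set \<Rightarrow> ('x \<Rightarrow> complex) set \<Rightarrow> bool" where
  "fprime F P \<longleftrightarrow> fideal F P \<and> (\<lambda>_. 1) \<notin> P \<and>
     (\<forall>f\<in>alg_gen F. \<forall>g\<in>alg_gen F. (\<lambda>x. f x * g x) \<in> P \<longrightarrow> f \<in> P \<or> g \<in> P)"

lemma fprimeD:
  assumes "fprime F P" "f \<in> alg_gen F" "g \<in> alg_gen F" "(\<lambda>x. f x * g x) \<in> P"
  shows "f \<in> P \<or> g \<in> P"
  using assms unfolding fprime_def by simp

lemma fideal_mult: "fideal F P \<Longrightarrow> f \<in> alg_gen F \<Longrightarrow> g \<in> P \<Longrightarrow> (\<lambda>x. f x * g x) \<in> P"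
  unfolding fideal_def by simp

definition vanishing :: "('x \<Rightarrow> complex) set \<Rightarrow> 'x set \<Rightarrow> ('x \<Rightarrow> complex) set" where
  "vanishing F Z = {f \<in> alg_gen F. \<forall>x\<in>Z. f x = 0}"

lemma fideal_fsub: "fideal F P \<Longrightarrow> fsub P"
  unfolding fideal_def fsub_def using alg_gen.const[where F = F] by auto

lemma fideal_vanishing: "fideal F (vanishing F Z)"
  unfolding fideal_def vanishing_def by (auto intro: alg_gen.intros)

lemma fprime_power:
  assumes "fprime F P" "f \<in> alg_gen F" "(\<lambda>x. f x ^ n) \<in> P"
  shows "f \<in> P"
  using assms(3)
proof (induction n)
  case 0
  then show ?case using assms(1) by (simp add: fprime_def)
next
  case (Suc n)
  then have "(\<lambda>x. f x * f x ^ n) \<in> P" by simp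
  with assms(1,2) alg_gen_power[OF assms(2), of n] have "f \<in> P \<or> (\<lambda>x. f x ^ n) \<in> P"
    unfolding fprime_def by simp
  then show ?case using Suc.IH by blast
qed

text \<open>These stand for the Krull dimension of the function algebra modulo \<open>P\<close> being at least, respectively
  at most, \<open>d\<close>; separate bounds avoid the existence of Hilbert polynomials.\<close>

definition growth_ge :: "('x \<Rightarrow> complex) set \<Rightarrow> ('x \<Rightarrow> complex) set \<Rightarrow> nat \<Rightarrow> bool" where
  "growth_ge F P d \<longleftrightarrow> (\<exists>c>0. \<forall>k\<ge>1. \<exists>n. rk {f. fdeg F k f} P n \<and> c * real k ^ d \<le> real n)"

definition growth_le :: "('x \<Rightarrow> complex) set \<Rightarrow> ('x \<Rightarrow> complex) set \<Rightarrow> nat \<Rightarrow> bool" where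
  "growth_le F P d \<longleftrightarrow> (\<exists>C. \<forall>k n. rk {f. fdeg F k f} P n \<longrightarrow> real n \<le> C * real (k + 1) ^ d)"

lemma growth_ge_le:
  assumes "growth_ge F P d" "growth_le F P d'"
  shows "d \<le> d'"
proof (rule ccontr)
  assume "\<not> d \<le> d'"
  then obtain e where e: "d = Suc (d' + e)" by (metis add_Suc_right less_iff_Suc_add not_le)
  obtain c where c: "c > 0" "\<And>k. k \<ge> 1 \<Longrightarrow> \<exists>n. rk {f. fdeg F k f} P n \<and> c * real k ^ d \<le> real n"
    using assms(1) unfolding growth_ge_def by blast
  obtain C where C: "\<And>k n. rk {f. fdeg F k f} P n \<Longrightarrow> real n \<le> C * real (k + 1) ^ d'"
    using assms(2) unfolding growth_le_def by blast
  \<comment> \<open>Large enough for the higher power to win; the factor \<open>2 ^ d'\<close> pays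
    for replacing k + 1 by 2 k.\<close>
  obtain k :: nat where k: "real k > max 1 (\<bar>C\<bar> * 2 ^ d' / c)" using reals_Archimedean2 by blast
  then have k1: "k \<ge> 1" by simp
  obtain n where n: "rk {f. fdeg F k f} P n" "c * real k ^ d \<le> real n" using c(2)[OF k1] by blast
  have "c * (real k * real k ^ d') \<le> c * real k ^ d"
  proof -
    have "real k ^ Suc d' \<le> real k ^ d" using k1 e by (intro power_increasing) auto
    then show ?thesis using c(1) by simp
  qed
  also have "\<dots> \<le> C * real (k + 1) ^ d'" using n C by force
  also have "\<dots> \<le> \<bar>C\<bar> * (2 * real k) ^ d'"
    using k1 by (intro mult_mono power_mono) auto
  also have "\<dots> = \<bar>C\<bar> * 2 ^ d' * real k ^ d'" by (simp add: power_mult_distrib)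
  finally have "c * real k * real k ^ d' \<le> \<bar>C\<bar> * 2 ^ d' * real k ^ d'" by (simp add: mult.assoc)
  then have "c * real k \<le> \<bar>C\<bar> * 2 ^ d'" using k1 by simp
  then have "real k \<le> \<bar>C\<bar> * 2 ^ d' / c" using c(1) by (simp add: field_simps)
  with k show False by simp
qed

lemma growth_ge_antimono_ideal: "growth_ge F P' d \<Longrightarrow> P \<subseteq> P' \<Longrightarrow> growth_ge F P d"
  unfolding growth_ge_def by (meson rk_antimono_ideal)

lemma growth_ge_0:
  assumes "(\<lambda>_. 1) \<notin> P" "fsub P"
  shows "growth_ge F P 0"
proof -
  have "findep P {0::nat} (\<lambda>_ _. 1)"
    unfolding findep_def
  proof (intro conjI allI impI ballI)
    fix c :: "nat \<Rightarrow> complex" and i assume c: "(\<lambda>x. \<Sum>i\<in>{0}. c i * 1) \<in> P" and i: "i \<in> {0::nat}"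
    show "c i = 0"
    proof (rule ccontr)
      assume "c i \<noteq> 0"
      then have "(\<lambda>x::'a. (1 / c 0) * (\<Sum>i\<in>{0}. c i * 1)) = (\<lambda>_. 1)" using i by auto
      then show False using fsubD(3)[OF assms(2) c, of "1 / c 0"] assms(1) by simp
    qed
  qed simp
  from rkI[OF this, of "{f. fdeg F k f}" for k] have "rk {f. fdeg F k f} P 1" for k
    by (auto intro: fdeg.const)
  then show ?thesis unfolding growth_ge_def by (intro exI[of _ 1]) (auto intro!: exI[of _ 1])
qed

text \<open>Multiplication by an element \<open>a\<close> of the larger ideal embeds the functions of degree \<open>k - j\<close>
  modulo \<open>P\<close> into the kernel of the reduction modulo \<open>P'\<close> in degree \<open>k\<close>; iterating this
  sums the growth function of \<open>P'\<close>.\<close>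

lemma rk_step:
  assumes P: "fprime F P" and P': "fideal F P'" "P \<subseteq> P'" and a: "fdeg F j a" "a \<in> P'" "a \<notin> P"
    and rk: "rk {f. fdeg F (k + j) f} P' n" "rk {f. fdeg F k f} P m"
  shows "rk {f. fdeg F (k + j) f} P (n + m)"
proof -
  obtain I :: "nat set" and h where I: "card I = n" "findep P' I h" "\<And>i. i \<in> I \<Longrightarrow> fdeg F (k + j) (h i)"
    using rk(1) unfolding rk_def by auto
  obtain J :: "nat set" and g where J: "card J = m" "findep P J g" "\<And>i. i \<in> J \<Longrightarrow> fdeg F k (g i)"
    using rk(2) unfolding rk_def by auto
  have fin: "finite I" "finite J" using I J by (auto simp: findep_def)
  define H where "H = case_sum h (\<lambda>i x. a x * g i x)"
  note fsP = fideal_fsub[OF P[unfolded fprime_def, THEN conjunct1]]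
  note fsP' = fideal_fsub[OF P'(1)]
  have "findep P (I <+> J) H"
    unfolding findep_def
  proof (intro conjI allI impI)
    show "finite (I <+> J)" using fin by simp
    fix c assume c: "(\<lambda>x. \<Sum>i\<in>I <+> J. c i * H i x) \<in> P"
    have split: "(\<Sum>i\<in>I <+> J. c i * H i x)
        = (\<Sum>i\<in>I. c (Inl i) * h i x) + a x * (\<Sum>i\<in>J. c (Inr i) * g i x)" for x
      using fin by (simp add: sum.Plus H_def sum_distrib_left algebra_simps)
    have gin: "(\<lambda>x. \<Sum>i\<in>J. c (Inr i) * g i x) \<in> alg_gen F"
      using fin J(3) by (intro alg_gen_sum' alg_gen_scale) (auto intro: fdeg_imp_alg_gen)
    have "(\<lambda>x. (\<Sum>i\<in>J. c (Inr i) * g i x) * a x) \<in> P'"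
      using P'(1) a(2) gin unfolding fideal_def by simp
    then have ag: "(\<lambda>x. a x * (\<Sum>i\<in>J. c (Inr i) * g i x)) \<in> P'" by (simp add: mult.commute)
    have "(\<lambda>x. (\<Sum>i\<in>I. c (Inl i) * h i x) + a x * (\<Sum>i\<in>J. c (Inr i) * g i x)) \<in> P'"
      using c P'(2) unfolding split by blast
    from fsubD(4)[OF fsP' this ag] have "(\<lambda>x. \<Sum>i\<in>I. c (Inl i) * h i x) \<in> P'" by simp
    then have cI: "c (Inl i) = 0" if "i \<in> I" for i
      using findepD[OF I(2), of "c \<circ> Inl"] that by simp
    then have "(\<lambda>x. a x * (\<Sum>i\<in>J. c (Inr i) * g i x)) \<in> P" using c unfolding split by simp
    then have "(\<lambda>x. \<Sum>i\<in>J. c (Inr i) * g i x) \<in> P"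
      using fprimeD[OF P fdeg_imp_alg_gen[OF a(1)] gin] a(3) by blast
    then have cJ: "c (Inr i) = 0" if "i \<in> J" for i
      using findepD[OF J(2), of "c \<circ> Inr"] that by simp
    show "\<forall>i\<in>I <+> J. c i = 0" using cI cJ by auto
  qed
  moreover have "H i \<in> {f. fdeg F (k + j) f}" if "i \<in> I <+> J" for i
    using that I(3) fdeg.mult[OF a(1) J(3)] by (auto simp: H_def add.commute)
  ultimately have "rk {f. fdeg F (k + j) f} P (card (I <+> J))" by (rule rkI)
  then show ?thesis using fin I(1) J(1) by (simp add: card_Plus)
qed

lemma growth_step:
  assumes P: "fprime F P" and P': "fideal F P'" "P \<subset> P'" and g: "growth_ge F P' d"
  shows "growth_ge F P (Suc d)"
proof -
  obtain a where a: "a \<in> P'" "a \<notin> P" using P'(2) by blast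
  have "a \<in> alg_gen F" using a(1) P'(1) by (auto simp: fideal_def)
  then obtain j where "fdeg F j a" using alg_gen_imp_fdeg by blast
  \<comment> \<open>The degree bound is made positive because the number of multiplications below is
    found by dividing by it.\<close>
  then have aj: "fdeg F (Suc j) a" by (rule fdeg_mono) simp
  obtain c where c: "c > 0" "\<And>k. k \<ge> 1 \<Longrightarrow> \<exists>n. rk {f. fdeg F k f} P' n \<and> c * real k ^ d \<le> real n"
    using g unfolding growth_ge_def by blast
  have step: "\<exists>n. rk {f. fdeg F (k + Suc j * t) f} P n \<and> real (Suc t) * (c * real k ^ d) \<le> real n"
    if k: "k \<ge> 1" for k t
  proof (induction t)
    case 0
    obtain n where "rk {f. fdeg F k f} P' n" "c * real k ^ d \<le> real n" using c(2)[OF k] by blast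
    then show ?case using P'(2) by (intro exI[of _ n]) (auto intro: rk_antimono_ideal)
  next
    case (Suc t)
    then obtain m where m: "rk {f. fdeg F (k + Suc j * t) f} P m" "real (Suc t) * (c * real k ^ d) \<le> real m"
      by blast
    have eq: "k + Suc j * t + Suc j = k + Suc j * Suc t" by simp
    obtain n where n: "rk {f. fdeg F (k + Suc j * t + Suc j) f} P' n"
        "c * real (k + Suc j * t + Suc j) ^ d \<le> real n"
      using c(2)[of "k + Suc j * t + Suc j"] k by auto
    have "c * real k ^ d \<le> c * real (k + Suc j * t + Suc j) ^ d"
      using c(1) by (intro mult_left_mono power_mono) auto
    with n(2) m(2) have "real (Suc (Suc t)) * (c * real k ^ d) \<le> real (n + m)"
      by (simp add: algebra_simps)
    moreover have "rk {f. fdeg F (k + Suc j * t + Suc j) f} P (n + m)"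
      using rk_step[OF P P'(1) _ aj a n(1) m(1)] P'(2) by blast
    ultimately show ?case unfolding eq by blast
  qed
  \<comment> \<open>\<open>2 ^ d\<close> comes from k >= K / 2, and \<open>2 * Suc j\<close> from
    Suc t >= K / (2 * Suc j).\<close>
  define c' where "c' = c / (2 ^ d * 2 * Suc j)"
  show ?thesis
    unfolding growth_ge_def
  proof (intro exI[of _ c'] conjI allI impI)
    show "c' > 0" unfolding c'_def using c(1) by (simp add: add_pos_nonneg)
    fix K :: nat assume K: "K \<ge> 1"
    \<comment> \<open>At most half of the degree K is spent on \<open>t\<close> multiplications by
      \<open>a\<close>; the rest, \<open>k\<close>, is at least K / 2 and enters the lower bound for
      \<open>P'\<close>.\<close>
    define t where "t = K div (2 * Suc j)"
    define k where "k = K - Suc j * t"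
    have "2 * (Suc j * t) \<le> K" by (metis mult.assoc t_def times_div_less_eq_dividend)
    then have k: "2 * k \<ge> K" "K = k + Suc j * t" "k \<ge> 1" using K by (auto simp: k_def)
    obtain n where n: "rk {f. fdeg F K f} P n" "real (Suc t) * (c * real k ^ d) \<le> real n"
      using step[OF k(3), of t] k(2) by auto
    have "K < 2 * Suc j * Suc t" unfolding t_def using dividend_less_times_div[of "2 * Suc j" K, OF mult_pos_pos[OF zero_less_numeral zero_less_Suc]] by (simp only: mult_Suc_right)
    then have "real K \<le> real (2 * Suc j) * real (Suc t)"
      by (metis less_imp_le of_nat_le_iff of_nat_mult)
    then have 1: "real K / (2 * Suc j) \<le> real (Suc t)" by (simp add: field_simps)
    have 2: "(real K / 2) ^ d \<le> real k ^ d" using k(1) by (intro power_mono) auto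
    have "c' * real K ^ Suc d = (real K / (2 * Suc j)) * (c * (real K / 2) ^ d)"
      by (simp add: c'_def power_divide algebra_simps)
    also have "\<dots> \<le> real (Suc t) * (c * real k ^ d)"
      using 1 2 c(1) by (intro mult_mono) auto
    finally show "\<exists>n. rk {f. fdeg F K f} P n \<and> c' * real K ^ Suc d \<le> real n" using n by auto
  qed
qed

section \<open>Lower growth bounds from algebraically independent functions\<close>

text \<open>A polynomial vanishing on a product of infinite sets has only zero coefficients, by
  splitting off one variable at a time. Infinite sets instead of all of \<complex> leave room for a
  coordinate that has to avoid 0.\<close>

lemma poly_box_zero:
  assumes "finite J" "\<And>i. i \<in> J \<Longrightarrow> infinite (A i)"
    "\<And>z. z \<in> PiE J A \<Longrightarrow> (\<Sum>\<alpha>\<in>PiE J (\<lambda>_. {..M}). c \<alpha> * (\<Prod>i\<in>J. z i ^ \<alpha> i)) = (0::complex)"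
    "\<alpha> \<in> PiE J (\<lambda>_. {..M::nat})"
  shows "c \<alpha> = 0"
  using assms
proof (induction J arbitrary: c \<alpha> rule: finite_induct)
  case empty
  then show ?case by auto
next
  case (insert j J)
  let ?X = "PiE J (\<lambda>_. {..M})"
  have inj: "inj_on (\<lambda>(y, g). g(j := y)) ({..M} \<times> ?X)"
    by (rule inj_combinator) (use insert in auto)
  have key: "(\<Sum>\<beta>\<in>?X. c (\<beta>(j := a)) * (\<Prod>i\<in>J. z i ^ \<beta> i)) = 0"
    if z: "z \<in> PiE J A" and a: "a \<le> M" for z a
  proof -
    \<comment> \<open>The polynomial as a function of the variable \<open>j\<close> alone. It has
      infinitely many roots, and its coefficients are polynomials in the remaining
      variables.\<close>
    define p where "p = (\<Sum>a\<le>M. monom (\<Sum>\<beta>\<in>?X. c (\<beta>(j := a)) * (\<Prod>i\<in>J. z i ^ \<beta> i)) a)"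
    have "poly p w = 0" if w: "w \<in> A j" for w
    proof -
      have zw: "z(j := w) \<in> PiE (insert j J) A" using z w by (auto simp: PiE_def extensional_def)
      have "0 = (\<Sum>\<alpha>\<in>PiE (insert j J) (\<lambda>_. {..M}). c \<alpha> * (\<Prod>i\<in>insert j J. (z(j := w)) i ^ \<alpha> i))"
        using insert.prems(2)[OF zw] by simp
      also have "\<dots> = (\<Sum>(a, \<beta>)\<in>{..M} \<times> ?X. c (\<beta>(j := a)) * (\<Prod>i\<in>insert j J. (z(j := w)) i ^ (\<beta>(j := a)) i))"
        unfolding PiE_insert_eq by (subst sum.reindex[OF inj]) (simp add: case_prod_beta)
      also have "\<dots> = (\<Sum>(a, \<beta>)\<in>{..M} \<times> ?X. w ^ a * (c (\<beta>(j := a)) * (\<Prod>i\<in>J. z i ^ \<beta> i)))"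
      proof (intro sum.cong refl, clarify)
        fix a \<beta>
        have "(\<Prod>i\<in>J. (z(j := w)) i ^ (\<beta>(j := a)) i) = (\<Prod>i\<in>J. z i ^ \<beta> i)"
          using insert.hyps by (intro prod.cong) auto
        then show "c (\<beta>(j := a)) * (\<Prod>i\<in>insert j J. (z(j := w)) i ^ (\<beta>(j := a)) i)
            = w ^ a * (c (\<beta>(j := a)) * (\<Prod>i\<in>J. z i ^ \<beta> i))"
          using insert.hyps by simp
      qed
      also have "\<dots> = (\<Sum>a\<le>M. w ^ a * (\<Sum>\<beta>\<in>?X. c (\<beta>(j := a)) * (\<Prod>i\<in>J. z i ^ \<beta> i)))"
        by (simp add: sum.cartesian_product[symmetric] sum_distrib_left)
      also have "\<dots> = poly p w"
        by (simp add: p_def poly_sum poly_monom mult.commute)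
      finally show ?thesis by simp
    qed
    then have "A j \<subseteq> {w. poly p w = 0}" by blast
    then have "p = 0"
      using insert.prems(1)[of j] poly_roots_finite[of p] finite_subset by blast
    then have "poly.coeff p a = 0" by simp
    then show ?thesis using a by (simp add: p_def coeff_sum)
  qed
  define a where "a = \<alpha> j"
  have a: "a \<le> M" using insert.prems(3) by (auto simp: a_def PiE_def Pi_def)
  define \<beta> where "\<beta> = restrict \<alpha> J"
  have \<beta>: "\<beta> \<in> ?X" using insert.prems(3) by (auto simp: \<beta>_def PiE_def Pi_def)
  have "\<alpha> = \<beta>(j := a)"
    using insert.prems(3) by (auto simp: fun_eq_iff \<beta>_def a_def PiE_def extensional_def)
  moreover have "c (\<beta>(j := a)) = 0"
    by (rule insert.IH[of "\<lambda>\<beta>. c (\<beta>(j := a))"]) (use insert.prems \<beta> key[OF _ a] in auto)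
  ultimately show ?case by metis
qed

text \<open>The \<open>u i\<close> take all values in a box of infinite sets, hence are
  algebraically independent on Z. The monomials in them with all exponents at most k div card J have
  degree at most k, and they are numerous enough.\<close>

lemma growth_ge_box:
  fixes J :: "'i set"
  assumes J: "finite J" and u: "\<And>i. i \<in> J \<Longrightarrow> fdeg F 1 (u i)"
    and A: "\<And>i. i \<in> J \<Longrightarrow> infinite (A i)"
    and cover: "\<And>z. z \<in> PiE J A \<Longrightarrow> \<exists>x\<in>Z. \<forall>i\<in>J. u i x = z i"
  shows "growth_ge F (vanishing F Z) (card J)"
  unfolding growth_ge_def
proof (intro exI[of _ "1 / real (card J) ^ card J"] conjI allI impI)
  let ?N = "card J"
  show "1 / real ?N ^ ?N > 0" using J by (cases "?N = 0") auto
  fix k :: nat assume k: "k \<ge> 1"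
  \<comment> \<open>For empty J this is k div 0 = 0; the single monomial 1 then suffices, as the
    constant above is 1 / 0 ^ 0 = 1.\<close>
  define M where "M = k div ?N"
  let ?X = "PiE J (\<lambda>_. {..M})"
  define h where "h \<alpha> = (\<lambda>x. \<Prod>i\<in>J. u i x ^ \<alpha> i)" for \<alpha> :: "'i \<Rightarrow> nat"
  have fin: "finite ?X" using J by (simp add: finite_PiE)
  have "findep (vanishing F Z) ?X h"
    unfolding findep_def
  proof (intro conjI allI impI ballI fin)
    fix c \<alpha> assume c: "(\<lambda>x. \<Sum>\<alpha>\<in>?X. c \<alpha> * h \<alpha> x) \<in> vanishing F Z" and \<alpha>: "\<alpha> \<in> ?X"
    show "c \<alpha> = 0"
    proof (rule poly_box_zero[OF J A _ \<alpha>])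
      fix z assume "z \<in> PiE J A"
      then obtain x where x: "x \<in> Z" "\<forall>i\<in>J. u i x = z i" using cover by blast
      have "(\<Sum>\<alpha>\<in>?X. c \<alpha> * h \<alpha> x) = 0" using c x(1) by (simp add: vanishing_def)
      moreover have "h \<alpha> x = (\<Prod>i\<in>J. z i ^ \<alpha> i)" for \<alpha>
        unfolding h_def using x(2) by (intro prod.cong) auto
      ultimately show "(\<Sum>\<alpha>\<in>?X. c \<alpha> * (\<Prod>i\<in>J. z i ^ \<alpha> i)) = 0" by simp
    qed
  qed
  moreover have "h \<alpha> \<in> {f. fdeg F k f}" if \<alpha>: "\<alpha> \<in> ?X" for \<alpha>
  proof -
    have "fdeg F (\<Sum>i\<in>J. 1 * \<alpha> i) (h \<alpha>)"
      unfolding h_def using J u by (intro fdeg_prod fdeg_power) auto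
    moreover have "(\<Sum>i\<in>J. 1 * \<alpha> i) \<le> k"
    proof -
      have "(\<Sum>i\<in>J. 1 * \<alpha> i) \<le> (\<Sum>i\<in>J. M)" using \<alpha> by (intro sum_mono) (auto simp: PiE_def Pi_def)
      also have "\<dots> \<le> k" by (simp add: M_def)
      finally show ?thesis .
    qed
    ultimately show ?thesis by (auto intro: fdeg_mono)
  qed
  ultimately have "rk {f. fdeg F k f} (vanishing F Z) (card ?X)" by (rule rkI)
  moreover have "1 / real ?N ^ ?N * real k ^ ?N \<le> real (card ?X)"
  proof (cases "?N = 0")
    case True
    then show ?thesis using J by (simp add: card_PiE)
  next
    case False
    have "k < ?N * Suc M" unfolding M_def using False dividend_less_times_div[of ?N k] by simp
    then have "real k \<le> real ?N * real (Suc M)" by (metis less_imp_le of_nat_le_iff of_nat_mult)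
    then have "real k / real ?N \<le> real (Suc M)" using False by (simp add: field_simps)
    then have "(real k / real ?N) ^ ?N \<le> real (Suc M) ^ ?N" by (intro power_mono) auto
    then show ?thesis using J by (simp add: card_PiE power_divide)
  qed
  ultimately show "\<exists>n. rk {f. fdeg F k f} (vanishing F Z) n \<and> 1 / real ?N ^ ?N * real k ^ ?N \<le> real n"
    by blast
qed

section \<open>Upper growth bounds from rational generators\<close>

text \<open>Each exponent is bounded separately. This box contains more than the monomials of total
  degree K, but it is counted at once and has the same order of growth.\<close>

definition monoms :: "('x \<Rightarrow> complex) set \<Rightarrow> nat \<Rightarrow> ('x \<Rightarrow> complex) set" where
  "monoms U K = (\<lambda>\<alpha> x. \<Prod>u\<in>U. u x ^ \<alpha> u) ` PiE U (\<lambda>_. {..K})"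

lemma monomsI:
  "\<alpha> \<in> PiE U (\<lambda>_. {..K}) \<Longrightarrow> s = (\<lambda>x. \<Prod>u\<in>U. u x ^ \<alpha> u) \<Longrightarrow> s \<in> monoms U K"
  unfolding monoms_def by blast

lemma card_monoms:
  assumes "finite U"
  shows "finite (monoms U K)" "card (monoms U K) \<le> (K + 1) ^ card U"
proof -
  have "finite (PiE U (\<lambda>_. {..K}))" using assms by (simp add: finite_PiE)
  then show "finite (monoms U K)" "card (monoms U K) \<le> (K + 1) ^ card U"
    unfolding monoms_def using card_image_le[of "PiE U (\<lambda>_. {..K})"] assms by (auto simp: card_PiE)
qed

lemma monoms_mult:
  assumes "finite U" "s \<in> monoms U j" "t \<in> monoms U k"
  shows "(\<lambda>x. s x * t x) \<in> monoms U (j + k)"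
proof -
  obtain \<alpha> \<beta> where \<alpha>: "\<alpha> \<in> PiE U (\<lambda>_. {..j})" "s = (\<lambda>x. \<Prod>u\<in>U. u x ^ \<alpha> u)"
    and \<beta>: "\<beta> \<in> PiE U (\<lambda>_. {..k})" "t = (\<lambda>x. \<Prod>u\<in>U. u x ^ \<beta> u)"
    using assms(2,3) unfolding monoms_def by blast
  have "restrict (\<lambda>u. \<alpha> u + \<beta> u) U \<in> PiE U (\<lambda>_. {..j + k})"
    using \<alpha>(1) \<beta>(1) by (fastforce simp: PiE_def Pi_def)
  moreover have "(\<lambda>x. s x * t x) = (\<lambda>x. \<Prod>u\<in>U. u x ^ restrict (\<lambda>u. \<alpha> u + \<beta> u) U u)"
    unfolding \<alpha>(2) \<beta>(2) by (auto simp: prod.distrib[symmetric] power_add intro!: prod.cong)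
  ultimately show ?thesis by (rule monomsI)
qed

lemma one_in_monoms: "(\<lambda>_. 1) \<in> monoms U K"
proof -
  have "restrict (\<lambda>_. 0) U \<in> PiE U (\<lambda>_. {..K})" by auto
  moreover have "(\<lambda>x. \<Prod>u\<in>U. u x ^ restrict (\<lambda>_. 0) U u) = (\<lambda>_. 1)" by (auto intro!: prod.neutral)
  ultimately show ?thesis by (rule monomsI[OF _ sym])
qed

lemma fdeg_imp_monoms:
  assumes "finite U" "fdeg U K g"
  shows "g \<in> flin (monoms U K)"
  using assms(2)
proof (induction rule: fdeg.induct)
  case (const k c)
  show ?case using flin_scale[OF flin_base[OF one_in_monoms[of U k]], of c] by simp
next
  case (gen u k)
  have "restrict (\<lambda>v. if v = u then 1 else 0) U \<in> PiE U (\<lambda>_. {..Suc k})" by auto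
  moreover have "(\<lambda>x. \<Prod>v\<in>U. v x ^ restrict (\<lambda>v. if v = u then 1 else 0) U v) = u"
  proof
    fix x
    have "(\<Prod>v\<in>U. v x ^ restrict (\<lambda>v. if v = u then 1 else 0) U v) = (\<Prod>v\<in>U. if v = u then v x else 1)"
      by (intro prod.cong) auto
    then show "(\<Prod>v\<in>U. v x ^ restrict (\<lambda>v. if v = u then 1 else 0) U v) = u x"
      using gen assms(1) by simp
  qed
  ultimately have "u \<in> monoms U (Suc k)" by (rule monomsI[OF _ sym])
  then show ?case by (rule flin_base)
next
  case (add k f g)
  then show ?case by (intro flin_add)
next
  case (mult j f k g)
  show ?case
    by (rule flin_mult[OF _ mult.IH]) (auto intro: flin_base monoms_mult[OF assms(1)])
qed

lemma cong_mod_mult: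
  assumes P: "fideal F P" and "f \<in> alg_gen F" "g' \<in> alg_gen F"
    "(\<lambda>x. f x - f' x) \<in> P" "(\<lambda>x. g x - g' x) \<in> P"
  shows "(\<lambda>x. f x * g x - f' x * g' x) \<in> P"
proof -
  have "(\<lambda>x. f x * (g x - g' x)) \<in> P" "(\<lambda>x. g' x * (f x - f' x)) \<in> P"
    using fideal_mult[OF P] assms by blast+
  from fsubD(2)[OF fideal_fsub[OF P] this] show ?thesis by (simp add: algebra_simps)
qed

text \<open>Modulo P, the function is a fraction \<open>g\<close> / D ^ M with numerator in the
  subalgebra generated by U, that is an element of the localisation at D.\<close>

definition rational_mod ::
  "('x \<Rightarrow> complex) set \<Rightarrow> ('x \<Rightarrow> complex) set \<Rightarrow> ('x \<Rightarrow> complex) \<Rightarrow> ('x \<Rightarrow> complex) \<Rightarrow> bool" where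
  "rational_mod U P D f \<longleftrightarrow> (\<exists>M. \<exists>g\<in>alg_gen U. (\<lambda>x. D x ^ M * f x - g x) \<in> P)"

lemma rational_modI: "g \<in> alg_gen U \<Longrightarrow> (\<lambda>x. D x ^ M * f x - g x) \<in> P \<Longrightarrow> rational_mod U P D f"
  unfolding rational_mod_def by blast

lemma rational_mod_ideal: "f \<in> P \<Longrightarrow> rational_mod U P D f"
  by (rule rational_modI[OF alg_gen.const[of 0], of _ 0]) simp

lemma rational_mod_cancel:
  assumes "rational_mod U P D (\<lambda>x. D x ^ N * f x)"
  shows "rational_mod U P D f"
proof -
  obtain M g where "g \<in> alg_gen U" "(\<lambda>x. D x ^ M * (D x ^ N * f x) - g x) \<in> P"
    using assms unfolding rational_mod_def by blast
  then show ?thesis by (intro rational_modI[of g U D "M + N"]) (simp_all add: power_add mult.assoc)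
qed

context
  fixes F U P :: "('x \<Rightarrow> complex) set" and D :: "'x \<Rightarrow> complex"
  assumes P: "fideal F P" and U: "U \<subseteq> alg_gen F" and D: "D \<in> alg_gen U"
begin

lemma denominator_power: "(\<lambda>x. D x ^ n) \<in> alg_gen U" "(\<lambda>x. D x ^ n) \<in> alg_gen F"
  using alg_gen_power[OF D] alg_gen_subset[OF U] by blast+

lemma rational_mod_alg_gen: "f \<in> alg_gen U \<Longrightarrow> rational_mod U P D f"
  by (rule rational_modI[of f U D 0]) (use fsubD(1)[OF fideal_fsub[OF P]] in auto)

lemma rational_mod_add:
  assumes "rational_mod U P D f" "rational_mod U P D f'"
  shows "rational_mod U P D (\<lambda>x. f x + f' x)"
proof -
  obtain M g M' g' where *: "g \<in> alg_gen U" "(\<lambda>x. D x ^ M * f x - g x) \<in> P"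
    "g' \<in> alg_gen U" "(\<lambda>x. D x ^ M' * f' x - g' x) \<in> P"
    using assms unfolding rational_mod_def by blast
  show ?thesis
  proof (rule rational_modI)
    show "(\<lambda>x. D x ^ M' * g x + D x ^ M * g' x) \<in> alg_gen U"
      by (intro alg_gen.add alg_gen.mult denominator_power *)
    have "(\<lambda>x. D x ^ M' * (D x ^ M * f x - g x)) \<in> P" "(\<lambda>x. D x ^ M * (D x ^ M' * f' x - g' x)) \<in> P"
      by (intro fideal_mult[OF P] denominator_power *)+
    from fsubD(2)[OF fideal_fsub[OF P] this]
    show "(\<lambda>x. D x ^ (M + M') * (f x + f' x) - (D x ^ M' * g x + D x ^ M * g' x)) \<in> P"
      by (simp add: power_add algebra_simps)
  qed
qed

lemma rational_mod_mult:
  assumes "f \<in> alg_gen F" "rational_mod U P D f" "rational_mod U P D f'"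
  shows "rational_mod U P D (\<lambda>x. f x * f' x)"
proof -
  obtain M g M' g' where *: "g \<in> alg_gen U" "(\<lambda>x. D x ^ M * f x - g x) \<in> P"
    "g' \<in> alg_gen U" "(\<lambda>x. D x ^ M' * f' x - g' x) \<in> P"
    using assms(2,3) unfolding rational_mod_def by blast
  have "(\<lambda>x. (D x ^ M * f x) * (D x ^ M' * f' x) - g x * g' x) \<in> P"
    using *(3) alg_gen_subset[OF U]
    by (intro cong_mod_mult[OF P _ _ *(2,4)] alg_gen.mult denominator_power assms(1)) blast
  then have "(\<lambda>x. D x ^ (M + M') * (f x * f' x) - g x * g' x) \<in> P"
    by (simp add: power_add mult_ac)
  then show ?thesis by (rule rational_modI[OF alg_gen.mult[OF *(1,3)]])
qed

lemma rational_mod_sum: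
  "finite S \<Longrightarrow> (\<And>i. i \<in> S \<Longrightarrow> rational_mod U P D (h i)) \<Longrightarrow> rational_mod U P D (\<lambda>x. \<Sum>i\<in>S. h i x)"
  by (induction S rule: finite_induct) (simp_all add: rational_mod_add rational_mod_alg_gen alg_gen.const)

end

text \<open>Clearing denominators: multiplication by a power of D whose exponent is proportional to
  the degree is injective modulo the prime P, and sends functions of degree n to polynomials in U of
  degree at most \<open>k0 * n\<close>.\<close>

lemma growth_le_rational:
  assumes F: "finite F" and U: "finite U" "U \<subseteq> alg_gen F" and P: "fprime F P"
    and D: "D \<in> alg_gen U" "D \<notin> P"
    and rat: "\<And>f. f \<in> F \<Longrightarrow> rational_mod U P D f"
  shows "growth_le F P (card U)"
proof -
  note sub = alg_gen_subset[OF U(2)]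
  have Pi: "fideal F P" using P by (simp add: fprime_def)
  note Ps = fideal_fsub[OF Pi]
  have "\<forall>f\<in>F. \<exists>M g k. fdeg U k g \<and> (\<lambda>x. D x ^ M * f x - g x) \<in> P"
    using rat alg_gen_imp_fdeg unfolding rational_mod_def by metis
  then obtain M g k where Mg: "\<And>f. f \<in> F \<Longrightarrow> fdeg U (k f) (g f)"
    "\<And>f. f \<in> F \<Longrightarrow> (\<lambda>x. D x ^ M f * f x - g f x) \<in> P" by metis
  obtain d0 where d0: "fdeg U d0 D" using alg_gen_imp_fdeg[OF D(1)] by blast
  define M0 where "M0 = (\<Sum>f\<in>F. M f)"
  have M0: "M f \<le> M0" if "f \<in> F" for f unfolding M0_def using that F by (intro member_le_sum) auto
  \<comment> \<open>The price of one degree in F: the degree of a numerator, and \<open>d0\<close>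
    for each factor D when the exponent of the denominator is raised to the common value
    \<open>M0\<close>.\<close>
  define k0 where "k0 = (\<Sum>f\<in>F. k f) + d0 * M0"
  have k0: "k f + d0 * M0 \<le> k0" if "f \<in> F" for f
    unfolding k0_def using that F by (simp add: member_le_sum)
  have Din: "(\<lambda>x. D x ^ n) \<in> alg_gen F" for n using D(1) sub by (auto intro: alg_gen_power)
  have key: "\<exists>g. fdeg U (k0 * n) g \<and> (\<lambda>x. D x ^ (M0 * n) * f x - g x) \<in> P" if "fdeg F n f" for n f
    using that
  proof (induction rule: fdeg.induct)
    case (const n c)
    have "fdeg U (k0 * n) (\<lambda>x. D x ^ (M0 * n) * c)"
    proof -
      have "fdeg U (d0 * (M0 * n) + 0) (\<lambda>x. D x ^ (M0 * n) * c)"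
        using d0 by (intro fdeg.mult fdeg_power fdeg.const)
      then show ?thesis by (rule fdeg_mono) (simp add: k0_def algebra_simps)
    qed
    then show ?case using fsubD(1)[OF Ps] by (intro exI[of _ "\<lambda>x. D x ^ (M0 * n) * c"]) auto
  next
    case (gen f n)
    let ?e = "M0 * Suc n - M f"
    have e: "M0 * Suc n = ?e + M f" using M0[OF gen] by simp
    have "(\<lambda>x. D x ^ ?e * (D x ^ M f * f x - g f x)) \<in> P"
      using Mg(2)[OF gen] by (intro fideal_mult[OF Pi] Din)
    moreover have "D x ^ (M0 * Suc n) = D x ^ ?e * D x ^ M f" for x
      using e by (metis power_add)
    ultimately have "(\<lambda>x. D x ^ (M0 * Suc n) * f x - D x ^ ?e * g f x) \<in> P"
      by (simp add: right_diff_distrib mult.assoc)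
    moreover have "fdeg U (k0 * Suc n) (\<lambda>x. D x ^ ?e * g f x)"
    proof -
      have "fdeg U (d0 * ?e + k f) (\<lambda>x. D x ^ ?e * g f x)"
        using Mg(1)[OF gen] d0 by (intro fdeg.mult fdeg_power)
      moreover have "d0 * ?e + k f \<le> k0 * Suc n"
      proof -
        have "d0 * ?e + k f \<le> d0 * (M0 * Suc n) + k f" by simp
        also have "\<dots> = d0 * M0 * n + (k f + d0 * M0)" by (simp add: algebra_simps)
        also have "\<dots> \<le> k0 * n + k0" using k0[OF gen] by (intro add_mono mult_le_mono1) auto
        finally show ?thesis by simp
      qed
      ultimately show ?thesis by (rule fdeg_mono)
    qed
    ultimately show ?case by blast
  next
    case (add n f f')
    then obtain g g' where g: "fdeg U (k0 * n) g" "(\<lambda>x. D x ^ (M0 * n) * f x - g x) \<in> P"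
      "fdeg U (k0 * n) g'" "(\<lambda>x. D x ^ (M0 * n) * f' x - g' x) \<in> P" by blast
    from fsubD(2)[OF Ps g(2,4)] have "(\<lambda>x. D x ^ (M0 * n) * (f x + f' x) - (g x + g' x)) \<in> P"
      by (simp add: algebra_simps)
    then show ?case using fdeg.add[OF g(1,3)] by blast
  next
    case (mult j f n f')
    then obtain g g' where g: "fdeg U (k0 * j) g" "(\<lambda>x. D x ^ (M0 * j) * f x - g x) \<in> P"
      "fdeg U (k0 * n) g'" "(\<lambda>x. D x ^ (M0 * n) * f' x - g' x) \<in> P" by blast
    have "(\<lambda>x. (D x ^ (M0 * j) * f x) * (D x ^ (M0 * n) * f' x) - g x * g' x) \<in> P"
      using mult.hyps g Din sub
      by (intro cong_mod_mult[OF Pi]) (auto intro!: alg_gen.mult dest: fdeg_imp_alg_gen)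
    then have "(\<lambda>x. D x ^ (M0 * (j + n)) * (f x * f' x) - g x * g' x) \<in> P"
      by (simp add: algebra_simps power_add)
    moreover have "fdeg U (k0 * (j + n)) (\<lambda>x. g x * g' x)"
      using fdeg.mult[OF g(1,3)] by (simp add: algebra_simps)
    ultimately show ?case by blast
  qed
  show ?thesis
    unfolding growth_le_def
  proof (intro exI[of _ "real (k0 + 1) ^ card U"] allI impI)
    fix n m assume "rk {f. fdeg F n f} P m"
    then obtain I :: "nat set" and h where I: "card I = m" "findep P I h" "\<And>i. i \<in> I \<Longrightarrow> fdeg F n (h i)"
      unfolding rk_def by auto
    define h' where "h' i = (\<lambda>x. D x ^ (M0 * n) * h i x)" for i
    have "findep P I h'"
      unfolding findep_def
    proof (intro conjI allI impI ballI)
      show "finite I" using I(2) by (simp add: findep_def)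
      fix c i assume c: "(\<lambda>x. \<Sum>i\<in>I. c i * h' i x) \<in> P" and i: "i \<in> I"
      have "(\<lambda>x. D x ^ (M0 * n) * (\<Sum>i\<in>I. c i * h i x)) \<in> P"
        using c by (simp add: h'_def sum_distrib_left algebra_simps)
      moreover have "(\<lambda>x. \<Sum>i\<in>I. c i * h i x) \<in> alg_gen F"
        using I(3) \<open>finite I\<close> by (intro alg_gen_sum' alg_gen_scale) (auto intro: fdeg_imp_alg_gen)
      ultimately have "(\<lambda>x. D x ^ (M0 * n)) \<in> P \<or> (\<lambda>x. \<Sum>i\<in>I. c i * h i x) \<in> P"
        by (intro fprimeD[OF P Din])
      then have "(\<lambda>x. \<Sum>i\<in>I. c i * h i x) \<in> P"
        using fprime_power[OF P _ , of D] D sub by blast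
      then show "c i = 0" using findepD[OF I(2) _ i] by blast
    qed
    \<comment> \<open>Everything that the monomials cover modulo P; its rank is therefore at most
      their number.\<close>
    define V where "V = {f. \<exists>p\<in>P. \<exists>w\<in>flin (monoms U (k0 * n)). f = (\<lambda>x. p x + w x)}"
    have V: "fsub V"
      unfolding fsub_def
    proof (intro conjI ballI allI)
      show "(\<lambda>_. 0) \<in> V"
        unfolding V_def using fsubD(1)[OF Ps] flin.zero by (intro CollectI bexI[of _ "\<lambda>_. 0"]) auto
    next
      fix f f' assume "f \<in> V" "f' \<in> V"
      then obtain p w p' w' where *: "p \<in> P" "w \<in> flin (monoms U (k0 * n))" "f = (\<lambda>x. p x + w x)"
        "p' \<in> P" "w' \<in> flin (monoms U (k0 * n))" "f' = (\<lambda>x. p' x + w' x)" unfolding V_def by blast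
      then show "(\<lambda>x. f x + f' x) \<in> V"
        unfolding V_def using fsubD(2)[OF Ps *(1,4)] flin_add[OF *(2,5)]
        by (intro CollectI bexI[of _ "\<lambda>x. p x + p' x"] bexI[of _ "\<lambda>x. w x + w' x"]) (auto simp: algebra_simps)
    next
      fix c f assume "f \<in> V"
      then obtain p w where *: "p \<in> P" "w \<in> flin (monoms U (k0 * n))" "f = (\<lambda>x. p x + w x)"
        unfolding V_def by blast
      then show "(\<lambda>x. c * f x) \<in> V"
        unfolding V_def using fsubD(3)[OF Ps *(1), of c] flin_scale[OF *(2), of c]
        by (intro CollectI bexI[of _ "\<lambda>x. c * p x"] bexI[of _ "\<lambda>x. c * w x"]) (auto simp: algebra_simps)
    qed
    have "h' i \<in> V" if i: "i \<in> I" for i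
    proof -
      obtain g where g: "fdeg U (k0 * n) g" "(\<lambda>x. h' i x - g x) \<in> P"
        using key[OF I(3)[OF i]] unfolding h'_def by blast
      then show ?thesis unfolding V_def using fdeg_imp_monoms[OF U(1) g(1)]
        by (intro CollectI bexI[of _ "\<lambda>x. h' i x - g x"] bexI[of _ g]) auto
    qed
    then have "rk V P (card I)" using rkI[OF \<open>findep P I h'\<close>] by blast
    then have "card I \<le> card (monoms U (k0 * n))"
      by (rule rk_bound[OF card_monoms(1)[OF U(1)] V Ps]) (auto simp: V_def)
    also have "\<dots> \<le> (k0 * n + 1) ^ card U" by (rule card_monoms(2)[OF U(1)])
    also have "\<dots> \<le> ((k0 + 1) * (n + 1)) ^ card U" by (intro power_mono) auto
    finally have "m \<le> (k0 + 1) ^ card U * (n + 1) ^ card U" unfolding I(1) power_mult_distrib .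
    then have "real m \<le> real ((k0 + 1) ^ card U * (n + 1) ^ card U)" using of_nat_le_iff by blast
    then show "real m \<le> real (k0 + 1) ^ card U * real (n + 1) ^ card U" by simp
  qed
qed

text \<open>Serves to replace the infinite set of all functionals by the coordinates of a basis,
  without changing degrees; \<open>growth_le_rational\<close> asks for finitely many
  generators.\<close>

lemma fdeg_generators:
  assumes "F0 \<subseteq> F" "\<And>f. f \<in> F \<Longrightarrow> fdeg F0 1 f"
  shows "fdeg F k f \<longleftrightarrow> fdeg F0 k f" "alg_gen F = alg_gen F0"
proof -
  show *: "fdeg F k f \<longleftrightarrow> fdeg F0 k f" for k f
  proof
    show "fdeg F k f \<Longrightarrow> fdeg F0 k f"
      by (induction rule: fdeg.induct) (auto intro: fdeg.intros fdeg_mono[OF assms(2)])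
    show "fdeg F0 k f \<Longrightarrow> fdeg F k f"
      by (induction rule: fdeg.induct) (use assms(1) in \<open>auto intro: fdeg.intros\<close>)
  qed
  show "alg_gen F = alg_gen F0"
    using * alg_gen_imp_fdeg fdeg_imp_alg_gen by (metis subsetI subset_antisym)
qed

lemma growth_le_generators:
  assumes "F0 \<subseteq> F" "\<And>f. f \<in> F \<Longrightarrow> fdeg F0 1 f"
  shows "growth_le F P d \<longleftrightarrow> growth_le F0 P d"
proof -
  have "fdeg F = fdeg F0" using fdeg_generators(1)[OF assms] by (intro ext) auto
  then show ?thesis by (simp add: growth_le_def)
qed

section \<open>Linear algebra over the complex numbers\<close>

context fd_complex_space
begin

definition Bs :: "'g set" where
  "Bs = (SOME B. finite B \<and> independent B \<and> span B = UNIV)"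

lemma Bs: "finite Bs" "independent Bs" "span Bs = UNIV"
proof -
  obtain B0 where B0: "finite B0" "span B0 = UNIV" using finite_dim by blast
  obtain B where B: "B \<subseteq> B0" "independent B" "span B = UNIV"
    using maximal_independent_subset[of B0] B0
    by (metis span_mono span_span subset_antisym top_greatest)
  then have "finite B \<and> independent B \<and> span B = UNIV" using B0 finite_subset by blast
  then have "finite Bs \<and> independent Bs \<and> span Bs = UNIV" unfolding Bs_def by (rule someI)
  then show "finite Bs" "independent Bs" "span Bs = UNIV" by blast+
qed

end

sublocale fd_complex_space \<subseteq> finite_dimensional_vector_space "(\<odot>)" Bs
  by unfold_locales (use Bs in auto)

context fd_complex_space
begin

definition co :: "'g \<Rightarrow> 'g \<Rightarrow> complex" where "co b x = representation Bs x b"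

lemma functional_co: "functional (co b)"
  unfolding functional_def co_def
  by unfold_locales (simp_all add: representation_add representation_scale Bs)

lemma co_expand: "(\<Sum>b\<in>Bs. co b x \<odot> b) = x"
  unfolding co_def using sum_representation_eq[OF Bs(2) _ Bs(1) subset_refl] Bs(3) by simp

lemma co_basis: "b \<in> Bs \<Longrightarrow> b' \<in> Bs \<Longrightarrow> co b b' = (if b' = b then 1 else 0)"
  unfolding co_def using representation_basis[OF Bs(2), of b'] by auto

lemma functional_expand:
  assumes "functional \<phi>"
  shows "\<phi> x = (\<Sum>b\<in>Bs. \<phi> b * co b x)"
  using functionalD[OF assms] co_expand[of x] by (metis (no_types, lifting) mult.commute sum.cong)

lemma functional_eqI: "(\<And>\<phi>. functional \<phi> \<Longrightarrow> \<phi> x = \<phi> y) \<Longrightarrow> x = y"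
  by (metis (no_types, lifting) co_expand functional_co sum.cong)

lemma functionalI:
  "(\<And>x y. \<phi> (x + y) = \<phi> x + \<phi> y) \<Longrightarrow> (\<And>c x. \<phi> (c \<odot> x) = c * \<phi> x) \<Longrightarrow> functional \<phi>"
  unfolding functional_def by unfold_locales (auto simp: algebra_simps)

lemma functional_more:
  assumes "functional \<phi>"
  shows "\<phi> 0 = 0" "\<phi> (- x) = - \<phi> x" "\<phi> (x - y) = \<phi> x - \<phi> y"
  using functionalD(2)[OF assms, of 0 0] functionalD(2)[OF assms, of "-1" x]
    functionalD(2)[OF assms, of "-1" y] functionalD(1)[OF assms, of x "- y"] by auto

abbreviation lin :: "('g \<Rightarrow> 'g) \<Rightarrow> bool" where
  "lin T \<equiv> Vector_Spaces.linear (\<odot>) (\<odot>) T"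

lemma linI: "(\<And>x y. T (x + y) = T x + T y) \<Longrightarrow> (\<And>c x. T (c \<odot> x) = c \<odot> T x) \<Longrightarrow> lin T"
  by (unfold_locales) (auto simp: algebra_simps)

lemma linD:
  assumes "lin T"
  shows "T (x + y) = T x + T y" "T (c \<odot> x) = c \<odot> T x" "T 0 = 0" "T (- x) = - T x"
    "T (x - y) = T x - T y" "T (sum h S) = (\<Sum>i\<in>S. T (h i))"
proof -
  interpret Vector_Spaces.linear "(\<odot>)" "(\<odot>)" T by fact
  show "T (x + y) = T x + T y" "T (c \<odot> x) = c \<odot> T x" "T 0 = 0" "T (- x) = - T x"
    "T (x - y) = T x - T y" "T (sum h S) = (\<Sum>i\<in>S. T (h i))"
    by (simp_all add: add scale neg diff sum)
qed

lemma lin_comp: "lin S \<Longrightarrow> lin T \<Longrightarrow> lin (\<lambda>x. S (T x))"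
  by (rule linI) (simp_all add: linD)

lemma lin_add: "lin S \<Longrightarrow> lin T \<Longrightarrow> lin (\<lambda>x. S x + T x)"
  by (rule linI) (simp_all add: linD algebra_simps)

lemma lin_scale: "lin T \<Longrightarrow> lin (\<lambda>x. c \<odot> T x)"
  by (rule linI) (simp_all add: linD algebra_simps)

lemma lin_ident: "lin (\<lambda>x. x)"
  by (rule linI) simp_all

lemma lin_funpow: "lin T \<Longrightarrow> lin (T ^^ n)"
  by (induction n) (auto simp: o_def intro: lin_comp lin_ident[folded id_def] simp: id_def lin_ident)

lemma functional_lin: "functional \<phi> \<Longrightarrow> lin T \<Longrightarrow> functional (\<lambda>x. \<phi> (T x))"
  by (rule functionalI) (simp_all add: functionalD linD)

lemma subspace_lin_image:
  assumes "lin T" "subspace W"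
  shows "subspace (T ` W)"
proof (rule subspaceI)
  show "0 \<in> T ` W" using subspace_0[OF assms(2)] linD(3)[OF assms(1)] by (metis imageI)
next
  fix x y assume "x \<in> T ` W" "y \<in> T ` W"
  then obtain a b where "a \<in> W" "b \<in> W" "x = T a" "y = T b" by blast
  then show "x + y \<in> T ` W" using subspace_add[OF assms(2)] linD(1)[OF assms(1)] by (metis imageI)
next
  fix c x assume "x \<in> T ` W"
  then obtain a where "a \<in> W" "x = T a" by blast
  then show "c \<odot> x \<in> T ` W" using subspace_scale[OF assms(2)] linD(2)[OF assms(1)] by (metis imageI)
qed

text \<open>A linear section of T over its range embeds the range as a subspace that meets the
  kernel only in 0.\<close>

lemma dim_range_kernel:
  assumes "lin T"
  shows "dim (range T) + dim {x. T x = 0} \<le> dim (UNIV :: 'g set)"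
proof -
  interpret p: vector_space_pair "(\<odot>)" "(\<odot>)" ..
  interpret p1: finite_dimensional_vector_space_pair_1 "(\<odot>)" Bs "(\<odot>)" ..
  obtain g where g: "lin g" "\<And>v. v \<in> range T \<Longrightarrow> T (g v) = v"
    using p.linear_exists_right_inverse_on[OF assms subspace_UNIV] by auto
  have r: "subspace (range T)" by (rule subspace_lin_image[OF assms subspace_UNIV])
  have k: "subspace {x. T x = 0}" by (rule subspaceI) (auto simp: linD[OF assms])
  have gr: "subspace (g ` range T)" by (rule subspace_lin_image[OF g(1) r])
  have "inj_on g (range T)" by (rule inj_on_inverseI[of _ T]) (use g(2) in auto)
  then have "inj_on g (span (range T))" using r by (metis span_eq_iff)
  then have d: "dim (g ` range T) = dim (range T)" by (rule p1.dim_image_eq[OF g(1)])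
  have "g ` range T \<inter> {x. T x = 0} \<subseteq> {0}" using g linD(3)[OF g(1)] by auto
  then have "dim (g ` range T \<inter> {x. T x = 0}) = 0" by simp
  with dim_sums_Int[OF gr k] d
    dim_subset[OF subset_UNIV, of "{x + y |x y. x \<in> g ` range T \<and> y \<in> {x. T x = 0}}"]
  show ?thesis by linarith
qed

lemma inj_on_imp_surj_on:
  assumes "lin T" "subspace W" "T ` W \<subseteq> W" "\<And>x. x \<in> W \<Longrightarrow> T x = 0 \<Longrightarrow> x = 0"
  shows "T ` W = W"
proof -
  interpret p1: finite_dimensional_vector_space_pair_1 "(\<odot>)" Bs "(\<odot>)" ..
  have "inj_on T W"
  proof (rule inj_onI)
    fix x y assume "x \<in> W" "y \<in> W" "T x = T y"
    from \<open>T x = T y\<close> have "T (x - y) = 0" unfolding linD(5)[OF assms(1)] by (rule right_minus_eq[THEN iffD2])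
    moreover have "x - y \<in> W" by (rule subspace_diff[OF assms(2) \<open>x \<in> W\<close> \<open>y \<in> W\<close>])
    ultimately have "x - y = 0" by (rule assms(4)[rotated])
    then show "x = y" by simp
  qed
  then have "inj_on T (span W)" using assms(2) by (metis span_eq_iff)
  then have "dim (T ` W) = dim W" by (rule p1.dim_image_eq[OF assms(1)])
  moreover have "subspace (T ` W)" by (rule subspace_lin_image[OF assms(1,2)])
  ultimately show ?thesis using subspace_dim_equal[OF _ assms(2,3)] by simp
qed

subsection \<open>Polynomials in an operator\<close>

definition pev :: "('g \<Rightarrow> 'g) \<Rightarrow> complex poly \<Rightarrow> 'g \<Rightarrow> 'g" where
  "pev T p v = (\<Sum>i\<le>degree p. poly.coeff p i \<odot> (T ^^ i) v)"

lemma pev_eq: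
  assumes "degree p \<le> n"
  shows "pev T p v = (\<Sum>i\<le>n. poly.coeff p i \<odot> (T ^^ i) v)"
  unfolding pev_def using assms by (intro sum.mono_neutral_left) (auto simp: coeff_eq_0)

lemma pev_0: "pev T 0 v = 0"
  by (simp add: pev_def)

lemma pev_pCons:
  assumes "lin T"
  shows "pev T (pCons a p) v = a \<odot> v + T (pev T p v)"
proof -
  have "pev T (pCons a p) v = (\<Sum>i\<le>Suc (degree p). poly.coeff (pCons a p) i \<odot> (T ^^ i) v)"
    by (rule pev_eq) (simp add: degree_pCons_le)
  also have "\<dots> = a \<odot> v + (\<Sum>i\<le>degree p. poly.coeff p i \<odot> T ((T ^^ i) v))"
    by (subst sum.atMost_Suc_shift) simp
  also have "(\<Sum>i\<le>degree p. poly.coeff p i \<odot> T ((T ^^ i) v)) = T (pev T p v)"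
    by (simp add: pev_def linD[OF assms])
  finally show ?thesis .
qed

lemma pev_add: "pev T (p + q) v = pev T p v + pev T q v"
proof -
  let ?n = "max (degree p) (degree q)"
  have "degree (p + q) \<le> ?n" by (rule degree_add_le_max)
  then show ?thesis
    by (simp add: pev_eq[of _ ?n] sum.distrib[symmetric] scale_left_distrib)
qed

lemma pev_smult: "pev T (Polynomial.smult c p) v = c \<odot> pev T p v"
  using pev_eq[OF degree_smult_le, of T c p v] by (simp add: pev_def scale_sum_right)

lemma pev_mult:
  assumes "lin T"
  shows "pev T (p * q) v = pev T p (pev T q v)"
proof (induction p)
  case 0
  then show ?case by (simp add: pev_0)
next
  case (pCons a p)
  then show ?case by (simp add: pev_add pev_smult pev_pCons[OF assms])
qed

lemma pev_eigenvector:
  assumes "lin T" "T v = \<mu> \<odot> v"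
  shows "pev T p v = poly p \<mu> \<odot> v"
proof (induction p)
  case 0
  then show ?case by (simp add: pev_0)
next
  case (pCons a p)
  then show ?case
    by (simp add: pev_pCons[OF assms(1)] linD[OF assms(1)] assms(2) algebra_simps)
qed

lemma pev_in:
  assumes "subspace W" "T ` W \<subseteq> W" "v \<in> W"
  shows "pev T p v \<in> W"
proof -
  have "(T ^^ i) v \<in> W" for i using assms by (induction i) auto
  then show ?thesis unfolding pev_def using assms(1) by (intro subspace_sum subspace_scale)
qed

lemma pev_linear: "lin T \<Longrightarrow> lin (pev T p)"
  unfolding pev_def
  by (rule linI) (simp_all add: linD[OF lin_funpow] sum.distrib scale_sum_right algebra_simps)

text \<open>Among dimension + 1 iterates of \<open>v\<close> two coincide, or they are too many to
  be independent; either way a relation results, whose coefficients form the polynomial.\<close>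

lemma annihilator_exists: "\<exists>p. p \<noteq> 0 \<and> pev T p v = 0"
proof (cases "inj_on (\<lambda>i. (T ^^ i) v) {..dimension}")
  case False
  then obtain i j where ij: "i \<noteq> j" "(T ^^ i) v = (T ^^ j) v" unfolding inj_on_def by blast
  let ?p = "monom (1::complex) i - monom 1 j"
  have "poly.coeff ?p i \<noteq> 0" using ij(1) by simp
  then have "?p \<noteq> 0" by (metis coeff_0)
  moreover have "pev T ?p v = 0"
  proof -
    have m: "pev T (monom c i) v = c \<odot> (T ^^ i) v" for c i
    proof -
      have "(\<Sum>k\<le>i. poly.coeff (monom c i) k \<odot> (T ^^ k) v) = (\<Sum>k\<le>i. if i = k then c \<odot> (T ^^ i) v else 0)"
        by (intro sum.cong) auto
      then show ?thesis using pev_eq[OF degree_monom_le, of T c i v] by simp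
    qed
    have "?p = monom 1 i + monom (- 1) j" by (simp add: minus_monom[symmetric])
    then have "pev T ?p v = pev T (monom 1 i) v + pev T (monom (- 1) j) v"
      by (simp only: pev_add)
    then show ?thesis using ij(2) by (simp add: m)
  qed
  ultimately show ?thesis by blast
next
  case True
  let ?S = "(\<lambda>i. (T ^^ i) v) ` {..dimension}"
  have "card ?S = Suc dimension" using card_image[OF True] by simp
  then have "dependent ?S"
    using dim_subset_UNIV[of ?S] by (intro dependent_biggerset_general) auto
  then obtain u where u: "(\<Sum>w\<in>?S. u w \<odot> w) = 0" "\<exists>w\<in>?S. u w \<noteq> 0"
    using dependent_finite[of ?S] by auto
  define p where "p = (\<Sum>i\<le>dimension. monom (u ((T ^^ i) v)) i)"
  have cf: "poly.coeff p i = (if i \<le> dimension then u ((T ^^ i) v) else 0)" for i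
    by (simp add: p_def coeff_sum)
  have "p \<noteq> 0"
  proof
    assume "p = 0"
    obtain i where "i \<le> dimension" "u ((T ^^ i) v) \<noteq> 0" using u(2) by auto
    then show False using cf[of i] \<open>p = 0\<close> by simp
  qed
  moreover have "degree p \<le> dimension" by (rule degree_le) (simp add: cf)
  then have "pev T p v = (\<Sum>i\<le>dimension. u ((T ^^ i) v) \<odot> (T ^^ i) v)"
    by (simp add: pev_eq cf)
  then have "pev T p v = 0" using u(1) by (simp add: sum.reindex[OF True])
  ultimately show ?thesis by blast
qed

text \<open>Split off a root of a polynomial that annihilates some \<open>v\<close>. Either the
  cofactor already annihilates \<open>v\<close> and has smaller degree, or its value at
  \<open>v\<close> is an eigenvector.\<close>

lemma eigenvector_exists:
  assumes T: "lin T" and W: "subspace W" "T ` W \<subseteq> W" "W \<noteq> {0}"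
  shows "\<exists>\<mu> v. v \<in> W \<and> v \<noteq> 0 \<and> T v = \<mu> \<odot> v"
proof -
  obtain v where v: "v \<in> W" "v \<noteq> 0" using W subspace_0 by fastforce
  obtain p where "p \<noteq> 0" "pev T p v = 0" using annihilator_exists by blast
  then show ?thesis
  proof (induction "degree p" arbitrary: p rule: less_induct)
    case less
    have "degree p \<noteq> 0"
    proof
      assume "degree p = 0"
      then obtain c where "p = [:c:]" using degree_eq_zeroE by blast
      then show False using less.prems v by (simp add: pev_def)
    qed
    then obtain \<mu> where \<mu>: "poly p \<mu> = 0"
      using fundamental_theorem_of_algebra[of p] constant_degree[of p] by auto
    then obtain q where q: "p = [:- \<mu>, 1:] * q" by (metis dvdE poly_eq_0_iff_dvd)
    then have q0: "q \<noteq> 0" using less.prems by auto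
    have "pev T [:- \<mu>, 1:] (pev T q v) = 0"
      using less.prems(2) pev_mult[OF T, of "[:- \<mu>, 1:]" q v] unfolding q by (simp only:)
    then have e: "T (pev T q v) = \<mu> \<odot> pev T q v"
      by (simp add: pev_pCons[OF T] pev_0 linD[OF T])
    show ?case
    proof (cases "pev T q v = 0")
      case True
      have "degree p = Suc (degree q)" using degree_mult_eq[of "[:- \<mu>, 1:]" q] q0 unfolding q by simp
      then show ?thesis using less.hyps[of q] q0 True by simp
    next
      case False
      then show ?thesis using e pev_in[OF W(1,2) v(1)] by blast
    qed
  qed
qed

text \<open>The product of annihilating polynomials of the basis vectors annihilates the whole
  space, so all eigenvalues are among its roots.\<close>

lemma finite_eigenvalues:
  assumes "lin T"
  shows "finite {\<mu>. \<exists>v. v \<noteq> 0 \<and> T v = \<mu> \<odot> v}"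
proof -
  have "\<exists>p. p \<noteq> 0 \<and> (\<forall>b\<in>B. pev T p b = 0)" if "finite B" for B
    using that
  proof (induction B rule: finite_induct)
    case empty
    then show ?case by (intro exI[of _ 1]) simp
  next
    case (insert b B)
    then obtain p where p: "p \<noteq> 0" "\<forall>b\<in>B. pev T p b = 0" by blast
    obtain q where q: "q \<noteq> 0" "pev T q b = 0" using annihilator_exists by blast
    have "pev T (q * p) b = 0"
      unfolding mult.commute[of q p] using q(2) by (simp add: pev_mult[OF assms] linD[OF pev_linear[OF assms]])
    moreover have "pev T (q * p) b' = 0" if "b' \<in> B" for b'
      using p that by (simp add: pev_mult[OF assms] linD[OF pev_linear[OF assms]])
    ultimately show ?case using p q by (intro exI[of _ "q * p"]) auto
  qed
  from this[OF Bs(1)] obtain p where p: "p \<noteq> 0" "\<And>b. b \<in> Bs \<Longrightarrow> pev T p b = 0" by blast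
  have z: "pev T p v = 0" for v
  proof -
    have "pev T p v = pev T p (\<Sum>b\<in>Bs. co b v \<odot> b)" by (simp add: co_expand)
    also have "\<dots> = 0" using p(2) by (simp add: linD[OF pev_linear[OF assms]])
    finally show ?thesis .
  qed
  have "{\<mu>. \<exists>v. v \<noteq> 0 \<and> T v = \<mu> \<odot> v} \<subseteq> {\<mu>. poly p \<mu> = 0}"
    using z pev_eigenvector[OF assms, of _ _ p] by fastforce
  then show ?thesis using poly_roots_finite[OF p(1)] finite_subset by blast
qed

text \<open>The Fitting argument: the ranges of the powers stabilise at some W, nonzero because T is
  not nilpotent. T maps W onto itself, hence is injective there, so an eigenvalue on W cannot be
  0.\<close>

lemma nonzero_eigenvalue_exists:
  assumes T: "lin T" and nil: "\<not> (\<exists>n. \<forall>v. (T ^^ n) v = 0)"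
  shows "\<exists>\<mu> v. \<mu> \<noteq> 0 \<and> v \<noteq> 0 \<and> T v = \<mu> \<odot> v"
proof -
  have sub: "subspace (range (T ^^ n))" for n
    by (rule subspace_lin_image[OF lin_funpow[OF T] subspace_UNIV])
  have dec: "range (T ^^ Suc n) \<subseteq> range (T ^^ n)" for n
    by (auto simp: funpow_swap1)
  have "\<exists>n. dim (range (T ^^ n)) \<le> dim (range (T ^^ Suc n))"
  proof (rule ccontr)
    assume "\<nexists>n. dim (range (T ^^ n)) \<le> dim (range (T ^^ Suc n))"
    then have lt: "dim (range (T ^^ Suc n)) < dim (range (T ^^ n))" for n by (meson not_le)
    have "dim (range (T ^^ n)) + n \<le> dim (range (T ^^ 0))" for n
    proof (induction n)
      case (Suc n)
      then show ?case using lt[of n] by linarith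
    qed simp
    from this[of "Suc (dim (range (T ^^ 0)))"] show False by simp
  qed
  then obtain n where n: "dim (range (T ^^ n)) \<le> dim (range (T ^^ Suc n))" by blast
  define W where "W = range (T ^^ n)"
  have eq: "range (T ^^ Suc n) = W"
    unfolding W_def by (rule subspace_dim_equal[OF sub sub dec n])
  have TW: "T ` W = W"
    using eq by (auto simp: W_def image_comp o_def)
  have "W \<noteq> {0}" using nil unfolding W_def by (metis rangeI singletonD)
  moreover have "subspace W" "T ` W \<subseteq> W" using sub[of n] TW by (auto simp: W_def)
  ultimately obtain \<mu> v where v: "v \<in> W" "v \<noteq> 0" "T v = \<mu> \<odot> v"
    using eigenvector_exists[OF T, of W] by metis
  have "\<mu> \<noteq> 0"
  proof
    assume "\<mu> = 0"
    then have Tv: "T v = 0" using v by simp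
    obtain g where g: "lin g" "\<And>w. w \<in> W \<Longrightarrow> T (g w) = w" "range g \<subseteq> W"
    proof -
      interpret p: vector_space_pair "(\<odot>)" "(\<odot>)" ..
      show ?thesis using p.linear_exists_right_inverse_on[OF T sub[of n]] TW that unfolding W_def by auto
    qed
    have "g ` W = W"
    proof (rule inj_on_imp_surj_on[OF g(1)])
      show "subspace W" using sub W_def by simp
      show "g ` W \<subseteq> W" using g(3) by auto
      show "\<And>x. x \<in> W \<Longrightarrow> g x = 0 \<Longrightarrow> x = 0" using g(2) linD(3)[OF T] by metis
    qed
    then obtain w where "w \<in> W" "v = g w" using v(1) by blast
    then have "w = 0" using g(2) Tv by metis
    then show False using \<open>v = g w\<close> v(2) linD(3)[OF g(1)] by simp
  qed
  with v show ?thesis by blast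
qed

subsection \<open>Traces\<close>

definition tr :: "('g \<Rightarrow> 'g) \<Rightarrow> complex" where "tr T = (\<Sum>b\<in>Bs. co b (T b))"

lemma tr_add: "tr (\<lambda>x. S x + T x) = tr S + tr T"
  by (simp add: tr_def functionalD[OF functional_co] sum.distrib)

lemma tr_diff: "tr (\<lambda>x. S x - T x) = tr S - tr T"
  by (simp add: tr_def functional_more[OF functional_co] sum_subtractf)

lemma tr_scale: "tr (\<lambda>x. c \<odot> S x) = c * tr S"
  by (simp add: tr_def functionalD[OF functional_co] sum_distrib_left)

lemma tr_comp:
  assumes "lin S" "lin T"
  shows "tr (\<lambda>x. S (T x)) = tr (\<lambda>x. T (S x))"
proof -
  have *: "tr (\<lambda>x. S (T x)) = (\<Sum>b\<in>Bs. \<Sum>c\<in>Bs. co c (T b) * co b (S c))" if "lin S" for S T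
  proof -
    have "co b (S (T b)) = (\<Sum>c\<in>Bs. co c (T b) * co b (S c))" for b
    proof -
      have "S (T b) = (\<Sum>c\<in>Bs. co c (T b) \<odot> S c)"
        by (subst co_expand[of "T b", symmetric]) (simp only: linD[OF that])
      then show ?thesis by (simp add: functionalD[OF functional_co])
    qed
    then show ?thesis by (simp add: tr_def)
  qed
  show ?thesis
    unfolding *[OF assms(1)] *[OF assms(2)] by (subst sum.swap) (simp add: mult.commute)
qed

text \<open>Independence of the basis lets traces be computed in adapted bases: one for a nilpotent
  operator, one of weight vectors of \<open>h\<close>.\<close>

lemma tr_basis:
  assumes T: "lin T" and B: "independent B" "span B = UNIV"
  shows "tr T = (\<Sum>b\<in>B. representation B (T b) b)"
proof -
  have finB: "finite B" using finiteI_independent[OF B(1)] .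
  define r where "r b x = representation B x b" for b x
  have fr: "functional (r b)" for b
    unfolding functional_def r_def
    by unfold_locales (simp_all add: representation_add representation_scale B)
  have rex: "(\<Sum>b\<in>B. r b x \<odot> b) = x" for x
    unfolding r_def using sum_representation_eq[OF B(1) _ finB subset_refl] B(2) by simp
  have "tr T = (\<Sum>c\<in>Bs. \<Sum>b\<in>B. r b c * co c (T b))"
    unfolding tr_def
  proof (intro sum.cong refl)
    fix c
    have "T c = (\<Sum>b\<in>B. r b c \<odot> T b)"
      by (subst rex[of c, symmetric]) (simp only: linD[OF T])
    then show "co c (T c) = (\<Sum>b\<in>B. r b c * co c (T b))" by (simp add: functionalD[OF functional_co])
  qed
  also have "\<dots> = (\<Sum>b\<in>B. \<Sum>c\<in>Bs. r b c * co c (T b))" by (rule sum.swap)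
  also have "\<dots> = (\<Sum>b\<in>B. r b (T b))"
    by (simp only: functional_expand[OF fr, symmetric])
  finally show ?thesis by (simp add: r_def)
qed

text \<open>A largest independent set with invariant span on which T has zero diagonal must be a
  basis: otherwise the last iterate of an outside vector that is not yet in the span could be
  adjoined.\<close>

lemma tr_nilpotent:
  assumes T: "lin T" and nil: "\<And>v. (T ^^ n) v = 0"
  shows "tr T = 0"
proof -
  define Q where "Q B \<longleftrightarrow> independent B \<and> (\<forall>b\<in>B. T b \<in> span (B - {b})) \<and> T ` span B \<subseteq> span B" for B
  have card: "card B \<le> dimension" if "Q B" for B
    using that independent_bound_general[of B] dim_subset_UNIV[of B] by (auto simp: Q_def)
  have "Q {}" using independent_empty linD(3)[OF T] by (simp add: Q_def)
  then obtain B where B: "Q B" "\<And>B'. Q B' \<Longrightarrow> card B' \<le> card B"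
    using ex_has_greatest_nat[of Q "{}" card "Suc dimension"] card by (metis le_imp_less_Suc)
  have finB: "finite B" using B(1) finiteI_independent by (auto simp: Q_def)
  have span: "span B = UNIV"
  proof (rule ccontr)
    assume "span B \<noteq> UNIV"
    then obtain v where v: "v \<notin> span B" by blast
    define k where "k = (LEAST k. (T ^^ k) v \<in> span B)"
    have ex: "(T ^^ n) v \<in> span B" using nil by (simp add: span_zero)
    have k: "(T ^^ k) v \<in> span B" unfolding k_def using ex by (rule LeastI)
    have "k \<noteq> 0" using v k by (metis funpow_0)
    then obtain j where j: "k = Suc j" using not0_implies_Suc by blast
    define w where "w = (T ^^ j) v"
    have w: "w \<notin> span B" unfolding w_def using not_less_Least[of j "\<lambda>k. (T ^^ k) v \<in> span B"] j k_def by simp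
    have Tw: "T w \<in> span B" using k j by (simp add: w_def)
    have wB: "w \<notin> B" using w span_base by blast
    have "Q (insert w B)"
      unfolding Q_def
    proof (intro conjI ballI)
      show "independent (insert w B)" using independent_insertI[OF w] B(1) by (simp add: Q_def)
      show "T b \<in> span (insert w B - {b})" if "b \<in> insert w B" for b
      proof (cases "b = w")
        case True
        then show ?thesis using Tw wB by simp
      next
        case False
        then have "T b \<in> span (B - {b})" using that B(1) by (auto simp: Q_def)
        then show ?thesis using span_mono[of "B - {b}" "insert w B - {b}"] by auto
      qed
      have "T ` insert w B \<subseteq> span B" using Tw B(1) span_base[of _ B] by (auto simp: Q_def)
      then have "span (T ` insert w B) \<subseteq> span (insert w B)"
        using span_mono[of B "insert w B"] by (intro span_minimal) auto
      moreover have "T ` span (insert w B) = span (T ` insert w B)"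
        using module_hom.span_image[of _ _ T] T by (metis linear_iff_module_hom)
      ultimately show "T ` span (insert w B) \<subseteq> span (insert w B)" by simp
    qed
    then show False using B(2)[of "insert w B"] finB wB by simp
  qed
  have "representation B (T b) b = 0" if b: "b \<in> B" for b
  proof -
    have "T b \<in> span (B - {b})" using b B(1) by (simp add: Q_def)
    then have "representation B (T b) = representation (B - {b}) (T b)"
      using B(1) by (intro representation_extend) (auto simp: Q_def)
    then show ?thesis using representation_ne_zero[of "B - {b}" "T b" b] by auto
  qed
  then show ?thesis using tr_basis[OF T, of B] B(1) span by (simp add: Q_def)
qed

end

section \<open>Weakly closed sets of nilpotent elements\<close>

context lie_algebra
begin

lemma br_zero [simp]: "br 0 x = 0" "br x 0 = 0"
  using br_scale_left[of 0 0 x] br_scale_right[of x 0 0] by auto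

lemma br_minus: "br (- x) y = - br x y" "br x (- y) = - br x y"
  using br_scale_left[of "-1" x y] br_scale_right[of x "-1" y] by auto

lemma br_diff: "br (x - y) z = br x z - br y z" "br x (y - z) = br x y - br x z"
  using br_add_left[of x "- y" z] br_add_right[of x y "- z"] by (auto simp: br_minus)

lemma br_anti: "br x y = - br y x"
proof -
  have "br x x + br y x + (br x y + br y y) = 0"
    using br_self[of "x + y"] unfolding br_add_right br_add_left .
  then have "br x y + br y x = 0" by (simp add: br_self add.commute)
  then show ?thesis by (simp add: eq_neg_iff_add_eq_0)
qed

lemma br_br_left: "br (br x y) z = br x (br y z) - br y (br x z)"
proof -
  have "br (br x y) z = - br z (br x y)" by (rule br_anti)
  moreover have "br y (br z x) = - br y (br x z)" by (subst br_anti[of z x]) (rule br_minus)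
  ultimately show ?thesis using jacobi[of x y z] by (simp add: algebra_simps add_eq_0_iff)
qed

lemma br_deriv: "br x (br y z) = br (br x y) z + br y (br x z)"
  by (simp add: br_br_left)

lemmas br_simps = br_add_left br_add_right br_scale_left br_scale_right br_minus br_diff

lemma lin_br: "lin (br x)"
  by (rule linI) (simp_all add: br_simps)

lemma lin_br_left: "lin (\<lambda>x. br x y)"
  by (rule linI) (simp_all add: br_simps)

lemma br_span_left:
  assumes "\<And>t. t \<in> T \<Longrightarrow> br t w \<in> U" "subspace U" "x \<in> span T"
  shows "br x w \<in> U"
  using assms(3)
proof (induction rule: span_induct_alt)
  case base
  then show ?case using subspace_0[OF assms(2)] by simp
next
  case (step c t x)
  then show ?case
    using assms(1)[of t] assms(2) by (simp add: br_simps subspace_add subspace_scale)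
qed

lemma br_span_right:
  assumes "\<And>t. t \<in> T \<Longrightarrow> br w t \<in> U" "subspace U" "x \<in> span T"
  shows "br w x \<in> U"
proof -
  have "br x w \<in> U"
  proof (rule br_span_left[OF _ assms(2,3)])
    fix t assume "t \<in> T"
    then have "- br w t \<in> U" using assms(1,2) by (simp add: subspace_neg)
    then show "br t w \<in> U" using br_anti[of t w] by simp
  qed
  then have "- br x w \<in> U" using assms(2) by (simp add: subspace_neg)
  then show ?thesis using br_anti[of w x] by simp
qed

lemma exists_max_dim:
  assumes "Q X"
  obtains X where "Q X" "\<And>Y. Q Y \<Longrightarrow> dim Y \<le> dim X"
proof -
  have "\<forall>Y. Q Y \<longrightarrow> dim Y < Suc dimension" using dim_subset_UNIV by (simp add: le_imp_less_Suc)
  then obtain X where "Q X" "\<forall>Y. Q Y \<longrightarrow> dim Y \<le> dim X"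
    using ex_has_greatest_nat[of Q X dim "Suc dimension"] assms by blast
  then show ?thesis using that by blast
qed

text \<open>The induction enlarges a weakly closed proper part \<open>T\<close> of \<open>S\<close> by one element normalising its span.\<close>

lemma jacobson_engel:
  assumes "\<And>x y. x \<in> S \<Longrightarrow> y \<in> S \<Longrightarrow> br x y \<in> S"
    and "\<And>x. x \<in> S \<Longrightarrow> \<exists>n. \<forall>v. (br x ^^ n) v = 0"
    and "subspace U" "subspace W" "U \<subset> W"
    and "\<And>x w. x \<in> S \<Longrightarrow> w \<in> W \<Longrightarrow> br x w \<in> W" "\<And>x w. x \<in> S \<Longrightarrow> w \<in> U \<Longrightarrow> br x w \<in> U"
  shows "\<exists>w\<in>W - U. \<forall>x\<in>S. br x w \<in> U"
  using assms
proof (induction "dim S" arbitrary: S U W rule: less_induct)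
  case less
  note S = less.prems(1) and nil = less.prems(2) and U = less.prems(3) and W = less.prems(4)
    and UW = less.prems(5) and SW = less.prems(6) and SU = less.prems(7)
  show ?case
  proof (cases "span S = {0}")
    case True
    then have "S \<subseteq> {0}" using span_superset by fastforce
    then show ?thesis using UW subspace_0[OF U] by fastforce
  next
    case False
    define QT where "QT T \<longleftrightarrow> T \<subseteq> S \<and> (\<forall>x\<in>T. \<forall>y\<in>T. br x y \<in> T) \<and> span T \<noteq> span S" for T
    have "QT {}" using False by (simp add: QT_def)
    then obtain T0 where T0: "QT T0" "\<And>T. QT T \<Longrightarrow> dim T \<le> dim T0"
      using exists_max_dim[of QT] by blast
    \<comment> \<open>Saturated in S: an element of S that lies in the span of T belongs to
      T.\<close>
    define T where "T = S \<inter> span T0"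
    have "T0 \<subseteq> T" using T0(1) span_superset by (auto simp: QT_def T_def)
    then have spT: "span T = span T0"
      by (metis T_def Int_lower2 span_mono span_span subset_antisym)
    have closT0: "br x y \<in> span T0" if "x \<in> span T0" "y \<in> span T0" for x y
    proof (rule br_span_left[OF _ subspace_span that(1)])
      fix t assume "t \<in> T0"
      then show "br t y \<in> span T0"
        using T0(1) by (intro br_span_right[OF _ subspace_span that(2)]) (auto simp: QT_def intro: span_base)
    qed
    have TS: "T \<subseteq> S" by (simp add: T_def)
    have closT: "br x y \<in> T" if "x \<in> T" "y \<in> T" for x y
      using that S closT0 by (auto simp: T_def)
    have neT: "span T \<noteq> span S" using T0(1) spT by (simp add: QT_def)
    have subT: "span T \<subset> span S" using neT span_mono[OF TS] by blast
    have dimT: "dim T < dim S" by (rule dim_psubset[OF subT])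
    have nilT: "\<And>x. x \<in> T \<Longrightarrow> \<exists>n. \<forall>v. (br x ^^ n) v = 0" using nil TS by blast
    \<comment> \<open>Stable spaces above \<open>span T\<close> in which S shows nothing new.
      Enlarging a maximal one by a vector that T kills modulo it must capture a new element of S,
      and the brackets of T with that element fall back into \<open>span T\<close>.\<close>
    define QU where "QU X \<longleftrightarrow> subspace X \<and> span T \<subseteq> X \<and> X \<subseteq> span S \<and>
      (\<forall>t\<in>T. \<forall>x\<in>X. br t x \<in> X) \<and> S \<inter> X \<subseteq> span T" for X
    have "QU (span T)"
      unfolding QU_def using subT closT0 spT span_superset by (auto simp: T_def)
    then obtain X where X: "QU X" "\<And>Y. QU Y \<Longrightarrow> dim Y \<le> dim X"
      using exists_max_dim[of QU] by blast
    have "X \<noteq> span S"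
    proof
      assume "X = span S"
      then have "S \<subseteq> span T" using X(1) span_superset[of S] by (auto simp: QU_def)
      then show False using subT by (metis span_mono span_span not_less_iff_gr_or_eq psubset_subset_trans less_irrefl)
    qed
    then have XS: "X \<subset> span S" using X(1) by (auto simp: QU_def)
    have "\<exists>w\<in>span S - X. \<forall>x\<in>T. br x w \<in> X"
    proof (rule less.hyps[OF dimT closT nilT])
      show "subspace X" using X(1) by (simp add: QU_def)
      show "X \<subset> span S" by fact
      show "\<And>x w. x \<in> T \<Longrightarrow> w \<in> span S \<Longrightarrow> br x w \<in> span S"
        by (rule br_span_right[OF _ subspace_span]) (use S TS in \<open>auto intro: span_base\<close>)
      show "\<And>x w. x \<in> T \<Longrightarrow> w \<in> X \<Longrightarrow> br x w \<in> X" using X(1) by (simp add: QU_def)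
    qed auto
    then obtain w where w: "w \<in> span S" "w \<notin> X" "\<And>x. x \<in> T \<Longrightarrow> br x w \<in> X" by blast
    have sX: "subspace X" using X(1) by (simp add: QU_def)
    define Y where "Y = span (insert w X)"
    have XY: "X \<subseteq> Y" unfolding Y_def using span_superset by blast
    have TY: "br t y \<in> X" if "t \<in> T" "y \<in> Y" for t y
      using that(2) unfolding Y_def
      by (rule br_span_right[OF _ sX, rotated]) (use X(1) w(3) that in \<open>auto simp: QU_def\<close>)
    have "\<not> QU Y"
    proof
      assume "QU Y"
      then have "dim Y \<le> dim X" using X(2) by blast
      moreover have "dim Y = Suc (dim X)" unfolding Y_def using w(2) sX by (simp add: dim_insert span_eq_iff[THEN iffD2])
      ultimately show False by simp
    qed
    moreover have "subspace Y" "span T \<subseteq> Y" "Y \<subseteq> span S" "\<forall>t\<in>T. \<forall>x\<in>Y. br t x \<in> Y"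
    proof -
      show "subspace Y" by (simp add: Y_def)
      show "span T \<subseteq> Y" using X(1) XY by (auto simp: QU_def)
      show "Y \<subseteq> span S" unfolding Y_def by (rule span_minimal) (use w(1) XS in auto)
      show "\<forall>t\<in>T. \<forall>x\<in>Y. br t x \<in> Y" using TY XY by blast
    qed
    ultimately obtain s where s: "s \<in> S" "s \<in> Y" "s \<notin> span T" unfolding QU_def by blast
    have Ts: "br t s \<in> span T" if "t \<in> T" for t
    proof -
      have "br t s \<in> S \<inter> X" using TY[OF that s(2)] S[of t s] that s(1) TS by blast
      then show ?thesis using X(1) unfolding QU_def by blast
    qed
    have Ts': "br x s \<in> span T" if "x \<in> span T" for x
      by (rule br_span_left[OF Ts subspace_span that])
    have Ts'': "br s x \<in> span T" if "x \<in> span T" for x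
      using Ts'[OF that] br_anti[of s x] by (metis span_neg)
    define T' where "T' = S \<inter> span (insert s T)"
    have closT': "br x y \<in> T'" if xy: "x \<in> T'" "y \<in> T'" for x y
    proof -
      from xy obtain a b where ab: "x - a \<odot> s \<in> span T" "y - b \<odot> s \<in> span T"
        unfolding T'_def using span_breakdown_eq by blast
      define x' y' where "x' = x - a \<odot> s" and "y' = y - b \<odot> s"
      have x': "x = x' + a \<odot> s" and y': "y = y' + b \<odot> s" by (simp_all add: x'_def y'_def)
      have "br x y = br x' y' + b \<odot> br x' s + a \<odot> br s y'"
        unfolding x' y' by (simp add: br_simps br_self)
      also have "\<dots> \<in> span T"
        using ab closT0 spT Ts' Ts'' by (auto simp: x'_def[symmetric] y'_def[symmetric] intro!: span_add span_scale)
      finally have "br x y \<in> span (insert s T)" using span_mono[of T "insert s T"] by blast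
      then show ?thesis using xy S by (simp add: T'_def)
    qed
    \<comment> \<open>By maximality of \<open>T0\<close> the enlarged part cannot be proper. So S
      lies in the span of T together with \<open>s\<close>.\<close>
    have "span T' = span S"
    proof (rule ccontr)
      assume "span T' \<noteq> span S"
      then have "QT T'" using closT' by (auto simp: QT_def T'_def)
      then have "dim T' \<le> dim T0" using T0(2) by blast
      moreover have "insert s T \<subseteq> T'" using s TS by (auto simp: T'_def intro: span_base)
      then have "dim (insert s T) \<le> dim T'" by (rule dim_subset)
      moreover have "dim (insert s T) = Suc (dim T)" using s(3) by (simp add: dim_insert)
      moreover have "dim T = dim T0" using spT by (metis dim_span)
      ultimately show False by simp
    qed
    then have spS: "S \<subseteq> span (insert s T)"
      by (metis T'_def Int_lower2 span_minimal subspace_span span_superset subset_trans)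
    \<comment> \<open>The vectors that T kills modulo U. By induction some of them lie outside U,
      and \<open>s\<close> acts nilpotently on \<open>W'\<close>, so the last iterate outside U is
      also killed by \<open>s\<close> modulo U.\<close>
    define W' where "W' = {w \<in> W. \<forall>t\<in>T. br t w \<in> U}"
    have stab: "br s w \<in> W'" if w: "w \<in> W'" for w
      unfolding W'_def
    proof (intro CollectI conjI ballI)
      show "br s w \<in> W" using w s(1) SW by (simp add: W'_def)
      fix t assume t: "t \<in> T"
      have "br t (br s w) = br (br t s) w + br s (br t w)" by (rule br_deriv)
      moreover have "br (br t s) w \<in> U"
        by (rule br_span_left[OF _ U Ts[OF t]]) (use w in \<open>auto simp: W'_def\<close>)
      moreover have "br s (br t w) \<in> U" using SU s(1) w t by (auto simp: W'_def)
      ultimately show "br t (br s w) \<in> U" using U by (simp add: subspace_add)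
    qed
    have "\<exists>w\<in>W - U. \<forall>x\<in>T. br x w \<in> U"
      by (rule less.hyps[OF dimT closT nilT U W UW]) (use SW SU TS in auto)
    then obtain w where w: "w \<in> W'" "w \<notin> U" unfolding W'_def by blast
    obtain n where n: "(br s ^^ n) w = 0" using nil[OF s(1)] by blast
    define k where "k = (LEAST k. (br s ^^ k) w \<in> U)"
    have k: "(br s ^^ k) w \<in> U" unfolding k_def
      by (rule LeastI[of _ n]) (simp add: n subspace_0[OF U])
    have "k \<noteq> 0" using k w(2) by (metis funpow_0)
    then obtain j where j: "k = Suc j" using not0_implies_Suc by blast
    define w0 where "w0 = (br s ^^ j) w"
    have "(br s ^^ i) w \<in> W'" for i by (induction i) (use w(1) stab in auto)
    then have w0: "w0 \<in> W'" by (simp add: w0_def)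
    have "w0 \<notin> U" unfolding w0_def using not_less_Least[of j "\<lambda>k. (br s ^^ k) w \<in> U"] j k_def by simp
    moreover have "br x w0 \<in> U" if "x \<in> S" for x
    proof (rule br_span_left[OF _ U])
      show "x \<in> span (insert s T)" using spS that by blast
      show "br t w0 \<in> U" if "t \<in> insert s T" for t
        using that w0 k j by (auto simp: W'_def w0_def)
    qed
    ultimately show ?thesis using w0 by (auto simp: W'_def)
  qed
qed

end

section \<open>Polynomial functions along the adjoint action\<close>

context fd_complex_space
begin

abbreviation FF :: "('g \<Rightarrow> complex) set" where "FF \<equiv> {\<phi>. functional \<phi>}"

lemma in_alg: "functional \<phi> \<Longrightarrow> \<phi> \<in> alg_gen FF"
  by (simp add: alg_gen.gen)

lemma jet_coeff_0:
  assumes "f \<in> alg_gen FF"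
  shows "jet_coeff m f 0 x = f (x 0)"
proof -
  obtain p where p: "\<And>t. poly p t = f (\<Sum>j\<le>m. t ^ j \<odot> x j)"
    using poly_along_arc[where f = f and m = m and x = x] assms by (auto simp: carrier_coord_ring)
  have "(\<Sum>j\<le>m. (0::complex) ^ j \<odot> x j) = (\<Sum>j\<le>m. if j = 0 then x 0 else 0)"
    by (intro sum.cong) auto
  then have "(\<Sum>j\<le>m. (0::complex) ^ j \<odot> x j) = x 0" by simp
  then show ?thesis using jet_coeff_eqI[where k = 0, OF p] p[of 0] by (simp add: poly_0_coeff_0)
qed

lemmas jet_add = jet_coeff_add[unfolded carrier_coord_ring]
lemmas jet_mult = jet_coeff_mult[unfolded carrier_coord_ring]

text \<open>The linear coefficient sees only \<open>x 0\<close> and \<open>x 1\<close>, so a longer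
  arc may be replaced by its first-order part.\<close>

lemma jet_coeff_1:
  assumes "f \<in> alg_gen FF" "m \<ge> 1" "m' \<ge> 1" "x 0 = x' 0" "x 1 = x' 1"
  shows "jet_coeff m f 1 x = jet_coeff m' f 1 x'"
  using assms(1)
proof induction
  case (const c)
  show ?case by (simp add: jet_coeff_const)
next
  case (gen f)
  then show ?case using assms by (simp add: jet_coeff_functional)
next
  case (add f g)
  then show ?case by (simp add: jet_add)
next
  case (mult f g)
  then show ?case using assms by (simp add: jet_mult jet_coeff_0)
qed

end

section \<open>Derivations along the adjoint vector fields and their exponentials\<close>

context lie_algebra
begin

text \<open>The derivative of \<open>f\<close> along the vector field sending p to [y, p], read off
  from the jet p + t [y, p]. In this form the rules for jets provide linearity and the product
  rule.\<close>

definition fdiff :: "'g \<Rightarrow> ('g \<Rightarrow> complex) \<Rightarrow> 'g \<Rightarrow> complex" where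
  "fdiff y f p = jet_coeff 1 f 1 (\<lambda>j. if j = 0 then p else br y p)"

lemma fdiff_const: "fdiff y (\<lambda>_. c) = (\<lambda>_. 0)"
  by (simp add: fdiff_def jet_coeff_const fun_eq_iff)

lemma fdiff_functional: "functional \<phi> \<Longrightarrow> fdiff y \<phi> = (\<lambda>p. \<phi> (br y p))"
  by (simp add: fdiff_def jet_coeff_functional fun_eq_iff)

lemma fdiff_add:
  "f \<in> alg_gen FF \<Longrightarrow> g \<in> alg_gen FF \<Longrightarrow> fdiff y (\<lambda>x. f x + g x) = (\<lambda>x. fdiff y f x + fdiff y g x)"
  by (simp add: fdiff_def jet_add fun_eq_iff)

lemma fdiff_mult:
  "f \<in> alg_gen FF \<Longrightarrow> g \<in> alg_gen FF \<Longrightarrow>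
    fdiff y (\<lambda>x. f x * g x) = (\<lambda>x. fdiff y f x * g x + f x * fdiff y g x)"
  by (simp add: fdiff_def jet_mult jet_coeff_0 fun_eq_iff)

lemma fdiff_scale: "f \<in> alg_gen FF \<Longrightarrow> fdiff y (\<lambda>x. c * f x) = (\<lambda>x. c * fdiff y f x)"
  by (simp add: fdiff_mult[OF alg_gen.const] fdiff_const)

lemma fdiff_in_alg: "f \<in> alg_gen FF \<Longrightarrow> fdiff y f \<in> alg_gen FF"
proof (induction rule: alg_gen.induct)
  case (const c)
  show ?case by (simp add: fdiff_const alg_gen.const)
next
  case (gen f)
  then show ?case by (simp add: fdiff_functional in_alg functional_lin lin_br)
next
  case (add f g)
  then show ?case by (simp add: fdiff_add alg_gen.add)
next
  case (mult f g)
  then show ?case by (simp add: fdiff_mult alg_gen.add alg_gen.mult)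
qed

lemma fdiff_sum:
  "finite S \<Longrightarrow> (\<And>i. i \<in> S \<Longrightarrow> h i \<in> alg_gen FF) \<Longrightarrow>
    fdiff y (\<lambda>x. \<Sum>i\<in>S. h i x) = (\<lambda>x. \<Sum>i\<in>S. fdiff y (h i) x)"
  by (induction S rule: finite_induct) (simp_all add: fdiff_const fdiff_add alg_gen_sum')

lemma fdiff_linear:
  assumes "f \<in> alg_gen FF"
  shows "fdiff (y + y') f p = fdiff y f p + fdiff y' f p" "fdiff (c \<odot> y) f p = c * fdiff y f p"
  using assms
  by (induction rule: alg_gen.induct)
    (auto simp: fdiff_const fdiff_functional fdiff_add fdiff_mult br_simps functionalD algebra_simps)

lemma fdiff_funpow_in_alg: "f \<in> alg_gen FF \<Longrightarrow> (fdiff y ^^ n) f \<in> alg_gen FF"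
  by (induction n) (auto intro: fdiff_in_alg)

text \<open>The coefficient of t^n in the expansion of \<open>f\<close> at \<open>exp_ad\<close> of
  t y, applied to p.\<close>

definition taylor :: "'g \<Rightarrow> ('g \<Rightarrow> complex) \<Rightarrow> nat \<Rightarrow> 'g \<Rightarrow> complex" where
  "taylor y f n p = (fdiff y ^^ n) f p / fact n"

lemma taylor_in_alg: "f \<in> alg_gen FF \<Longrightarrow> taylor y f n \<in> alg_gen FF"
  using alg_gen_scale[OF fdiff_funpow_in_alg[of f n y], of "1 / fact n"] by (simp add: taylor_def[abs_def])

lemma taylor_0: "taylor y f 0 = f"
  by (simp add: taylor_def fun_eq_iff)

lemma taylor_Suc:
  assumes "f \<in> alg_gen FF"
  shows "of_nat (Suc n) * taylor y f (Suc n) p = fdiff y (taylor y f n) p"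
proof -
  have "fdiff y (taylor y f n) = fdiff y (\<lambda>p. (1 / fact n) * (fdiff y ^^ n) f p)"
    by (simp add: taylor_def[abs_def])
  also have "\<dots> = (\<lambda>p. (1 / fact n) * fdiff y ((fdiff y ^^ n) f) p)"
    by (rule fdiff_scale[OF fdiff_funpow_in_alg[OF assms]])
  finally show ?thesis by (simp add: taylor_def field_simps del: of_nat_Suc)
qed

lemma taylor_add:
  assumes "f \<in> alg_gen FF" "g \<in> alg_gen FF"
  shows "taylor y (\<lambda>x. f x + g x) n p = taylor y f n p + taylor y g n p"
proof -
  have "(fdiff y ^^ n) (\<lambda>x. f x + g x) = (\<lambda>x. (fdiff y ^^ n) f x + (fdiff y ^^ n) g x)"
    by (induction n) (simp_all add: fdiff_add fdiff_funpow_in_alg assms)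
  then show ?thesis by (simp add: taylor_def add_divide_distrib)
qed

text \<open>The Leibniz rule divided by factorials. In the induction the two shifted sums carry the
  weights i and n + 1 - i, which add up to n + 1.\<close>

lemma taylor_mult:
  assumes f: "f \<in> alg_gen FF" and g: "g \<in> alg_gen FF"
  shows "taylor y (\<lambda>x. f x * g x) n = (\<lambda>p. \<Sum>i\<le>n. taylor y f i p * taylor y g (n - i) p)"
proof (induction n)
  case 0
  show ?case by (simp add: taylor_0)
next
  case (Suc n)
  note fg = alg_gen.mult[OF f g]
  let ?a = "taylor y f" and ?b = "taylor y g"
  show ?case
  proof
    fix p
    let ?S = "\<Sum>i\<le>Suc n. ?a i p * ?b (Suc n - i) p"
    have "of_nat (Suc n) * taylor y (\<lambda>x. f x * g x) (Suc n) p
        = fdiff y (\<lambda>p. \<Sum>i\<le>n. ?a i p * ?b (n - i) p) p"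
      unfolding taylor_Suc[OF fg] Suc ..
    also have "\<dots> = (\<Sum>i\<le>n. fdiff y (?a i) p * ?b (n - i) p + ?a i p * fdiff y (?b (n - i)) p)"
      by (subst fdiff_sum) (auto simp: fdiff_mult taylor_in_alg f g alg_gen.mult)
    also have "\<dots> = (\<Sum>i\<le>n. of_nat (Suc i) * ?a (Suc i) p * ?b (n - i) p)
        + (\<Sum>i\<le>n. of_nat (Suc (n - i)) * (?a i p * ?b (Suc (n - i)) p))"
      unfolding sum.distrib[symmetric]
      by (intro sum.cong refl) (simp only: taylor_Suc[OF f, symmetric] taylor_Suc[OF g, symmetric] ac_simps)
    also have "(\<Sum>i\<le>n. of_nat (Suc i) * ?a (Suc i) p * ?b (n - i) p)
        = (\<Sum>i\<le>Suc n. of_nat i * (?a i p * ?b (Suc n - i) p))"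
      by (subst sum.atMost_Suc_shift) (simp add: mult.assoc)
    also have "(\<Sum>i\<le>n. of_nat (Suc (n - i)) * (?a i p * ?b (Suc (n - i)) p))
        = (\<Sum>i\<le>Suc n. of_nat (Suc n - i) * (?a i p * ?b (Suc n - i) p))"
    proof -
      have "(\<Sum>i\<le>n. of_nat (Suc (n - i)) * (?a i p * ?b (Suc (n - i)) p))
        = (\<Sum>i\<le>n. of_nat (Suc n - i) * (?a i p * ?b (Suc n - i) p))"
        by (intro sum.cong refl) (auto simp: Suc_diff_le)
      then show ?thesis by simp
    qed
    also have "(\<Sum>i\<le>Suc n. of_nat i * (?a i p * ?b (Suc n - i) p))
        + (\<Sum>i\<le>Suc n. of_nat (Suc n - i) * (?a i p * ?b (Suc n - i) p)) = of_nat (Suc n) * ?S"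
      unfolding sum.distrib[symmetric] sum_distrib_left
    proof (intro sum.cong refl)
      fix i assume "i \<in> {..Suc n}"
      then have "of_nat i + of_nat (Suc n - i) = (of_nat (Suc n) :: complex)"
        by (metis atMost_iff le_add_diff_inverse of_nat_add)
      then show "of_nat i * (?a i p * ?b (Suc n - i) p) + of_nat (Suc n - i) * (?a i p * ?b (Suc n - i) p)
          = of_nat (Suc n) * (?a i p * ?b (Suc n - i) p)"
        by (metis distrib_right)
    qed
    finally show "taylor y (\<lambda>x. f x * g x) (Suc n) p = ?S"
      using mult_left_cancel[of "of_nat (Suc n) :: complex"] of_nat_neq_0 by blast
  qed
qed

lemma taylor_functional:
  assumes "functional \<phi>"
  shows "taylor y \<phi> n p = \<phi> ((br y ^^ n) p) / fact n"
proof -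
  have "(fdiff y ^^ n) \<phi> = (\<lambda>p. \<phi> ((br y ^^ n) p))"
  proof (induction n)
    case (Suc n)
    have "functional (\<lambda>p. \<phi> ((br y ^^ n) p))" by (rule functional_lin[OF assms lin_funpow[OF lin_br]])
    then show ?case by (simp add: Suc fdiff_functional funpow_swap1)
  qed simp
  then show ?thesis by (simp add: taylor_def)
qed

text \<open>In the norm given by the sum of the moduli of the coordinates, ad y is bounded by some
  M, so the terms are dominated by a multiple of M^n / n!.\<close>

lemma functional_series_summable:
  assumes "functional \<phi>"
  shows "summable (\<lambda>n. norm (\<phi> ((br y ^^ n) p) / fact n))"
proof -
  define nrm where "nrm v = (\<Sum>b\<in>Bs. norm (co b v))" for v
  define M where "M = (\<Sum>b\<in>Bs. nrm (br y b))"
  define K where "K = (\<Sum>b\<in>Bs. norm (\<phi> b))"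
  have nonneg: "nrm v \<ge> 0" for v by (simp add: nrm_def sum_nonneg)
  have co_le: "norm (co b v) \<le> nrm v" if "b \<in> Bs" for b v
    unfolding nrm_def using that Bs(1) by (intro member_le_sum) auto
  have step: "nrm (br y v) \<le> M * nrm v" for v
  proof -
    have "norm (co c (br y v)) \<le> (\<Sum>b\<in>Bs. norm (co c (br y b)) * nrm v)" for c
    proof -
      have "co c (br y v) = (\<Sum>b\<in>Bs. co c (br y b) * co b v)"
        by (rule functional_expand[OF functional_lin[OF functional_co lin_br]])
      then have "norm (co c (br y v)) \<le> (\<Sum>b\<in>Bs. norm (co c (br y b) * co b v))"
        by (simp only: norm_sum)
      also have "\<dots> \<le> (\<Sum>b\<in>Bs. norm (co c (br y b)) * nrm v)"
        by (intro sum_mono) (simp add: norm_mult mult_left_mono co_le)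
      finally show ?thesis .
    qed
    then have "nrm (br y v) \<le> (\<Sum>c\<in>Bs. \<Sum>b\<in>Bs. norm (co c (br y b)) * nrm v)"
      unfolding nrm_def[of "br y v"] by (rule sum_mono)
    also have "\<dots> = (\<Sum>b\<in>Bs. \<Sum>c\<in>Bs. norm (co c (br y b)) * nrm v)" by (rule sum.swap)
    also have "\<dots> = M * nrm v" by (simp add: M_def nrm_def[of "br y _"] sum_distrib_right)
    finally show ?thesis .
  qed
  have M0: "M \<ge> 0" by (simp add: M_def sum_nonneg nonneg)
  have pw: "nrm ((br y ^^ n) p) \<le> M ^ n * nrm p" for n
  proof (induction n)
    case (Suc n)
    have "nrm ((br y ^^ Suc n) p) \<le> M * nrm ((br y ^^ n) p)" using step by simp
    also have "\<dots> \<le> M * (M ^ n * nrm p)" using Suc M0 by (rule mult_left_mono)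
    finally show ?case by (simp add: mult.assoc)
  qed simp
  have \<phi>: "norm (\<phi> v) \<le> K * nrm v" for v
  proof -
    have "norm (\<phi> v) \<le> (\<Sum>b\<in>Bs. norm (\<phi> b * co b v))"
      by (subst functional_expand[OF assms]) (rule norm_sum)
    also have "\<dots> \<le> (\<Sum>b\<in>Bs. norm (\<phi> b) * nrm v)"
      by (intro sum_mono) (simp add: norm_mult mult_left_mono co_le)
    finally show ?thesis by (simp add: K_def sum_distrib_right)
  qed
  have K0: "K \<ge> 0" by (simp add: K_def sum_nonneg)
  show ?thesis
  proof (rule summable_comparison_test')
    have "summable (\<lambda>n. inverse (fact n) * M ^ n)" by (rule summable_exp)
    then show "summable (\<lambda>n. (K * nrm p) * (inverse (fact n) * M ^ n))" by (rule summable_mult)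
    fix n :: nat assume "n \<ge> 0"
    have "norm (\<phi> ((br y ^^ n) p)) \<le> K * (M ^ n * nrm p)"
      using \<phi>[of "(br y ^^ n) p"] mult_left_mono[OF pw K0] by (rule order_trans)
    then have "norm (\<phi> ((br y ^^ n) p)) / fact n \<le> K * (M ^ n * nrm p) / fact n"
      by (intro divide_right_mono) auto
    then show "norm (norm (\<phi> ((br y ^^ n) p) / fact n)) \<le> (K * nrm p) * (inverse (fact n) * M ^ n)"
      by (simp add: norm_divide field_simps)
  qed
qed

lemma exp_ad_unique:
  assumes "\<And>\<phi>. functional \<phi> \<Longrightarrow> (\<lambda>n. \<phi> ((br x ^^ n) y) / fact n) sums \<phi> z"
  shows "exp_ad x y = z"
  unfolding exp_ad_def
proof (rule the_equality)
  show "\<forall>\<phi>. functional \<phi> \<longrightarrow> (\<lambda>n. \<phi> ((br x ^^ n) y) / fact n) sums \<phi> z" using assms by blast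
  fix w assume "\<forall>\<phi>. functional \<phi> \<longrightarrow> (\<lambda>n. \<phi> ((br x ^^ n) y) / fact n) sums \<phi> w"
  then show "w = z" using assms sums_unique2 by (blast intro: functional_eqI)
qed

lemma exp_ad_sums:
  assumes "functional \<phi>"
  shows "(\<lambda>n. \<phi> ((br x ^^ n) y) / fact n) sums \<phi> (exp_ad x y)"
proof -
  define z where "z = (\<Sum>b\<in>Bs. (\<Sum>n. co b ((br x ^^ n) y) / fact n) \<odot> b)"
  have *: "(\<lambda>n. \<phi> ((br x ^^ n) y) / fact n) sums \<phi> z" if \<phi>: "functional \<phi>" for \<phi>
  proof -
    have "(\<lambda>n. co b ((br x ^^ n) y) / fact n) sums (\<Sum>n. co b ((br x ^^ n) y) / fact n)" for b
      by (rule summable_sums[OF summable_norm_cancel[OF functional_series_summable[OF functional_co]]])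
    then have "(\<lambda>n. \<Sum>b\<in>Bs. \<phi> b * (co b ((br x ^^ n) y) / fact n)) sums
        (\<Sum>b\<in>Bs. \<phi> b * (\<Sum>n. co b ((br x ^^ n) y) / fact n))"
      by (intro sums_sum sums_mult)
    moreover have "(\<Sum>b\<in>Bs. \<phi> b * (co b ((br x ^^ n) y) / fact n)) = \<phi> ((br x ^^ n) y) / fact n" for n
      by (subst functional_expand[OF \<phi>, of "(br x ^^ n) y"]) (simp add: sum_divide_distrib)
    moreover have "(\<Sum>b\<in>Bs. \<phi> b * (\<Sum>n. co b ((br x ^^ n) y) / fact n)) = \<phi> z"
      by (simp add: z_def functionalD[OF \<phi>] mult.commute)
    ultimately show ?thesis by simp
  qed
  then show ?thesis using exp_ad_unique[of x y z, OF *] assms by simp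
qed

text \<open>Absolute convergence is carried through the induction because products of functions are
  treated by the Cauchy product of their series.\<close>

lemma taylor_sums:
  assumes "f \<in> alg_gen FF"
  shows "summable (\<lambda>n. norm (taylor y f n p)) \<and> (\<lambda>n. taylor y f n p) sums f (exp_ad y p)"
  using assms
proof (induction rule: alg_gen.induct)
  case (const c)
  have "(fdiff y ^^ n) (\<lambda>_. c) = (\<lambda>_. if n = 0 then c else 0)" for n
    by (induction n) (auto simp: fdiff_const)
  then have t: "(\<lambda>n. taylor y (\<lambda>_. c) n p) = (\<lambda>n. if n = 0 then c else 0)"
    by (auto simp: taylor_def fun_eq_iff)
  have "(\<lambda>n. norm (taylor y (\<lambda>_. c) n p)) = (\<lambda>n. if n = 0 then norm c else 0)"
    using t by (auto simp: fun_eq_iff)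
  then show ?case
    using sums_single[of 0 "\<lambda>_. c"] sums_single[of 0 "\<lambda>_. norm c"]
    by (auto simp: t sums_iff)
next
  case (gen f)
  then have f: "functional f" by simp
  show ?case unfolding taylor_functional[OF f]
    using functional_series_summable[OF f] exp_ad_sums[OF f] by blast
next
  case (add f g)
  have "summable (\<lambda>n. norm (taylor y f n p) + norm (taylor y g n p))"
    using add.IH by (intro summable_add) auto
  then have "summable (\<lambda>n. norm (taylor y f n p + taylor y g n p))"
    by (rule summable_comparison_test'[of _ 0]) (simp add: norm_triangle_ineq)
  then show ?case
    unfolding taylor_add[OF add.hyps] using add.IH by (auto intro: sums_add)
next
  case (mult f g)
  let ?a = "\<lambda>n. taylor y f n p" and ?b = "\<lambda>n. taylor y g n p"
  have s: "summable (\<lambda>n. norm (?a n))" "summable (\<lambda>n. norm (?b n))" using mult.IH by auto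
  have "(\<lambda>n. \<Sum>i\<le>n. ?a i * ?b (n - i)) sums ((\<Sum>n. ?a n) * (\<Sum>n. ?b n))"
    by (rule Cauchy_product_sums[OF s])
  then have 1: "(\<lambda>n. taylor y (\<lambda>x. f x * g x) n p) sums (f (exp_ad y p) * g (exp_ad y p))"
    using mult.IH by (simp add: taylor_mult[OF mult.hyps] sums_iff)
  have "summable (\<lambda>n. \<Sum>i\<le>n. norm (?a i) * norm (?b (n - i)))"
    using summable_Cauchy_product[of "\<lambda>n. norm (?a n)" "\<lambda>n. norm (?b n)"] s by simp
  then have "summable (\<lambda>n. norm (\<Sum>i\<le>n. ?a i * ?b (n - i)))"
    by (rule summable_comparison_test'[of _ 0]) (auto simp: norm_mult[symmetric] intro: order_trans[OF norm_sum])
  then show ?case using 1 unfolding taylor_mult[OF mult.hyps] by simp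
qed

text \<open>The bridge from derivations to the group: all Taylor coefficients along the flow vanish
  at \<open>p\<close>, hence so does their sum.\<close>

lemma exp_ad_vanish:
  assumes "\<F> \<subseteq> alg_gen FF" "\<And>f. f \<in> \<F> \<Longrightarrow> fdiff y f \<in> \<F>" "\<And>f. f \<in> \<F> \<Longrightarrow> f p = 0" "f \<in> \<F>"
  shows "f (exp_ad y p) = 0"
proof -
  have "(fdiff y ^^ n) f \<in> \<F>" for n by (induction n) (use assms in auto)
  then have "taylor y f n p = 0" for n using assms(3) by (simp add: taylor_def)
  then have "(\<lambda>n. taylor y f n p) = (\<lambda>_. 0)" by simp
  moreover have "(\<lambda>n. taylor y f n p) sums f (exp_ad y p)" using taylor_sums[of f y p] assms by blast
  ultimately show ?thesis using sums_unique2[OF _ sums_zero] by metis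
qed

lemma lin_exp_ad: "lin (exp_ad y)"
proof (rule linI)
  note l = linD[OF lin_funpow[OF lin_br]]
  show "exp_ad y (a + b) = exp_ad y a + exp_ad y b" for a b
  proof (rule exp_ad_unique)
    fix \<phi> assume \<phi>: "functional \<phi>"
    show "(\<lambda>n. \<phi> ((br y ^^ n) (a + b)) / fact n) sums \<phi> (exp_ad y a + exp_ad y b)"
      using sums_add[OF exp_ad_sums[OF \<phi>, of y a] exp_ad_sums[OF \<phi>, of y b]]
      by (simp add: l functionalD[OF \<phi>] add_divide_distrib)
  qed
  show "exp_ad y (c \<odot> a) = c \<odot> exp_ad y a" for c a
  proof (rule exp_ad_unique)
    fix \<phi> assume \<phi>: "functional \<phi>"
    show "(\<lambda>n. \<phi> ((br y ^^ n) (c \<odot> a)) / fact n) sums \<phi> (c \<odot> exp_ad y a)"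
      using sums_mult[OF exp_ad_sums[OF \<phi>, of y a], of c] by (simp add: l functionalD[OF \<phi>])
  qed
qed

lemma exp_ad_eigenvector:
  assumes "br y p = \<mu> \<odot> p"
  shows "exp_ad (s \<odot> y) p = exp (s * \<mu>) \<odot> p"
proof (rule exp_ad_unique)
  fix \<phi> assume \<phi>: "functional \<phi>"
  have "(br (s \<odot> y) ^^ n) p = (s * \<mu>) ^ n \<odot> p" for n
    by (induction n) (simp_all add: br_simps assms mult_ac)
  moreover have "(\<lambda>n. (s * \<mu>) ^ n / fact n) sums exp (s * \<mu>)"
    using exp_converges[of "s * \<mu>"] by (simp add: scaleR_conv_of_real field_simps)
  then have "(\<lambda>n. (s * \<mu>) ^ n / fact n * \<phi> p) sums (exp (s * \<mu>) * \<phi> p)" by (rule sums_mult2)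
  ultimately show "(\<lambda>n. \<phi> ((br (s \<odot> y) ^^ n) p) / fact n) sums \<phi> (exp (s * \<mu>) \<odot> p)"
    by (simp add: functionalD[OF \<phi>])
qed

lemma exp_ad_nilpotent:
  assumes "\<And>n. n \<ge> N \<Longrightarrow> (br y ^^ n) p = 0"
  shows "exp_ad y p = (\<Sum>n<N. (1 / fact n) \<odot> (br y ^^ n) p)"
proof (rule exp_ad_unique)
  fix \<phi> assume \<phi>: "functional \<phi>"
  have "(\<lambda>n. \<phi> ((br y ^^ n) p) / fact n) sums (\<Sum>n<N. \<phi> ((br y ^^ n) p) / fact n)"
    by (rule sums_finite) (use assms functional_more[OF \<phi>] in auto)
  then show "(\<lambda>n. \<phi> ((br y ^^ n) p) / fact n) sums \<phi> (\<Sum>n<N. (1 / fact n) \<odot> (br y ^^ n) p)"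
    by (simp add: functionalD[OF \<phi>])
qed

end

text \<open>Divided by s, the series sums to 0 away from the origin and is continuous there, so its
  constant term vanishes.\<close>

lemma powser_zero_coeff_1:
  fixes a :: "nat \<Rightarrow> complex"
  assumes "\<And>s. (\<lambda>n. a n * s ^ n) sums 0"
  shows "a 1 = 0"
proof -
  have a0: "a 0 = 0" using assms[of 0] by simp
  define f where "f s = (if s = 0 then a 1 else 0)" for s :: complex
  have "(\<lambda>n. a (Suc n) * s ^ n) sums f s" for s
  proof (cases "s = 0")
    case True
    then show ?thesis by (simp add: f_def)
  next
    case False
    have "(\<lambda>n. a (Suc n) * s ^ Suc n) sums 0"
      using assms[of s] by (subst sums_Suc_iff) (simp add: a0)
    from sums_mult[OF this, of "1 / s"] show ?thesis using False by (simp add: f_def)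
  qed
  then have "(f \<longlongrightarrow> a (Suc 0)) (at 0)"
    by (intro powser_limit_0[of 1]) auto
  moreover have "(f \<longlongrightarrow> 0) (at 0)"
    by (rule tendsto_eventually) (auto simp: f_def eventually_at intro!: exI[of _ 1])
  ultimately show ?thesis using tendsto_unique[of "at (0::complex)" f] by simp
qed

section \<open>Separating functionals and quadratic pencils\<close>

context fd_complex_space
begin

lemma vec_eqI: "(\<And>b. co b x = co b y) \<Longrightarrow> x = y"
  by (metis (no_types, lifting) co_expand sum.cong)

lemmas co_simps = functionalD(1,2)[OF functional_co] functional_more[OF functional_co]

lemma separating_functional:
  assumes "subspace W" "v \<notin> W"
  obtains \<phi> where "functional \<phi>" "\<And>w. w \<in> W \<Longrightarrow> \<phi> w = 0" "\<phi> v = 1"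
proof -
  obtain B where B: "B \<subseteq> W" "independent B" "span B = W"
    using basis_subspace_exists[OF assms(1)] by metis
  have "independent (insert v B)" using B assms(2) by (simp add: independent_insertI)
  then obtain C where C: "insert v B \<subseteq> C" "independent C" "UNIV \<subseteq> span C"
    using maximal_independent_subset_extend[OF subset_UNIV, of "insert v B"] by metis
  then have "span C = UNIV" by blast
  note C = C(1,2) this
  define \<phi> where "\<phi> x = representation C x v" for x
  show ?thesis
  proof (rule that)
    show "functional \<phi>"
      unfolding functional_def \<phi>_def
      by unfold_locales (simp_all add: representation_add representation_scale C)
    show "\<phi> v = 1" using representation_basis[OF C(2), of v] C(1) by (auto simp: \<phi>_def)
    fix w assume "w \<in> W"
    then have w: "w \<in> span B" using B by simp
    have "representation C w = representation B w"
      using C w by (intro representation_extend) auto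
    moreover have "v \<notin> B" using B(1) assms(2) by blast
    ultimately show "\<phi> w = 0" using representation_ne_zero[of B w v] by (auto simp: \<phi>_def)
  qed
qed

lemma surj_on_imp_inj_on:
  assumes T: "lin T" and W: "subspace W" "T ` W = W" and v: "v \<in> W" "T v = 0"
  shows "v = 0"
proof -
  interpret p: vector_space_pair "(\<odot>)" "(\<odot>)" ..
  obtain g where g: "lin g" "\<And>w. w \<in> W \<Longrightarrow> T (g w) = w" "range g \<subseteq> W"
    using p.linear_exists_right_inverse_on[OF T W(1)] W(2) by auto
  have "g ` W = W"
  proof (rule inj_on_imp_surj_on[OF g(1) W(1)])
    show "g ` W \<subseteq> W" using g(3) by auto
    show "\<And>x. x \<in> W \<Longrightarrow> g x = 0 \<Longrightarrow> x = 0" using g(2) linD(3)[OF T] by metis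
  qed
  then obtain w where w: "w \<in> W" "v = g w" using v(1) by blast
  then have "w = 0" using g(2) v(2) by metis
  then show ?thesis using w(2) linD(3)[OF g(1)] by simp
qed

text \<open>Makes \<open>eigenvector_exists\<close> available for the companion operator, which acts
  on pairs.\<close>

lemma fd_complex_space_prod: "fd_complex_space (\<lambda>c (p :: 'g \<times> 'g). (c \<odot> fst p, c \<odot> snd p))"
proof -
  interpret V: vector_space "\<lambda>c (p :: 'g \<times> 'g). (c \<odot> fst p, c \<odot> snd p)"
    by unfold_locales (auto simp: algebra_simps)
  let ?B = "(\<lambda>b. (b, 0)) ` Bs \<union> (\<lambda>b. (0, b)) ` Bs"
  have "p \<in> V.span ?B" for p :: "'g \<times> 'g"
  proof -
    have 1: "(x, 0) \<in> V.span ?B" for x :: 'g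
    proof -
      have "x \<in> span Bs" by (simp add: Bs)
      then show ?thesis
      proof (induction rule: span_induct_alt)
        case base
        show ?case using V.span_zero by (simp add: zero_prod_def)
      next
        case (step c b y)
        then have "(b, 0) \<in> V.span ?B" by (intro V.span_base) auto
        from V.span_add[OF V.span_scale[OF this, of c] step(2)] show ?case by simp
      qed
    qed
    have 2: "(0, x) \<in> V.span ?B" for x :: 'g
    proof -
      have "x \<in> span Bs" by (simp add: Bs)
      then show ?thesis
      proof (induction rule: span_induct_alt)
        case base
        show ?case using V.span_zero by (simp add: zero_prod_def)
      next
        case (step c b y)
        then have "(0, b) \<in> V.span ?B" by (intro V.span_base) auto
        from V.span_add[OF V.span_scale[OF this, of c] step(2)] show ?case by simp
      qed
    qed
    show ?thesis using V.span_add[OF 1[of "fst p"] 2[of "snd p"]] by simp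
  qed
  then have "finite ?B \<and> V.span ?B = UNIV" using Bs by auto
  then show ?thesis by unfold_locales blast
qed

text \<open>Linearised by the companion operator on pairs, a quadratic pencil with invertible leading
  coefficient has an eigenvalue.\<close>

lemma quadratic_pencil_singular:
  assumes lin: "lin P" "lin Q" "lin R" and I: "subspace I" "I \<noteq> {0}"
    and im: "P ` I \<subseteq> I" "Q ` I \<subseteq> I" "R ` I = I"
  shows "\<exists>s v. v \<in> I \<and> v \<noteq> 0 \<and> P v + s \<odot> Q v + (s * s) \<odot> R v = 0"
proof -
  interpret p: vector_space_pair "(\<odot>)" "(\<odot>)" ..
  obtain g where g: "lin g" "\<And>w. w \<in> I \<Longrightarrow> R (g w) = w" "range g \<subseteq> I"
    using p.linear_exists_right_inverse_on[OF lin(3) I(1)] im(3) by auto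
  interpret V: fd_complex_space "\<lambda>c (p :: 'g \<times> 'g). (c \<odot> fst p, c \<odot> snd p)"
    by (rule fd_complex_space_prod)
  \<comment> \<open>With \<open>g\<close> as an inverse of R on I, an eigenvector (v, w) for s has w
    = s v and P v + Q w = - R (s w), which is the pencil equation.\<close>
  define T where "T = (\<lambda>(v, w). (w, - g (P v + Q w)))"
  have "V.lin T"
    by (rule V.linI) (auto simp: T_def linD[OF lin(1)] linD[OF lin(2)] linD[OF g(1)] algebra_simps)
  moreover have "V.subspace (I \<times> I)"
    by (rule V.subspaceI)
      (auto simp: zero_prod_def subspace_0[OF I(1)] subspace_add[OF I(1)] subspace_scale[OF I(1)])
  moreover have "T ` (I \<times> I) \<subseteq> I \<times> I"
  proof -
    have "- g x \<in> I" for x using g(3) by (intro subspace_neg[OF I(1)]) auto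
    then show ?thesis by (auto simp: T_def)
  qed
  moreover have "I \<times> I \<noteq> {0}"
    using I subspace_0[OF I(1)] by (auto simp: zero_prod_def set_eq_iff)
  ultimately obtain s z where z: "z \<in> I \<times> I" "z \<noteq> 0" "T z = (s \<odot> fst z, s \<odot> snd z)"
    using V.eigenvector_exists by blast
  obtain v w where vw: "z = (v, w)" by force
  have w: "w = s \<odot> v" and e: "- g (P v + Q w) = s \<odot> w" using z(3) by (auto simp: vw T_def)
  have vI: "v \<in> I" using z(1) vw by simp
  have "P v + Q w \<in> I" using z(1) im I(1) by (auto simp: vw intro!: subspace_add)
  then have "P v + Q w = R (g (P v + Q w))" using g(2) by simp
  also have "g (P v + Q w) = - ((s * s) \<odot> v)" using e w by (metis minus_minus scale_scale)
  finally have "P v + s \<odot> Q v + (s * s) \<odot> R v = 0"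
    using w by (simp add: linD[OF lin(2)] linD[OF lin(3)])
  moreover have "v \<noteq> 0" using z(2) w vw by (auto simp: zero_prod_def)
  ultimately show ?thesis using vI by blast
qed

end

section \<open>Extremal elements\<close>

context lie_algebra
begin

text \<open>The derivative at s = 0 of a curve inside a subspace stays in it. It is tested by a
  functional that vanishes on W, along which the curve is a power series.\<close>

lemma exp_ad_stable_derivation:
  assumes "subspace W" "\<And>s. exp_ad (s \<odot> y) c \<in> W"
  shows "br y c \<in> W"
proof (rule ccontr)
  assume "br y c \<notin> W"
  then obtain \<phi> where \<phi>: "functional \<phi>" "\<And>w. w \<in> W \<Longrightarrow> \<phi> w = 0" "\<phi> (br y c) = 1"
    using separating_functional[OF assms(1)] by metis
  define a where "a n = \<phi> ((br y ^^ n) c) / fact n" for n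
  have "(\<lambda>n. a n * s ^ n) sums 0" for s
  proof -
    have "(br (s \<odot> y) ^^ n) c = s ^ n \<odot> (br y ^^ n) c" for n
      by (induction n) (simp_all add: br_simps mult.commute)
    then have "\<phi> ((br (s \<odot> y) ^^ n) c) / fact n = a n * s ^ n" for n
      by (simp add: a_def functionalD[OF \<phi>(1)])
    moreover have "(\<lambda>n. \<phi> ((br (s \<odot> y) ^^ n) c) / fact n) sums \<phi> (exp_ad (s \<odot> y) c)"
      by (rule exp_ad_sums[OF \<phi>(1)])
    ultimately show ?thesis using \<phi>(2)[OF assms(2)] by simp
  qed
  then have "a 1 = 0" by (rule powser_zero_coeff_1)
  then show False using \<phi>(3) by (simp add: a_def)
qed

lemma flin_in_alg: "S \<subseteq> alg_gen F \<Longrightarrow> f \<in> flin S \<Longrightarrow> f \<in> alg_gen F"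
  by (erule flin.induct) (auto intro!: alg_gen.const alg_gen.add alg_gen_scale)

text \<open>The vanishing criterion for generators: the derivative of an equation may be any linear
  combination of the equations.\<close>

lemma exp_ad_vanish_flin:
  assumes G: "\<G> \<subseteq> alg_gen FF" "\<And>g. g \<in> \<G> \<Longrightarrow> fdiff y g \<in> flin \<G>" "\<And>g. g \<in> \<G> \<Longrightarrow> g p = 0"
    and g: "g \<in> \<G>"
  shows "g (exp_ad y p) = 0"
proof (rule exp_ad_vanish[of "flin \<G>"])
  show "flin \<G> \<subseteq> alg_gen FF" using flin_in_alg[OF G(1)] by blast
  show "g \<in> flin \<G>" by (rule flin_base[OF g])
  fix f assume "f \<in> flin \<G>"
  then show "fdiff y f \<in> flin \<G>"
  proof (induction rule: flin.induct)
    case zero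
    then show ?case by (simp add: fdiff_const flin.zero)
  next
    case (step s f c)
    have "s \<in> alg_gen FF" "f \<in> alg_gen FF" using step G(1) flin_in_alg[OF G(1)] by auto
    then have "fdiff y (\<lambda>x. c * s x + f x) = (\<lambda>x. c * fdiff y s x + fdiff y f x)"
      by (simp add: fdiff_add fdiff_scale alg_gen_scale)
    then show ?case using step G(2) by (auto intro!: flin_add flin_scale)
  qed
next
  fix f assume "f \<in> flin \<G>"
  then show "f p = 0" by induction (use G(3) in auto)
qed

lemma lin_br_comp: "lin T \<Longrightarrow> lin (\<lambda>v. br x (T v))"
  by (rule lin_comp[OF lin_br])

lemma br_expand_left: "br x w = (\<Sum>b\<in>Bs. co b x \<odot> br b w)"
proof -
  have "br x w = br (\<Sum>b\<in>Bs. co b x \<odot> b) w" by (simp only: co_expand)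
  also have "\<dots> = (\<Sum>b\<in>Bs. co b x \<odot> br b w)" by (simp only: linD[OF lin_br_left])
  finally show ?thesis .
qed

text \<open>A component of (ad x)^2 z as a quadratic function of x. Conditions on (ad x)^2 thereby
  become polynomial equations that can be differentiated.\<close>

definition quad :: "('g \<Rightarrow> complex) \<Rightarrow> 'g \<Rightarrow> 'g \<Rightarrow> complex" where
  "quad \<phi> z x = \<phi> (br x (br x z))"

lemma quad_expand:
  assumes "functional \<phi>"
  shows "quad \<phi> z = (\<lambda>x. \<Sum>b\<in>Bs. co b x * \<phi> (br b (br x z)))"
  by (rule ext, unfold quad_def, subst br_expand_left) (simp add: functionalD[OF assms])

lemma functional_br_br: "functional \<phi> \<Longrightarrow> functional (\<lambda>x. \<phi> (br b (br x z)))"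
  by (rule functional_lin[OF _ lin_comp[OF lin_br lin_br_left]])

lemma quad_in_alg: "functional \<phi> \<Longrightarrow> quad \<phi> z \<in> alg_gen FF"
  unfolding quad_expand
  by (intro alg_gen_sum' alg_gen.mult in_alg functional_co functional_br_br Bs(1))

text \<open>By the Jacobi identity the derivative is again a combination of functions
  \<open>quad\<close>, so equations of this kind are stable under the group.\<close>

lemma fdiff_quad:
  assumes \<phi>: "functional \<phi>"
  shows "fdiff y (quad \<phi> z) = (\<lambda>x. quad (\<lambda>v. \<phi> (br y v)) z x - quad \<phi> (br y z) x)"
proof
  fix x
  have "fdiff y (quad \<phi> z) x = (\<Sum>b\<in>Bs. co b (br y x) * \<phi> (br b (br x z)) + co b x * \<phi> (br b (br (br y x) z)))"
    unfolding quad_expand[OF \<phi>]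
    by (subst fdiff_sum)
      (simp_all add: Bs(1) fdiff_mult fdiff_functional alg_gen.mult in_alg functional_co functional_br_br \<phi>)
  also have "\<dots> = \<phi> (br (br y x) (br x z)) + \<phi> (br x (br (br y x) z))"
  proof -
    have *: "\<phi> (br u w) = (\<Sum>b\<in>Bs. co b u * \<phi> (br b w))" for u w
      by (subst br_expand_left) (simp add: functionalD[OF \<phi>])
    show ?thesis
      unfolding sum.distrib *[of "br y x" "br x z", symmetric] *[of x "br (br y x) z", symmetric] ..
  qed
  also have "\<dots> = \<phi> (br y (br x (br x z)) - br x (br x (br y z)))"
    by (simp add: br_br_left br_simps functionalD[OF \<phi>] functional_more[OF \<phi>])
  finally show "fdiff y (quad \<phi> z) x = quad (\<lambda>v. \<phi> (br y v)) z x - quad \<phi> (br y z) x"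
    by (simp add: quad_def functional_more[OF \<phi>])
qed

lemma sandwich_exp_ad:
  assumes "\<And>z. br c (br c z) = 0"
  shows "br (exp_ad y c) (br (exp_ad y c) z) = 0"
proof (rule functional_eqI)
  fix \<phi> assume \<phi>: "functional \<phi>"
  define \<G> where "\<G> = {quad \<phi> z | \<phi> z. functional \<phi>}"
  have "quad \<phi> z (exp_ad y c) = 0"
  proof (rule exp_ad_vanish_flin[of \<G>])
    show "\<G> \<subseteq> alg_gen FF" by (auto simp: \<G>_def quad_in_alg)
    show "quad \<phi> z \<in> \<G>" using \<phi> by (auto simp: \<G>_def)
    fix g assume "g \<in> \<G>"
    then obtain \<psi> w where g: "functional \<psi>" "g = quad \<psi> w" by (auto simp: \<G>_def)
    then show "g c = 0" by (simp add: quad_def assms functional_more)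
    have "quad (\<lambda>v. \<psi> (br y v)) w \<in> flin \<G>" "quad \<psi> (br y w) \<in> flin \<G>"
      using g functional_lin[OF g(1) lin_br] by (auto simp: \<G>_def intro!: flin_base)
    then have "(\<lambda>x. quad (\<lambda>v. \<psi> (br y v)) w x + (- 1) * quad \<psi> (br y w) x) \<in> flin \<G>"
      by (intro flin_add flin_scale)
    then show "fdiff y g \<in> flin \<G>" using g by (simp add: fdiff_quad)
  qed
  then show "\<phi> (br (exp_ad y c) (br (exp_ad y c) z)) = \<phi> 0"
    by (simp add: quad_def functional_more[OF \<phi>])
qed

end

section \<open>Existence of an extremal element and of a triple containing it\<close>

context simple_lie_algebra
begin

lemma ideal_eq_UNIV:
  assumes "subspace J" "\<And>x y. y \<in> J \<Longrightarrow> br x y \<in> J" "J \<noteq> {0}"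
  shows "J = UNIV"
  using simple[of J] assms by (auto simp: lie_ideal_def)

lemma center_trivial:
  assumes "\<And>x. br x w = 0"
  shows "w = 0"
proof (rule ccontr)
  assume "w \<noteq> 0"
  have "{w. \<forall>x. br x w = 0} = UNIV"
    by (rule ideal_eq_UNIV) (use assms \<open>w \<noteq> 0\<close> in \<open>auto simp: br_simps intro!: subspaceI\<close>)
  then show False using nonabelian by blast
qed

text \<open>\<open>jacobson_engel\<close> with U = {0} and W the whole algebra yields a nonzero
  vector killed by S. If S spanned, it would be central.\<close>

lemma weakly_closed_not_spanning:
  assumes "\<And>x y. x \<in> S \<Longrightarrow> y \<in> S \<Longrightarrow> br x y \<in> S" "\<And>x. x \<in> S \<Longrightarrow> \<exists>n. \<forall>v. (br x ^^ n) v = 0"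
  shows "span S \<noteq> UNIV"
proof
  assume S: "span S = UNIV"
  have "\<exists>w\<in>UNIV - {0}. \<forall>x\<in>S. br x w \<in> {0}"
  proof (rule jacobson_engel[OF assms])
    obtain x y where "br x y \<noteq> 0" using nonabelian by blast
    then have "br x y \<notin> {0}" by simp
    then show "{0} \<subset> (UNIV :: 'a set)" by blast
  qed simp_all
  then obtain w where w: "w \<noteq> 0" "\<And>x. x \<in> S \<Longrightarrow> br x w \<in> {0}" by blast
  have "br x w \<in> {0}" for x
    by (rule br_span_left[OF w(2) subspace_single_0]) (use S in auto)
  then show False using center_trivial w(1) by blast
qed

text \<open>The elements c with (ad c)^2 = 0 form a bracket-closed set of ad-nilpotent elements, so
  they do not span. Yet their set is stable under all \<open>exp_ad\<close>, so its span is an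
  ideal, and a nonzero one if c is nonzero.\<close>

lemma no_sandwich:
  assumes "\<And>z. br c (br c z) = 0"
  shows "c = 0"
proof (rule ccontr)
  assume "c \<noteq> 0"
  define S where "S = {c. \<forall>z. br c (br c z) = 0}"
  have zero: "br c (br c z) = 0" if "c \<in> S" for c z using that by (simp add: S_def)
  \<comment> \<open>Expanding ad [c, [c, a]] = 0, the terms containing (ad c)^2 drop out and only -
    2 (ad c) (ad a) (ad c) is left.\<close>
  have mid: "br c (br a (br c v)) = 0" if c: "c \<in> S" for c a v
  proof -
    have "br (br c (br c a)) v = (- 2) \<odot> br c (br a (br c v))"
      unfolding br_br_left by (rule vec_eqI) (simp add: br_simps zero[OF c] co_simps)
    then show ?thesis by (simp add: zero[OF c])
  qed
  have closed: "br x y \<in> S" if "x \<in> S" "y \<in> S" for x y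
    unfolding S_def using mid[OF that(1)] mid[OF that(2)] zero[OF that(1)] zero[OF that(2)]
    by (simp add: br_br_left br_simps)
  have "\<exists>n. \<forall>v. (br x ^^ n) v = 0" if "x \<in> S" for x
    using zero[OF that] by (intro exI[of _ 2]) (simp add: numeral_2_eq_2)
  then have "span S \<noteq> UNIV" using weakly_closed_not_spanning[of S] closed by blast
  moreover have "span S = UNIV"
  proof (rule ideal_eq_UNIV)
    show "span S \<noteq> {0}" using assms \<open>c \<noteq> 0\<close> span_base[of c S] by (auto simp: S_def)
    fix x y assume "y \<in> span S"
    then show "br x y \<in> span S"
    proof (rule br_span_right[OF _ subspace_span, rotated])
      fix t assume t: "t \<in> S"
      show "br x t \<in> span S"
        by (rule exp_ad_stable_derivation[OF subspace_span])
          (use sandwich_exp_ad[OF zero[OF t]] in \<open>auto simp: S_def intro: span_base\<close>)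
    qed
  qed simp
  ultimately show False by blast
qed

text \<open>An eigenvector of \<open>ad h\<close> for an eigenvalue of maximal modulus shifts weights too far for its
  third power to survive.\<close>

lemma cube_zero_exists: "\<exists>e. e \<noteq> 0 \<and> (\<forall>v. br e (br e (br e v)) = 0)"
proof -
  have "\<exists>h. \<not> (\<exists>n. \<forall>v. (br h ^^ n) v = 0)"
  proof (rule ccontr)
    assume "\<nexists>h. \<not> (\<exists>n. \<forall>v. (br h ^^ n) v = 0)"
    then have "span UNIV \<noteq> UNIV" by (intro weakly_closed_not_spanning) auto
    then show False by simp
  qed
  then obtain h where "\<not> (\<exists>n. \<forall>v. (br h ^^ n) v = 0)" by blast
  then obtain \<mu>0 v0 where \<mu>0: "\<mu>0 \<noteq> 0" "v0 \<noteq> 0" "br h v0 = \<mu>0 \<odot> v0"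
    using nonzero_eigenvalue_exists[OF lin_br] by blast
  define \<Lambda> where "\<Lambda> = {\<mu>. \<exists>v. v \<noteq> 0 \<and> br h v = \<mu> \<odot> v}"
  have fin: "finite \<Lambda>" unfolding \<Lambda>_def by (rule finite_eigenvalues[OF lin_br])
  have ne: "\<mu>0 \<in> \<Lambda>" using \<mu>0 by (auto simp: \<Lambda>_def)
  obtain \<mu> where \<mu>: "\<mu> \<in> \<Lambda>" "\<And>l. l \<in> \<Lambda> \<Longrightarrow> norm l \<le> norm \<mu>"
  proof -
    have "Max (norm ` \<Lambda>) \<in> norm ` \<Lambda>" using fin ne by (intro Max_in) auto
    then obtain \<mu> where "\<mu> \<in> \<Lambda>" "norm \<mu> = Max (norm ` \<Lambda>)" by auto
    then show ?thesis using that fin by (metis Max_ge finite_imageI imageI)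
  qed
  have "norm \<mu> > 0" using \<mu>(2)[OF ne] \<mu>0(1) by (meson less_le_trans zero_less_norm_iff)
  obtain e where e: "e \<noteq> 0" "br h e = \<mu> \<odot> e" using \<mu>(1) by (auto simp: \<Lambda>_def)
  define T where "T v = br e (br e (br e v))" for v
  have T: "lin T" unfolding T_def[abs_def] by (intro lin_br_comp lin_ident)
  have he: "br h (br e v) = \<mu> \<odot> br e v + br e (br h v)" for v
    using br_deriv[of h e v] e(2) by (simp add: br_simps)
  have hT: "br h (T v) = T (br h v) + (3 * \<mu>) \<odot> T v" for v
  proof -
    have "br h (T v) = \<mu> \<odot> T v + (\<mu> \<odot> T v + (\<mu> \<odot> T v + T (br h v)))"
      unfolding T_def by (simp add: he br_simps)
    then show ?thesis by (intro vec_eqI) (simp add: co_simps)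
  qed
  have "T v = 0" for v
  proof (rule ccontr)
    assume nz: "T v \<noteq> 0"
    have "\<exists>\<nu> w. w \<in> range T \<and> w \<noteq> 0 \<and> br h w = \<nu> \<odot> w"
    proof (rule eigenvector_exists[OF lin_br])
      show "subspace (range T)" by (rule subspace_lin_image[OF T subspace_UNIV])
      show "br h ` range T \<subseteq> range T"
        by (auto simp: hT linD(1,2)[OF T, symmetric])
      show "range T \<noteq> {0}" using nz by auto
    qed
    then obtain \<nu> u where u: "T u \<noteq> 0" "br h (T u) = \<nu> \<odot> T u" by blast
    then have "\<nu> \<in> \<Lambda>" by (auto simp: \<Lambda>_def)
    \<comment> \<open>Since |\<nu>| <= |\<mu>|, the number \<nu> - 3 \<mu> has modulus at least 2
      |\<mu>| and is no eigenvalue of ad h; so S is injective, and maps the kernel of T onto itself.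
      But S sends \<open>u\<close> into that kernel, which puts \<open>u\<close> itself
      there.\<close>
    define S where "S v = br h v + (3 * \<mu> - \<nu>) \<odot> v" for v
    have S: "lin S" unfolding S_def[abs_def] by (intro lin_add lin_br lin_scale[OF lin_ident])
    have inj: "x = 0" if "S x = 0" for x
    proof (rule ccontr)
      assume "x \<noteq> 0"
      have "br h x = - ((3 * \<mu> - \<nu>) \<odot> x)" using that by (simp add: S_def add_eq_0_iff2)
      then have "br h x = (\<nu> - 3 * \<mu>) \<odot> x" by (simp flip: scale_minus_left)
      then have "\<nu> - 3 * \<mu> \<in> \<Lambda>" using \<open>x \<noteq> 0\<close> by (auto simp: \<Lambda>_def)
      then have "norm (\<nu> - 3 * \<mu>) \<le> norm \<mu>" by (rule \<mu>(2))
      moreover have "norm (3 * \<mu>) \<le> norm (\<nu> - 3 * \<mu>) + norm \<nu>"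
        using norm_triangle_ineq4[of "\<nu> - 3 * \<mu>" \<nu>] by (simp add: norm_minus_commute)
      moreover have "norm (3 * \<mu>) = 3 * norm \<mu>" by (simp add: norm_mult)
      ultimately show False using \<mu>(2)[OF \<open>\<nu> \<in> \<Lambda>\<close>] \<open>norm \<mu> > 0\<close> by linarith
    qed
    let ?K = "{v. T v = 0}"
    have K: "subspace ?K" by (rule subspaceI) (auto simp: linD[OF T])
    have "S ` ?K = ?K"
    proof (rule inj_on_imp_surj_on[OF S K _ inj])
      show "S ` ?K \<subseteq> ?K"
      proof clarify
        fix v assume "T v = 0"
        then have "T (br h v) = 0" using hT[of v] by simp
        then show "T (S v) = 0" using \<open>T v = 0\<close> by (simp add: S_def linD[OF T])
      qed
    qed
    moreover have "S u \<in> ?K"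
    proof -
      have "T (br h u) = (\<nu> - 3 * \<mu>) \<odot> T u"
        using hT[of u] u(2) by (simp add: scale_left_diff_distrib algebra_simps)
      then show ?thesis by (simp add: S_def linD[OF T] flip: scale_left_distrib)
    qed
    ultimately obtain k where k: "k \<in> ?K" "S u = S k" by (metis (lifting) imageE)
    then have "S (u - k) = 0" by (simp add: linD[OF S])
    then have "u = k" using inj by force
    then show False using k(1) u(1) by simp
  qed
  then show ?thesis using e(1) by (auto simp: T_def)
qed

text \<open>By minimality, (ad a)^2 has the same image I as (ad e)^2 for each nonzero
  \<open>a\<close> in I. If I were more than a line, two independent elements would give a quadratic
  pencil of operators on I with no singular member, against
  \<open>quadratic_pencil_singular\<close>. The extremal element obtained is such an
  \<open>a\<close>.\<close>

lemma extremal_exists: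
  "\<exists>e. (\<forall>v. \<exists>c. br e (br e v) = c \<odot> e) \<and> (\<exists>v. br e (br e v) \<noteq> 0)"
proof -
  define Z where "Z = {e. e \<noteq> 0 \<and> (\<forall>v. br e (br e (br e v)) = 0)}"
  define sq where "sq e = range (\<lambda>v. br e (br e v))" for e
  obtain e0 where "e0 \<in> Z" using cube_zero_exists by (auto simp: Z_def)
  then obtain e where e: "e \<in> Z" "\<And>a. a \<in> Z \<Longrightarrow> dim (sq e) \<le> dim (sq a)"
    using exists_least_iff[of "\<lambda>n. \<exists>e\<in>Z. dim (sq e) = n"] by (metis not_le_imp_less)
  have lsq: "lin (\<lambda>v. br e (br e v))" for e by (intro lin_br_comp lin_ident)
  have ssq: "subspace (sq e)" for e unfolding sq_def by (rule subspace_lin_image[OF lsq subspace_UNIV])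
  define I where "I = sq e"
  have sI: "subspace I" by (simp add: I_def ssq)
  have c1: "br e (br e (br e v)) = 0" for v using e(1) by (simp add: Z_def)
  \<comment> \<open>The expansion of ad ((ad e)^3 z) = 0, in which the terms with (ad e)^3
    vanish.\<close>
  have c2: "br e (br e (br z (br e v))) = br e (br z (br e (br e v)))" for z v
  proof -
    let ?t = "br e (br e (br z (br e v))) - br e (br z (br e (br e v)))"
    have "br (br e (br e (br e z))) v = 0" by (simp add: c1)
    moreover have "br (br e (br e (br e z))) v = - (3 \<odot> ?t)"
      unfolding br_br_left by (rule vec_eqI) (simp add: br_simps c1 co_simps)
    ultimately have "3 \<odot> ?t = 0" by simp
    then have "?t = 0" by simp
    then show ?thesis by simp
  qed
  \<comment> \<open>The fundamental formula of Jordan theory: for a = (ad e)^2 z one has (ad a)^2 =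
    (ad e)^2 (ad z)^2 (ad e)^2.\<close>
  have sq_elem: "br (br e (br e z)) (br (br e (br e z)) v) = br e (br e (br z (br z (br e (br e v)))))" for z v
    by (simp add: br_br_left br_simps c1 c2)
  have cube: "br a (br a (br a v)) = 0" if "a = br e (br e z)" for a z v
    unfolding that sq_elem by (simp add: br_br_left br_simps c1 c2)
  have full: "sq a = I" if a: "a \<in> I" "a \<noteq> 0" for a
  proof -
    obtain z where z: "a = br e (br e z)" using a(1) by (auto simp: I_def sq_def)
    have "sq a \<subseteq> I" unfolding sq_def z sq_elem by (auto simp: I_def sq_def)
    moreover have "a \<in> Z" using cube[OF z] a(2) by (simp add: Z_def)
    then have "dim I \<le> dim (sq a)" using e(2) by (simp add: I_def)
    ultimately show ?thesis by (intro subspace_dim_equal ssq sI)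
  qed
  have "\<exists>v. br e (br e v) \<noteq> 0" using no_sandwich[of e] e(1) by (auto simp: Z_def)
  then obtain a where a: "a \<in> I" "a \<noteq> 0" by (auto simp: I_def sq_def)
  have "I \<subseteq> range (\<lambda>c. c \<odot> a)"
  proof (rule ccontr)
    assume "\<not> I \<subseteq> range (\<lambda>c. c \<odot> a)"
    then obtain b where b: "b \<in> I" "b \<notin> range (\<lambda>c. c \<odot> a)" by blast
    have ne: "a + s \<odot> b \<noteq> 0" for s
    proof
      assume "a + s \<odot> b = 0"
      then have sb: "s \<odot> b = - a" by (simp add: add_eq_0_iff)
      have "s \<noteq> 0" using sb a(2) by auto
      then have "b = (1 / s) \<odot> (s \<odot> b)" by simp
      also have "\<dots> = (- 1 / s) \<odot> a" unfolding sb by simp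
      finally show False using b(2) by blast
    qed
    obtain y z where y: "a = br e (br e y)" and z: "b = br e (br e z)"
      using a(1) b(1) by (auto simp: I_def sq_def)
    \<comment> \<open>By \<open>sq_elem\<close>, \<open>M u\<close> maps I onto the image of (ad
      a)^2 with a = (ad e)^2 u, which is I unless this a is 0. Along u = y + s z it depends
      quadratically on s, with leading coefficient \<open>M z\<close>.\<close>
    define M where "M u v = br e (br e (br u (br u v)))" for u v
    have M: "lin (M u)" for u unfolding M_def[abs_def] by (intro lin_br_comp lin_ident)
    have onto: "M u ` I = I" if u: "br e (br e u) \<in> I" "br e (br e u) \<noteq> 0" for u
    proof -
      have "M u ` I = sq (br e (br e u))"
        by (simp add: I_def sq_def image_image M_def sq_elem)
      then show ?thesis using full[OF u] by simp
    qed
    define Q where "Q v = br e (br e (br y (br z v) + br z (br y v)))" for v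
    have "lin Q" unfolding Q_def[abs_def] by (intro lin_br_comp lin_ident lin_add)
    have MI: "M u v \<in> I" "Q v \<in> I" for u v by (auto simp: M_def Q_def I_def sq_def)
    have "b \<noteq> 0" using b(2) by (metis rangeI scale_zero_left)
    then have "\<exists>s v. v \<in> I \<and> v \<noteq> 0 \<and> M y v + s \<odot> Q v + (s * s) \<odot> M z v = 0"
      using a b onto[of z] z MI \<open>lin Q\<close> sI
      by (intro quadratic_pencil_singular[OF M _ M]) auto
    then obtain s v where v: "v \<in> I" "v \<noteq> 0" "M y v + s \<odot> Q v + (s * s) \<odot> M z v = 0" by blast
    have "M (y + s \<odot> z) v = M y v + s \<odot> Q v + (s * s) \<odot> M z v"
      by (simp add: M_def Q_def br_simps algebra_simps)
    then have "M (y + s \<odot> z) v = 0" using v(3) by simp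
    moreover have "br e (br e (y + s \<odot> z)) = a + s \<odot> b" by (simp add: y z br_simps)
    then have "M (y + s \<odot> z) ` I = I"
      using ne a(1) b(1) sI by (intro onto) (auto simp: subspace_add subspace_scale)
    ultimately show False using surj_on_imp_inj_on[OF M sI] v by blast
  qed
  then have "\<forall>v. \<exists>c. br a (br a v) = c \<odot> a" using full[OF a] by (auto simp: sq_def)
  moreover have "\<exists>v. br a (br a v) \<noteq> 0" using no_sandwich[of a] a(2) by blast
  ultimately show ?thesis by blast
qed

text \<open>On \<open>ker (ad e)\<close> the operator \<open>ad h\<close> is annihilated by \<open>t (t - 1) (t - 2)\<close>, which is
  \<open>(t + 2) (t\<^sup>2 - 5 t + 12) - 24\<close>; so \<open>ad h + 2\<close> is invertible there and
  corrects \<open>y\<close> to the third member of a triple.\<close>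

lemma extremal_triple_exists:
  "\<exists>e h f. e \<noteq> 0 \<and> br h e = 2 \<odot> e \<and> br h f = (- 2) \<odot> f \<and> br e f = h \<and> (\<forall>v. \<exists>c. br e (br e v) = c \<odot> e)"
proof -
  obtain e v0 where extr: "\<And>v. \<exists>c. br e (br e v) = c \<odot> e" and v0: "br e (br e v0) \<noteq> 0"
    using extremal_exists by blast
  have "e \<noteq> 0" using v0 by auto
  obtain c0 where c0: "br e (br e v0) = c0 \<odot> e" using extr by blast
  then have "c0 \<noteq> 0" using v0 by auto
  \<comment> \<open>Scaled so that h = [e, y] satisfies [h, e] = 2 e. The relation [h, y] = - 2 y
    may still fail.\<close>
  define y where "y = (- 2 / c0) \<odot> v0"
  have y: "br e (br e y) = (- 2) \<odot> e" using \<open>c0 \<noteq> 0\<close> by (simp add: y_def br_simps c0)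
  define h where "h = br e y"
  have eh: "br e h = (- 2) \<odot> e" using y by (simp add: h_def)
  have he: "br h e = 2 \<odot> e" using eh br_anti[of h e] by simp
  have comm: "br e (br h v) = br h (br e v) - 2 \<odot> br e v" for v
    using br_deriv[of e h v] eh by (simp add: br_simps algebra_simps)
  have ey: "br e (br y v) = br h v + br y (br e v)" for v
    using br_deriv[of e y v] by (simp add: h_def)
  \<comment> \<open>Where image and kernel of ad e meet, ad h is the identity up to multiples of e:
    moving (ad e)^2 past ad y turns (ad e)^2 [y, u] into 2 (ad h - 1) w.\<close>
  have key: "\<exists>c. br h w - w = c \<odot> e" if w: "w = br e u" "br e w = 0" for w u
  proof -
    have "br e (br e (br y u)) = 2 \<odot> (br h w - w)"
      by (rule vec_eqI) (simp add: ey br_simps comm co_simps w(1)[symmetric] w(2))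
    then obtain c where "2 \<odot> (br h w - w) = c \<odot> e" using extr by metis
    then have "(1 / 2) \<odot> (2 \<odot> (br h w - w)) = (1 / 2) \<odot> (c \<odot> e)" by simp
    then show ?thesis by (auto intro: exI[of _ "c / 2"])
  qed
  have ker: "br e (br h v) = 0" if "br e v = 0" for v using comm[of v] that by simp
  have cubic: "br h (br h (br h v)) - 3 \<odot> br h (br h v) + 2 \<odot> br h v = 0" if v: "br e v = 0" for v
  proof -
    have "br h v = br e (br y v)" using ey[of v] v by simp
    then obtain c where "br h (br h v) - br h v = c \<odot> e" using key[of "br h v"] ker[OF v] by blast
    then have "br h (br h (br h v) - br h v) - 2 \<odot> (br h (br h v) - br h v) = 0"
      by (simp add: br_simps he mult.commute)
    moreover have "br h (br h (br h v)) - 3 \<odot> br h (br h v) + 2 \<odot> br h v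
        = br h (br h (br h v) - br h v) - 2 \<odot> (br h (br h v) - br h v)"
      by (rule vec_eqI) (simp add: br_simps co_simps algebra_simps)
    ultimately show ?thesis by simp
  qed
  \<comment> \<open>The defect of \<open>y\<close> as third member of a triple. It commutes with e,
    so it can be removed by some z in the kernel of ad e without changing h.\<close>
  define c where "c = br h y + 2 \<odot> y"
  have c: "br e c = 0"
    by (rule vec_eqI) (simp add: c_def br_simps comm h_def[symmetric] eh br_self co_simps)
  define z where "z = (1 / 24) \<odot> (br h (br h c) - 5 \<odot> br h c + 12 \<odot> c)"
  have ez: "br e z = 0" using c ker[OF c] ker[OF ker[OF c]] by (simp add: z_def br_simps)
  have hz: "br h z + 2 \<odot> z = c"
  proof -
    have "br h (br h (br h c)) = 3 \<odot> br h (br h c) - 2 \<odot> br h c"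
      using cubic[OF c] by (simp add: algebra_simps)
    then have "br h z = (1 / 24) \<odot> (3 \<odot> br h (br h c) - 2 \<odot> br h c - 5 \<odot> br h (br h c) + 12 \<odot> br h c)"
      unfolding z_def by (simp only: br_simps)
    then have hz: "co b (br h z) = (1 / 24) * (3 * co b (br h (br h c)) - 2 * co b (br h c)
        - 5 * co b (br h (br h c)) + 12 * co b (br h c))" for b
      by (simp only: co_simps)
    show ?thesis by (rule vec_eqI) (simp add: co_simps hz, simp add: z_def co_simps field_simps)
  qed
  define f where "f = y - z"
  have "br e f = h" by (simp add: f_def br_simps ez h_def)
  moreover have "br h f = (- 2) \<odot> f"
  proof -
    have "br h y = c - 2 \<odot> y" "br h z = c - 2 \<odot> z" using hz by (auto simp: c_def algebra_simps)
    then show ?thesis by (simp add: f_def br_simps algebra_simps)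
  qed
  ultimately show ?thesis using \<open>e \<noteq> 0\<close> he extr by blast
qed

end

section \<open>The five-term grading of an extremal triple\<close>

locale extremal_triple = simple_lie_algebra scale br
  for scale :: "complex \<Rightarrow> 'g::ab_group_add \<Rightarrow> 'g" (infixr \<open>\<odot>\<close> 75) and br :: "'g \<Rightarrow> 'g \<Rightarrow> 'g" +
  fixes e h f :: 'g
  assumes e0: "e \<noteq> 0" and he: "br h e = 2 \<odot> e" and hf: "br h f = (- 2) \<odot> f" and ef: "br e f = h"
    and extremal_e: "\<And>v. \<exists>c. br e (br e v) = c \<odot> e"
begin

lemma eh: "br e h = (- 2) \<odot> e" and fh: "br f h = 2 \<odot> f" and fe: "br f e = - h"
  using br_anti[of e h] br_anti[of f h] br_anti[of f e] by (simp_all add: he hf ef)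

lemma EH: "br e (br h v) = br h (br e v) - 2 \<odot> br e v"
  using br_deriv[of e h v] by (simp add: eh br_simps)

lemma EF: "br e (br f v) = br h v + br f (br e v)"
  using br_deriv[of e f v] by (simp add: ef)

definition gs :: "int \<Rightarrow> 'g set" where "gs i = {v. br h v = of_int i \<odot> v}"

lemma gsD: "v \<in> gs i \<Longrightarrow> br h v = of_int i \<odot> v"
  by (simp add: gs_def)

lemma subspace_gs: "subspace (gs i)"
  by (rule subspaceI) (auto simp: gs_def br_simps scale_right_distrib mult.commute)

lemma gs_br: "x \<in> gs i \<Longrightarrow> y \<in> gs j \<Longrightarrow> br x y \<in> gs (i + j)"
  using br_deriv[of h x y] by (simp add: gs_def br_simps scale_left_distrib)

lemma gs_mem: "e \<in> gs 2" "f \<in> gs (- 2)" "h \<in> gs 0"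
  by (simp_all add: gs_def he hf br_self)

lemma gs_scale: "x \<in> gs i \<Longrightarrow> c \<odot> x \<in> gs i"
  by (rule subspace_scale[OF subspace_gs])

text \<open>The coordinate of \<open>f\<close>: (ad e)^2 v is a multiple of e, and for v = f that
  multiple is - 2, which explains the factor. A functional with value 1 at e reads it off.\<close>

definition alpha :: "'g \<Rightarrow> complex" where
  "alpha v = (- 1 / 2) * (SOME \<psi>. functional \<psi> \<and> \<psi> e = 1) (br e (br e v))"

lemma alpha: "functional alpha" "br e (br e v) = (- 2 * alpha v) \<odot> e"
proof -
  obtain \<psi>0 where "functional \<psi>0" "\<psi>0 e = 1"
    using separating_functional[of "{0}" e] e0 by auto
  then have "\<exists>\<psi>. functional \<psi> \<and> \<psi> e = 1" by blast
  from someI_ex[OF this] obtain \<psi> where \<psi>: "functional \<psi>" "\<psi> e = 1"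
    and a: "alpha = (\<lambda>v. (- 1 / 2) * \<psi> (br e (br e v)))"
    unfolding alpha_def[abs_def] by blast
  show "functional alpha"
    unfolding a by (rule functionalI) (simp_all add: br_simps functionalD[OF \<psi>(1)] algebra_simps)
  obtain c where c: "br e (br e v) = c \<odot> e" using extremal_e by blast
  then have "\<psi> (br e (br e v)) = c" by (simp add: functionalD[OF \<psi>(1)] \<psi>(2))
  then show "br e (br e v) = (- 2 * alpha v) \<odot> e" using c by (simp add: a)
qed

lemma alpha_f: "alpha f = 1"
proof -
  have "(- 2 * alpha f) \<odot> e = (- 2) \<odot> e" using alpha(2)[of f] by (simp add: ef eh)
  then show ?thesis using e0 by (simp only: scale_cancel_right) simp
qed

text \<open>Extremality applied to [f, u]: commuting both factors ad e past ad f gives 2 (ad h - 1)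
  w, which is therefore a multiple of e.\<close>

lemma ker_im:
  assumes "w = br e u" "br e w = 0"
  shows "\<exists>c. br h w - w = c \<odot> e"
proof -
  have "br e (br e (br f u)) = 2 \<odot> (br h w - w)"
    by (rule vec_eqI) (simp add: EF br_simps EH co_simps assms(1)[symmetric] assms(2))
  then have "2 \<odot> (br h w - w) = (- 2 * alpha (br f u)) \<odot> e" using alpha(2) by metis
  then have "(1 / 2) \<odot> (2 \<odot> (br h w - w)) = (1 / 2) \<odot> ((- 2 * alpha (br f u)) \<odot> e)" by (rule arg_cong)
  then have "br h w - w = ((1 / 2) * (- 2 * alpha (br f u))) \<odot> e" by (simp only: scale_scale) simp
  then show ?thesis by blast
qed

text \<open>The polynomial is t (t - 1) (t - 2). On the kernel of ad e, the vector [h, v] = [e,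
  [f, v]] lies in the image as well, so ad h - 1 sends it to a multiple of e, of weight 2.\<close>

lemma ker_cubic:
  assumes v: "br e v = 0"
  shows "pev (br h) [:0, 2, - 3, 1:] v = 0"
proof -
  have k: "br e (br h v) = 0" using EH[of v] v by simp
  have "br h v = br e (br f v)" using EF[of v] v by simp
  then obtain c where "br h (br h v) - br h v = c \<odot> e" using ker_im[of "br h v"] k by blast
  then have "br h (br h (br h v) - br h v) - 2 \<odot> (br h (br h v) - br h v) = 0"
    by (simp add: br_simps he mult.commute)
  moreover have "pev (br h) [:0, 2, - 3, 1:] v
      = br h (br h (br h v) - br h v) - 2 \<odot> (br h (br h v) - br h v)"
    by (rule vec_eqI) (simp add: pev_pCons[OF lin_br] pev_0 br_simps co_simps algebra_simps)
  ultimately show ?thesis by simp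
qed

text \<open>The factor t + 1 moves the kernel of (ad e)^2 into that of ad e, up to a multiple of
  \<open>h\<close>; having weight 0, \<open>h\<close> is killed by the cubic.\<close>

lemma ker2_quartic:
  assumes v: "br e (br e v) = 0"
  shows "pev (br h) ([:0, 2, - 3, 1:] * [:1, 1:]) v = 0"
proof -
  have "br e (br e v) = 0 \<and> br e v = br e v" using v by simp
  then obtain c where c: "br h (br e v) - br e v = c \<odot> e" using ker_im[of "br e v" v] by blast
  define w where "w = br h v + v + (c / 2) \<odot> h"
  have "br e w = 0"
  proof -
    have "br e w = (br h (br e v) - br e v) - c \<odot> e"
      by (rule vec_eqI) (simp add: w_def br_simps EH eh co_simps algebra_simps)
    then show ?thesis using c by simp
  qed
  then have "pev (br h) [:0, 2, - 3, 1:] w = 0" by (rule ker_cubic)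
  moreover have "pev (br h) [:1, 1:] v = w - (c / 2) \<odot> h"
    by (simp add: pev_pCons[OF lin_br] pev_0 w_def add.commute)
  moreover have "pev (br h) [:0, 2, - 3, 1:] h = 0"
    using pev_eigenvector[OF lin_br, of h h 0] by (simp add: br_self)
  ultimately show ?thesis
    by (simp only: pev_mult[OF lin_br] linD[OF pev_linear[OF lin_br]]) simp
qed

text \<open>t (t - 1) (t - 2) (t + 1) (t + 2). The factor t + 2 takes care of \<open>f\<close>,
  which together with the kernel of (ad e)^2 spans everything.\<close>

definition weight_annihilator :: "complex poly" where "weight_annihilator = [:0, 2, - 3, 1:] * [:1, 1:] * [:2, 1:]"

lemma ker2_decomp: "br e (br e (v - alpha v \<odot> f)) = 0"
  by (simp add: br_simps alpha(2) alpha_f)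

lemma pev_weight_annihilator: "pev (br h) weight_annihilator v = 0"
proof -
  let ?w = "v - alpha v \<odot> f"
  have "pev (br h) weight_annihilator ?w = pev (br h) [:2, 1:] (pev (br h) ([:0, 2, - 3, 1:] * [:1, 1:]) ?w)"
    unfolding weight_annihilator_def by (subst mult.commute) (rule pev_mult[OF lin_br])
  also have "\<dots> = 0"
    unfolding ker2_quartic[OF ker2_decomp] by (rule linD(3)[OF pev_linear[OF lin_br]])
  finally have w: "pev (br h) weight_annihilator ?w = 0" .
  have "pev (br h) weight_annihilator f = poly weight_annihilator (- 2) \<odot> f" by (rule pev_eigenvector[OF lin_br hf])
  then have "pev (br h) weight_annihilator f = 0" by (simp add: weight_annihilator_def)
  moreover have "v = ?w + alpha v \<odot> f" by simp
  then have "pev (br h) weight_annihilator v = pev (br h) weight_annihilator ?w + alpha v \<odot> pev (br h) weight_annihilator f"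
    by (metis linD(1,2)[OF pev_linear[OF lin_br]])
  ultimately show ?thesis using w by simp
qed

lemma gs_zero:
  assumes "v \<in> gs i" "i < - 2 \<or> 2 < i"
  shows "v = 0"
proof -
  have "poly weight_annihilator (of_int i) \<odot> v = 0"
    using pev_eigenvector[OF lin_br gsD[OF assms(1)], of weight_annihilator] pev_weight_annihilator[of v] by simp
  moreover have "poly weight_annihilator (of_int i) = of_int (i * (i - 1) * (i - 2) * (i + 1) * (i + 2))"
    by (simp add: weight_annihilator_def algebra_simps)
  moreover have "i * (i - 1) * (i - 2) * (i + 1) * (i + 2) \<noteq> 0" using assms(2) by auto
  ultimately show ?thesis by (metis of_int_eq_0_iff scale_eq_0_iff)
qed

lemma gs_minus2:
  assumes "v \<in> gs (- 2)"
  shows "v = alpha v \<odot> f"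
proof -
  let ?w = "v - alpha v \<odot> f"
  have "?w \<in> gs (- 2)" using assms gs_mem by (intro subspace_diff subspace_gs gs_scale)
  then have "br h ?w = (- 2) \<odot> ?w" using gsD by fastforce
  \<comment> \<open>The quartic annihilates \<open>?w\<close> by \<open>ker2_quartic\<close>, and
    its value at the eigenvalue - 2 is 24.\<close>
  from pev_eigenvector[OF lin_br this, of "[:0, 2, - 3, 1:] * [:1, 1:]"]
  have "24 \<odot> ?w = 0" unfolding ker2_quartic[OF ker2_decomp] by simp
  then show ?thesis by simp
qed

lemma gs_2:
  assumes "v \<in> gs 2"
  shows "\<exists>c. v = c \<odot> e"
proof -
  have "br e v \<in> gs (2 + 2)" by (rule gs_br[OF gs_mem(1) assms])
  then have ev: "br e v = 0" by (rule gs_zero) simp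
  have hv: "br h v = 2 \<odot> v" using gsD[OF assms] by simp
  then have "v = br e ((1 / 2) \<odot> br f v)" using EF[of v] ev by (simp add: br_simps)
  then obtain c where "br h v - v = c \<odot> e" using ker_im ev by blast
  moreover have "br h v - v = v" unfolding hv by (rule vec_eqI) (simp add: co_simps)
  ultimately show ?thesis by auto
qed

text \<open>The projections onto the weight spaces are Lagrange interpolation polynomials in \<open>ad h\<close>.\<close>

definition weight_poly :: "int \<Rightarrow> complex poly" where
  "weight_poly i = (if i = - 2 then Polynomial.smult (1 / 24) ([:0, 1:] * [:- 1, 1:] * [:- 2, 1:] * [:1, 1:])
    else if i = - 1 then Polynomial.smult (- 1 / 6) ([:0, 1:] * [:- 1, 1:] * [:- 2, 1:] * [:2, 1:])
    else if i = 0 then Polynomial.smult (1 / 4) ([:- 1, 1:] * [:- 2, 1:] * [:1, 1:] * [:2, 1:])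
    else if i = 1 then Polynomial.smult (- 1 / 6) ([:0, 1:] * [:- 2, 1:] * [:1, 1:] * [:2, 1:])
    else if i = 2 then Polynomial.smult (1 / 24) ([:0, 1:] * [:- 1, 1:] * [:1, 1:] * [:2, 1:])
    else 0)"

definition pr :: "int \<Rightarrow> 'g \<Rightarrow> 'g" where "pr i = pev (br h) (weight_poly i)"

lemma lin_pr: "lin (pr i)"
  unfolding pr_def by (rule pev_linear[OF lin_br])

lemma pr_sum: "v = pr (- 2) v + pr (- 1) v + pr 0 v + pr 1 v + pr 2 v"
proof -
  have "pr (- 2) v + pr (- 1) v + pr 0 v + pr 1 v + pr 2 v
      = pev (br h) (weight_poly (- 2) + weight_poly (- 1) + weight_poly 0 + weight_poly 1 + weight_poly 2) v"
    by (simp add: pr_def pev_add)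
  also have "weight_poly (- 2) + weight_poly (- 1) + weight_poly 0 + weight_poly 1 + weight_poly 2 = 1"
    by (simp add: weight_poly_def one_pCons)
  also have "pev (br h) 1 v = v" by (simp add: pev_def)
  finally show ?thesis by simp
qed

lemma pr_in_gs: "pr i v \<in> gs i"
proof -
  have "\<exists>c. [:- of_int i, 1:] * weight_poly i = Polynomial.smult c weight_annihilator"
  proof -
    consider "i = - 2" | "i = - 1" | "i = 0" | "i = 1" | "i = 2" | "weight_poly i = 0"
      using weight_poly_def[of i] by (metis (full_types))
    then show ?thesis
    proof cases
      case 1
      then show ?thesis by (intro exI[of _ "1 / 24"]) (simp add: weight_poly_def weight_annihilator_def)
    next
      case 2
      then show ?thesis by (intro exI[of _ "- 1 / 6"]) (simp add: weight_poly_def weight_annihilator_def)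
    next
      case 3
      then show ?thesis by (intro exI[of _ "1 / 4"]) (simp add: weight_poly_def weight_annihilator_def)
    next
      case 4
      then show ?thesis by (intro exI[of _ "- 1 / 6"]) (simp add: weight_poly_def weight_annihilator_def)
    next
      case 5
      then show ?thesis by (intro exI[of _ "1 / 24"]) (simp add: weight_poly_def weight_annihilator_def)
    next
      case 6
      then show ?thesis by (intro exI[of _ 0]) simp
    qed
  qed
  then obtain c where "[:- of_int i, 1:] * weight_poly i = Polynomial.smult c weight_annihilator" by blast
  then have "pev (br h) [:- of_int i, 1:] (pr i v) = 0"
    unfolding pr_def pev_mult[OF lin_br, symmetric] by (simp add: pev_smult pev_weight_annihilator)
  then show ?thesis by (simp add: gs_def pev_pCons[OF lin_br] pev_0 add_eq_0_iff2)
qed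

lemma pr_gs:
  assumes "v \<in> gs j"
  shows "pr i v = (if i = j then v else 0)"
proof (cases "- 2 \<le> j \<and> j \<le> 2")
  case True
  then have "j = - 2 \<or> j = - 1 \<or> j = 0 \<or> j = 1 \<or> j = 2" by auto
  moreover have "pr i v = poly (weight_poly i) (of_int j) \<odot> v"
    unfolding pr_def by (rule pev_eigenvector[OF lin_br gsD[OF assms]])
  ultimately show ?thesis by (auto simp: weight_poly_def)
next
  case False
  then have "v = 0" using gs_zero[OF assms] by auto
  then show ?thesis by (simp add: linD[OF lin_pr])
qed

lemma alpha_gs: "v \<in> gs i \<Longrightarrow> i > - 2 \<Longrightarrow> alpha v = 0"
proof -
  assume v: "v \<in> gs i" "i > - 2"
  have "br e (br e v) \<in> gs (2 + (2 + i))" by (intro gs_br gs_mem v)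
  then have "br e (br e v) = 0" by (rule gs_zero) (use v(2) in simp)
  then have "(- 2 * alpha v) \<odot> e = 0" unfolding alpha(2) .
  then show "alpha v = 0" using e0 by simp
qed

lemma pr_minus2: "pr (- 2) v = alpha v \<odot> f"
proof -
  have "alpha v = alpha (pr (- 2) v + pr (- 1) v + pr 0 v + pr 1 v + pr 2 v)"
    using pr_sum[of v] by simp
  also have "\<dots> = alpha (pr (- 2) v)"
    by (simp add: functionalD[OF alpha(1)] alpha_gs[OF pr_in_gs])
  finally show ?thesis using gs_minus2[OF pr_in_gs[of "- 2" v]] by simp
qed

lemma EF_gs1: "u \<in> gs 1 \<Longrightarrow> br e (br f u) = u"
proof -
  assume u: "u \<in> gs 1"
  have "br e u \<in> gs (2 + 1)" by (intro gs_br gs_mem u)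
  then have "br e u = 0" by (rule gs_zero) simp
  then show ?thesis using EF[of u] gsD[OF u] by simp
qed

text \<open>Two applications of ad f lower the weight by 4, so only the component of weight 2
  survives, and it lands in the line of weight - 2.\<close>

lemma f_ext: "\<exists>c. br f (br f v) = c \<odot> f"
proof -
  have z: "br f (br f (pr i v)) = 0" if "i < 2" for i
  proof -
    have "br f (br f (pr i v)) \<in> gs (- 2 + (- 2 + i))" by (intro gs_br gs_mem pr_in_gs)
    then show ?thesis by (rule gs_zero) (use that in simp)
  qed
  have "br f (br f v) = br f (br f (pr (- 2) v + pr (- 1) v + pr 0 v + pr 1 v + pr 2 v))"
    using pr_sum[of v] by simp
  also have "\<dots> = br f (br f (pr 2 v))" by (simp add: br_simps z)
  also have "\<dots> = alpha (br f (br f (pr 2 v))) \<odot> f"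
  proof (rule gs_minus2)
    have "br f (br f (pr 2 v)) \<in> gs (- 2 + (- 2 + 2))" by (intro gs_br gs_mem pr_in_gs)
    then show "br f (br f (pr 2 v)) \<in> gs (- 2)" by simp
  qed
  finally show ?thesis by blast
qed

lemma h0: "h \<noteq> 0"
  using he e0 by auto

lemma f0: "f \<noteq> 0"
  using alpha_f functional_more(1)[OF alpha(1)] by auto

text \<open>The alternative is \<open>\<ss>\<ll>\<^sub>2\<close>: without a further element commuting with \<open>e\<close> and \<open>h\<close>,
  the weight spaces \<open>\<plusminus>1\<close> span an ideal.\<close>

lemma centralizer_or_A1: "(\<exists>k. k \<noteq> 0 \<and> br h k = 0 \<and> br e k = 0) \<or> type_A1"
proof (rule disjCI)
  assume nA: "\<not> type_A1"
  show "\<exists>k. k \<noteq> 0 \<and> br h k = 0 \<and> br e k = 0"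
  proof (rule ccontr)
    assume no: "\<nexists>k. k \<noteq> 0 \<and> br h k = 0 \<and> br e k = 0"
    \<comment> \<open>A suitable multiple of \<open>h\<close> corrects x to an element commuting
      with both e and h, which by assumption is 0.\<close>
    have g0: "\<exists>c. x = c \<odot> h" if x: "x \<in> gs 0" for x
    proof -
      have "br e x \<in> gs (2 + 0)" by (intro gs_br gs_mem x)
      then obtain c where c: "br e x = c \<odot> e" using gs_2[of "br e x"] by auto
      have "br e (x + (c / 2) \<odot> h) = 0" "br h (x + (c / 2) \<odot> h) = 0"
        using gsD[OF x] by (simp_all add: br_simps c eh br_self)
      then have "x + (c / 2) \<odot> h = 0" using no by blast
      then have "x = (- c / 2) \<odot> h" by (simp add: add_eq_0_iff2)
      then show ?thesis by blast
    qed
    \<comment> \<open>One scalar governs both brackets: ad e is applied to [x, y] = \<beta> h, where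
      [e, x] = 0 because there is no weight 3.\<close>
    have pm: "\<exists>\<beta>. br x y = \<beta> \<odot> h \<and> br x (br e y) = (- 2 * \<beta>) \<odot> e"
      if x: "x \<in> gs 1" and y: "y \<in> gs (- 1)" for x y
    proof -
      have "br x y \<in> gs (1 + - 1)" by (intro gs_br x y)
      then obtain \<beta> where \<beta>: "br x y = \<beta> \<odot> h" using g0 by auto
      have "br e x \<in> gs (2 + 1)" by (intro gs_br gs_mem x)
      then have "br e x = 0" by (rule gs_zero) simp
      then have "br x (br e y) = br e (br x y)" using br_deriv[of e x y] by simp
      then have "br x (br e y) = (- 2 * \<beta>) \<odot> e" using \<beta> by (simp add: br_simps eh mult.commute)
      then show ?thesis using \<beta> by blast
    qed
    \<comment> \<open>With [x, x'] = \<omega> e and y = [f, x], antisymmetry gives \<omega> = 2 b2,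
      whereas the Jacobi identity for x, x', y gives \<omega> x = - b2 x. So b2 = 0 or x =
      0.\<close>
    have pp: "br x x' = 0" if x: "x \<in> gs 1" and x': "x' \<in> gs 1" for x x'
    proof -
      have "br x x' \<in> gs (1 + 1)" by (intro gs_br x x')
      then obtain \<omega> where \<omega>: "br x x' = \<omega> \<odot> e" using gs_2[of "br x x'"] by auto
      define y where "y = br f x"
      have "br f x \<in> gs (- 2 + 1)" by (intro gs_br gs_mem x)
      then have y: "y \<in> gs (- 1)" by (simp add: y_def)
      have ey: "br e y = x" unfolding y_def by (rule EF_gs1[OF x])
      obtain b1 where b1: "br x y = b1 \<odot> h" "br x x = (- 2 * b1) \<odot> e" using pm[OF x y] ey by auto
      obtain b2 where b2: "br x' y = b2 \<odot> h" "br x' x = (- 2 * b2) \<odot> e" using pm[OF x' y] ey by auto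
      have "b1 = 0" using b1(2) e0 by (simp add: br_self)
      have "- \<omega> \<odot> e = (- 2 * b2) \<odot> e" using b2(2) \<omega> br_anti[of x' x] by simp
      then have w2: "\<omega> = 2 * b2" using e0 by (simp flip: scale_minus_left)
      have "br (br x x') y = br x (br x' y) - br x' (br x y)" by (rule br_br_left)
      then have "\<omega> \<odot> x = b2 \<odot> br x h" using \<omega> b1 b2 ey \<open>b1 = 0\<close> by (simp add: br_simps)
      moreover have "br x h = - x" using br_anti[of x h] gsD[OF x] by simp
      ultimately have "\<omega> \<odot> x + b2 \<odot> x = 0" by simp
      then have "(\<omega> + b2) \<odot> x = 0" by (simp only: scale_left_distrib)
      then have "3 * b2 = 0 \<or> x = 0" using w2 by auto
      then show ?thesis
      proof
        assume "3 * b2 = 0"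
        then show ?thesis using \<omega> w2 by simp
      qed simp
    qed
    have gsE: "br e y \<in> gs 1" if "y \<in> gs (- 1)" for y
      using gs_br[OF gs_mem(1) that] by simp
    have pm0: "br x y = 0" if x: "x \<in> gs 1" and y: "y \<in> gs (- 1)" for x y
    proof -
      obtain \<beta> where "br x y = \<beta> \<odot> h" "br x (br e y) = (- 2 * \<beta>) \<odot> e" using pm[OF x y] by blast
      then show ?thesis using pp[OF x gsE[OF y]] e0 by auto
    qed
    have mm0: "br y y' = 0" if y: "y \<in> gs (- 1)" and y': "y' \<in> gs (- 1)" for y y'
    proof -
      have "br y y' \<in> gs (- 1 + - 1)" by (intro gs_br y y')
      then have c: "br y y' = alpha (br y y') \<odot> f" using gs_minus2[of "br y y'"] by simp
      have "br e (br y y') = br (br e y) y' + br y (br e y')" by (rule br_deriv)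
      also have "\<dots> = 0"
        using pm0[OF gsE[OF y] y'] pm0[OF gsE[OF y'] y] br_anti[of y "br e y'"] by simp
      finally have "alpha (br y y') \<odot> h = 0" using c by (metis br_scale_right ef)
      then show ?thesis using c h0 by simp
    qed
    \<comment> \<open>All brackets inside J vanish and the other weights preserve it, so it is an
      ideal. It misses e, hence is 0, and only the span of f, h, e is left.\<close>
    define J where "J = {a + b | a b. a \<in> gs 1 \<and> b \<in> gs (- 1)}"
    have sJ: "subspace J" unfolding J_def by (rule subspace_sums[OF subspace_gs subspace_gs])
    have JI: "a \<in> J" if "a \<in> gs 1 \<or> a \<in> gs (- 1)" for a
      using that subspace_0[OF subspace_gs] unfolding J_def by (metis (mono_tags, lifting) CollectI add.left_neutral add.right_neutral)
    have JU: "J \<noteq> UNIV"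
    proof
      assume "J = UNIV"
      then have "e \<in> J" by simp
      then obtain a b where ab: "e = a + b" "a \<in> gs 1" "b \<in> gs (- 1)" unfolding J_def by blast
      have "e = pr 2 e" by (simp add: pr_gs[OF gs_mem(1)])
      also have "\<dots> = 0" by (simp add: ab(1) linD[OF lin_pr] pr_gs[OF ab(2)] pr_gs[OF ab(3)])
      finally show False using e0 by simp
    qed
    have J: "br x y \<in> J" if y: "y \<in> J" for x y
    proof -
      obtain a b where ab: "y = a + b" "a \<in> gs 1" "b \<in> gs (- 1)" using y unfolding J_def by blast
      have "br (pr i x) y \<in> J" for i
      proof (cases "i \<in> {- 2, - 1, 0, 1, 2}")
        case True
        have "br (pr i x) a \<in> gs (i + 1)" "br (pr i x) b \<in> gs (i + - 1)"
          by (intro gs_br pr_in_gs ab)+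
        moreover have "br (pr 1 x) a = 0" "br (pr 1 x) b = 0" "br (pr (- 1) x) a = 0" "br (pr (- 1) x) b = 0"
          using pp pm0 mm0 ab pr_in_gs br_anti[of "pr (- 1) x" a] by (metis neg_0_equal_iff_equal)+
        moreover have "c \<in> J" if "c \<in> gs 3 \<or> c \<in> gs (- 3)" for c
        proof -
          have "c = 0" using that gs_zero[of c] by auto
          then show ?thesis using subspace_0[OF sJ] by simp
        qed
        ultimately have "br (pr i x) a \<in> J \<and> br (pr i x) b \<in> J"
          using True JI subspace_0[OF sJ] by auto
        then show ?thesis unfolding ab(1) br_add_right using subspace_add[OF sJ] by blast
      next
        case False
        then have "pr i x = 0" by (auto simp: pr_def weight_poly_def pev_0)
        then show ?thesis using subspace_0[OF sJ] by simp
      qed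
      then have "br (pr (- 2) x) y + br (pr (- 1) x) y + br (pr 0 x) y + br (pr 1 x) y + br (pr 2 x) y \<in> J"
        by (intro subspace_add[OF sJ])
      then show ?thesis by (subst pr_sum[of x]) (simp only: br_add_left)
    qed
    have "J = {0}" using ideal_eq_UNIV[OF sJ J] JU by blast
    then have p1: "pr 1 v = 0" "pr (- 1) v = 0" for v using JI pr_in_gs by blast+
    obtain \<eta> where \<eta>: "functional \<eta>" "\<eta> h = 1" using separating_functional[of "{0}" h] h0 by auto
    obtain \<epsilon> where \<epsilon>: "functional \<epsilon>" "\<epsilon> e = 1" using separating_functional[of "{0}" e] e0 by auto
    define b where "b v = \<eta> (pr 0 v)" for v
    define c where "c v = \<epsilon> (pr 2 v)" for v
    have fb: "functional b" and fc: "functional c"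
      unfolding b_def[abs_def] c_def[abs_def] by (rule functional_lin[OF \<eta>(1) lin_pr], rule functional_lin[OF \<epsilon>(1) lin_pr])
    have dec: "v = alpha v \<odot> f + b v \<odot> h + c v \<odot> e" for v
    proof -
      obtain c0 where "pr 0 v = c0 \<odot> h" using g0[OF pr_in_gs] by blast
      moreover from this have "b v = c0" by (simp add: b_def functionalD[OF \<eta>(1)] \<eta>(2))
      moreover obtain c2 where "pr 2 v = c2 \<odot> e" using gs_2[OF pr_in_gs] by blast
      moreover from this have "c v = c2" by (simp add: c_def functionalD[OF \<epsilon>(1)] \<epsilon>(2))
      ultimately show ?thesis using pr_sum[of v] by (simp add: p1 pr_minus2)
    qed
    have vals: "alpha f = 1" "alpha h = 0" "alpha e = 0" "b f = 0" "b h = 1" "b e = 0"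
      "c f = 0" "c h = 0" "c e = 1"
      using alpha_gs[OF gs_mem(3)] alpha_gs[OF gs_mem(1)] alpha_f
      by (simp_all add: b_def c_def pr_gs[OF gs_mem(1)] pr_gs[OF gs_mem(2)] pr_gs[OF gs_mem(3)]
          \<eta> \<epsilon> functional_more[OF \<eta>(1)] functional_more[OF \<epsilon>(1)])
    \<comment> \<open>The standard representation: h goes to diag (1, - 1), and e and f to the
      elementary matrices above and below the diagonal.\<close>
    define \<theta> :: "'g \<Rightarrow> complex^2^2" where
      "\<theta> v = vector [vector [b v, c v], vector [alpha v, - b v]]" for v
    have "type_A1"
      unfolding type_A1_def
    proof (intro exI[of _ \<theta>] conjI allI)
      show "bij_betw \<theta> UNIV {A. trace A = 0}"
        unfolding bij_betw_def
      proof
        show "inj \<theta>"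
        proof (rule injI)
          fix x y assume "\<theta> x = \<theta> y"
          then have "alpha x = alpha y" "b x = b y" "c x = c y"
            by (auto simp: \<theta>_def vec_eq_iff forall_2)
          then show "x = y" using dec[of x] dec[of y] by simp
        qed
        show "range \<theta> = {A. trace A = 0}"
        proof (intro equalityI subsetI)
          fix A assume "A \<in> range \<theta>"
          then show "A \<in> {A. trace A = 0}" by (auto simp: \<theta>_def trace_def sum_2)
        next
          fix A :: "complex^2^2" assume "A \<in> {A. trace A = 0}"
          then have t: "A $ 2 $ 2 = - A $ 1 $ 1" by (simp add: trace_def sum_2 add_eq_0_iff)
          have "A = \<theta> (A $ 2 $ 1 \<odot> f + A $ 1 $ 1 \<odot> h + A $ 1 $ 2 \<odot> e)"
            by (simp add: \<theta>_def vec_eq_iff forall_2 functionalD[OF fb] functionalD[OF fc] functionalD[OF alpha(1)] vals t)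
          then show "A \<in> range \<theta>" by blast
        qed
      qed
      show "\<theta> (x + y) = \<theta> x + \<theta> y" for x y
        by (simp add: \<theta>_def vec_eq_iff forall_2 functionalD[OF fb] functionalD[OF fc] functionalD[OF alpha(1)])
      show "\<theta> (s \<odot> x) = (\<chi> i j. s * \<theta> x $ i $ j)" for s x
        by (simp add: \<theta>_def vec_eq_iff forall_2 functionalD[OF fb] functionalD[OF fc] functionalD[OF alpha(1)])
      show "\<theta> (br x y) = \<theta> x ** \<theta> y - \<theta> y ** \<theta> x" for x y
      proof -
        have "br x y = br (alpha x \<odot> f + b x \<odot> h + c x \<odot> e) (alpha y \<odot> f + b y \<odot> h + c y \<odot> e)"
          using dec[of x] dec[of y] by simp
        also have "\<dots> = (2 * (alpha x * b y - b x * alpha y)) \<odot> f + (c x * alpha y - alpha x * c y) \<odot> h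
            + (2 * (b x * c y - c x * b y)) \<odot> e"
          by (rule vec_eqI) (simp add: br_simps br_self he hf ef eh fh fe co_simps algebra_simps)
        finally have xy: "br x y = \<dots>" .
        show ?thesis
          unfolding xy \<theta>_def vec_eq_iff forall_2 matrix_matrix_mult_def
          by (simp add: sum_2 functionalD[OF fb] functionalD[OF fc] functionalD[OF alpha(1)] vals)
      qed
    qed
    with nA show False by blast
  qed
qed

lemma im_e: "\<exists>c d. br e v = c \<odot> h + pr 1 (br e v) + d \<odot> e"
proof -
  have z: "pr i (br e v) = 0" if "i < 0" for i
  proof -
    have "br e (pr j v) \<in> gs (2 + j)" for j by (intro gs_br gs_mem pr_in_gs)
    then have p: "pr i (br e (pr j v)) = (if i = 2 + j then br e (pr j v) else 0)" for j by (rule pr_gs)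
    have "br e v = br e (pr (- 2) v) + br e (pr (- 1) v) + br e (pr 0 v) + br e (pr 1 v) + br e (pr 2 v)"
      by (subst pr_sum[of v]) (simp only: br_add_right)
    then show ?thesis using that by (simp only: linD[OF lin_pr] p) simp
  qed
  have 0: "pr 0 (br e v) = alpha v \<odot> h"
  proof -
    have "br e (pr j v) \<in> gs (2 + j)" for j by (intro gs_br gs_mem pr_in_gs)
    then have p: "pr 0 (br e (pr j v)) = (if 0 = 2 + j then br e (pr j v) else 0)" for j by (rule pr_gs)
    have "br e v = br e (pr (- 2) v) + br e (pr (- 1) v) + br e (pr 0 v) + br e (pr 1 v) + br e (pr 2 v)"
      by (subst pr_sum[of v]) (simp only: br_add_right)
    then have "pr 0 (br e v) = br e (pr (- 2) v)" by (simp only: linD[OF lin_pr] p) simp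
    then show ?thesis by (simp add: pr_minus2 br_simps ef)
  qed
  obtain d where "pr 2 (br e v) = d \<odot> e" using gs_2[OF pr_in_gs] by blast
  with pr_sum[of "br e v"] 0 z show ?thesis
    by (intro exI[of _ "alpha v"] exI[of _ d]) simp
qed

lemma dim_range_e:
  assumes "\<not> type_A1"
  shows "2 * dim (range (br e)) \<le> dim (UNIV :: 'g set)"
proof -
  obtain k where k: "k \<noteq> 0" "br h k = 0" "br e k = 0" using centralizer_or_A1 assms by blast
  \<comment> \<open>S lies in the kernel of ad e. The image exceeds its span by at most the line of
    \<open>h\<close>, and the kernel contains \<open>k\<close> in addition; these two extra
    dimensions balance.\<close>
  define S where "S = insert e (gs 1)"
  have "range (br e) \<subseteq> span (insert h S)"
  proof clarify
    fix v
    obtain c d where "br e v = c \<odot> h + pr 1 (br e v) + d \<odot> e" using im_e by blast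
    moreover have "c \<odot> h + pr 1 (br e v) + d \<odot> e \<in> span (insert h S)"
      using pr_in_gs[of 1] by (intro span_add span_scale span_base) (auto simp: S_def)
    ultimately show "br e v \<in> span (insert h S)" by simp
  qed
  then have "dim (range (br e)) \<le> dim (insert h S)" by (rule dim_mono)
  also have "\<dots> \<le> Suc (dim S)" by (simp add: dim_insert)
  finally have 1: "dim (range (br e)) \<le> Suc (dim S)" .
  have "k \<notin> span S"
  proof
    assume "k \<in> span S"
    then have "pr 0 k = 0"
    proof (induction rule: span_induct_alt)
      case (step c s x)
      then have "pr 0 s = 0" using pr_gs[OF gs_mem(1), of 0] pr_gs[of s 1 0] by (auto simp: S_def)
      then show ?case using step by (simp add: linD[OF lin_pr])
    qed (simp add: linD[OF lin_pr])
    moreover have "k \<in> gs 0" using k(2) by (simp add: gs_def)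
    ultimately show False using k(1) pr_gs[of k 0 0] by simp
  qed
  then have 2: "dim (insert k S) = Suc (dim S)" by (simp add: dim_insert)
  have "insert k S \<subseteq> {x. br e x = 0}"
  proof -
    have "br e u = 0" if "u \<in> gs 1" for u
      using gs_zero[OF gs_br[OF gs_mem(1) that]] by simp
    then show ?thesis using k(3) by (auto simp: S_def br_self)
  qed
  then have "dim (insert k S) \<le> dim {x. br e x = 0}" by (rule dim_subset)
  with 1 2 dim_range_kernel[OF lin_br, of e] show ?thesis by linarith
qed

end

section \<open>Krull dimension and growth\<close>

lemma fprime_vanishing_iff:
  "fprime F (vanishing F Z) \<longleftrightarrow> Z \<noteq> {} \<and>
    (\<forall>f\<in>alg_gen F. \<forall>g\<in>alg_gen F. (\<forall>x\<in>Z. f x * g x = 0) \<longrightarrow> (\<forall>x\<in>Z. f x = 0) \<or> (\<forall>x\<in>Z. g x = 0))"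
proof -
  have "(\<lambda>_. 1) \<notin> vanishing F Z \<longleftrightarrow> Z \<noteq> {}"
    by (auto simp: vanishing_def alg_gen.const)
  then show ?thesis
    using fideal_vanishing[of F Z] alg_gen.mult[where F = F] by (auto simp: fprime_def vanishing_def)
qed

context fd_complex_space
begin

abbreviation van :: "'g set \<Rightarrow> ('g \<Rightarrow> complex) set" where "van \<equiv> vanishing FF"

lemma topspace_zariski: "topspace zariski = UNIV"
proof -
  have "(\<lambda>_. 1) \<in> carrier coord_ring" by (simp add: carrier_coord_ring alg_gen.const)
  then have "openin zariski UNIV"
    unfolding openin_zariski by (intro exI[of _ "{\<lambda>_. 1}"]) auto
  then show ?thesis by (metis openin_subset top.extremum_uniqueI)
qed

lemma closedin_subtopology_zariski:
  "closedin (subtopology zariski X) Z \<longleftrightarrow> (\<exists>S\<subseteq>alg_gen FF. Z = {p \<in> X. \<forall>f\<in>S. f p = 0})"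
proof
  assume "closedin (subtopology zariski X) Z"
  then obtain T where T: "closedin zariski T" "Z = T \<inter> X" unfolding closedin_subtopology by blast
  then obtain S where "S \<subseteq> alg_gen FF" "- T = {x. \<exists>f\<in>S. f x \<noteq> 0}"
    unfolding closedin_def openin_zariski topspace_zariski carrier_coord_ring
    by (auto simp: Compl_eq_Diff_UNIV)
  then show "\<exists>S\<subseteq>alg_gen FF. Z = {p \<in> X. \<forall>f\<in>S. f p = 0}" using T(2) by (intro exI[of _ S]) blast
next
  assume "\<exists>S\<subseteq>alg_gen FF. Z = {p \<in> X. \<forall>f\<in>S. f p = 0}"
  then obtain S where S: "S \<subseteq> alg_gen FF" "Z = {p \<in> X. \<forall>f\<in>S. f p = 0}" by blast
  let ?T = "{p. \<forall>f\<in>S. f p = 0}"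
  have "UNIV - ?T = {x. \<exists>f\<in>S. f x \<noteq> 0}" by auto
  then have "closedin zariski ?T"
    using S(1) unfolding closedin_def openin_zariski topspace_zariski carrier_coord_ring by auto
  then show "closedin (subtopology zariski X) Z"
    unfolding closedin_subtopology using S(2) by (intro exI[of _ ?T]) auto
qed

lemma irreducible_iff_prime: "irreducible_space (subtopology zariski Z) \<longleftrightarrow> fprime FF (van Z)"
proof
  assume irr: "irreducible_space (subtopology zariski Z)"
  show "fprime FF (van Z)"
    unfolding fprime_vanishing_iff
  proof (intro conjI ballI impI)
    show "Z \<noteq> {}" using irr by (simp add: irreducible_space_def topspace_zariski)
    fix f g assume fg: "f \<in> alg_gen FF" "g \<in> alg_gen FF" "\<forall>x\<in>Z. f x * g x = 0"
    let ?A = "{p \<in> Z. \<forall>f'\<in>{f}. f' p = 0}" and ?B = "{p \<in> Z. \<forall>f'\<in>{g}. f' p = 0}"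
    have "closedin (subtopology zariski Z) ?A" "closedin (subtopology zariski Z) ?B"
      unfolding closedin_subtopology_zariski using fg by blast+
    moreover have "?A \<union> ?B = Z" using fg by auto
    ultimately have "?A = Z \<or> ?B = Z"
      using irr by (auto simp: irreducible_space_def reducible_space_def topspace_zariski)
    then show "(\<forall>x\<in>Z. f x = 0) \<or> (\<forall>x\<in>Z. g x = 0)" by blast
  qed
next
  assume prime: "fprime FF (van Z)"
  have "\<not> reducible_space (subtopology zariski Z)"
  proof
    assume "reducible_space (subtopology zariski Z)"
    then obtain A B where AB: "closedin (subtopology zariski Z) A" "closedin (subtopology zariski Z) B"
      "A \<noteq> Z" "B \<noteq> Z" "A \<union> B = Z" by (auto simp: reducible_space_def topspace_zariski)
    obtain S T where S: "S \<subseteq> alg_gen FF" "A = {p \<in> Z. \<forall>f\<in>S. f p = 0}"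
      and T: "T \<subseteq> alg_gen FF" "B = {p \<in> Z. \<forall>f\<in>T. f p = 0}"
      using AB(1,2) unfolding closedin_subtopology_zariski by blast
    obtain f where f: "f \<in> S" "\<not> (\<forall>x\<in>Z. f x = 0)" using AB(3) S by blast
    obtain g where g: "g \<in> T" "\<not> (\<forall>x\<in>Z. g x = 0)" using AB(4) T by blast
    have "\<forall>x\<in>Z. f x * g x = 0" using AB(5) S T f g by auto
    then show False using prime f g S T unfolding fprime_vanishing_iff by blast
  qed
  then show "irreducible_space (subtopology zariski Z)"
    using prime by (simp add: irreducible_space_def topspace_zariski fprime_vanishing_iff)
qed

definition prime_chain :: "'g set \<Rightarrow> (nat \<Rightarrow> 'g set) \<Rightarrow> nat \<Rightarrow> bool" where
  "prime_chain X Z n \<longleftrightarrow> (\<forall>i\<le>n. closedin (subtopology zariski X) (Z i) \<and> fprime FF (van (Z i))) \<and>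
     (\<forall>i<n. Z i \<subset> Z (Suc i))"

lemma zariski_dim_eq: "zariski_dim X = Sup {enat n | n. \<exists>Z. prime_chain X Z n}"
proof -
  have "irreducible_space (subtopology (subtopology zariski X) Z) \<longleftrightarrow> fprime FF (van Z)"
    if "closedin (subtopology zariski X) Z" for Z
  proof -
    have "Z \<subseteq> X" using closedin_subset[OF that] by (simp add: topspace_zariski)
    then show ?thesis by (simp add: subtopology_subtopology irreducible_iff_prime Int_absorb1)
  qed
  then have "(\<exists>Z. prime_chain X Z n) \<longleftrightarrow> (\<exists>Z :: nat \<Rightarrow> 'g set.
     (\<forall>i\<le>n. closedin (subtopology zariski X) (Z i) \<and>
        irreducible_space (subtopology (subtopology zariski X) (Z i))) \<and>
     (\<forall>i<n. Z i \<subset> Z (Suc i)))" for n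
    unfolding prime_chain_def by (intro ex_cong1) auto
  then show ?thesis by (simp add: zariski_dim_def krull_dim_def)
qed

lemma van_strict:
  assumes "closedin (subtopology zariski X) Z" "Z \<subset> Z'" "Z' \<subseteq> X"
  shows "van Z' \<subset> van Z"
proof -
  obtain S where S: "S \<subseteq> alg_gen FF" "Z = {p \<in> X. \<forall>f\<in>S. f p = 0}"
    using assms(1) unfolding closedin_subtopology_zariski by blast
  obtain p where p: "p \<in> Z'" "p \<notin> Z" using assms(2) by blast
  then obtain f where f: "f \<in> S" "f p \<noteq> 0" using S assms(3) by blast
  then have "f \<in> van Z" "f \<notin> van Z'" using S p by (auto simp: vanishing_def)
  moreover have "van Z' \<subseteq> van Z" using assms(2) by (auto simp: vanishing_def)
  ultimately show ?thesis by blast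
qed

text \<open>Going up a chain of irreducible closed sets, the ideals decrease strictly and
  \<open>growth_step\<close> adds one to the growth each time.\<close>

lemma zariski_dim_le:
  assumes "growth_le FF (van X) N"
  shows "zariski_dim X \<le> enat N"
  unfolding zariski_dim_eq
proof (rule Sup_least, clarify)
  fix n Z assume c: "prime_chain X Z n"
  have "growth_ge FF (van (Z i)) i" if "i \<le> n" for i
    using that
  proof (induction i)
    case 0
    then have "fprime FF (van (Z 0))" using c by (simp add: prime_chain_def)
    then show ?case by (intro growth_ge_0 fideal_fsub) (auto simp: fprime_def)
  next
    case (Suc i)
    have "closedin (subtopology zariski X) (Z (Suc i))" using c Suc.prems by (simp add: prime_chain_def)
    then have "Z (Suc i) \<subseteq> X" using closedin_subset by (fastforce simp: topspace_zariski)
    then have "van (Z (Suc i)) \<subset> van (Z i)"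
      using c Suc.prems by (intro van_strict[of X]) (auto simp: prime_chain_def)
    then show ?case
      using c Suc by (intro growth_step[OF _ fideal_vanishing]) (auto simp: prime_chain_def)
  qed
  then have g: "growth_ge FF (van (Z n)) n" by blast
  have "Z n \<subseteq> X" using c closedin_subset[of "subtopology zariski X" "Z n"] by (auto simp: prime_chain_def topspace_zariski)
  then have "van X \<subseteq> van (Z n)" by (auto simp: vanishing_def)
  then have "growth_ge FF (van X) n" by (rule growth_ge_antimono_ideal[OF g])
  then show "enat n \<le> enat N" using growth_ge_le[OF _ assms] by simp
qed

definition rel_closure :: "'g set \<Rightarrow> 'g set \<Rightarrow> 'g set" where
  "rel_closure X Y = {p \<in> X. \<forall>f\<in>van Y. f p = 0}"

lemma rel_closure: "closedin (subtopology zariski X) (rel_closure X Y)" "Y \<subseteq> X \<Longrightarrow> van (rel_closure X Y) = van Y"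
proof -
  show "closedin (subtopology zariski X) (rel_closure X Y)"
    unfolding closedin_subtopology_zariski rel_closure_def by (intro exI[of _ "van Y"]) (auto simp: vanishing_def)
  show "Y \<subseteq> X \<Longrightarrow> van (rel_closure X Y) = van Y"
    by (auto simp: rel_closure_def vanishing_def)
qed

lemma zariski_dim_ge:
  assumes "prime_chain X Z n"
  shows "enat n \<le> zariski_dim X"
  unfolding zariski_dim_eq by (rule Sup_upper) (use assms in blast)

section \<open>Polynomial curves and irreducibility\<close>

definition pcurve :: "(complex \<Rightarrow> 'g) \<Rightarrow> bool" where
  "pcurve g \<longleftrightarrow> (\<exists>M a. \<forall>t. g t = (\<Sum>j\<le>M. t ^ j \<odot> a j))"

lemma pcurveI: "(\<And>t. g t = (\<Sum>j\<le>M. t ^ j \<odot> a j)) \<Longrightarrow> pcurve g"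
  unfolding pcurve_def by (rule exI[of _ M], rule exI[of _ a]) simp

lemma pcurve_const: "pcurve (\<lambda>_. v)"
  by (rule pcurveI[where M = 0 and a = "\<lambda>_. v"]) simp

lemma pcurve_add:
  assumes "pcurve g" "pcurve g'"
  shows "pcurve (\<lambda>t. g t + g' t)"
proof -
  obtain M a M' a' where g: "\<forall>t. g t = (\<Sum>j\<le>M. t ^ j \<odot> a j)" "\<forall>t. g' t = (\<Sum>j\<le>M'. t ^ j \<odot> a' j)"
    using assms unfolding pcurve_def by blast
  define N where "N = max M M'"
  have "(\<Sum>j\<le>M. t ^ j \<odot> a j) = (\<Sum>j\<le>N. t ^ j \<odot> (if j \<le> M then a j else 0))" for t
    by (intro sum.mono_neutral_cong_left) (auto simp: N_def)
  moreover have "(\<Sum>j\<le>M'. t ^ j \<odot> a' j) = (\<Sum>j\<le>N. t ^ j \<odot> (if j \<le> M' then a' j else 0))" for t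
    by (intro sum.mono_neutral_cong_left) (auto simp: N_def)
  ultimately have "g t + g' t
      = (\<Sum>j\<le>N. t ^ j \<odot> ((if j \<le> M then a j else 0) + (if j \<le> M' then a' j else 0)))" for t
    using g by (simp add: scale_right_distrib sum.distrib)
  then show ?thesis by (rule pcurveI)
qed

lemma pcurve_lin:
  assumes "lin T" "pcurve g"
  shows "pcurve (\<lambda>t. T (g t))"
proof -
  obtain M a where "\<forall>t. g t = (\<Sum>j\<le>M. t ^ j \<odot> a j)" using assms(2) unfolding pcurve_def by blast
  then show ?thesis by (intro pcurveI[where M = M and a = "\<lambda>j. T (a j)"]) (simp add: linD[OF assms(1)])
qed

lemma pcurve_affine:
  assumes "pcurve g"
  shows "pcurve (\<lambda>t. (a + t * b) \<odot> g t)"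
proof -
  obtain M c where g: "\<forall>t. g t = (\<Sum>j\<le>M. t ^ j \<odot> c j)" using assms unfolding pcurve_def by blast
  have "t \<odot> g t = (\<Sum>j\<le>Suc M. t ^ j \<odot> (case j of 0 \<Rightarrow> 0 | Suc i \<Rightarrow> c i))" for t
    unfolding g[rule_format] by (subst sum.atMost_Suc_shift) (simp add: scale_sum_right)
  then have "pcurve (\<lambda>t. t \<odot> g t)" by (rule pcurveI)
  then have "pcurve (\<lambda>t. a \<odot> g t + b \<odot> (t \<odot> g t))"
    by (intro pcurve_add pcurve_lin[OF lin_scale[OF lin_ident]] assms)
  then show ?thesis by (simp add: scale_left_distrib mult.commute)
qed

lemma poly_along_pcurve:
  assumes "pcurve g" "F \<in> alg_gen FF"
  obtains p where "\<And>t. poly p t = F (g t)"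
proof -
  obtain M a where g: "\<forall>t. g t = (\<Sum>j\<le>M. t ^ j \<odot> a j)" using assms unfolding pcurve_def by blast
  obtain p where "\<forall>t. poly p t = F (\<Sum>j\<le>M. t ^ j \<odot> a j)"
    using poly_along_arc[of F a M] assms(2) by (auto simp: carrier_coord_ring)
  then show ?thesis using g by (intro that[of p]) simp
qed

text \<open>Restricted to a polynomial curve inside Z through two given points, a product that
  vanishes on Z becomes a vanishing product of one-variable polynomials.\<close>

lemma fprime_pcurves:
  assumes "Z \<noteq> {}" "\<And>x y. x \<in> Z \<Longrightarrow> y \<in> Z \<Longrightarrow> \<exists>g. pcurve g \<and> g 0 = x \<and> g 1 = y \<and> (\<forall>t. g t \<in> Z)"
  shows "fprime FF (van Z)"
  unfolding fprime_vanishing_iff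
proof (intro conjI ballI impI assms(1))
  fix u v assume uv: "u \<in> alg_gen FF" "v \<in> alg_gen FF" "\<forall>x\<in>Z. u x * v x = 0"
  show "(\<forall>x\<in>Z. u x = 0) \<or> (\<forall>x\<in>Z. v x = 0)"
  proof (rule ccontr)
    assume "\<not> ((\<forall>x\<in>Z. u x = 0) \<or> (\<forall>x\<in>Z. v x = 0))"
    then obtain x y where xy: "x \<in> Z" "u x \<noteq> 0" "y \<in> Z" "v y \<noteq> 0" by blast
    obtain g where g: "pcurve g" "g 0 = x" "g 1 = y" "\<And>t. g t \<in> Z" using assms(2) xy by blast
    obtain p where p: "\<And>t. poly p t = u (g t)" using poly_along_pcurve[OF g(1) uv(1)] by blast
    obtain q where q: "\<And>t. poly q t = v (g t)" using poly_along_pcurve[OF g(1) uv(2)] by blast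
    have "poly (p * q) t = 0" for t using uv(3) g(4) by (simp add: p q)
    then have "p * q = 0" using poly_all_0_iff_0 by blast
    then have "p = 0 \<or> q = 0" by simp
    then show False using p[of 0] q[of 1] xy g by auto
  qed
qed

text \<open>Parameters of extremal exponentials enter quadratically; the bound 2 k is the reason why
  2 k + 1 zeros are decisive in \<open>growth_hyperplane\<close>.\<close>

lemma poly_quadratic_curve:
  assumes "fdeg FF k F"
  shows "\<exists>p. degree p \<le> 2 * k \<and> (\<forall>t. poly p t = F (A + t \<odot> B + (t * t) \<odot> C))"
  using assms
proof (induction rule: fdeg.induct)
  case (const k c)
  show ?case by (rule exI[of _ "[:c:]"]) simp
next
  case (gen \<phi> k)
  then show ?case
    by (intro exI[of _ "[:\<phi> A, \<phi> B, \<phi> C:]"]) (simp add: functionalD algebra_simps)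
next
  case (add k F G)
  then obtain p q where "degree p \<le> 2 * k" "\<forall>t. poly p t = F (A + t \<odot> B + (t * t) \<odot> C)"
    "degree q \<le> 2 * k" "\<forall>t. poly q t = G (A + t \<odot> B + (t * t) \<odot> C)" by blast
  then show ?case by (intro exI[of _ "p + q"]) (simp add: degree_add_le)
next
  case (mult j F k G)
  then obtain p q where pq: "degree p \<le> 2 * j" "\<forall>t. poly p t = F (A + t \<odot> B + (t * t) \<odot> C)"
    "degree q \<le> 2 * k" "\<forall>t. poly q t = G (A + t \<odot> B + (t * t) \<odot> C)" by blast
  have "degree (p * q) \<le> 2 * (j + k)"    by (rule order_trans[OF degree_mult_le]) (use pq(1,3) in simp)
  then show ?case using pq by (intro exI[of _ "p * q"]) simp
qed

end

section \<open>Polynomial parametrisation of orbits\<close>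

context lie_algebra
begin

definition Ext :: "'g set" where "Ext = {x. \<forall>v. \<exists>c. br x (br x v) = c \<odot> x}"

lemma exp_ad_Ext:
  assumes "z \<in> Ext"
  shows "exp_ad (s \<odot> z) p = p + s \<odot> br z p + (s * s) \<odot> ((1 / 2) \<odot> br z (br z p))"
proof -
  have 3: "br z (br z (br z v)) = 0" for v
  proof -
    obtain c where "br z (br z v) = c \<odot> z" using assms by (auto simp: Ext_def)
    then show ?thesis by (simp add: br_simps br_self)
  qed
  have "(br (s \<odot> z) ^^ (n + 3)) p = 0" for n
    by (induction n) (simp_all add: numeral_3_eq_3 br_simps 3)
  then have "(br (s \<odot> z) ^^ n) p = 0" if "n \<ge> 3" for n
    using that by (metis le_add_diff_inverse2)
  then have "exp_ad (s \<odot> z) p = (\<Sum>n<3. (1 / fact n) \<odot> (br (s \<odot> z) ^^ n) p)"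
    by (rule exp_ad_nilpotent)
  also have "\<dots> = p + s \<odot> br z p + (s * s) \<odot> ((1 / 2) \<odot> br z (br z p))"
    by (simp add: numeral_3_eq_3 br_simps mult.commute)
  finally show ?thesis .
qed

fun Phi :: "(nat \<Rightarrow> 'g) \<Rightarrow> 'g \<Rightarrow> nat \<Rightarrow> (nat \<Rightarrow> complex) \<Rightarrow> 'g" where
  "Phi z x 0 s = x"
| "Phi z x (Suc r) s = exp_ad (s r \<odot> z r) (Phi z x r s)"

text \<open>The parameters from \<open>i\<close> on are frozen. For i = r nothing that matters is
  frozen, and for i = 0 a single point is left; a chain of closed sets is built between the
  two.\<close>

definition param_slice :: "(nat \<Rightarrow> 'g) \<Rightarrow> 'g \<Rightarrow> nat \<Rightarrow> nat \<Rightarrow> (nat \<Rightarrow> complex) \<Rightarrow> 'g set" where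
  "param_slice z x r i c = {Phi z x r s | s. \<forall>j\<ge>i. s j = c j}"

lemma Phi_cong: "(\<And>j. j < r \<Longrightarrow> s j = s' j) \<Longrightarrow> Phi z x r s = Phi z x r s'"
  by (induction r) auto

lemma Phi_cong_seq: "(\<And>j. j < r \<Longrightarrow> z j = z' j) \<Longrightarrow> Phi z x r s = Phi z' x r s"
  by (induction r) auto

text \<open>The parameter occurs in one exponential only, which is quadratic in it, and the later
  factors act linearly.\<close>

lemma Phi_quadratic:
  assumes "\<And>j. z j \<in> Ext"
  shows "\<exists>A B C. \<forall>t. Phi z x r (s(i := t)) = A + t \<odot> B + (t * t) \<odot> C"
proof (induction r)
  case 0
  show ?case by (rule exI[of _ x], rule exI[of _ 0], rule exI[of _ 0]) simp
next
  case (Suc r)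
  show ?case
  proof (cases "r = i")
    case True
    have "Phi z x r (s(i := t)) = Phi z x r s" for t by (rule Phi_cong) (use True in auto)
    then have "Phi z x (Suc r) (s(i := t)) = Phi z x r s + t \<odot> br (z r) (Phi z x r s)
        + (t * t) \<odot> ((1 / 2) \<odot> br (z r) (br (z r) (Phi z x r s)))" for t
      using exp_ad_Ext[OF assms, of t r] True by simp
    then show ?thesis by blast
  next
    case False
    obtain A B C where ABC: "\<And>t. Phi z x r (s(i := t)) = A + t \<odot> B + (t * t) \<odot> C" using Suc by blast
    let ?T = "exp_ad (s r \<odot> z r)"
    have "Phi z x (Suc r) (s(i := t)) = ?T A + t \<odot> ?T B + (t * t) \<odot> ?T C" for t
      using False by (simp add: ABC linD[OF lin_exp_ad] del: fun_upd_apply) (simp add: fun_upd_other)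
    then show ?thesis by blast
  qed
qed

lemma Phi_pcurve:
  assumes "\<And>j. z j \<in> Ext"
  shows "pcurve (\<lambda>t. Phi z x r (\<lambda>j. s j + t * d j))"
proof (induction r)
  case 0
  show ?case by (simp add: pcurve_const)
next
  case (Suc r)
  have 1: "pcurve (\<lambda>t. br (z r) (Phi z x r (\<lambda>j. s j + t * d j)))"
    by (rule pcurve_lin[OF lin_br Suc])
  have 2: "pcurve (\<lambda>t. (1 / 2) \<odot> br (z r) (br (z r) (Phi z x r (\<lambda>j. s j + t * d j))))"
    by (rule pcurve_lin[OF lin_scale[OF lin_br] 1])
  have "pcurve (\<lambda>t. Phi z x r (\<lambda>j. s j + t * d j)
      + (s r + t * d r) \<odot> br (z r) (Phi z x r (\<lambda>j. s j + t * d j))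
      + (s r + t * d r) \<odot> ((s r + t * d r) \<odot> ((1 / 2) \<odot> br (z r) (br (z r) (Phi z x r (\<lambda>j. s j + t * d j))))))"
    by (intro pcurve_add pcurve_affine Suc 1 2)
  then show ?case by (simp only: Phi.simps exp_ad_Ext[OF assms] scale_scale mult.assoc)
qed

lemma fprime_param_slice:
  assumes "\<And>j. z j \<in> Ext"
  shows "fprime FF (van (param_slice z x r i c))"
proof (rule fprime_pcurves)
  show "param_slice z x r i c \<noteq> {}" by (auto simp: param_slice_def)
  fix p q assume "p \<in> param_slice z x r i c" "q \<in> param_slice z x r i c"
  then obtain s s' where s: "p = Phi z x r s" "\<And>j. j \<ge> i \<Longrightarrow> s j = c j"
    "q = Phi z x r s'" "\<And>j. j \<ge> i \<Longrightarrow> s' j = c j" by (auto simp: param_slice_def)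
  let ?g = "\<lambda>t. Phi z x r (\<lambda>j. s j + t * (s' j - s j))"
  have "pcurve ?g" by (rule Phi_pcurve[OF assms])
  moreover have "?g 0 = p" "?g 1 = q" by (simp_all add: s)
  moreover have "?g t \<in> param_slice z x r i c" for t
    unfolding param_slice_def by (rule CollectI, rule exI[of _ "\<lambda>j. s j + t * (s' j - s j)"]) (simp add: s)
  ultimately show "\<exists>g. pcurve g \<and> g 0 = p \<and> g 1 = q \<and> (\<forall>t. g t \<in> param_slice z x r i c)" by blast
qed

text \<open>A function of degree \<open>k\<close> that vanishes on \<open>2 k + 1\<close> of the hyperplane sections vanishes
  identically, so only finitely many sections are small in degree \<open>k\<close>.\<close>

lemma growth_hyperplane:
  assumes z: "\<And>j. z j \<in> Ext" and g: "growth_ge FF (van (param_slice z x r (Suc i) c)) (Suc n)"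
  shows "\<exists>\<gamma>. growth_ge FF (van (param_slice z x r i (c(i := \<gamma>)))) n"
proof -
  let ?P = "van (param_slice z x r (Suc i) c)" and ?Q = "\<lambda>\<gamma>. van (param_slice z x r i (c(i := \<gamma>)))"
  let ?V = "\<lambda>k. {F. fdeg FF k F}"
  obtain c0 where c0: "c0 > 0" "\<And>k. k \<ge> 1 \<Longrightarrow> \<exists>N. rk (?V k) ?P N \<and> c0 * real k ^ Suc n \<le> real N"
    using g unfolding growth_ge_def by blast
  then obtain N where N: "\<And>k. k \<ge> 1 \<Longrightarrow> rk (?V k) ?P (N k) \<and> c0 * real k ^ Suc n \<le> real (N k)"
    by metis
  \<comment> \<open>Chosen so that 2 k + 1 sections of rank at most \<open>R k\<close> account for
    at most \<open>N k\<close> - 1 dimensions: some function of degree k then vanishes on all these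
    sections without vanishing on the whole.\<close>
  define R where "R k = (N k - 1) div (2 * k + 1)" for k
  define bad where "bad k = {\<gamma>. \<not> rk (?V k) (?Q \<gamma>) (Suc (R k))}" for k
  have fin: "finite (bad k)" if k: "k \<ge> 1" for k
  proof (rule ccontr)
    assume "infinite (bad k)"
    then obtain T where T: "T \<subseteq> bad k" "finite T" "card T = 2 * k + 1"
      using infinite_arbitrarily_large by blast
    let ?W = "?V k \<inter> (\<Inter>\<gamma>\<in>T. ?Q \<gamma>)"
    have r: "rk ?W ?P (N k - card T * R k)"
      using T(1) N[OF k]
      by (intro rk_cut_many fsub_fdeg T(2) fideal_fsub[OF fideal_vanishing]) (auto simp: bad_def)
    have "?W \<subseteq> ?P"
    proof
      fix F assume F: "F \<in> ?W"
      then have dF: "fdeg FF k F" by simp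
      have "F (Phi z x r s) = 0" if s: "\<forall>j\<ge>Suc i. s j = c j" for s
      proof -
        obtain A B C where ABC: "\<And>t. Phi z x r (s(i := t)) = A + t \<odot> B + (t * t) \<odot> C"
          using Phi_quadratic[of z x r s i, OF z] by blast
        obtain p where p: "degree p \<le> 2 * k" "\<And>t. poly p t = F (A + t \<odot> B + (t * t) \<odot> C)"
          using poly_quadratic_curve[OF dF] by blast
        have "poly p t = 0" if t: "t \<in> T" for t
        proof -
          have "Phi z x r (s(i := t)) \<in> param_slice z x r i (c(i := t))"
            unfolding param_slice_def using s by (intro CollectI exI[of _ "s(i := t)"]) auto
          then show ?thesis using F t by (auto simp: p(2) ABC vanishing_def)
        qed
        then have "T \<subseteq> {t. poly p t = 0}" by blast
        moreover have "card {t. poly p t = 0} \<le> degree p" if "p \<noteq> 0"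
          using that by (rule card_poly_roots_bound)
        ultimately have "p = 0"
          using T(3) p(1) card_mono[OF poly_roots_finite[of p], of T] by (cases "p = 0") auto
        then have "F (A + s i \<odot> B + (s i * s i) \<odot> C) = 0" using p(2) by (metis poly_0)
        then show ?thesis using ABC[of "s i"] by simp
      qed
      then show "F \<in> ?P" using fdeg_imp_alg_gen[OF dF] by (auto simp: vanishing_def param_slice_def)
    qed
    then have "N k - card T * R k = 0" using rk_self[OF _ fideal_fsub[OF fideal_vanishing] r] by blast
    moreover have "N k > 0"
    proof -
      have "0 < c0 * real k ^ Suc n" using c0(1) k by simp
      then show ?thesis using N[OF k] by linarith
    qed
    moreover have "card T * R k \<le> N k - 1" unfolding T(3) R_def by (rule times_div_less_eq_dividend)
    ultimately show False by linarith
  qed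
  \<comment> \<open>Every degree excludes finitely many values, so some complex number is good for
    all degrees at once.\<close>
  have "countable (\<Union>k\<in>{1..}. bad k)" using fin by (intro countable_UN) (auto intro: countable_finite)
  then have "(\<Union>k\<in>{1..}. bad k) \<noteq> UNIV" using uncountable_UNIV_complex by auto
  then obtain \<gamma> where \<gamma>: "\<And>k. k \<ge> 1 \<Longrightarrow> \<gamma> \<notin> bad k" by auto
  have "growth_ge FF (?Q \<gamma>) n"
    unfolding growth_ge_def
  proof (intro exI[of _ "c0 / 3"] conjI allI impI)
    show "c0 / 3 > 0" using c0(1) by simp
    fix k :: nat assume k: "k \<ge> 1"
    have "rk (?V k) (?Q \<gamma>) (Suc (R k))" using \<gamma>[OF k] by (simp add: bad_def)
    \<comment> \<open>The 3 comes from 2 k + 1 <= 3 k, valid as k >= 1.\<close>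
    moreover have "c0 / 3 * real k ^ n \<le> real (Suc (R k))"
    proof -
      have "N k - 1 < (2 * k + 1) * Suc (R k)"
        unfolding R_def using dividend_less_times_div[of "2 * k + 1" "N k - 1"] by simp
      then have "N k \<le> (2 * k + 1) * Suc (R k)" by linarith
      also have "\<dots> \<le> (3 * k) * Suc (R k)" using k by (intro mult_le_mono1) simp
      finally have "real (N k) \<le> real (3 * k * Suc (R k))" using of_nat_le_iff by blast
      then have "c0 * real k ^ Suc n \<le> 3 * real k * real (Suc (R k))"
        using N[OF k] by (simp only: of_nat_mult) linarith
      then have "real k * (c0 * real k ^ n) \<le> real k * (3 * real (Suc (R k)))"
        by (simp add: mult_ac del: of_nat_Suc)
      then have "c0 * real k ^ n \<le> 3 * real (Suc (R k))"
        using k by (simp del: of_nat_Suc)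
      then show ?thesis by simp
    qed
    ultimately show "\<exists>m. rk (?V k) (?Q \<gamma>) m \<and> c0 / 3 * real k ^ n \<le> real m" by blast
  qed
  then show ?thesis by blast
qed

lemma growth_singleton:
  assumes "growth_ge FF (van {p}) n"
  shows "n = 0"
proof (rule ccontr)
  assume "n \<noteq> 0"
  have "growth_le FF (van {p}) 0"
    unfolding growth_le_def
  proof (intro exI[of _ 1] allI impI)
    fix k m assume r: "rk {F. fdeg FF k F} (van {p}) m"
    have "m \<le> card {\<lambda>_::'g. 1 :: complex}"
    proof (rule rk_bound[OF _ fsub_fdeg fideal_fsub[OF fideal_vanishing] r])
      fix F assume "F \<in> {F. fdeg FF k F}"
      then have "F \<in> alg_gen FF" by (auto intro: fdeg_imp_alg_gen)
      then have "(\<lambda>x. F x - F p) \<in> van {p}" by (simp add: vanishing_def alg_gen_diff alg_gen.const)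
      moreover have "(\<lambda>_. F p) \<in> flin {\<lambda>_::'g. 1}"
        using flin_scale[OF flin_base[of "\<lambda>_. 1" "{\<lambda>_. 1}"], of "F p"] by simp
      ultimately show "\<exists>q\<in>van {p}. \<exists>w\<in>flin {\<lambda>_. 1}. F = (\<lambda>x. q x + w x)"
        by (intro bexI[of _ "\<lambda>x. F x - F p"] bexI[of _ "\<lambda>_. F p"]) auto
    qed simp
    then show "real m \<le> 1 * real (k + 1) ^ 0" by simp
  qed
  from growth_ge_le[OF assms this] show False using \<open>n \<noteq> 0\<close> by simp
qed

text \<open>Freezing a parameter generically lowers the growth by at most one. If it keeps growth
  \<open>n\<close>, its chain is reused with the top replaced by the larger closure. If not, the two
  ideals differ, the closures are distinct, and the chain becomes one longer.\<close>

lemma param_slice_chain: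
  assumes z: "\<And>j. z j \<in> Ext" and X: "param_slice z x r i c \<subseteq> X" and g: "growth_ge FF (van (param_slice z x r i c)) n"
  shows "\<exists>Z. prime_chain X Z n \<and> Z n = rel_closure X (param_slice z x r i c)"
  using X g
proof (induction i arbitrary: c n)
  case 0
  have "param_slice z x r 0 c = {Phi z x r c}"
  proof -
    have "s = c" if "\<forall>j\<ge>0. s j = c j" for s using that by auto
    then show ?thesis by (auto simp: param_slice_def)
  qed
  with 0 have "n = 0" using growth_singleton by metis
  moreover have "prime_chain X (\<lambda>_. rel_closure X (param_slice z x r 0 c)) 0"
    using rel_closure(1)[of X "param_slice z x r 0 c"] rel_closure(2)[of "param_slice z x r 0 c" X] 0(1) fprime_param_slice[of z, OF z] by (simp add: prime_chain_def)
  ultimately show ?case by blast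
next
  case (Suc i)
  let ?Y = "param_slice z x r (Suc i) c"
  show ?case
  proof (cases n)
    case 0
    have "prime_chain X (\<lambda>_. rel_closure X ?Y) 0"
      using rel_closure(1)[of X ?Y] rel_closure(2)[of ?Y X] Suc(2) fprime_param_slice[of z, OF z] by (simp add: prime_chain_def)
    then show ?thesis using 0 by blast
  next
    case n: (Suc m)
    then obtain \<gamma> where \<gamma>: "growth_ge FF (van (param_slice z x r i (c(i := \<gamma>)))) m"
      using growth_hyperplane[of z, OF z] Suc(3) by blast
    let ?Y' = "param_slice z x r i (c(i := \<gamma>))"
    have sub: "?Y' \<subseteq> ?Y"
    proof
      fix p assume "p \<in> ?Y'"
      then obtain s where s: "p = Phi z x r s" "\<forall>j\<ge>i. s j = (c(i := \<gamma>)) j" by (auto simp: param_slice_def)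
      have "\<forall>j\<ge>Suc i. s j = c j"
      proof (intro allI impI)
        fix j assume "j \<ge> Suc i"
        then show "s j = c j" using s(2)[rule_format, of j] by simp
      qed
      then show "p \<in> ?Y" using s(1) by (auto simp: param_slice_def)
    qed
    then have Y'X: "?Y' \<subseteq> X" using Suc(2) by blast
    have cl_sub: "rel_closure X ?Y' \<subseteq> rel_closure X ?Y" using sub by (auto simp: rel_closure_def vanishing_def)
    have good: "closedin (subtopology zariski X) (rel_closure X ?Y)" "fprime FF (van (rel_closure X ?Y))"
      using rel_closure(1)[of X ?Y] rel_closure(2)[of ?Y X] Suc(2) fprime_param_slice[of z, OF z] by auto
    show ?thesis
    proof (cases "growth_ge FF (van ?Y') n")
      case True
      then obtain Z where Z: "prime_chain X Z n" "Z n = rel_closure X ?Y'" using Suc.IH[OF Y'X] by blast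
      have "prime_chain X (Z(n := rel_closure X ?Y)) n"
        unfolding prime_chain_def
      proof (intro conjI allI impI)
        fix j assume "j \<le> n"
        then show "closedin (subtopology zariski X) ((Z(n := rel_closure X ?Y)) j)"
          "fprime FF (van ((Z(n := rel_closure X ?Y)) j))"
          using Z(1) good by (auto simp: prime_chain_def)
      next
        fix j assume j: "j < n"
        then have "Z j \<subset> Z (Suc j)" using Z(1) by (simp add: prime_chain_def)
        then show "(Z(n := rel_closure X ?Y)) j \<subset> (Z(n := rel_closure X ?Y)) (Suc j)"
          using j Z(2) cl_sub by auto
      qed
      then show ?thesis by (intro exI[of _ "Z(n := rel_closure X ?Y)"] conjI) (assumption, simp)
    next
      case False
      obtain Z where Z: "prime_chain X Z m" "Z m = rel_closure X ?Y'" using Suc.IH[OF Y'X \<gamma>] by blast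
      have "van ?Y \<noteq> van ?Y'" using False Suc(3) by metis
      then have "rel_closure X ?Y' \<noteq> rel_closure X ?Y" using rel_closure(2)[OF Y'X] rel_closure(2)[OF Suc(2)] by metis
      then have strict: "rel_closure X ?Y' \<subset> rel_closure X ?Y" using cl_sub by blast
      have "prime_chain X (Z(n := rel_closure X ?Y)) n"
        unfolding prime_chain_def
      proof (intro conjI allI impI)
        fix j assume "j \<le> n"
        then show "closedin (subtopology zariski X) ((Z(n := rel_closure X ?Y)) j)"
          "fprime FF (van ((Z(n := rel_closure X ?Y)) j))"
          using Z(1) good n by (auto simp: prime_chain_def)
      next
        fix j assume j: "j < n"
        show "(Z(n := rel_closure X ?Y)) j \<subset> (Z(n := rel_closure X ?Y)) (Suc j)"
        proof (cases "j = m")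
          case True
          then show ?thesis using n Z(2) strict by simp
        next
          case False
          then have "j < m" using j n by simp
          then have "Z j \<subset> Z (Suc j)" using Z(1) by (simp add: prime_chain_def)
          then show ?thesis using \<open>j < m\<close> n by simp
        qed
      qed
      then show ?thesis by (intro exI[of _ "Z(n := rel_closure X ?Y)"] conjI) (assumption, simp)
    qed
  qed
qed

end

section \<open>Orbits\<close>

context lie_algebra
begin

lemma lin_adjoint_group: "\<gamma> \<in> adjoint_group \<Longrightarrow> lin \<gamma>"
  by (induction rule: adjoint_group.induct) (auto simp: o_def id_def intro: lin_ident lin_comp[OF lin_exp_ad])

lemma adjoint_group_comp: "\<gamma> \<in> adjoint_group \<Longrightarrow> \<delta> \<in> adjoint_group \<Longrightarrow> \<gamma> \<circ> \<delta> \<in> adjoint_group"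
  by (induction rule: adjoint_group.induct) (auto simp: comp_assoc intro: adjoint_group.intros)

lemma orbit_self: "x \<in> orbit x"
  unfolding orbit_def using adjoint_group.intros(1) by (force simp: id_def)

lemma orbit_exp_ad: "p \<in> orbit x \<Longrightarrow> exp_ad y p \<in> orbit x"
proof -
  assume "p \<in> orbit x"
  then obtain \<gamma> where "\<gamma> \<in> adjoint_group" "p = \<gamma> x" by (auto simp: orbit_def)
  then have "exp_ad y \<circ> \<gamma> \<in> adjoint_group" "exp_ad y p = (exp_ad y \<circ> \<gamma>) x"
    by (auto intro: adjoint_group.intros(2))
  then show "exp_ad y p \<in> orbit x" unfolding orbit_def by blast
qed

lemma orbit_induct [consumes 1, case_names base step]:
  assumes "p \<in> orbit x" "P x" "\<And>p y. P p \<Longrightarrow> P (exp_ad y p)"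
  shows "P p"
proof -
  obtain \<gamma> where "\<gamma> \<in> adjoint_group" "p = \<gamma> x" using assms(1) by (auto simp: orbit_def)
  then show ?thesis by (induction arbitrary: p) (use assms(2,3) in auto)
qed

lemma orbit_scale:
  assumes "c \<odot> x \<in> orbit x" "p \<in> orbit x"
  shows "c \<odot> p \<in> orbit x"
proof -
  obtain \<gamma> \<delta> where g: "\<gamma> \<in> adjoint_group" "p = \<gamma> x" "\<delta> \<in> adjoint_group" "c \<odot> x = \<delta> x"
    using assms by (auto simp: orbit_def)
  have "c \<odot> p = (\<gamma> \<circ> \<delta>) x" using g(2,4) linD(2)[OF lin_adjoint_group[OF g(1)]] by (metis comp_apply)
  then show ?thesis using adjoint_group_comp[OF g(1,3)] unfolding orbit_def by blast
qed

lemma Phi_in_orbit: "Phi z x r s \<in> orbit x"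
  by (induction r) (auto intro: orbit_self orbit_exp_ad)

text \<open>Proportionality of (ad x)^2 z to x, expressed by the vanishing of 2 x 2 minors. As
  polynomial equations in x these can be differentiated along the group.\<close>

lemma Ext_iff:
  "x \<in> Ext \<longleftrightarrow> (\<forall>\<phi> \<psi> z. functional \<phi> \<and> functional \<psi> \<longrightarrow> quad \<phi> z x * \<psi> x - quad \<psi> z x * \<phi> x = 0)"
proof
  assume x: "x \<in> Ext"
  show "\<forall>\<phi> \<psi> z. functional \<phi> \<and> functional \<psi> \<longrightarrow> quad \<phi> z x * \<psi> x - quad \<psi> z x * \<phi> x = 0"
  proof (intro allI impI, elim conjE)
    fix \<phi> \<psi> z assume f: "functional \<phi>" "functional \<psi>"
    obtain c where "br x (br x z) = c \<odot> x" using x by (auto simp: Ext_def)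
    then show "quad \<phi> z x * \<psi> x - quad \<psi> z x * \<phi> x = 0"
      by (simp add: quad_def functionalD[OF f(1)] functionalD[OF f(2)])
  qed
next
  assume q: "\<forall>\<phi> \<psi> z. functional \<phi> \<and> functional \<psi> \<longrightarrow> quad \<phi> z x * \<psi> x - quad \<psi> z x * \<phi> x = 0"
  show "x \<in> Ext"
  proof (cases "x = 0")
    case True
    then show ?thesis by (simp add: Ext_def)
  next
    case False
    then obtain \<psi> where \<psi>: "functional \<psi>" "\<psi> x = 1"
      using separating_functional[of "{0}" x] by auto
    have "br x (br x z) = quad \<psi> z x \<odot> x" for z
    proof (rule functional_eqI)
      fix \<phi> assume \<phi>: "functional \<phi>"
      then show "\<phi> (br x (br x z)) = \<phi> (quad \<psi> z x \<odot> x)"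
        using q[rule_format, of \<phi> \<psi> z] \<psi> by (simp add: functionalD[OF \<phi>] quad_def)
    qed
    then show ?thesis by (auto simp: Ext_def)
  qed
qed

text \<open>The derivation \<open>fdiff y\<close> sends each minor to a combination of minors, by
  the product rule and \<open>fdiff_quad\<close>.\<close>

lemma exp_ad_in_Ext:
  assumes "x \<in> Ext"
  shows "exp_ad y x \<in> Ext"
  unfolding Ext_iff
proof (intro allI impI, elim conjE)
  fix \<phi> \<psi> z assume f: "functional \<phi>" "functional \<psi>"
  define K where "K \<phi> \<psi> z = (\<lambda>x. quad \<phi> z x * \<psi> x - quad \<psi> z x * \<phi> x)" for \<phi> \<psi> z
  have K_alt: "K \<phi> \<psi> z = (\<lambda>x. quad \<phi> z x * \<psi> x + (- 1) * (quad \<psi> z x * \<phi> x))" for \<phi> \<psi> z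
    by (simp add: K_def)
  define \<G> where "\<G> = {K \<phi> \<psi> z | \<phi> \<psi> z. functional \<phi> \<and> functional \<psi>}"
  note alg = quad_in_alg in_alg alg_gen.mult alg_gen_scale
  have "K \<phi> \<psi> z (exp_ad y x) = 0"
  proof (rule exp_ad_vanish_flin[of \<G>])
    show "\<G> \<subseteq> alg_gen FF"
    proof
      fix g assume "g \<in> \<G>"
      then obtain \<phi> \<psi> z where "functional \<phi>" "functional \<psi>" "g = K \<phi> \<psi> z" by (auto simp: \<G>_def)
      then show "g \<in> alg_gen FF" unfolding K_def by (simp add: alg_gen_diff alg)
    qed
    show "K \<phi> \<psi> z \<in> \<G>" using f by (auto simp: \<G>_def)
    fix g assume "g \<in> \<G>"
    then obtain \<phi> \<psi> z where g: "functional \<phi>" "functional \<psi>" "g = K \<phi> \<psi> z" by (auto simp: \<G>_def)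
    show "g x = 0" using assms g unfolding Ext_iff K_def by simp
    have f': "functional (\<lambda>v. \<phi> (br y v))" "functional (\<lambda>v. \<psi> (br y v))"
      using g functional_lin[OF _ lin_br] by auto
    have "fdiff y (K \<phi> \<psi> z) = (\<lambda>x. K (\<lambda>v. \<phi> (br y v)) \<psi> z x
        + (K \<phi> (\<lambda>v. \<psi> (br y v)) z x + (- 1) * K \<phi> \<psi> (br y z) x))"
      unfolding K_alt
      by (subst fdiff_add, (intro alg g)+, subst fdiff_scale, (intro alg g)+,
          subst (1 2) fdiff_mult, (intro alg g)+)
        (simp add: fdiff_quad[OF g(1)] fdiff_quad[OF g(2)] fdiff_functional g(1,2) algebra_simps)
    moreover have "(\<lambda>x. K (\<lambda>v. \<phi> (br y v)) \<psi> z x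
        + (K \<phi> (\<lambda>v. \<psi> (br y v)) z x + (- 1) * K \<phi> \<psi> (br y z) x)) \<in> flin \<G>"
      by (intro flin_add flin_scale flin_base) (use g f' in \<open>auto simp: \<G>_def\<close>)
    ultimately show "fdiff y g \<in> flin \<G>" using g(3) by simp
  qed
  then show "quad \<phi> z (exp_ad y x) * \<psi> (exp_ad y x) - quad \<psi> z (exp_ad y x) * \<phi> (exp_ad y x) = 0"
    by (simp add: K_def)
qed

lemma coordinate_generators:
  shows "co ` Bs \<subseteq> FF" "\<phi> \<in> FF \<Longrightarrow> fdeg (co ` Bs) 1 \<phi>"
proof -
  show "co ` Bs \<subseteq> FF" using functional_co by auto
  assume "\<phi> \<in> FF"
  then have "\<phi> = (\<lambda>x. \<Sum>b\<in>Bs. \<phi> b * co b x)" using functional_expand by auto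
  moreover have "fdeg (co ` Bs) 1 (\<lambda>x. \<Sum>b\<in>Bs. \<phi> b * co b x)"
    by (intro fdeg_sum fdeg_scale Bs(1)) (use fdeg.gen[of _ "co ` Bs" 0] in auto)
  ultimately show "fdeg (co ` Bs) 1 \<phi>" by simp
qed

lemma growth_le_rational_FF:
  assumes U: "finite U" "U \<subseteq> alg_gen FF" and P: "fprime FF P" and D: "D \<in> alg_gen U" "D \<notin> P"
    and rat: "\<And>\<phi>. functional \<phi> \<Longrightarrow> rational_mod U P D \<phi>"
  shows "growth_le FF P (card U)"
proof -
  have alg: "alg_gen FF = alg_gen (co ` Bs)" by (rule fdeg_generators(2)[OF coordinate_generators])
  have "fprime (co ` Bs) P" using P unfolding fprime_def fideal_def alg .
  then have "growth_le (co ` Bs) P (card U)"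
    using U D rat functional_co Bs(1) unfolding alg by (intro growth_le_rational[of "co ` Bs" U P D]) auto
  then show ?thesis using growth_le_generators[OF coordinate_generators] by blast
qed

text \<open>A bound common to all prime ideals. It guarantees that a parametrisation of largest
  growth exists.\<close>

lemma growth_le_coordinates:
  assumes "fprime FF P"
  shows "growth_le FF P (card (co ` Bs))"
proof (rule growth_le_rational_FF[OF _ _ assms])
  show "co ` Bs \<subseteq> alg_gen FF" using functional_co by (auto intro: in_alg)
  show "(\<lambda>_. 1) \<in> alg_gen (co ` Bs)" by (rule alg_gen.const)
  show "(\<lambda>_. 1) \<notin> P" using assms by (simp add: fprime_def)
  show "rational_mod (co ` Bs) P (\<lambda>_. 1) \<phi>" if "functional \<phi>" for \<phi>
  proof (rule rational_modI)
    show "\<phi> \<in> alg_gen (co ` Bs)"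
      using that fdeg_generators(2)[OF coordinate_generators] in_alg by metis
    show "(\<lambda>x. 1 ^ 0 * \<phi> x - \<phi> x) \<in> P" using assms by (simp add: fprime_def fideal_def)
  qed
qed (use Bs(1) in auto)

end

section \<open>The Killing form\<close>

context extremal_triple
begin

definition kappa :: "'g \<Rightarrow> 'g \<Rightarrow> complex" where "kappa x y = tr (\<lambda>v. br x (br y v))"

lemma functional_kappa: "functional (kappa x)"
proof (rule functionalI)
  fix a b :: 'g and c
  show "kappa x (a + b) = kappa x a + kappa x b"
    by (simp add: kappa_def br_simps tr_add)
  show "kappa x (c \<odot> a) = c * kappa x a"
    by (simp add: kappa_def br_simps tr_scale)
qed

lemma kappa_sym: "kappa x y = kappa y x"
  unfolding kappa_def by (rule tr_comp[OF lin_br lin_br])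

lemma kappa_invariant: "kappa (br x y) z = kappa x (br y z)"
proof -
  have "kappa (br x y) z = tr (\<lambda>v. br x (br y (br z v))) - tr (\<lambda>v. br y (br x (br z v)))"
    by (simp add: kappa_def br_br_left tr_diff)
  also have "tr (\<lambda>v. br y (br x (br z v))) = tr (\<lambda>v. br x (br z (br y v)))"
    by (rule tr_comp[OF lin_br lin_br_comp[OF lin_br]])
  finally show ?thesis by (simp add: kappa_def br_br_left br_simps tr_diff)
qed

text \<open>In a basis of weight vectors the trace of (ad h)^2 is a sum of squares of integers,
  which is 0 only if \<open>h\<close> acts trivially.\<close>

lemma kappa_h: "kappa h h \<noteq> 0"
proof -
  define S where "S = (\<Union>i. gs i)"
  have "v \<in> span S" for v
  proof -
    have "pr i v \<in> span S" for i using pr_in_gs by (intro span_base) (auto simp: S_def)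
    then show ?thesis by (subst pr_sum) (intro span_add)
  qed
  moreover obtain B where B: "B \<subseteq> S" "independent B" "S \<subseteq> span B"
    using maximal_independent_subset[of S] by metis
  ultimately have sp: "span B = UNIV" by (metis UNIV_eq_I span_minimal subsetD subspace_span)
  have finB: "finite B" by (rule finiteI_independent[OF B(2)])
  have "\<forall>b\<in>B. \<exists>i. b \<in> gs i" using B(1) by (auto simp: S_def)
  then obtain w where w: "\<And>b. b \<in> B \<Longrightarrow> b \<in> gs (w b)" by metis
  have r: "representation B (br h (br h b)) b = of_int (w b * w b)" if b: "b \<in> B" for b
  proof -
    have "br h (br h b) = of_int (w b * w b) \<odot> b" using gsD[OF w[OF b]] by (simp add: br_simps)
    then show ?thesis
      using representation_scale[OF B(2), of b] representation_basis[OF B(2) b] sp by simp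
  qed
  have k: "kappa h h = (\<Sum>b\<in>B. of_int (w b * w b))"
    unfolding kappa_def tr_basis[OF lin_br_comp[OF lin_br] B(2) sp] using r by (intro sum.cong) auto
  then have "kappa h h = of_int (\<Sum>b\<in>B. w b * w b)" by simp
  moreover have "(\<Sum>b\<in>B. w b * w b) \<noteq> 0"
  proof
    assume "(\<Sum>b\<in>B. w b * w b) = 0"
    then have "\<forall>b\<in>B. w b * w b = 0" using finB by (subst (asm) sum_nonneg_eq_0_iff) auto
    then have "br h b = 0" if "b \<in> B" for b using gsD[OF w[OF that]] that by simp
    then have "br h e \<in> {0}"
      using br_span_right[of B h "{0}" e] sp by auto
    then show False using he e0 by simp
  qed
  ultimately show ?thesis by (metis of_int_eq_0_iff)
qed

text \<open>By invariance the radical of the form is an ideal, and it does not contain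
  \<open>h\<close>.\<close>

lemma kappa_nondegenerate:
  assumes "\<And>y. kappa x y = 0"
  shows "x = 0"
proof (rule ccontr)
  assume "x \<noteq> 0"
  have f: "functional (\<lambda>x. kappa x y)" for y
    using functional_kappa[of y] by (subst kappa_sym)
  define R where "R = {x. \<forall>y. kappa x y = 0}"
  have "R = UNIV"
  proof (rule ideal_eq_UNIV)
    show "subspace R"
      by (rule subspaceI) (auto simp: R_def functionalD[OF f] functional_more[OF f])
    show "R \<noteq> {0}" using assms \<open>x \<noteq> 0\<close> by (auto simp: R_def)
    fix u v assume "v \<in> R"
    then have "kappa (br v u) y = 0" for y unfolding kappa_invariant by (simp add: R_def)
    then have "kappa (br u v) y = 0" for y
      by (subst br_anti) (simp add: functional_more[OF f])
    then show "br u v \<in> R" by (simp add: R_def)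
  qed
  then have "h \<in> R" by simp
  then show False using kappa_h by (simp add: R_def)
qed

lemma kappa_represents:
  assumes "functional \<phi>"
  shows "\<exists>z. \<forall>y. kappa z y = \<phi> y"
proof -
  have f: "functional (\<lambda>x. kappa x y)" for y
    using functional_kappa[of y] by (subst kappa_sym)
  define T where "T z = (\<Sum>b\<in>Bs. kappa z b \<odot> b)" for z
  have T: "lin T"
    by (rule linI) (simp_all add: T_def functionalD[OF f] scale_left_distrib sum.distrib scale_sum_right)
  have co_T: "co b (T z) = kappa z b" if "b \<in> Bs" for b z
  proof -
    have "co b (T z) = (\<Sum>b'\<in>Bs. if b' = b then kappa z b' else 0)"
      unfolding T_def functionalD(3)[OF functional_co]
      by (intro sum.cong) (auto simp: functionalD[OF functional_co] co_basis that)
    then show ?thesis using that Bs(1) by simp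
  qed
  have "T ` UNIV = UNIV"
  proof (rule inj_on_imp_surj_on[OF T subspace_UNIV])
    fix z assume "T z = 0"
    then have k: "kappa z b = 0" if "b \<in> Bs" for b
      using co_T[OF that, of z] functional_more(1)[OF functional_co] by simp
    have "kappa z y = 0" for y
      by (subst functional_expand[OF functional_kappa]) (simp add: k)
    then show "z = 0" by (rule kappa_nondegenerate)
  qed simp
  then obtain z where z: "T z = (\<Sum>b\<in>Bs. \<phi> b \<odot> b)" by (metis UNIV_I imageE)
  have "kappa z b = \<phi> b" if b: "b \<in> Bs" for b
  proof -
    have "co b (\<Sum>b'\<in>Bs. \<phi> b' \<odot> b') = (\<Sum>b'\<in>Bs. if b' = b then \<phi> b' else 0)"
      unfolding functionalD(3)[OF functional_co]
      by (intro sum.cong) (auto simp: functionalD[OF functional_co] co_basis b)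
    then show ?thesis using co_T[OF b, of z] b Bs(1) unfolding z by simp
  qed
  then have "kappa z y = \<phi> y" for y
    using functional_expand[OF functional_kappa, of z y] functional_expand[OF assms, of y] by simp
  then show ?thesis by blast
qed

text \<open>If \<open>z\<close> commutes with the nilpotent \<open>x\<close> then \<open>ad z \<circ> ad x\<close> is nilpotent,
  so \<open>x\<close> is orthogonal to its centraliser, whose orthogonal complement is the image of \<open>ad x\<close>.\<close>

lemma nilpotent_in_image:
  assumes "\<And>v. (br x ^^ n) v = 0"
  shows "\<exists>y. br y x = x"
proof -
  have "x \<in> range (br x)"
  proof (rule ccontr)
    assume "x \<notin> range (br x)"
    then obtain \<phi> where \<phi>: "functional \<phi>" "\<And>w. w \<in> range (br x) \<Longrightarrow> \<phi> w = 0" "\<phi> x = 1"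
      using separating_functional[OF subspace_lin_image[OF lin_br subspace_UNIV]] by metis
    obtain z where z: "\<And>y. kappa z y = \<phi> y" using kappa_represents[OF \<phi>(1)] by blast
    have "kappa (br z x) y = 0" for y
      unfolding kappa_invariant z using \<phi>(2) by blast
    then have "br z x = 0" by (rule kappa_nondegenerate)
    then have comm: "br z (br x v) = br x (br z v)" for v using br_deriv[of z x v] by simp
    have "((\<lambda>v. br z (br x v)) ^^ m) v = (br z ^^ m) ((br x ^^ m) v)" for m v
    proof (induction m)
      case (Suc m)
      have "br x ((br z ^^ m) u) = (br z ^^ m) (br x u)" for u
        by (induction m) (simp_all add: comm[symmetric])
      then show ?case by (simp add: Suc)
    qed simp
    then have "((\<lambda>v. br z (br x v)) ^^ n) v = 0" for v
      using assms by (simp add: linD(3)[OF lin_funpow[OF lin_br]])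
    then have "kappa z x = 0"
      unfolding kappa_def by (rule tr_nilpotent[OF lin_br_comp[OF lin_br]])
    then show False using z \<phi>(3) by simp
  qed
  then obtain y where "x = br x y" by blast
  then have "br (- y) x = x" using br_anti[of y x] by (simp add: br_minus)
  then show ?thesis by blast
qed

text \<open>With [y, x] = x the exponential of s y multiplies x by e^s, and s = \<open>Ln c\<close>
  realises the scalar c.\<close>

lemma nilpotent_cone:
  assumes "nilpotent x" "c \<noteq> 0" "p \<in> orbit x"
  shows "c \<odot> p \<in> orbit x"
proof (rule orbit_scale[OF _ assms(3)])
  obtain y where "br y x = x" using assms(1) nilpotent_in_image unfolding nilpotent_def by blast
  then have "exp_ad (Ln c \<odot> y) x = exp (Ln c * 1) \<odot> x" by (intro exp_ad_eigenvector) simp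
  then have "exp_ad (Ln c \<odot> y) x = c \<odot> x" using assms(2) by simp
  then show "c \<odot> x \<in> orbit x" using orbit_exp_ad[OF orbit_self] by metis
qed

section \<open>The ideal of an orbit\<close>

lemma e_Ext: "e \<in> Ext" and f_Ext: "f \<in> Ext"
  using extremal_e f_ext by (auto simp: Ext_def)

text \<open>The set is stable under all exponentials, so its span is stable under their derivatives
  and is a nonzero ideal.\<close>

lemma span_Ext: "span Ext = UNIV"
proof (rule ideal_eq_UNIV)
  show "span Ext \<noteq> {0}" using span_base[OF e_Ext] e0 by auto
  fix x y assume "y \<in> span Ext"
  then show "br x y \<in> span Ext"
  proof (rule br_span_right[OF _ subspace_span, rotated])
    fix t assume "t \<in> Ext"
    then show "br x t \<in> span Ext"
      by (intro exp_ad_stable_derivation[OF subspace_span] span_base exp_ad_in_Ext)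
  qed
qed simp

definition orbit_param :: "(nat \<Rightarrow> 'g) \<Rightarrow> 'g \<Rightarrow> nat \<Rightarrow> 'g set" where
  "orbit_param z x r = param_slice z x r r (\<lambda>_. 0)"

lemma orbit_param_eq: "orbit_param z x r = range (Phi z x r)"
proof -
  have "Phi z x r s = Phi z x r (\<lambda>j. if j < r then s j else 0)" for s
    by (rule Phi_cong) simp
  then show ?thesis
    unfolding orbit_param_def param_slice_def by (auto intro!: exI[of _ "\<lambda>j. if j < r then _ j else 0"])
qed

text \<open>A parametrisation by products of \<open>exp (ad z)\<close> with extremal \<open>z\<close> that is maximal for its growth
  cannot be enlarged, so its ideal is stable under the derivations \<open>fdiff z\<close> and hence under the
  whole group.\<close>

lemma orbit_param_exists:
  obtains z r where "\<And>j. z j \<in> Ext" "van (orbit_param z x r) = van (orbit x)"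
    "\<And>F y. F \<in> van (orbit x) \<Longrightarrow> fdiff y F \<in> van (orbit x)"
proof -
  define Q where "Q n \<longleftrightarrow> (\<exists>z r. (\<forall>j. z j \<in> Ext) \<and> growth_ge FF (van (orbit_param z x r)) n)" for n
  have prime: "fprime FF (van (orbit_param z x r))" if "\<forall>j. z j \<in> Ext" for z r
    unfolding orbit_param_def by (rule fprime_param_slice) (use that in blast)
  have bound: "n < Suc (card (co ` Bs))" if q: "Q n" for n
  proof -
    obtain z r where zr: "\<forall>j. z j \<in> Ext" "growth_ge FF (van (orbit_param z x r)) n"
      using q unfolding Q_def by blast
    then show ?thesis using growth_ge_le[OF zr(2) growth_le_coordinates[OF prime]] by simp
  qed
  have "Q 0"
    unfolding Q_def
  proof (intro exI conjI allI)
    show "growth_ge FF (van (orbit_param (\<lambda>_. e) x 0)) 0"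
      using prime[of "\<lambda>_. e" 0] e_Ext
      by (intro growth_ge_0 fideal_fsub) (auto simp: fprime_def)
  qed (rule e_Ext)
  then obtain n where n: "Q n" "\<And>m. Q m \<Longrightarrow> m \<le> n"
    using ex_has_greatest_nat[of Q 0 id "Suc (card (co ` Bs))"] bound by auto
  then obtain z r where z: "\<forall>j. z j \<in> Ext" and gr: "growth_ge FF (van (orbit_param z x r)) n"
    unfolding Q_def by blast
  define I where "I = van (orbit_param z x r)"
  have ext_zero: "F (exp_ad (s \<odot> y) p) = 0"
    if y: "y \<in> Ext" and F: "F \<in> I" and p: "p \<in> orbit_param z x r" for y F p s
  proof -
    define z' where "z' = z(r := y)"
    have z': "\<forall>j. z' j \<in> Ext" using z y by (simp add: z'_def)
    have Phi': "Phi z' x r t = Phi z x r t" for t by (rule Phi_cong_seq) (simp add: z'_def)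
    have mem: "exp_ad (s \<odot> y) p \<in> orbit_param z' x (Suc r)" if p: "p \<in> orbit_param z x r" for p s
    proof -
      obtain t where t: "p = Phi z x r t" using p unfolding orbit_param_eq by blast
      have "Phi z' x r (t(r := s)) = p" unfolding Phi' t by (rule Phi_cong) simp
      then have "exp_ad (s \<odot> y) p = Phi z' x (Suc r) (t(r := s))" by (simp add: z'_def)
      then show ?thesis unfolding orbit_param_eq by blast
    qed
    have "orbit_param z x r \<subseteq> orbit_param z' x (Suc r)"
    proof
      fix p assume "p \<in> orbit_param z x r"
      from mem[OF this, of 0] show "p \<in> orbit_param z' x (Suc r)"
        using exp_ad_Ext[OF y, of 0 p] by simp
    qed
    then have sub: "van (orbit_param z' x (Suc r)) \<subseteq> I" by (auto simp: I_def vanishing_def)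
    have "van (orbit_param z' x (Suc r)) = I"
    proof (rule ccontr)
      assume "van (orbit_param z' x (Suc r)) \<noteq> I"
      then have "van (orbit_param z' x (Suc r)) \<subset> I" using sub by blast
      then have "growth_ge FF (van (orbit_param z' x (Suc r))) (Suc n)"
        using gr unfolding I_def by (intro growth_step[OF prime[OF z'] fideal_vanishing])
      then have "Q (Suc n)" using z' unfolding Q_def by blast
      then show False using n(2) by fastforce
    qed
    then show ?thesis using F mem[OF p, of s] by (auto simp: vanishing_def)
  qed
  have I_alg: "I \<subseteq> alg_gen FF" by (auto simp: I_def vanishing_def)
  have D_Ext: "fdiff y F p = 0" if y: "y \<in> Ext" and F: "F \<in> I" and p: "p \<in> orbit_param z x r" for y F p
  proof -
    \<comment> \<open>The exponential arc of an extremal element is exactly this quadratic arc, so F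
      vanishing along it makes the linear jet coefficient vanish, and that coefficient is
      \<open>fdiff y F p\<close>.\<close>
    define a where "a j = (if j = 0 then p else if j = 1 then br y p else (1 / 2) \<odot> br y (br y p))" for j :: nat
    have "(\<Sum>j\<le>2. t ^ j \<odot> a j) = exp_ad (t \<odot> y) p" for t
      by (simp add: exp_ad_Ext[OF y] a_def numeral_2_eq_2)
    then have "poly 0 t = F (\<Sum>j\<le>2. t ^ j \<odot> a j)" for t using ext_zero[OF y F p] by simp
    then have "jet_coeff 2 F 1 a = poly.coeff 0 1" by (rule jet_coeff_eqI)
    moreover have "jet_coeff 1 F 1 (\<lambda>j. if j = 0 then p else br y p) = jet_coeff 2 F 1 a"
      using F I_alg by (intro jet_coeff_1) (auto simp: a_def)
    ultimately show ?thesis by (simp add: fdiff_def)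
  qed
  \<comment> \<open>The derivation depends linearly on y, and extremal elements span.\<close>
  have D: "fdiff y F \<in> I" if F: "F \<in> I" for y F
  proof -
    have "F \<in> alg_gen FF" using F I_alg by blast
    have "fdiff y F p = 0" if p: "p \<in> orbit_param z x r" for p
    proof -
      have "y \<in> span Ext" by (simp add: span_Ext)
      then show ?thesis
      proof (induction rule: span_induct_alt)
        case base
        then show ?case using fdiff_linear(2)[OF \<open>F \<in> alg_gen FF\<close>, of 0 0] by simp
      next
        case (step c t y)
        then show ?case using D_Ext[OF _ F p] by (simp add: fdiff_linear[OF \<open>F \<in> alg_gen FF\<close>])
      qed
    qed
    then show ?thesis using fdiff_in_alg[OF \<open>F \<in> alg_gen FF\<close>] by (simp add: I_def vanishing_def)
  qed
  have "F p = 0" if "p \<in> orbit x" and F: "F \<in> I" for p F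
  proof -
    from that(1) have "\<forall>F\<in>I. F p = 0"
    proof (induction rule: orbit_induct)
      case base
      have "x \<in> orbit_param z x r"
      proof -
        have "Phi z x r (\<lambda>_. 0) = x"
          by (induction r) (use z exp_ad_Ext[of _ 0] in auto)
        then show ?thesis unfolding orbit_param_eq by (metis rangeI)
      qed
      then show ?case by (auto simp: I_def vanishing_def)
    next
      case (step p y)
      then show ?case using exp_ad_vanish[OF I_alg D] by blast
    qed
    then show ?thesis using F by blast
  qed
  then have "I \<subseteq> van (orbit x)" using I_alg by (auto simp: vanishing_def)
  moreover have "van (orbit x) \<subseteq> I"
    using Phi_in_orbit by (auto simp: I_def vanishing_def orbit_param_eq)
  ultimately have "I = van (orbit x)" by blast
  then show ?thesis using that[of z r] z D by (auto simp: I_def)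
qed

lemma fprime_orbit: "fprime FF (van (orbit x))"
proof -
  obtain z r where z: "\<And>j. z j \<in> Ext" "van (orbit_param z x r) = van (orbit x)"
    using orbit_param_exists by metis
  then show ?thesis using fprime_param_slice[of z x r r "\<lambda>_. 0"] by (simp add: orbit_param_def)
qed

lemma fdiff_van_orbit: "F \<in> van (orbit x) \<Longrightarrow> fdiff y F \<in> van (orbit x)"
  using orbit_param_exists by metis

text \<open>The parametrised set lies in the orbit and has the same ideal, so the chain consists of
  relatively closed subsets of the orbit itself.\<close>

lemma zariski_dim_orbit_ge:
  assumes "growth_ge FF (van (orbit x)) n"
  shows "enat n \<le> zariski_dim (orbit x)"
proof -
  obtain z r where z: "\<And>j. z j \<in> Ext" "van (orbit_param z x r) = van (orbit x)"
    using orbit_param_exists by metis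
  have "param_slice z x r r (\<lambda>_. 0) \<subseteq> orbit x" using Phi_in_orbit by (auto simp: param_slice_def)
  then obtain Z where "prime_chain (orbit x) Z n"
    using param_slice_chain[of z x r r "\<lambda>_. 0" "orbit x" n] z assms by (auto simp: orbit_param_def)
  then show ?thesis by (rule zariski_dim_ge)
qed

lemma van_orbit_exp_ad:
  assumes "\<forall>F\<in>van (orbit x). F p = 0" "F \<in> van (orbit x)"
  shows "F (exp_ad y p) = 0"
  by (rule exp_ad_vanish[of "van (orbit x)"]) (use assms fdiff_van_orbit in \<open>auto simp: vanishing_def\<close>)

text \<open>The common zeros of the functionals vanishing on the orbit form an ideal, since these
  functionals are stable under the derivations; it contains x.\<close>

lemma functional_van_orbit:
  assumes "x \<noteq> 0" "functional \<phi>" "\<And>p. p \<in> orbit x \<Longrightarrow> \<phi> p = 0"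
  shows "\<phi> v = 0"
proof -
  define N where "N = {v. \<forall>\<psi>. functional \<psi> \<and> \<psi> \<in> van (orbit x) \<longrightarrow> \<psi> v = 0}"
  have "N = UNIV"
  proof (rule ideal_eq_UNIV)
    show "subspace N"
      by (rule subspaceI) (auto simp: N_def functionalD functional_more)
    have "x \<in> N" using orbit_self by (auto simp: N_def vanishing_def)
    then show "N \<noteq> {0}" using assms(1) by blast
    fix y v assume v: "v \<in> N"
    show "br y v \<in> N"
      unfolding N_def
    proof (intro CollectI allI impI, elim conjE)
      fix \<psi> assume \<psi>: "functional \<psi>" "\<psi> \<in> van (orbit x)"
      have "(\<lambda>v. \<psi> (br y v)) \<in> van (orbit x)"
        using fdiff_van_orbit[OF \<psi>(2), of y] by (simp add: fdiff_functional[OF \<psi>(1)])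
      then show "\<psi> (br y v) = 0" using v functional_lin[OF \<psi>(1) lin_br] by (auto simp: N_def)
    qed
  qed
  moreover have "\<phi> \<in> van (orbit x)" using assms(2,3) by (simp add: vanishing_def in_alg)
  ultimately show ?thesis using assms(2) by (auto simp: N_def)
qed

text \<open>Scaling by \<open>\<lambda>\<^sup>2 exp (s h)\<close> with \<open>\<lambda> = e\<^sup>s\<close> and letting \<open>\<lambda>\<close> tend to \<open>0\<close> moves a point of the
  cone to its component of weight \<open>- 2\<close>.\<close>

lemma van_orbit_f:
  assumes "nilpotent x" "x \<noteq> 0"
  shows "van (orbit x) \<subseteq> van (orbit f)"
proof -
  have "\<not> (\<forall>p\<in>orbit x. alpha p = 0)"
    using functional_van_orbit[OF assms(2) alpha(1), of f] alpha_f by auto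
  then obtain p where p: "p \<in> orbit x" "alpha p \<noteq> 0" by blast
  \<comment> \<open>The coefficient of t^j in t^2 \<open>exp_ad\<close> (s h) p with t = e^s: the
    factor t^2 shifts the weights - 2, ..., 2 to the exponents 0, ..., 4.\<close>
  define a where "a j = pr (int j - 2) p" for j
  have "F (alpha p \<odot> f) = 0" if F: "F \<in> van (orbit x)" for F
  proof -
    have Fa: "F \<in> alg_gen FF" using F by (simp add: vanishing_def)
    obtain P where P: "\<And>t. poly P t = F (\<Sum>j\<le>4. t ^ j \<odot> a j)"
      using poly_along_arc[of F a 4] Fa by (auto simp: carrier_coord_ring)
    have sum4: "(\<Sum>j\<le>4. t ^ j \<odot> a j)
        = pr (- 2) p + t \<odot> pr (- 1) p + t ^ 2 \<odot> pr 0 p + t ^ 3 \<odot> pr 1 p + t ^ 4 \<odot> pr 2 p" for t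
      by (simp add: a_def numeral_eq_Suc)
    have "poly P t = 0" if t: "t \<noteq> 0" for t
    proof -
      define s where "s = Ln t"
      have et: "exp s = t" using t by (simp add: s_def)
      have w: "exp_ad (s \<odot> h) (pr i p) = exp (s * of_int i) \<odot> pr i p" for i
        by (rule exp_ad_eigenvector[OF gsD[OF pr_in_gs]])
      have "exp_ad (s \<odot> h) p = exp_ad (s \<odot> h) (pr (- 2) p + pr (- 1) p + pr 0 p + pr 1 p + pr 2 p)"
        using pr_sum[of p] by simp
      also have "\<dots> = exp (- 2 * s) \<odot> pr (- 2) p + exp (- s) \<odot> pr (- 1) p + pr 0 p
          + exp s \<odot> pr 1 p + exp (2 * s) \<odot> pr 2 p"
        by (simp add: linD(1)[OF lin_exp_ad] w mult.commute)
      finally have "t ^ 2 \<odot> exp_ad (s \<odot> h) p = (t ^ 2 * exp (- 2 * s)) \<odot> pr (- 2) p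
          + (t ^ 2 * exp (- s)) \<odot> pr (- 1) p + t ^ 2 \<odot> pr 0 p
          + (t ^ 2 * exp s) \<odot> pr 1 p + (t ^ 2 * exp (2 * s)) \<odot> pr 2 p"
        by (simp add: scale_right_distrib)
      moreover have e2: "exp (s * 2) = t * t" using exp_double[of s] et by (simp add: mult.commute power2_eq_square)
      then have "t ^ 2 * exp (- 2 * s) = 1" "t ^ 2 * exp (- s) = t" "t ^ 2 * exp s = t ^ 3"
        "t ^ 2 * exp (2 * s) = t ^ 4"
        using t et by (simp_all add: exp_minus power2_eq_square power3_eq_cube power4_eq_xxxx field_simps)
      ultimately have "t ^ 2 \<odot> exp_ad (s \<odot> h) p = (\<Sum>j\<le>4. t ^ j \<odot> a j)" unfolding sum4 by simp
      moreover have "t ^ 2 \<odot> exp_ad (s \<odot> h) p \<in> orbit x"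
        using t p(1) by (intro nilpotent_cone[OF assms(1)] orbit_exp_ad) auto
      ultimately show ?thesis using F by (simp add: P vanishing_def)
    qed
    then have "UNIV - {0} \<subseteq> {t. poly P t = 0}" by auto
    then have "infinite {t. poly P t = 0}"
      using infinite_UNIV_char_0[where 'a = complex] finite_subset by (metis finite_Diff2 finite.emptyI finite_insert)
    then have "P = 0" using poly_roots_finite by blast
    then show ?thesis using P[of 0] unfolding sum4 by (simp add: pr_minus2)
  qed
  then have af: "\<forall>F\<in>van (orbit x). F (alpha p \<odot> f) = 0" by blast
  \<comment> \<open>The exponential of s h multiplies \<open>f\<close> by e^(- 2 s), which is to
    cancel \<open>alpha p\<close>.\<close>
  define s where "s = Ln (alpha p) / 2"
  have "exp_ad (s \<odot> h) (alpha p \<odot> f) = f"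
  proof -
    have "exp_ad (s \<odot> h) (alpha p \<odot> f) = exp (s * (- 2)) \<odot> (alpha p \<odot> f)"
      by (rule exp_ad_eigenvector) (simp add: br_simps hf mult.commute)
    also have "exp (s * (- 2)) = 1 / alpha p"
      using p(2) by (simp add: s_def exp_minus field_simps)
    finally show ?thesis using p(2) by simp
  qed
  then have "\<forall>F\<in>van (orbit x). F f = 0" using van_orbit_exp_ad[OF af] by metis
  have "\<forall>F\<in>van (orbit x). F q = 0" if "q \<in> orbit f" for q
    using that
  proof (induction rule: orbit_induct)
    case base
    show ?case by fact
  next
    case (step p y)
    then show ?case using van_orbit_exp_ad by blast
  qed
  then show ?thesis by (auto simp: vanishing_def)
qed

lemma nilpotent_f: "nilpotent f"
  unfolding nilpotent_def
proof
  have "br h f \<in> br_span UNIV UNIV" unfolding br_span_def by (rule span_base) blast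
  then have "(- 1 / 2) \<odot> br h f \<in> br_span UNIV UNIV" unfolding br_span_def by (rule span_scale)
  then show "f \<in> br_span UNIV UNIV" by (simp add: hf)
  have "br f (br f (br f v)) = 0" for v
  proof -
    obtain c where "br f (br f v) = c \<odot> f" using f_ext by blast
    then show ?thesis by (simp add: br_simps br_self)
  qed
  then show "\<exists>n. \<forall>y. (br f ^^ n) y = 0" by (intro exI[of _ 3]) (simp add: numeral_3_eq_3)
qed

end

section \<open>Rational coordinates on the orbit of an extremal element\<close>

context extremal_triple
begin

lemma orbit_f_Ext: "p \<in> orbit f \<Longrightarrow> p \<in> Ext"
  by (induction rule: orbit_induct) (auto intro: f_Ext exp_ad_in_Ext)

lemma pr_br:
  assumes a: "a \<in> gs j"
  shows "pr i (br a x) = br a (pr (i - j) x)"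
proof -
  have p: "pr i (br a (pr k x)) = (if i = j + k then br a (pr k x) else 0)" for k
    by (rule pr_gs[OF gs_br[OF a pr_in_gs]])
  have "br a x = br a (pr (- 2) x) + br a (pr (- 1) x) + br a (pr 0 x) + br a (pr 1 x) + br a (pr 2 x)"
    by (subst pr_sum[of x]) (simp only: br_add_right)
  then have s: "pr i (br a x) = (\<Sum>k\<in>{- 2, - 1, 0, 1, 2}. if i = j + k then br a (pr k x) else 0)"
    by (simp add: linD(1)[OF lin_pr] p add.assoc)
  show ?thesis
  proof (cases "i - j \<in> {- 2, - 1, 0, 1, 2}")
    case True
    have "(i = j + k) = (i - j = k)" for k by auto
    then show ?thesis unfolding s using True by (simp add: sum.delta)
  next
    case False
    then have "pr (i - j) x = 0" by (auto simp: pr_def weight_poly_def pev_0)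
    moreover have "(\<Sum>k\<in>{- 2, - 1, 0, 1, 2}. if i = j + k then br a (pr k x) else 0) = 0"
      using False by (intro sum.neutral) auto
    ultimately show ?thesis unfolding s by simp
  qed
qed

lemma pr_outside: "i < - 2 \<or> 2 < i \<Longrightarrow> pr i x = 0"
  by (auto simp: pr_def weight_poly_def pev_0)

lemma pr_br_e: "pr i (br e x) = br e (pr (i - 2) x)"
  by (rule pr_br[OF gs_mem(1)])

lemma br_e_components: "br e x = alpha x \<odot> h + pr 1 (br e x) + pr 2 (br e x)"
proof -
  have "pr 0 (br e x) = alpha x \<odot> h" by (simp add: pr_br_e pr_minus2 br_simps ef)
  moreover have "pr (- 1) (br e x) = 0" "pr (- 2) (br e x) = 0"
    by (simp_all add: pr_br_e pr_outside)
  ultimately show ?thesis using pr_sum[of "br e x"] by simp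
qed

text \<open>For extremal \<open>x\<close> the eigenvector equation \<open>[[e, x], x] = - 2 \<alpha> x\<close> determines the
  components of \<open>x\<close> recursively from \<open>[e, x]\<close>.\<close>

lemma component_recursion:
  assumes "x \<in> Ext"
  shows "(alpha x ^ 2 * of_int (i + 2)) \<odot> pr i x
    = - (alpha x \<odot> (br (pr 1 (br e x)) (pr (i - 1) x) + br (pr 2 (br e x)) (pr (i - 2) x)))"
proof -
  define u where "u = br e x"
  obtain c where c: "br x (br x e) = c \<odot> x" using assms by (auto simp: Ext_def)
  have ux: "br u x = c \<odot> x"
    using c br_anti[of x e] br_anti[of u x] by (simp add: u_def br_minus)
  have pru: "pr i (br u x) = of_int i \<odot> (alpha x \<odot> pr i x) + br (pr 1 u) (pr (i - 1) x) + br (pr 2 u) (pr (i - 2) x)" for i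
  proof -
    have "br u x = alpha x \<odot> br h x + br (pr 1 u) x + br (pr 2 u) x"
      using br_e_components[of x] unfolding u_def[symmetric] by (metis br_add_left br_scale_left)
    then have "pr i (br u x) = alpha x \<odot> pr i (br h x) + pr i (br (pr 1 u) x) + pr i (br (pr 2 u) x)"
      by (simp add: linD(1,2)[OF lin_pr])
    then show ?thesis
      by (simp add: pr_br[OF gs_mem(3)] pr_br[OF pr_in_gs] gsD[OF pr_in_gs] mult.commute)
  qed
  \<comment> \<open>The component of weight - 2 fixes the eigenvalue c = - 2 \<open>alpha x\<close>,
    up to the factor \<open>alpha x\<close>. Subtracting it from the eigenvalue i of
    \<open>h\<close> produces the factor i + 2.\<close>
  have "c \<odot> (alpha x \<odot> f) = pr (- 2) (br u x)" by (simp add: ux linD(2)[OF lin_pr] pr_minus2)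
  also have "\<dots> = (- 2 * (alpha x * alpha x)) \<odot> f" by (simp add: pru pr_outside pr_minus2)
  finally have "(c * alpha x) \<odot> f = (- 2 * (alpha x * alpha x)) \<odot> f" by simp
  then have c2: "c * alpha x = - 2 * (alpha x * alpha x)" using f0 by (simp only: scale_cancel_right) simp
  have "alpha x \<odot> pr i (br u x) = (c * alpha x) \<odot> pr i x" by (simp add: ux linD(2)[OF lin_pr] mult.commute)
  then have "alpha x \<odot> (of_int i \<odot> (alpha x \<odot> pr i x) + br (pr 1 u) (pr (i - 1) x) + br (pr 2 u) (pr (i - 2) x))
      = (- 2 * (alpha x * alpha x)) \<odot> pr i x"
    unfolding pru c2 .
  then have e: "co b (alpha x \<odot> (of_int i \<odot> (alpha x \<odot> pr i x) + br (pr 1 u) (pr (i - 1) x) + br (pr 2 u) (pr (i - 2) x)))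
      = co b ((- 2 * (alpha x * alpha x)) \<odot> pr i x)" for b by (rule arg_cong)
  show ?thesis
    unfolding u_def[symmetric]
  proof (rule vec_eqI)
    fix b
    show "co b ((alpha x ^ 2 * of_int (i + 2)) \<odot> pr i x)
        = co b (- (alpha x \<odot> (br (pr 1 u) (pr (i - 1) x) + br (pr 2 u) (pr (i - 2) x))))"
    proof -
      let ?a = "alpha x" and ?c = "co b (pr i x)"
      let ?s = "co b (br (pr 1 u) (pr (i - 1) x)) + co b (br (pr 2 u) (pr (i - 2) x))"
      have "?a ^ 2 * (of_int i + 2) * ?c = ?a * (of_int i * (?a * ?c) + ?s) + 2 * (?a * ?a) * ?c - ?a * ?s"
        by (simp add: power2_eq_square algebra_simps)
      also have "?a * (of_int i * (?a * ?c) + ?s) = - 2 * (?a * ?a) * ?c"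
        using e[of b] unfolding co_simps by (simp only: add.assoc)
      finally show ?thesis by (simp add: co_simps)
    qed
  qed
qed

lemma exp_ad_commute:
  assumes "\<And>v. br e (br y v) = br y (br e v)"
  shows "br e (exp_ad y p) = exp_ad y (br e p)"
proof (rule exp_ad_unique[symmetric])
  fix \<phi> assume \<phi>: "functional \<phi>"
  have "(br y ^^ n) (br e p) = br e ((br y ^^ n) p)" for n
    by (induction n) (simp_all add: assms)
  then show "(\<lambda>n. \<phi> ((br y ^^ n) (br e p)) / fact n) sums \<phi> (br e (exp_ad y p))"
    using exp_ad_sums[OF functional_lin[OF \<phi> lin_br[of e]], of y p] by simp
qed

text \<open>The point s f lies on the cone and has bracket s h with e. An exponential of a multiple
  of e supplies the e-component of the bracket, and one of weight 1, which commutes with ad e, the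
  component \<open>w\<close>.\<close>

lemma orbit_f_covers:
  assumes u: "u = s \<odot> h + w + d \<odot> e" "w \<in> gs 1" "s \<noteq> 0"
  shows "\<exists>x\<in>orbit f. br e x = u"
proof -
  \<comment> \<open>Solves - 2 k s = d; likewise \<open>w'\<close> is chosen so that [w', s h] =
    w.\<close>
  define k where "k = - d / (2 * s)"
  define w' where "w' = (- 1 / s) \<odot> w"
  have w': "w' \<in> gs 1" unfolding w'_def by (rule gs_scale[OF u(2)])
  have "br e w' \<in> gs (2 + 1)" by (intro gs_br gs_mem w')
  then have ew: "br e w' = 0" by (rule gs_zero) simp
  have wh: "br w' h = - w'" using br_anti[of w' h] gsD[OF w'] by simp
  have we: "br w' e = 0" using br_anti[of w' e] ew by simp
  define p where "p = exp_ad (k \<odot> e) (s \<odot> f)"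
  have sf: "s \<odot> f \<in> orbit f" by (rule nilpotent_cone[OF nilpotent_f u(3) orbit_self])
  have ep: "br e p = s \<odot> h + d \<odot> e"
  proof -
    have "br e p = s \<odot> h - (2 * k * s) \<odot> e"
      unfolding p_def exp_ad_Ext[OF e_Ext] by (simp add: br_simps ef eh br_self mult_ac)
    moreover have "2 * k * s = - d" using u(3) by (simp add: k_def)
    ultimately show ?thesis by simp
  qed
  have "br e (exp_ad w' p) = exp_ad w' (br e p)"
    using br_deriv[of e w'] ew by (intro exp_ad_commute) simp
  also have "\<dots> = (\<Sum>n<2. (1 / fact n) \<odot> (br w' ^^ n) (br e p))"
  proof (rule exp_ad_nilpotent)
    have "(br w' ^^ (n + 2)) (br e p) = 0" for n
      by (induction n) (simp_all add: ep br_simps wh we br_self numeral_2_eq_2)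
    then show "(br w' ^^ n) (br e p) = 0" if "2 \<le> n" for n
      using that by (metis le_add_diff_inverse2)
  qed
  also have "\<dots> = u"
  proof -
    have "s \<odot> w' = - w" using u(3) by (simp add: w'_def)
    then show ?thesis by (simp add: numeral_2_eq_2 ep br_simps wh we u(1))
  qed
  finally have "br e (exp_ad w' p) = u" .
  moreover have "exp_ad w' p \<in> orbit f" unfolding p_def by (intro orbit_exp_ad sf)
  ultimately show ?thesis by blast
qed

text \<open>The coordinates of x are those of [e, x] in a basis of the image of ad e. By
  \<open>component_recursion\<close> they generate all functions rationally, with denominator a
  power of \<open>alpha\<close>, and by \<open>orbit_f_covers\<close> they take all values with
  \<open>alpha\<close> nonzero.\<close>

lemma orbit_f_coordinates:
  obtains U A where "finite U" "card U = dim (range (br e))" "U \<subseteq> FF" "alpha \<in> alg_gen U"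
    "\<forall>\<phi>. functional \<phi> \<longrightarrow> rational_mod U (van (orbit f)) alpha \<phi>"
    "\<forall>u\<in>U. infinite (A u)"
    "\<forall>z\<in>PiE U A. \<exists>x\<in>orbit f. \<forall>u\<in>U. u x = (z u :: complex)"
proof -
  define R where "R = range (br e)"
  have sR: "subspace R" unfolding R_def by (rule subspace_lin_image[OF lin_br subspace_UNIV])
  \<comment> \<open>The basis is to consist of \<open>h\<close> and of vectors without component of
    weight 0, so that the coefficient of \<open>h\<close> in [e, x] is exactly
    \<open>alpha x\<close>.\<close>
  define V0 where "V0 = {u \<in> R. pr 0 u = 0}"
  have sV0: "subspace V0"
    unfolding V0_def by (rule subspaceI)
      (auto simp: linD[OF lin_pr] subspace_0[OF sR] subspace_add[OF sR] subspace_scale[OF sR])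
  obtain C where C: "finite C" "C \<subseteq> V0" "independent C" "span C = V0"
    using basis_subspace_exists[OF sV0] by metis
  have prh: "pr 0 h = h" using pr_gs[OF gs_mem(3), of 0] by simp
  have "h \<notin> V0" using prh h0 by (auto simp: V0_def)
  then have "h \<notin> span C" using C(4) by simp
  then have hC: "h \<notin> C" "independent (insert h C)"
    using independent_insertI[OF _ C(3), of h] span_base[of h C] by auto
  have hR: "h \<in> R" unfolding R_def using ef by (metis rangeI)
  have BR: "insert h C \<subseteq> R" using C(2) hR by (auto simp: V0_def)
  have spanR: "span (insert h C) = R"
  proof (intro equalityI)
    show "span (insert h C) \<subseteq> R" by (rule span_minimal[OF BR sR])
    show "R \<subseteq> span (insert h C)"
    proof
      fix u assume u: "u \<in> R"
      then obtain x where x: "u = br e x" by (auto simp: R_def)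
      have "pr 0 u = alpha x \<odot> h" by (simp add: x pr_br_e pr_minus2 br_simps ef)
      then have "u - alpha x \<odot> h \<in> V0"
        using u hR sR by (auto simp: V0_def linD[OF lin_pr] prh intro: subspace_diff subspace_scale)
      then have "u - alpha x \<odot> h \<in> span C" using C by simp
      then show "u \<in> span (insert h C)" by (auto simp: span_breakdown_eq)
    qed
  qed
  define B where "B = insert h C"
  have B: "finite B" "independent B" "span B = R" "card B = dim R"
    using C hC spanR dim_eq_card_independent[OF hC(2)] dim_span[of "insert h C"] by (auto simp: B_def)
  \<comment> \<open>The coordinates on the image must be functionals on the whole space, so the
    basis is extended.\<close>
  obtain D where D: "B \<subseteq> D" "independent D" "UNIV \<subseteq> span D"
    using maximal_independent_subset_extend[OF subset_UNIV B(2)] by metis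
  then have spD: "span D = UNIV" by blast
  define \<rho> where "\<rho> c u = representation D u c" for c u
  have f\<rho>: "functional (\<rho> c)" for c
    unfolding functional_def \<rho>_def
    by unfold_locales (simp_all add: representation_add representation_scale D spD)
  have \<rho>_basis: "\<rho> c c' = (if c = c' then 1 else 0)" if "c \<in> B" "c' \<in> B" for c c'
    using representation_basis[OF D(2), of c'] that D(1) by (auto simp: \<rho>_def)
  have expand: "u = (\<Sum>c\<in>B. \<rho> c u \<odot> c)" if "u \<in> R" for u
  proof -
    have "u \<in> span B" using that B(3) by simp
    then have "representation D u = representation B u"
      using D by (intro representation_extend) auto
    then show ?thesis
      using sum_representation_eq[OF B(2) \<open>u \<in> span B\<close> B(1) subset_refl] by (simp add: \<rho>_def)
  qed
  define \<upsilon> where "\<upsilon> c x = \<rho> c (br e x)" for c x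
  have f\<upsilon>: "functional (\<upsilon> c)" for c unfolding \<upsilon>_def[abs_def] by (rule functional_lin[OF f\<rho> lin_br])
  have inj: "inj_on \<upsilon> B"
  proof (rule inj_onI)
    fix c c' assume c: "c \<in> B" "c' \<in> B" "\<upsilon> c = \<upsilon> c'"
    obtain x where "br e x = c" using c(1) BR by (auto simp: B_def R_def)
    moreover have "\<upsilon> c x = \<upsilon> c' x" using c(3) by simp
    ultimately show "c = c'" using \<rho>_basis[OF c(1,1)] \<rho>_basis[OF c(2,1)] by (auto simp: \<upsilon>_def split: if_splits)
  qed
  define U where "U = \<upsilon> ` B"
  have U: "finite U" "card U = dim (range (br e))" "U \<subseteq> FF"
    using B card_image[OF inj] f\<upsilon> by (auto simp: U_def R_def)
  have in_U: "(\<lambda>x. \<psi> (br e x)) \<in> alg_gen U" if \<psi>: "functional \<psi>" for \<psi>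
  proof -
    have "\<psi> (br e x) = (\<Sum>c\<in>B. \<psi> c * \<upsilon> c x)" for x
      by (subst expand[of "br e x"]) (simp_all add: R_def functionalD[OF \<psi>] \<upsilon>_def mult.commute)
    moreover have "(\<lambda>x. \<Sum>c\<in>B. \<psi> c * \<upsilon> c x) \<in> alg_gen U"
      by (intro alg_gen_sum' alg_gen_scale alg_gen.gen B(1)) (auto simp: U_def)
    ultimately show ?thesis by simp
  qed
  have alphaU: "alpha \<in> alg_gen U"
  proof -
    obtain \<eta> where \<eta>: "functional \<eta>" "\<eta> h = 1" using separating_functional[of "{0}" h] h0 by auto
    have "alpha x = \<eta> (pr 0 (br e x))" for x
      by (simp add: pr_br_e pr_minus2 br_simps ef functionalD[OF \<eta>(1)] \<eta>(2))
    then have "alpha = (\<lambda>x. \<eta> (pr 0 (br e x)))" by auto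
    then show ?thesis using in_U[OF functional_lin[OF \<eta>(1) lin_pr]] by metis
  qed
  define rat where "rat = rational_mod U (van (orbit f)) alpha"
  have UFF: "U \<subseteq> alg_gen FF" using U(3) by (auto intro: alg_gen.gen)
  note ctxt = fideal_vanishing[of FF "orbit f"] UFF alphaU
  note rat_U = rational_mod_alg_gen[OF ctxt, folded rat_def]
    and rat_add = rational_mod_add[OF ctxt, folded rat_def]
    and rat_mult = rational_mod_mult[OF ctxt, folded rat_def]
    and rat_sum = rational_mod_sum[OF ctxt, folded rat_def]
  have br_expand: "\<phi> (br (pr j (br e x)) (pr i x)) = (\<Sum>b\<in>Bs. co b (pr i x) * \<phi> (br (pr j (br e x)) b))"
    if \<phi>: "functional \<phi>" for \<phi> i j x
  proof -
    have "br (pr j (br e x)) (pr i x) = br (pr j (br e x)) (\<Sum>b\<in>Bs. co b (pr i x) \<odot> b)"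
      by (simp only: co_expand)
    then show ?thesis by (simp only: linD[OF lin_br] functionalD[OF \<phi>])
  qed
  have f_br: "functional (\<lambda>v. \<phi> (br (pr j v) b))" if "functional \<phi>" for \<phi> j b
    by (rule functional_lin[OF functional_lin[OF that lin_br_left] lin_pr])
  have br_in_alg: "(\<lambda>x. \<phi> (br (pr j (br e x)) (pr i x))) \<in> alg_gen FF" if \<phi>: "functional \<phi>" for \<phi> i j
    unfolding br_expand[OF \<phi>]
    by (intro alg_gen_sum' alg_gen.mult in_alg functional_lin[OF functional_co lin_pr]
        functional_lin[OF f_br[OF \<phi>] lin_br] Bs(1))
  have rat_br: "rat (\<lambda>x. \<phi> (br (pr j (br e x)) (pr i x)))"
    if \<phi>: "functional \<phi>" and i: "\<And>\<phi>. functional \<phi> \<Longrightarrow> rat (\<lambda>x. \<phi> (pr i x))" for \<phi> i j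
  proof -
    have "rat (\<lambda>x. co b (pr i x) * \<phi> (br (pr j (br e x)) b))" for b
    proof (rule rat_mult)
      show "(\<lambda>x. co b (pr i x)) \<in> alg_gen FF" by (rule in_alg[OF functional_lin[OF functional_co lin_pr]])
      show "rat (\<lambda>x. co b (pr i x))" by (rule i[OF functional_co])
      show "rat (\<lambda>x. \<phi> (br (pr j (br e x)) b))" by (rule rat_U[OF in_U[OF f_br[OF \<phi>]]])
    qed
    then show ?thesis unfolding br_expand[OF \<phi>] by (intro rat_sum Bs(1))
  qed
  \<comment> \<open>The recursion expresses the component of weight i by the two lower weights after
    division by \<open>alpha x ^ 2 * (i + 2)\<close>; only i = - 2 is out of its reach, and there
    the component is \<open>alpha x\<close> times f.\<close>
  have step: "rat (\<lambda>x. \<phi> (pr i x))"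
    if \<phi>: "functional \<phi>" and i: "i \<noteq> - 2"
      and prev: "\<And>\<phi>. functional \<phi> \<Longrightarrow> rat (\<lambda>x. \<phi> (pr (i - 1) x))" "\<And>\<phi>. functional \<phi> \<Longrightarrow> rat (\<lambda>x. \<phi> (pr (i - 2) x))"
    for \<phi> i
  proof -
    let ?H = "\<lambda>x. \<phi> (br (pr 1 (br e x)) (pr (i - 1) x)) + \<phi> (br (pr 2 (br e x)) (pr (i - 2) x))"
    let ?K = "\<lambda>x. alpha x ^ 2 * \<phi> (pr i x) - (- 1 / of_int (i + 2)) * (alpha x * ?H x)"
    have i2: "of_int (i + 2) \<noteq> (0 :: complex)" using i by (metis add.inverse_unique add.commute of_int_eq_0_iff)
    have H: "?H \<in> alg_gen FF" by (intro alg_gen.add br_in_alg \<phi>)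
    have "?K x = 0" if x: "x \<in> orbit f" for x
    proof -
      have "\<phi> ((alpha x ^ 2 * of_int (i + 2)) \<odot> pr i x)
          = \<phi> (- (alpha x \<odot> (br (pr 1 (br e x)) (pr (i - 1) x) + br (pr 2 (br e x)) (pr (i - 2) x))))"
        using component_recursion[OF orbit_f_Ext[OF x], of i] by (rule arg_cong)
      then have "of_int (i + 2) * (alpha x ^ 2 * \<phi> (pr i x)) = - (alpha x * ?H x)"
        by (simp add: functionalD[OF \<phi>] functional_more[OF \<phi>] mult_ac del: of_int_add)
      then have "alpha x ^ 2 * \<phi> (pr i x) = - (alpha x * ?H x) / of_int (i + 2)"
        using i2 by (metis nonzero_mult_div_cancel_left)
      then show ?thesis by simp
    qed
    moreover have "?K \<in> alg_gen FF"
      using \<phi> by (intro alg_gen_diff alg_gen_scale alg_gen.mult alg_gen_power H in_alg alpha functional_lin[OF _ lin_pr])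
    ultimately have "rat ?K" unfolding rat_def by (intro rational_mod_ideal) (simp add: vanishing_def)
    moreover have "rat (\<lambda>x. (- 1 / of_int (i + 2)) * (alpha x * ?H x))"
      by (intro rat_mult rat_add rat_br \<phi> prev rat_U alphaU alg_gen.const in_alg alpha)
    ultimately have "rat (\<lambda>x. ?K x + (- 1 / of_int (i + 2)) * (alpha x * ?H x))" by (rule rat_add)
    then have "rat (\<lambda>x. alpha x ^ 2 * \<phi> (pr i x))" by (simp only: diff_add_cancel)
    then show ?thesis unfolding rat_def by (rule rational_mod_cancel)
  qed
  have z: "rat (\<lambda>x. \<phi> (pr i x))" if "functional \<phi>" "i < - 2" for \<phi> i
    using rat_U[OF alg_gen.const[of 0]] that by (simp add: pr_outside functional_more)
  have m2: "rat (\<lambda>x. \<phi> (pr (- 2) x))" if "functional \<phi>" for \<phi>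
    unfolding pr_minus2 functionalD(2)[OF that]
    by (rule rat_U) (intro alg_gen.mult alphaU alg_gen.const)
  have m1: "rat (\<lambda>x. \<phi> (pr (- 1) x))" if "functional \<phi>" for \<phi>
    by (rule step[OF that]) (use m2 z in auto)
  have c0: "rat (\<lambda>x. \<phi> (pr 0 x))" if "functional \<phi>" for \<phi>
    by (rule step[OF that]) (use m2 m1 in auto)
  have c1: "rat (\<lambda>x. \<phi> (pr 1 x))" if "functional \<phi>" for \<phi>
    by (rule step[OF that]) (use m1 c0 in auto)
  have c2: "rat (\<lambda>x. \<phi> (pr 2 x))" if "functional \<phi>" for \<phi>
    by (rule step[OF that]) (use c0 c1 in auto)
  have rational: "rat \<phi>" if \<phi>: "functional \<phi>" for \<phi>
  proof -
    have e: "\<phi> x = \<phi> (pr (- 2) x) + \<phi> (pr (- 1) x) + \<phi> (pr 0 x) + \<phi> (pr 1 x) + \<phi> (pr 2 x)" for x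
      by (subst pr_sum[of x]) (simp only: functionalD[OF \<phi>])
    have "\<phi> = (\<lambda>x. \<phi> (pr (- 2) x) + \<phi> (pr (- 1) x) + \<phi> (pr 0 x) + \<phi> (pr 1 x) + \<phi> (pr 2 x))"
      by (rule ext) (rule e)
    moreover have "rat (\<lambda>x. \<phi> (pr (- 2) x) + \<phi> (pr (- 1) x) + \<phi> (pr 0 x) + \<phi> (pr 1 x) + \<phi> (pr 2 x))"
      by (intro rat_add m2 m1 c0 c1 c2 \<phi>)
    ultimately show ?thesis by metis
  qed
  define A where "A u = (if u = \<upsilon> h then UNIV - {0} else UNIV :: complex set)" for u
  show ?thesis
  proof (rule that[OF U alphaU])
    show "\<forall>\<phi>. functional \<phi> \<longrightarrow> rational_mod U (van (orbit f)) alpha \<phi>"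
      using rational unfolding rat_def by blast
    show "\<forall>u\<in>U. infinite (A u)"
      using infinite_UNIV_char_0[where 'a = complex] by (auto simp: A_def)
    show "\<forall>z\<in>PiE U A. \<exists>x\<in>orbit f. \<forall>u\<in>U. u x = z u"
    proof
    fix z assume z: "z \<in> PiE U A"
    define u where "u = (\<Sum>c\<in>B. z (\<upsilon> c) \<odot> c)"
    have uR: "u \<in> R" unfolding u_def using BR by (intro subspace_sum[OF sR] subspace_scale[OF sR]) (auto simp: B_def)
    have "\<upsilon> h \<in> U" by (simp add: U_def B_def)
    then have zh: "z (\<upsilon> h) \<noteq> 0" using z by (force simp: A_def PiE_def Pi_def)
    have "pr 0 u = z (\<upsilon> h) \<odot> h"
    proof -
      have "pr 0 c = 0" if "c \<in> C" for c using C(2) that by (auto simp: V0_def)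
      then show ?thesis
        unfolding u_def B_def using C(1) hC(1) by (simp add: linD[OF lin_pr] prh)
    qed
    moreover obtain x0 where x0: "u = br e x0" using uR by (auto simp: R_def)
    moreover have "pr 0 (br e x0) = alpha x0 \<odot> h" by (simp add: pr_br_e pr_minus2 br_simps ef)
    ultimately have "alpha x0 = z (\<upsilon> h)" using h0 by simp
    moreover obtain d where "pr 2 (br e x0) = d \<odot> e" using gs_2[OF pr_in_gs] by blast
    ultimately have "u = z (\<upsilon> h) \<odot> h + pr 1 (br e x0) + d \<odot> e"
      using br_e_components[of x0] x0 by simp
    then obtain x where x: "x \<in> orbit f" "br e x = u"
      using orbit_f_covers[OF _ pr_in_gs zh] by blast
    have "\<upsilon> c x = z (\<upsilon> c)" if c: "c \<in> B" for c
    proof -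
      have "\<rho> c u = (\<Sum>c'\<in>B. if c = c' then z (\<upsilon> c') else 0)"
        unfolding u_def functionalD(3)[OF f\<rho>]
        by (intro sum.cong) (auto simp: functionalD[OF f\<rho>] \<rho>_basis c)
      then show ?thesis using c B(1) by (simp add: \<upsilon>_def x(2))
    qed
    then show "\<exists>x\<in>orbit f. \<forall>u\<in>U. u x = z u" using x(1) by (auto simp: U_def)
    qed
  qed
qed

lemma growth_orbit_f:
  "growth_le FF (van (orbit f)) (dim (range (br e)))" "growth_ge FF (van (orbit f)) (dim (range (br e)))"
proof -
  obtain U A where U: "finite U" "card U = dim (range (br e))" "U \<subseteq> FF" "alpha \<in> alg_gen U"
    and rat: "\<forall>\<phi>. functional \<phi> \<longrightarrow> rational_mod U (van (orbit f)) alpha \<phi>"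
    and A: "\<forall>u\<in>U. infinite (A u)" "\<forall>z\<in>PiE U A. \<exists>x\<in>orbit f. \<forall>u\<in>U. u x = (z u :: complex)"
    by (rule orbit_f_coordinates)
  have "growth_le FF (van (orbit f)) (card U)"
  proof (rule growth_le_rational_FF[OF U(1) _ fprime_orbit U(4)])
    show "U \<subseteq> alg_gen FF" using U(3) by (auto intro: alg_gen.gen)
    show "alpha \<notin> van (orbit f)" using orbit_self[of f] alpha_f by (auto simp: vanishing_def intro!: bexI[of _ f])
    show "rational_mod U (van (orbit f)) alpha \<phi>" if "functional \<phi>" for \<phi> using rat that by blast
  qed
  then show "growth_le FF (van (orbit f)) (dim (range (br e)))" using U(2) by simp
  have "growth_ge FF (van (orbit f)) (card U)"
  proof (rule growth_ge_box[OF U(1)])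
    show "fdeg FF 1 u" if "u \<in> U" for u using fdeg.gen[of u FF 0] that U(3) by auto
    show "infinite (A u)" if "u \<in> U" for u using A(1) that by blast
    show "\<exists>x\<in>orbit f. \<forall>u\<in>U. u x = z u" if "z \<in> PiE U A" for z using A(2) that by blast
  qed
  then show "growth_ge FF (van (orbit f)) (dim (range (br e)))" using U(2) by simp
qed

lemma zariski_dim_orbit_f: "zariski_dim (orbit f) = enat (dim (range (br e)))"
  using zariski_dim_le[OF growth_orbit_f(1)] zariski_dim_orbit_ge[OF growth_orbit_f(2)] by (rule antisym)

end

section \<open>Irreducible spectra\<close>

lemma fideal_imp_ideal:
  assumes "fideal F P"
  shows "ideal P (fun_ring (alg_gen F))"
proof -
  let ?R = "fun_ring (alg_gen F)"
  interpret R: cring ?R by (rule cring_fun_ring)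
  have minus: "\<ominus>\<^bsub>?R\<^esub> g = (\<lambda>x. - g x)" if "g \<in> alg_gen F" for g
    using that alg_gen_scale[OF that, of "- 1"] by (intro R.minus_equality) (auto simp: fun_ring_def)
  have r: "(\<lambda>x. a x * g x) \<in> P" if "a \<in> P" "g \<in> alg_gen F" for a g
    using fideal_mult[OF assms that(2,1)] by (simp add: mult.commute)
  show ?thesis
  proof (rule idealI[OF R.ring_axioms])
    show "subgroup P (add_monoid ?R)"
    proof (rule R.add.subgroupI)
      show "P \<subseteq> carrier ?R" using assms by (auto simp: fun_ring_def fideal_def)
      show "P \<noteq> {}" using assms by (auto simp: fideal_def)
      fix g assume g: "g \<in> P"
      then have "(\<lambda>x. - 1 * g x) \<in> P" using fsubD(3)[OF fideal_fsub[OF assms]] by blast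
      then show "\<ominus>\<^bsub>?R\<^esub> g \<in> P" using g assms by (subst minus) (auto simp: fideal_def)
    qed (use assms in \<open>auto simp: fun_ring_def fideal_def\<close>)
  qed (use assms r in \<open>auto simp: fun_ring_def intro: fideal_mult\<close>)
qed

lemma topspace_Spec: "topspace (Spec R) = {P. primeideal P R}"
proof -
  have "openin (Spec R) {P. primeideal P R}"
    unfolding openin_Spec
    by (intro exI[of _ "carrier R"]) (auto dest: primeideal.I_notcarr intro: ideal.Icarr primeideal.axioms(1))
  moreover have "P \<in> topspace (Spec R) \<Longrightarrow> primeideal P R" for P
    unfolding topspace_def openin_Spec by auto
  ultimately show ?thesis using openin_subset by blast
qed

lemma not_reducible_Spec:
  assumes "\<not> reducible_space (Spec R)" "a \<in> carrier R" "b \<in> carrier R"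
    and ab: "\<And>Q. primeideal Q R \<Longrightarrow> a \<otimes>\<^bsub>R\<^esub> b \<in> Q"
  shows "(\<forall>Q. primeideal Q R \<longrightarrow> a \<in> Q) \<or> (\<forall>Q. primeideal Q R \<longrightarrow> b \<in> Q)"
proof -
  have cl: "closedin (Spec R) {Q. primeideal Q R \<and> c \<in> Q}" if "c \<in> carrier R" for c
  proof -
    have "topspace (Spec R) - {Q. primeideal Q R \<and> c \<in> Q} = {Q. primeideal Q R \<and> \<not> {c} \<subseteq> Q}"
      by (auto simp: topspace_Spec)
    then show ?thesis
      unfolding closedin_def openin_Spec using that by (auto simp: topspace_Spec)
  qed
  have "{Q. primeideal Q R \<and> a \<in> Q} \<union> {Q. primeideal Q R \<and> b \<in> Q} = topspace (Spec R)"
    unfolding topspace_Spec using ab primeideal.I_prime[OF _ assms(2,3)] by blast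
  then have "{Q. primeideal Q R \<and> a \<in> Q} = topspace (Spec R) \<or> {Q. primeideal Q R \<and> b \<in> Q} = topspace (Spec R)"
    using assms(1) cl[OF assms(2)] cl[OF assms(3)] unfolding reducible_space_def by blast
  then show ?thesis unfolding topspace_Spec by blast
qed

text \<open>The point x as a prime of the quotient ring. An element of all primes must therefore
  vanish at x, which ties the nilradical to values of functions.\<close>

lemma point_primeideal:
  fixes F :: "('x \<Rightarrow> complex) set"
  assumes J: "ideal J (fun_ring (alg_gen F))" and x: "J \<subseteq> vanishing F {x}"
  defines "R \<equiv> fun_ring (alg_gen F)"
  defines "Q \<equiv> (\<lambda>g. J +>\<^bsub>R\<^esub> g) ` {g \<in> alg_gen F. g x = 0}"
  shows "primeideal Q (R Quot J)" "g \<in> alg_gen F \<Longrightarrow> J +>\<^bsub>R\<^esub> g \<in> Q \<longleftrightarrow> g x = 0"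
proof -
  interpret R: cring R unfolding R_def by (rule cring_fun_ring)
  interpret J: ideal J R using J unfolding R_def .
  have carr: "carrier R = alg_gen F" by (simp add: R_def fun_ring_def)
  have mem: "J +>\<^bsub>R\<^esub> g \<in> Q \<longleftrightarrow> g x = 0" if g: "g \<in> alg_gen F" for g
  proof
    assume "J +>\<^bsub>R\<^esub> g \<in> Q"
    then obtain g' where g': "g' \<in> alg_gen F" "g' x = 0" "J +>\<^bsub>R\<^esub> g = J +>\<^bsub>R\<^esub> g'" unfolding Q_def by blast
    then have "g \<in> J +>\<^bsub>R\<^esub> g'" using J.a_rcos_self[of g] g by (simp add: carr)
    then obtain j where "j \<in> J" "g = (\<lambda>x. j x + g' x)"
      by (auto simp: a_r_coset_def' R_def fun_ring_def)
    then show "g x = 0" using x g'(2) by (auto simp: vanishing_def)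
  qed (use g in \<open>auto simp: Q_def\<close>)
  then show "J +>\<^bsub>R\<^esub> g \<in> Q \<longleftrightarrow> g x = 0" if "g \<in> alg_gen F" for g using that .
  have "fideal F {g \<in> alg_gen F. g x = 0}"
    using fideal_vanishing[of F "{x}"] by (simp add: vanishing_def)
  then have "ideal {g \<in> alg_gen F. g x = 0} R" unfolding R_def by (rule fideal_imp_ideal)
  moreover have "J \<subseteq> {g \<in> alg_gen F. g x = 0}" using x by (auto simp: vanishing_def)
  ultimately have idl: "ideal Q (R Quot J)"
    using R.quot_ideal_correspondence[OF J.ideal_axioms] unfolding Q_def bij_betw_def by blast
  have carQ: "\<exists>g\<in>alg_gen F. X = J +>\<^bsub>R\<^esub> g" if "X \<in> carrier (R Quot J)" for X
    using that by (auto simp: FactRing_def A_RCOSETS_def' carr)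
  show "primeideal Q (R Quot J)"
  proof (rule primeidealI[OF idl J.quotient_is_cring[OF R.is_cring]])
    have "J +>\<^bsub>R\<^esub> (\<lambda>_. 1) \<notin> Q" using mem[OF alg_gen.const[of 1]] by simp
    moreover have "J +>\<^bsub>R\<^esub> (\<lambda>_. 1) \<in> carrier (R Quot J)"
      using ring_hom_closed[OF J.rcos_ring_hom, of "\<lambda>_. 1"] by (simp add: carr alg_gen.const)
    ultimately show "carrier (R Quot J) \<noteq> Q" by blast
    fix X Y assume XY: "X \<in> carrier (R Quot J)" "Y \<in> carrier (R Quot J)" "X \<otimes>\<^bsub>R Quot J\<^esub> Y \<in> Q"
    obtain a b where ab: "a \<in> alg_gen F" "X = J +>\<^bsub>R\<^esub> a" "b \<in> alg_gen F" "Y = J +>\<^bsub>R\<^esub> b"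
      using carQ XY(1,2) by meson
    have "X \<otimes>\<^bsub>R Quot J\<^esub> Y = J +>\<^bsub>R\<^esub> (a \<otimes>\<^bsub>R\<^esub> b)"
      unfolding ab using ring_hom_mult[OF J.rcos_ring_hom, of a b] ab by (simp add: carr)
    also have "a \<otimes>\<^bsub>R\<^esub> b = (\<lambda>x. a x * b x)" by (simp add: R_def fun_ring_def)
    finally have "a x * b x = 0" using XY(3) mem[OF alg_gen.mult[OF ab(1,3)]] by simp
    then show "X \<in> Q \<or> Y \<in> Q" using mem ab by auto
  qed
qed

text \<open>The witness is the preimage of the nilradical of the quotient ring.\<close>

lemma irreducible_Spec_prime:
  fixes F S :: "('x \<Rightarrow> complex) set"
  assumes S: "S \<subseteq> alg_gen F" and x0: "\<forall>s\<in>S. s x0 = 0"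
    and irr: "\<not> reducible_space (Spec (fun_ring (alg_gen F) Quot genideal (fun_ring (alg_gen F)) S))"
  obtains P where "fprime F P" "S \<subseteq> P" "\<forall>g\<in>P. \<forall>x. (\<forall>s\<in>S. s x = 0) \<longrightarrow> g x = 0"
proof -
  define R where "R = fun_ring (alg_gen F)"
  define J where "J = genideal R S"
  interpret R: cring R unfolding R_def by (rule cring_fun_ring)
  have carr: "carrier R = alg_gen F" by (simp add: R_def fun_ring_def)
  have J: "ideal J R" "S \<subseteq> J"
    unfolding J_def using R.genideal_ideal R.genideal_self S by (auto simp: carr)
  interpret J: ideal J R by (rule J(1))
  have J0: "J \<subseteq> vanishing F {x}" if "\<forall>s\<in>S. s x = 0" for x
  proof -
    have "S \<subseteq> vanishing F {x}" using S that by (auto simp: vanishing_def)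
    then show ?thesis
      unfolding J_def by (rule R.genideal_minimal[OF fideal_imp_ideal[OF fideal_vanishing[of F "{x}"], folded R_def]])
  qed
  define q where "q g = J +>\<^bsub>R\<^esub> g" for g
  have hom: "q \<in> ring_hom R (R Quot J)" using J.rcos_ring_hom by (simp add: q_def[abs_def])
  have q: "q g \<in> carrier (R Quot J)" "q (\<lambda>x. g x + g' x) = q g \<oplus>\<^bsub>R Quot J\<^esub> q g'"
    "q (\<lambda>x. g x * g' x) = q g \<otimes>\<^bsub>R Quot J\<^esub> q g'" if "g \<in> alg_gen F" "g' \<in> alg_gen F" for g g'
    using ring_hom_closed[OF hom, of g] ring_hom_add[OF hom, of g g'] ring_hom_mult[OF hom, of g g'] that
    by (simp_all add: R_def fun_ring_def)
  have qJ: "q g = \<zero>\<^bsub>R Quot J\<^esub>" if "g \<in> J" for g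
    using J.a_rcos_const[OF that] by (simp add: q_def FactRing_def)
  define P where "P = {g \<in> alg_gen F. \<forall>Q. primeideal Q (R Quot J) \<longrightarrow> q g \<in> Q}"
  have pt: "g x = 0" if g: "g \<in> P" and x: "\<forall>s\<in>S. s x = 0" for g x
  proof -
    note pp = point_primeideal[where F = F, folded R_def, OF J(1) J0[OF x]]
    show ?thesis using g pp(1) pp(2)[of g] by (simp add: P_def q_def)
  qed
  have JP: "J \<subseteq> P"
  proof
    fix g assume g: "g \<in> J"
    have "q g \<in> Q" if "primeideal Q (R Quot J)" for Q
      unfolding qJ[OF g] by (rule additive_subgroup.zero_closed[OF ideal.axioms(1)[OF primeideal.axioms(1)[OF that]]])
    then show "g \<in> P" using g J.a_subset by (auto simp: P_def carr)
  qed
  have "fprime F P"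
    unfolding fprime_def fideal_def
  proof (intro conjI ballI impI)
    show "P \<subseteq> alg_gen F" by (auto simp: P_def)
    show "(\<lambda>_. 0) \<in> P" using JP J.zero_closed by (auto simp: R_def fun_ring_def)
    show "(\<lambda>_. 1) \<notin> P" using pt[of "\<lambda>_. 1" x0] x0 by auto
  next
    fix g g' assume g: "g \<in> P" "g' \<in> P"
    then have g': "g \<in> alg_gen F" "g' \<in> alg_gen F" by (auto simp: P_def)
    have "q (\<lambda>x. g x + g' x) \<in> Q" if Q: "primeideal Q (R Quot J)" for Q
      unfolding q(2)[OF g']
      by (rule additive_subgroup.a_closed[OF ideal.axioms(1)[OF primeideal.axioms(1)[OF Q]]])
        (use g Q in \<open>auto simp: P_def\<close>)
    then show "(\<lambda>x. g x + g' x) \<in> P" using alg_gen.add[OF g'] by (simp add: P_def)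
  next
    fix g g' assume g: "g \<in> alg_gen F" "g' \<in> P"
    then have g': "g' \<in> alg_gen F" by (auto simp: P_def)
    have "q (\<lambda>x. g x * g' x) \<in> Q" if Q: "primeideal Q (R Quot J)" for Q
      unfolding q(3)[OF g(1) g']
      by (rule ideal.I_l_closed[OF primeideal.axioms(1)[OF Q] _ q(1)[OF g(1) g(1)]])
        (use g Q in \<open>auto simp: P_def\<close>)
    then show "(\<lambda>x. g x * g' x) \<in> P" using alg_gen.mult[OF g(1) g'] by (simp add: P_def)
  next
    fix g g' assume g: "g \<in> alg_gen F" "g' \<in> alg_gen F" "(\<lambda>x. g x * g' x) \<in> P"
    have "(\<forall>Q. primeideal Q (R Quot J) \<longrightarrow> q g \<in> Q) \<or> (\<forall>Q. primeideal Q (R Quot J) \<longrightarrow> q g' \<in> Q)"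
    proof (rule not_reducible_Spec[OF irr[folded R_def J_def] q(1)[OF g(1,1)] q(1)[OF g(2,2)]])
      show "q g \<otimes>\<^bsub>R Quot J\<^esub> q g' \<in> Q" if "primeideal Q (R Quot J)" for Q
        using g(3) that q(3)[OF g(1,2)] by (simp add: P_def)
    qed
    then show "g \<in> P \<or> g' \<in> P" using g(1,2) by (auto simp: P_def)
  qed
  then show thesis using that[of P] J(2) JP pt by blast
qed

section \<open>Jets of the cone over a nilpotent orbit\<close>

context fd_complex_space
begin

abbreviation JF :: "nat \<Rightarrow> ((nat \<Rightarrow> 'g) \<Rightarrow> complex) set" where
  "JF m \<equiv> {\<lambda>x. \<phi> (x j) | \<phi> j. functional \<phi> \<and> j \<le> m}"

lemma jet_coeff_in_JF: "F \<in> alg_gen FF \<Longrightarrow> k \<le> m \<Longrightarrow> jet_coeff m F k \<in> alg_gen (JF m)"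
  using jet_coeff_in_jet_ring by (simp add: carrier_coord_ring carrier_jet_ring)

text \<open>On arcs of order \<open>l\<close> in \<open>t\<close>, only the terms of degree at most 2 of a polynomial contribute
  to the coefficients up to \<open>t\<^sup>2\<^sup>l\<close>.\<close>

lemma jet_coeff_quadratic:
  assumes "F \<in> alg_gen FF"
  obtains c \<phi> q where "functional \<phi>"
    "\<forall>m l x k. 1 \<le> l \<longrightarrow> m \<le> 2 * l \<longrightarrow> (\<forall>j<l. x j = 0) \<longrightarrow> k \<le> m \<longrightarrow>
      jet_coeff m F k x = (if k = 0 then c else 0) + \<phi> (x k) + (if k = 2 * l then q (x l) else 0)"
proof -
  define Q where "Q F c \<phi> q \<longleftrightarrow> functional \<phi> \<and>
    (\<forall>m l x k. 1 \<le> l \<longrightarrow> m \<le> 2 * l \<longrightarrow> (\<forall>j<l. x j = 0) \<longrightarrow> k \<le> m \<longrightarrow>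
      jet_coeff m F k x = (if k = 0 then c else 0) + \<phi> (x k) + (if k = 2 * l then q (x l) else 0))"
    for F c \<phi> q
  have QD: "jet_coeff m F k x = (if k = 0 then c else 0) + \<phi> (x k) + (if k = 2 * l then q (x l) else 0)"
    if "Q F c \<phi> q" "1 \<le> l" "m \<le> 2 * l" "\<forall>j<l. x j = 0" "k \<le> m" for F c \<phi> q m l x k
    using that by (simp add: Q_def)
  have "\<exists>c \<phi> q. Q F c \<phi> q"
    using assms
  proof induction
    case (const c)
    have "Q (\<lambda>_. c) c (\<lambda>_. 0) (\<lambda>_. 0)" by (simp add: Q_def jet_coeff_const functionalI)
    then show ?case by blast
  next
    case (gen \<phi>)
    then have "Q \<phi> 0 \<phi> (\<lambda>_. 0)" by (simp add: Q_def jet_coeff_functional)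
    then show ?case by blast
  next
    case (add F G)
    then obtain c \<phi> q c' \<phi>' q' where F: "Q F c \<phi> q" and G: "Q G c' \<phi>' q'" by blast
    then have f: "functional \<phi>" "functional \<phi>'" by (simp_all add: Q_def)
    have "functional (\<lambda>v. \<phi> v + \<phi>' v)"
      by (rule functionalI) (simp_all add: functionalD(1,2)[OF f(1)] functionalD(1,2)[OF f(2)] algebra_simps)
    then have "Q (\<lambda>x. F x + G x) (c + c') (\<lambda>v. \<phi> v + \<phi>' v) (\<lambda>v. q v + q' v)"
      unfolding Q_def using add.hyps by (simp add: jet_add QD[OF F] QD[OF G])
    then show ?case by blast
  next
    case (mult F G)
    then obtain c \<phi> q c' \<phi>' q' where F: "Q F c \<phi> q" and G: "Q G c' \<phi>' q'" by blast
    then have f: "functional \<phi>" "functional \<phi>'" by (simp_all add: Q_def)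
    have "functional (\<lambda>v. c * \<phi>' v + c' * \<phi> v)"
      by (rule functionalI) (simp_all add: functionalD(1,2)[OF f(1)] functionalD(1,2)[OF f(2)] algebra_simps)
    moreover have "jet_coeff m (\<lambda>x. F x * G x) k x = (if k = 0 then c * c' else 0) + (c * \<phi>' (x k) + c' * \<phi> (x k))
        + (if k = 2 * l then c * q' (x l) + c' * q (x l) + \<phi> (x l) * \<phi>' (x l) else 0)"
      if l: "1 \<le> l" "m \<le> 2 * l" "\<forall>j<l. x j = 0" and k: "k \<le> m" for m l x k
    proof -
      define a where "a i = \<phi> (x i) + (if i = 2 * l then q (x l) else 0)" for i
      define a' where "a' i = \<phi>' (x i) + (if i = 2 * l then q' (x l) else 0)" for i
      have a0: "a i = 0" "a' i = 0" if "i < l" for i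
        using that l(3) functional_more(1)[OF f(1)] functional_more(1)[OF f(2)] by (simp_all add: a_def a'_def)
      have "jet_coeff m (\<lambda>x. F x * G x) k x
          = (\<Sum>i\<le>k. ((if i = 0 then c else 0) + a i) * ((if k - i = 0 then c' else 0) + a' (k - i)))"
        using mult.hyps k by (simp add: jet_mult QD[OF F l] QD[OF G l] a_def a'_def add.assoc)
      also have "\<dots> = (\<Sum>i\<le>k. (if i = 0 then (if k = 0 then c * c' else 0) + c * a' k else 0)
          + (if i = k then c' * a k else 0) + a i * a' (k - i))"
        by (intro sum.cong) (auto simp: algebra_simps)
      also have "\<dots> = (if k = 0 then c * c' else 0) + c * a' k + c' * a k + (\<Sum>i\<le>k. a i * a' (k - i))"
        by (simp add: sum.distrib)
      \<comment> \<open>Both sequences vanish below \<open>l\<close>, so a nonzero term needs i >= l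
        and k - i >= l, which for k <= 2 l leaves i = l, k = 2 l.\<close>
      also have "(\<Sum>i\<le>k. a i * a' (k - i)) = (\<Sum>i\<le>k. if i = l then (if k = 2 * l then \<phi> (x l) * \<phi>' (x l) else 0) else 0)"
      proof (intro sum.cong refl)
        fix i assume "i \<in> {..k}"
        show "a i * a' (k - i) = (if i = l then (if k = 2 * l then \<phi> (x l) * \<phi>' (x l) else 0) else 0)"
        proof (cases "i < l \<or> k - i < l")
          case True
          then show ?thesis using a0 l by auto
        next
          case False
          then have "i = l" "k = 2 * l" using l k by auto
          then show ?thesis using l(1) by (simp add: a_def a'_def)
        qed
      qed
      also have "\<dots> = (if k = 2 * l then \<phi> (x l) * \<phi>' (x l) else 0)" by simp
      finally show ?thesis by (simp add: a_def a'_def algebra_simps)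
    qed
    ultimately have "Q (\<lambda>x. F x * G x) (c * c') (\<lambda>v. c * \<phi>' v + c' * \<phi> v) (\<lambda>v. c * q' v + c' * q v + \<phi> v * \<phi>' v)"
      unfolding Q_def by blast
    then show ?case by blast
  qed
  then obtain c \<phi> q where "Q F c \<phi> q" by blast
  then show thesis unfolding Q_def by (intro that[of \<phi> c q]) blast+
qed

lemma jet_coeff_alg_gen:
  assumes U: "U \<subseteq> FF" and g: "g \<in> alg_gen U" and k: "k \<le> m"
  shows "jet_coeff m g k \<in> alg_gen ((\<lambda>(u, j) x. u (x j)) ` (U \<times> {..m}))"
  using g k
proof (induction arbitrary: k)
  case (const c)
  show ?case by (simp add: jet_coeff_const alg_gen.const)
next
  case (gen u)
  then have "jet_coeff m u k = (\<lambda>x. u (x k))" using U by (intro jet_coeff_functional) auto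
  then show ?case using gen by (auto intro!: alg_gen.gen)
next
  case (add f g)
  have "f \<in> alg_gen FF" "g \<in> alg_gen FF" using add.hyps alg_gen_mono[OF U] by auto
  then show ?case using add by (simp add: jet_add alg_gen.add)
next
  case (mult f g)
  have "f \<in> alg_gen FF" "g \<in> alg_gen FF" using mult.hyps alg_gen_mono[OF U] by auto
  then show ?case using mult by (auto simp: jet_mult intro!: alg_gen_sum alg_gen.mult)
qed

lemma growth_le_rational_JF:
  assumes U: "finite U" "U \<subseteq> alg_gen (JF m)" and P: "fprime (JF m) P" and D: "D \<in> alg_gen U" "D \<notin> P"
    and rat: "\<And>\<phi> j. functional \<phi> \<Longrightarrow> j \<le> m \<Longrightarrow> rational_mod U P D (\<lambda>x. \<phi> (x j))"
  shows "growth_le (JF m) P (card U)"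
proof -
  define G where "G = (\<lambda>(b, j) x. co b (x j)) ` (Bs \<times> {..m})"
  have G: "G \<subseteq> JF m" using functional_co by (fastforce simp: G_def)
  have deg: "fdeg G 1 F" if "F \<in> JF m" for F
  proof -
    obtain \<phi> j where F: "F = (\<lambda>x. \<phi> (x j))" "functional \<phi>" "j \<le> m" using \<open>F \<in> JF m\<close> by blast
    have "fdeg G 1 (\<lambda>x. \<Sum>b\<in>Bs. \<phi> b * co b (x j))"
    proof (intro fdeg_sum fdeg_scale Bs(1))
      fix b assume "b \<in> Bs"
      then have "(\<lambda>x. co b (x j)) \<in> G" using F(3) by (force simp: G_def)
      then show "fdeg G 1 (\<lambda>x. co b (x j))" using fdeg.gen[of _ G 0] by simp
    qed
    then show ?thesis unfolding F(1) by (subst functional_expand[OF F(2)])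
  qed
  have alg: "alg_gen (JF m) = alg_gen G" by (rule fdeg_generators(2)[OF G deg])
  have "growth_le G P (card U)"
  proof (rule growth_le_rational[OF _ U(1) _ _ D])
    show "finite G" using Bs(1) by (simp add: G_def)
    show "U \<subseteq> alg_gen G" using U(2) alg by simp
    show "fprime G P" using P unfolding fprime_def fideal_def alg .
    show "rational_mod U P D F" if "F \<in> G" for F
      using that rat functional_co by (fastforce simp: G_def)
  qed
  then show ?thesis using growth_le_generators[OF G deg] by blast
qed

end

context extremal_triple
begin

text \<open>F vanishes along t p for each p in the cone, so its constant, linear and quadratic parts
  vanish on the orbit. As the orbit spans, the linear part is 0 everywhere; what remains is the
  quadratic part.\<close>

lemma jet_coeff_van_orbit:
  assumes x: "nilpotent x" "x \<noteq> 0" and F: "F \<in> van (orbit x)"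
  shows "\<exists>q. (\<forall>p\<in>orbit x. q p = 0) \<and> (\<forall>m l y k. 1 \<le> l \<longrightarrow> m \<le> 2 * l \<longrightarrow> (\<forall>j<l. y j = 0) \<longrightarrow> k \<le> m \<longrightarrow>
    jet_coeff m F k y = (if k = 2 * l then q (y l) else 0))"
proof -
  have Fa: "F \<in> alg_gen FF" and F0: "\<And>p. p \<in> orbit x \<Longrightarrow> F p = 0" using F by (auto simp: vanishing_def)
  obtain c \<phi> q where \<phi>: "functional \<phi>"
    and jet: "\<And>m l y k. 1 \<le> l \<Longrightarrow> m \<le> 2 * l \<Longrightarrow> (\<forall>j<l. y j = 0) \<Longrightarrow> k \<le> m \<Longrightarrow>
      jet_coeff m F k y = (if k = 0 then c else 0) + \<phi> (y k) + (if k = 2 * l then q (y l) else 0)"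
    by (rule jet_coeff_quadratic[OF Fa]) blast
  have "c = 0 \<and> \<phi> p = 0 \<and> q p = 0" if p: "p \<in> orbit x" for p
  proof -
    define y where "y j = (if j = (1::nat) then p else 0)" for j
    have arc: "(\<Sum>j\<le>2. t ^ j \<odot> y j) = t \<odot> p" for t :: complex
      by (simp add: y_def numeral_2_eq_2)
    obtain r where r: "\<And>t. poly r t = F (\<Sum>j\<le>2. t ^ j \<odot> y j)"
      using poly_along_arc[of F y 2] Fa by (auto simp: carrier_coord_ring)
    have "poly r t = 0" if "t \<noteq> 0" for t
      unfolding r arc by (rule F0[OF nilpotent_cone[OF x(1) that p]])
    then have "- {0} \<subseteq> {t. poly r t = 0}" by auto
    moreover have "infinite (- {0 :: complex})" by (simp add: infinite_UNIV_char_0)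
    ultimately have "infinite {t. poly r t = 0}" using finite_subset by blast
    then have "r = 0" using poly_roots_finite by blast
    then have z: "jet_coeff 2 F k y = 0" for k using jet_coeff_eqI[where k = k, OF r] by simp
    have "jet_coeff 2 F k y = (if k = 0 then c else 0) + \<phi> (y k) + (if k = 2 then q p else 0)" if "k \<le> 2" for k
      using jet[of 1 2 y k] that by (simp add: y_def)
    from this[of 0] this[of 1] this[of 2] show ?thesis
      unfolding z using functional_more(1)[OF \<phi>] by (simp add: y_def)
  qed
  then have q: "\<forall>p\<in>orbit x. q p = 0" and c: "c = 0" and \<phi>0: "\<And>p. p \<in> orbit x \<Longrightarrow> \<phi> p = 0"
    using orbit_self by blast+
  have "\<phi> v = 0" for v by (rule functional_van_orbit[OF x(2) \<phi> \<phi>0])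
  then show ?thesis using q c jet by auto
qed

text \<open>The j-th jet coefficient of a relation \<alpha>^M \<phi> - g in I has \<alpha> (x 0)^M
  \<phi> (x j) as its only term with the top variable in \<phi>. The remaining terms involve jets of
  polynomials in U and values of \<phi> at lower indices, so induction on j applies.\<close>

lemma jet_rational:
  fixes U :: "('g \<Rightarrow> complex) set" and m :: nat
  assumes U: "U \<subseteq> FF" "\<alpha> \<in> alg_gen U"
    and rat: "\<And>\<phi>. functional \<phi> \<Longrightarrow> rational_mod U I \<alpha> \<phi>"
    and P: "fideal (JF m) P" and J: "\<And>F k. F \<in> I \<Longrightarrow> k \<le> m \<Longrightarrow> jet_coeff m F k \<in> P"
    and \<phi>: "functional \<phi>" "j \<le> m"
  defines "U' \<equiv> (\<lambda>(u, j) x. u (x j)) ` (U \<times> {..m})"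
  shows "rational_mod U' P (\<lambda>x. \<alpha> (x 0)) (\<lambda>x. \<phi> (x j))"
proof -
  have UF: "alg_gen U \<subseteq> alg_gen FF" by (rule alg_gen_mono[OF U(1)])
  have "U' \<subseteq> JF m" using U(1) by (fastforce simp: U'_def)
  then have UJ: "U' \<subseteq> alg_gen (JF m)" by (auto intro: alg_gen.gen)
  have jU: "jet_coeff m g k \<in> alg_gen U'" if "g \<in> alg_gen U" "k \<le> m" for g k
    unfolding U'_def by (rule jet_coeff_alg_gen[OF U(1) that])
  have "jet_coeff m \<alpha> 0 = (\<lambda>x. \<alpha> (x 0))"
    using U(2) UF by (intro ext) (auto intro!: jet_coeff_0)
  then have DU: "(\<lambda>x. \<alpha> (x 0)) \<in> alg_gen U'" using jU[OF U(2), of 0] by simp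
  define rt where "rt = rational_mod U' P (\<lambda>x. \<alpha> (x 0))"
  note rt_U = rational_mod_alg_gen[OF P UJ DU, folded rt_def]
    and rt_add = rational_mod_add[OF P UJ DU, folded rt_def]
    and rt_mult = rational_mod_mult[OF P UJ DU, folded rt_def]
    and rt_sum = rational_mod_sum[OF P UJ DU, folded rt_def]
  have "rt (\<lambda>x. \<phi> (x j))"
    using \<phi>(2)
  proof (induction j rule: less_induct)
    case (less j)
    obtain M g where g: "g \<in> alg_gen U" and inI: "(\<lambda>x. \<alpha> x ^ M * \<phi> x - g x) \<in> I"
      using rat[OF \<phi>(1)] unfolding rational_mod_def by blast
    let ?F = "\<lambda>x. \<alpha> x ^ M * \<phi> x - g x" and ?a = "\<lambda>x. \<alpha> x ^ M"
    have aU: "?a \<in> alg_gen U" by (rule alg_gen_power[OF U(2)])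
    have alg: "?a \<in> alg_gen FF" "\<phi> \<in> alg_gen FF" "(\<lambda>x. - 1 * g x) \<in> alg_gen FF" "g \<in> alg_gen FF"
      using aU g UF in_alg[OF \<phi>(1)] alg_gen_scale[of g FF "- 1"] by auto
    have "jet_coeff m ?F j = jet_coeff m (\<lambda>x. ?a x * \<phi> x + - 1 * g x) j" by simp
    also have "\<dots> = (\<lambda>x. jet_coeff m (\<lambda>x. ?a x * \<phi> x) j x + jet_coeff m (\<lambda>x. - 1 * g x) j x)"
      by (rule jet_add[OF alg_gen.mult[OF alg(1,2)] alg(3)])
    finally have "jet_coeff m ?F j x = (\<Sum>i\<le>j. jet_coeff m ?a i x * \<phi> (x (j - i))) + jet_coeff m (\<lambda>x. - 1 * g x) j x" for x
      using less.prems by (simp add: jet_mult[OF alg(1,2)] jet_coeff_functional[OF \<phi>(1)])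
    moreover have "(\<Sum>i\<le>j. jet_coeff m ?a i x * \<phi> (x (j - i)))
        = \<alpha> (x 0) ^ M * \<phi> (x j) + (\<Sum>i\<in>{1..j}. jet_coeff m ?a i x * \<phi> (x (j - i)))" for x
      using sum.remove[of "{..j}" 0] jet_coeff_0[OF alg(1)]
      by (simp add: atMost_atLeast0 sum.atLeast_Suc_atMost)
    ultimately have eq: "\<alpha> (x 0) ^ M * \<phi> (x j) = jet_coeff m ?F j x
        + (- 1 * jet_coeff m (\<lambda>x. - 1 * g x) j x + (\<Sum>i\<in>{1..j}. (- 1 * jet_coeff m ?a i x) * \<phi> (x (j - i))))" for x
      by (simp add: sum_negf)
    have "rt (\<lambda>x. (- 1 * jet_coeff m ?a i x) * \<phi> (x (j - i)))" if "i \<in> {1..j}" for i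
    proof (rule rt_mult)
      have a: "(\<lambda>x. - 1 * jet_coeff m ?a i x) \<in> alg_gen U'"
        using that less.prems by (intro alg_gen_scale jU aU) auto
      then show "(\<lambda>x. - 1 * jet_coeff m ?a i x) \<in> alg_gen (JF m)" using alg_gen_subset[OF UJ] by blast
      show "rt (\<lambda>x. - 1 * jet_coeff m ?a i x)" by (rule rt_U[OF a])
      show "rt (\<lambda>x. \<phi> (x (j - i)))" using that less.prems by (intro less.IH) auto
    qed
    then have "rt (\<lambda>x. \<Sum>i\<in>{1..j}. (- 1 * jet_coeff m ?a i x) * \<phi> (x (j - i)))" by (intro rt_sum) auto
    moreover have "rt (\<lambda>x. - 1 * jet_coeff m (\<lambda>x. - 1 * g x) j x)"
      by (intro rt_U alg_gen_scale jU g less.prems)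
    moreover have "rt (jet_coeff m ?F j)" unfolding rt_def by (rule rational_mod_ideal[OF J[OF inI less.prems]])
    ultimately have "rt (\<lambda>x. \<alpha> (x 0) ^ M * \<phi> (x j))" unfolding eq by (intro rt_add)
    then show ?case unfolding rt_def by (rule rational_mod_cancel)
  qed
  then show ?thesis by (simp add: rt_def)
qed

end

section \<open>Reducibility of the jet schemes\<close>

context extremal_triple
begin

text \<open>If the jet scheme were irreducible, its dimension would be \<open>(m + 1) dim O\<close>, as \<open>alpha \<noteq> 0\<close>
  defines a nonempty open subset. The proper closed subset of the arcs which start with order
  about \<open>m / 2\<close> is at least as large.\<close>

lemma jet_scheme_reducible:
  assumes m: "1 \<le> m" and dimN: "2 * dim (range (br e)) \<le> dim (UNIV :: 'g set)"
  shows "reducible_space (jet_scheme m (van (orbit f)))"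
proof (rule ccontr)
  define N where "N = dim (range (br e))"
  define I where "I = van (orbit f)"
  define S where "S = {jet_coeff m F k | F k. F \<in> I \<and> k \<le> m}"
  \<comment> \<open>Half of m rounded up, so m is 2 l or 2 l - 1.\<close>
  define l where "l = (m + 1) div 2"
  have l: "1 \<le> l" "m \<le> 2 * l" "2 * l \<le> m + 1" using m by (auto simp: l_def)
  have IF: "I \<subseteq> alg_gen FF" by (auto simp: I_def vanishing_def)
  have S: "S \<subseteq> alg_gen (JF m)" using IF jet_coeff_in_JF by (auto simp: S_def)
  \<comment> \<open>The constant arc at \<open>f\<close>. It lies in the jet scheme and has
    \<open>alpha\<close> = 1, so the denominator is not in the prime ideal.\<close>
  define x0 where "x0 j = (if j = (0::nat) then f else 0)" for j
  have "\<forall>s\<in>S. s x0 = 0"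
  proof
    fix s assume "s \<in> S"
    then obtain F k where F: "F \<in> I" "s = jet_coeff m F k" by (auto simp: S_def)
    have "(\<Sum>j\<le>m. t ^ j \<odot> x0 j) = f" for t :: complex
    proof -
      have "(\<Sum>j\<le>m. t ^ j \<odot> x0 j) = (\<Sum>j\<le>m. if j = 0 then f else 0)"
        by (intro sum.cong) (auto simp: x0_def)
      then show ?thesis by simp
    qed
    moreover have "F f = 0" using F(1) orbit_self by (auto simp: I_def vanishing_def)
    ultimately show "s x0 = 0" unfolding F(2) by (subst jet_coeff_eqI[of 0]) simp_all
  qed
  assume "\<not> reducible_space (jet_scheme m (van (orbit f)))"
  then have "\<not> reducible_space (Spec (fun_ring (alg_gen (JF m)) Quot genideal (fun_ring (alg_gen (JF m))) S))"
    unfolding jet_scheme_def jet_ideal_def jet_ring_def S_def I_def .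
  from irreducible_Spec_prime[OF S \<open>\<forall>s\<in>S. s x0 = 0\<close> this]
  obtain P where P: "fprime (JF m) P" "S \<subseteq> P" "\<forall>g\<in>P. \<forall>x. (\<forall>s\<in>S. s x = 0) \<longrightarrow> g x = 0" .
  have Pi: "fideal (JF m) P" using P(1) by (simp add: fprime_def)
  obtain U A where U: "finite U" "card U = N" "U \<subseteq> FF" "alpha \<in> alg_gen U"
    and rat: "\<forall>\<phi>. functional \<phi> \<longrightarrow> rational_mod U I alpha \<phi>"
    and A: "\<forall>u\<in>U. infinite (A u)" "\<forall>z\<in>PiE U A. \<exists>x\<in>orbit f. \<forall>u\<in>U. u x = (z u :: complex)"
    unfolding N_def I_def by (rule orbit_f_coordinates)
  define U' where "U' = (\<lambda>(u, j) x. u (x j)) ` (U \<times> {..m})"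
  define D where "D x = alpha (x (0::nat))" for x
  have "D x0 = 1" by (simp add: D_def x0_def alpha_f)
  then have DP: "D \<notin> P" using P(3) \<open>\<forall>s\<in>S. s x0 = 0\<close> by force
  have U'J: "U' \<subseteq> JF m" using U(3) by (fastforce simp: U'_def)
  have "D = jet_coeff m alpha 0"
    using jet_coeff_0[OF in_alg[OF alpha(1)]] by (auto simp: D_def fun_eq_iff)
  then have DU: "D \<in> alg_gen U'" unfolding U'_def using jet_coeff_alg_gen[OF U(3,4)] by simp
  have JP: "jet_coeff m F k \<in> P" if "F \<in> I" "k \<le> m" for F k
    using that P(2) by (auto simp: S_def)
  have "growth_le (JF m) P (card U')"
  proof (rule growth_le_rational_JF[OF _ _ P(1) DU DP])
    show "finite U'" using U(1) by (simp add: U'_def)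
    show "U' \<subseteq> alg_gen (JF m)" using U'J by (auto intro: alg_gen.gen)
    show "rational_mod U' P D (\<lambda>x. \<phi> (x j))" if "functional \<phi>" "j \<le> m" for \<phi> j
      unfolding D_def U'_def by (rule jet_rational[OF U(3,4) _ Pi JP that]) (use rat in blast)
  qed
  moreover have "card U' \<le> N * (m + 1)"
    using card_image_le[of "U \<times> {..m}" "\<lambda>(u, j) x. u (x j)"] U(1,2)
    by (simp add: U'_def card_cartesian_product)
  \<comment> \<open>For arcs of order at least l the equations reduce to the quadratic parts,
    evaluated at \<open>x l\<close> and in degree 2 l only. They matter only when m = 2 l, and there
    \<open>x l\<close> is put on the orbit.\<close>
  moreover define W where "W = {x. (\<forall>j<l. x j = 0) \<and> (m = 2 * l \<longrightarrow> x l \<in> orbit f)}"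
  have WS: "s x = 0" if s: "s \<in> S" and x: "x \<in> W" for s x
  proof -
    obtain F k where F: "F \<in> I" "s = jet_coeff m F k" "k \<le> m" using s by (auto simp: S_def)
    obtain q where q: "\<forall>p\<in>orbit f. q p = 0"
      "\<forall>m l y k. 1 \<le> l \<longrightarrow> m \<le> 2 * l \<longrightarrow> (\<forall>j<l. y j = 0) \<longrightarrow> k \<le> m \<longrightarrow>
        jet_coeff m F k y = (if k = 2 * l then q (y l) else 0)"
      using jet_coeff_van_orbit[OF nilpotent_f f0 F(1)[unfolded I_def]] by blast
    have "s x = (if k = 2 * l then q (x l) else 0)"
      unfolding F(2) using q(2) l F(3) x by (auto simp: W_def)
    then show ?thesis using q(1) x l(2) F(3) by (auto simp: W_def)
  qed
  have "P \<subset> vanishing (JF m) W"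
  proof
    show "P \<subseteq> vanishing (JF m) W" using P(3) WS Pi by (auto simp: vanishing_def fideal_def)
    have "D x = 0" if "x \<in> W" for x
      using that l(1) functional_more(1)[OF alpha(1)] by (auto simp: W_def D_def)
    moreover have "D \<in> alg_gen (JF m)" using DU alg_gen_mono[OF U'J] by blast
    ultimately show "P \<noteq> vanishing (JF m) W" using DP by (auto simp: vanishing_def)
  qed
  \<comment> \<open>Free coordinates on W: the last l coefficients of the arc without restriction,
    and for m = 2 l also the N coordinates of the point \<open>x l\<close> on the orbit.\<close>
  define K where "K = (Bs \<times> {m + 1 - l..m}) <+> (if m = 2 * l then U else {})"
  define u where "u i x = (case i of Inl (b, j) \<Rightarrow> co b (x j) | Inr v \<Rightarrow> v (x l))"
    for i :: "'g \<times> nat + ('g \<Rightarrow> complex)" and x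
  define B where "B i = (case i of Inl _ \<Rightarrow> UNIV | Inr v \<Rightarrow> A v)"
    for i :: "'g \<times> nat + ('g \<Rightarrow> complex)"
  have "growth_ge (JF m) (vanishing (JF m) W) (card K)"
  proof (rule growth_ge_box)
    show "finite K" using Bs(1) U(1) by (simp add: K_def)
    show "fdeg (JF m) 1 (u i)" if "i \<in> K" for i
    proof -
      have "u i \<in> JF m"
      proof (cases i)
        case (Inl c)
        then obtain b j where "i = Inl (b, j)" "j \<le> m" using \<open>i \<in> K\<close> by (auto simp: K_def)
        then have "u i = (\<lambda>x. co b (x j))" "functional (co b)" "j \<le> m"
          using functional_co by (auto simp: u_def)
        then show ?thesis by blast
      next
        case (Inr v)
        then have "functional v" "m = 2 * l" using \<open>i \<in> K\<close> U(3) by (auto simp: K_def split: if_splits)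
        then have "u i = (\<lambda>x. v (x l))" "functional v" "l \<le> m" using Inr by (auto simp: u_def)
        then show ?thesis by blast
      qed
      then show ?thesis using fdeg.gen[of "u i" "JF m" 0] by simp
    qed
    show "infinite (B i)" if "i \<in> K" for i
      using that A(1) infinite_UNIV_char_0[where 'a = complex] by (auto simp: B_def K_def split: sum.splits if_splits)
    fix z assume z: "z \<in> PiE K B"
    obtain p where p: "m = 2 * l \<longrightarrow> p \<in> orbit f \<and> (\<forall>v\<in>U. v p = z (Inr v))"
    proof (cases "m = 2 * l")
      case True
      have "restrict (\<lambda>v. z (Inr v)) U \<in> PiE U A"
      proof
        fix v assume "v \<in> U"
        then have "z (Inr v) \<in> B (Inr v)" using z True by (intro PiE_mem[OF z]) (auto simp: K_def)
        then show "restrict (\<lambda>v. z (Inr v)) U v \<in> A v" using \<open>v \<in> U\<close> by (simp add: B_def)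
      qed auto
      then obtain p where "p \<in> orbit f" "\<forall>v\<in>U. v p = restrict (\<lambda>v. z (Inr v)) U v" using A(2) by blast
      then show thesis by (intro that[of p]) auto
    qed auto
    define x where "x j = (if j < l then 0 else if j < m + 1 - l then p else \<Sum>b\<in>Bs. z (Inl (b, j)) \<odot> b)" for j
    have xl: "x l = p" if "m = 2 * l" using that l(1) by (simp add: x_def)
    have "x \<in> W" unfolding W_def using p xl by (auto simp: x_def)
    moreover have "u i x = z i" if i: "i \<in> K" for i
    proof (cases i)
      case (Inl c)
      then obtain b j where b: "i = Inl (b, j)" "b \<in> Bs" "m + 1 - l \<le> j" using i by (auto simp: K_def)
      have "co b (x j) = (\<Sum>b'\<in>Bs. z (Inl (b', j)) * co b b')"
        using b(3) l by (simp add: x_def functionalD[OF functional_co])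
      also have "\<dots> = (\<Sum>b'\<in>Bs. if b' = b then z (Inl (b', j)) else 0)"
        using b(2) by (intro sum.cong) (auto simp: co_basis)
      also have "\<dots> = z (Inl (b, j))" using b(2) Bs(1) by simp
      finally show ?thesis by (simp add: b(1) u_def)
    next
      case (Inr v)
      then have "v \<in> U" "m = 2 * l" using i by (auto simp: K_def split: if_splits)
      then show ?thesis using p xl Inr by (simp add: u_def)
    qed
    ultimately show "\<exists>x\<in>W. \<forall>i\<in>K. u i x = z i" by blast
  qed
  \<comment> \<open>The inclusion of ideals is proper, and the extra one gained here gives the
    contradiction even in the boundary case 2 N = dim g.\<close>
  from growth_step[OF P(1) fideal_vanishing \<open>P \<subset> vanishing (JF m) W\<close> this]
  have "growth_ge (JF m) P (Suc (card K))" .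
  moreover have "N * (m + 1) \<le> card K"
  proof -
    have "2 * N \<le> card Bs" using dimN by (simp add: N_def dim_UNIV)
    then have *: "2 * N * l \<le> card Bs * l" by simp
    have "card {m + 1 - l..m} = l" using l by simp
    then have cK: "card K = card Bs * l + (if m = 2 * l then N else 0)"
      unfolding K_def using Bs(1) U(1,2) by (simp add: card_Plus card_cartesian_product)
    show ?thesis
    proof (cases "m = 2 * l")
      case True
      then show ?thesis using * cK by (simp add: algebra_simps)
    next
      case False
      then have "m + 1 = 2 * l" using l by simp
      then have "N * (m + 1) = 2 * N * l" by simp
      then show ?thesis using * cK by (simp only: trans_le_add1)
    qed
  qed
  ultimately show False using growth_ge_le by fastforce
qed

end

section \<open>The minimal nilpotent orbit\<close>

context fd_complex_space
begin

lemma vanishing_ideal_closure: "vanishing_ideal (zariski closure_of X) = van X"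
proof
  have "X \<subseteq> zariski closure_of X" by (rule closure_of_subset) (simp add: topspace_zariski)
  then show "vanishing_ideal (zariski closure_of X) \<subseteq> van X"
    by (auto simp: vanishing_ideal_def carrier_coord_ring vanishing_def)
  show "van X \<subseteq> vanishing_ideal (zariski closure_of X)"
  proof
    fix F assume F: "F \<in> van X"
    then have Fa: "F \<in> alg_gen FF" by (simp add: vanishing_def)
    then have "closedin (subtopology zariski UNIV) {p. F p = 0}"
      unfolding closedin_subtopology_zariski by (intro exI[of _ "{F}"]) auto
    then have "zariski closure_of X \<subseteq> {p. F p = 0}"
      using F by (intro closure_of_minimal) (auto simp: vanishing_def)
    then show "F \<in> vanishing_ideal (zariski closure_of X)"
      using Fa by (auto simp: vanishing_ideal_def carrier_coord_ring)
  qed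
qed

end

context simple_lie_algebra
begin

lemma br_span_UNIV: "br_span UNIV UNIV = UNIV"
proof -
  have "lie_ideal (br_span UNIV UNIV) UNIV"
    unfolding lie_ideal_def br_span_def by (auto intro: span_base)
  moreover obtain x y where "br x y \<noteq> 0" using nonabelian by blast
  then have "br_span UNIV UNIV \<noteq> {0}"
    unfolding br_span_def using span_base[of "br x y" "{br x y | x y. x \<in> UNIV \<and> y \<in> UNIV}"] by blast
  ultimately show ?thesis using simple by blast
qed

lemma smallest_semisimple_ideal_UNIV:
  assumes "\<not> X \<subseteq> {0}"
  shows "smallest_semisimple_ideal X UNIV"
proof -
  have UNIV0: "(UNIV :: 'a set) \<noteq> {0}" using nonabelian br_zero by (metis UNIV_I singletonD)
  have "((\<lambda>J. br_span J J) ^^ k) UNIV = UNIV" for k by (induction k) (simp_all add: br_span_UNIV)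
  then have "\<not> solvable UNIV" using UNIV0 by (simp add: solvable_def)
  then have "semisimple UNIV" unfolding semisimple_def using simple by blast
  moreover have "lie_ideal UNIV UNIV" by (simp add: lie_ideal_def)
  ultimately show ?thesis
    unfolding smallest_semisimple_ideal_def using simple assms by blast
qed

lemma orbit_0: "orbit 0 = {0}"
proof -
  have "p = 0" if "p \<in> orbit 0" for p
    using that
  proof (induction rule: orbit_induct)
    case (step p y)
    then show ?case using linD(2)[OF lin_exp_ad, of y 0 0] by simp
  qed simp
  then show ?thesis using orbit_self by blast
qed

end

theorem corollary4p3:
  fixes scale :: "complex \<Rightarrow> 'g::ab_group_add \<Rightarrow> 'g"
    and br :: "'g \<Rightarrow> 'g \<Rightarrow> 'g"
    and Omin :: "'g set"
  assumes "simple_lie_algebra scale br"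
    and "\<not> lie_algebra.type_A1 scale br"
    and "lie_algebra.minimal_nilpotent_orbit scale br Omin"
  shows "lie_algebra.little scale br Omin \<and>
    0 < 2 * fd_complex_space.zariski_dim scale Omin \<and>
    2 * fd_complex_space.zariski_dim scale Omin \<le> enat (vector_space.dim scale UNIV) \<and>
    (\<forall>m::nat\<ge>1. reducible_space
       (fd_complex_space.jet_scheme scale m
         (fd_complex_space.vanishing_ideal scale
           (fd_complex_space.zariski scale closure_of Omin))))"
proof -
  interpret simple_lie_algebra scale br by (rule assms(1))
  obtain e h f where "e \<noteq> 0" "br h e = scale 2 e" "br h f = scale (- 2) f" "br e f = h"
    "\<forall>v. \<exists>c. br e (br e v) = scale c e"
    using extremal_triple_exists by blast
  then interpret extremal_triple scale br e h f by unfold_locales auto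
  define N where "N = dim (range (br e))"
  obtain x where x: "nilpotent x" "Omin = orbit x"
    using assms(3) by (auto simp: minimal_nilpotent_orbit_def nilpotent_orbit_def)
  have x0: "x \<noteq> 0" using assms(3) x(2) orbit_0 by (auto simp: minimal_nilpotent_orbit_def)
  have N1: "1 \<le> N"
  proof (rule ccontr)
    assume "\<not> 1 \<le> N"
    then have "N = 0" by simp
    then have "range (br e) \<subseteq> {0}" by (simp only: N_def dim_eq_0)
    then show False using ef h0 by blast
  qed
  have "orbit f \<noteq> {0}" using f0 orbit_self[of f] by auto
  then have "zariski_dim Omin \<le> zariski_dim (orbit f)"
    using assms(3) nilpotent_f unfolding minimal_nilpotent_orbit_def nilpotent_orbit_def by blast
  then have le: "zariski_dim Omin \<le> enat N" by (simp add: zariski_dim_orbit_f N_def)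
  \<comment> \<open>A strictly smaller ideal would have growth at least N + 1, and the dimension of
    the minimal orbit would exceed that of the orbit of \<open>f\<close>.\<close>
  have van: "van Omin = van (orbit f)"
  proof (rule ccontr)
    assume "van Omin \<noteq> van (orbit f)"
    then have "van (orbit x) \<subset> van (orbit f)" using van_orbit_f[OF x(1) x0] x(2) by blast
    then have "growth_ge FF (van (orbit x)) (Suc N)"
      by (rule growth_step[OF fprime_orbit fideal_vanishing _ growth_orbit_f(2)[folded N_def]])
    then have "enat (Suc N) \<le> zariski_dim Omin" unfolding x(2) by (rule zariski_dim_orbit_ge)
    with le have "enat (Suc N) \<le> enat N" by (rule order_trans[rotated])
    then show False by simp
  qed
  have "enat N \<le> zariski_dim Omin"
    unfolding x(2) by (rule zariski_dim_orbit_ge) (use growth_orbit_f(2) van x(2) in \<open>simp add: N_def\<close>)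
  with le have dim: "zariski_dim Omin = enat N" by (rule antisym)
  have two: "2 * zariski_dim Omin = enat (2 * N)" unfolding dim by (metis numeral_eq_enat times_enat_simps(1))
  have dimN: "2 * N \<le> local.dim UNIV" unfolding N_def by (rule dim_range_e[OF assms(2)])
  have pos: "0 < 2 * zariski_dim Omin" unfolding two using N1 by (simp add: zero_enat_def)
  have bound: "2 * zariski_dim Omin \<le> enat (local.dim UNIV)" unfolding two using dimN by simp
  have "\<not> Omin \<subseteq> {0}" using x(2) x0 orbit_self[of x] by blast
  then have "little Omin"
    unfolding little_def using smallest_semisimple_ideal_UNIV pos bound x nilpotent_orbit_def by blast
  moreover have "vanishing_ideal (zariski closure_of Omin) = van (orbit f)"
    using van vanishing_ideal_closure by simp
  ultimately show ?thesis
    using pos bound jet_scheme_reducible dimN unfolding N_def by simp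
qed

end
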